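(* Let $R=\bigoplus_{n\ge 0}R_n$ be a graded commutative Noetherian ring, where $R_0$ is a Noetherian local ring with maximal ideal $\mathfrak{m}_0$ and $R$ is generated as an $R_0$-algebra by finitely many elements of $R_1$. Let $R_+=\bigoplus_{n>0}R_n$ and let $M$ be a non-zero finitely generated graded $R$-module. Let $g(M)$ denote the cohomological finite length dimension of $M$ with respect to $R_+$, and suppose $g(M)<\infty$. Then $H^i_{\mathfrak{m}_0R}(H^j_{R_+}(M))$ is an Artinian $R$-module for $i=0,1$ and all $j\le g(M)$.
   Context: For an ideal $\mathfrak{b}$ of $R$ and an $R$-module $T$, $H^i_{\mathfrak{b}}(T)$ denotes the $i$-th local cohomology module of $T$ with respect to $\mathfrak{b}$ (graded if $\mathfrak{b}$ and $T$ are graded); $H^j_{R_+}(M)_n$ is the $n$-th graded component of $H^j_{R_+}(M)$, an $R_0$-module. The cohomological finite length dimension of $M$ with respect to $R_+$ is $$g(M):=\sup\{\, i : \text{for all } j<i,\ \ell_{R_0}(H^j_{R_+}(M)_n)<\infty \text{ for all } n\ll 0 \,\},$$ where $\ell_{R_0}$ denotes length over $R_0$. "For all $n\ll 0$" means: there is $n_0\in\mathbb{Z}$ such that the assertion holds for all integers $n\le n_0$. The indices $i,j$ are non-negative integers. *)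

theory Defs
  imports
    "HOL-Algebra.Algebra"
    "HOL-Library.Extended_Nat"
begin

section \<open>Modules\<close>

definition module_hom ::
    "('r, 'x) ring_scheme \<Rightarrow> ('r, 'a, 'y) module_scheme \<Rightarrow> ('r, 'b, 'z) module_scheme
      \<Rightarrow> ('a \<Rightarrow> 'b) \<Rightarrow> bool"
  where "module_hom R A B f \<longleftrightarrow>
    f \<in> carrier A \<rightarrow> carrier B \<and>
    (\<forall>x\<in>carrier A. \<forall>y\<in>carrier A. f (x \<oplus>\<^bsub>A\<^esub> y) = f x \<oplus>\<^bsub>B\<^esub> f y) \<and>
    (\<forall>a\<in>carrier R. \<forall>x\<in>carrier A. f (a \<odot>\<^bsub>A\<^esub> x) = a \<odot>\<^bsub>B\<^esub> f x)"

text \<open>The fields \<open>mult\<close> and \<open>one\<close> of a module record carry no meaning.\<close>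

definition quotient_module :: "('r, 'm, 'y) module_scheme \<Rightarrow> 'm set \<Rightarrow> ('r, 'm set) module"
  where "quotient_module M N =
    \<lparr>carrier = a_rcosets\<^bsub>M\<^esub> N, monoid.mult = (\<lambda>U V. N), one = N, ring.zero = N, add = set_add M,
     smult = (\<lambda>a U. \<Union>x\<in>U. N +>\<^bsub>M\<^esub> (a \<odot>\<^bsub>M\<^esub> x))\<rparr>"

definition finitely_generated_module ::
    "('r, 'x) ring_scheme \<Rightarrow> ('r, 'm, 'y) module_scheme \<Rightarrow> bool"
  where "finitely_generated_module R M \<longleftrightarrow>
    (\<exists>S. finite S \<and> S \<subseteq> carrier M \<and> (\<forall>N. submodule N R M \<and> S \<subseteq> N \<longrightarrow> N = carrier M))"

definition artinian_module :: "('r, 'x) ring_scheme \<Rightarrow> ('r, 'm, 'y) module_scheme \<Rightarrow> bool"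
  where "artinian_module R M \<longleftrightarrow> module R M \<and>
    (\<forall>N :: nat \<Rightarrow> 'm set. (\<forall>n. submodule (N n) R M \<and> N (Suc n) \<subseteq> N n) \<longrightarrow>
      (\<exists>k. \<forall>n\<ge>k. N n = N k))"

definition module_length :: "('r, 'x) ring_scheme \<Rightarrow> ('r, 'm, 'y) module_scheme \<Rightarrow> enat"
  where "module_length R M = Sup {enat k | k. \<exists>N :: nat \<Rightarrow> 'm set.
    (\<forall>i\<le>k. submodule (N i) R M) \<and> (\<forall>i<k. N i \<subset> N (Suc i))}"

definition local_ring :: "('r, 'x) ring_scheme \<Rightarrow> 'r set \<Rightarrow> bool"
  where "local_ring R \<mm> \<longleftrightarrow> cring R \<and> (\<forall>J. maximalideal J R \<longleftrightarrow> J = \<mm>)"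

section \<open>Gradings\<close>

definition internal_direct_sum :: "('a, 'x) ring_scheme \<Rightarrow> ('i \<Rightarrow> 'a set) \<Rightarrow> bool"
  where "internal_direct_sum G A \<longleftrightarrow>
    (\<forall>i. additive_subgroup (A i) G) \<and>
    (\<forall>x\<in>carrier G. \<exists>!c. (\<forall>i. c i \<in> A i) \<and> finite {i. c i \<noteq> \<zero>\<^bsub>G\<^esub>} \<and>
        x = finsum G c {i. c i \<noteq> \<zero>\<^bsub>G\<^esub>})"

definition graded_ring :: "('r, 'x) ring_scheme \<Rightarrow> (nat \<Rightarrow> 'r set) \<Rightarrow> bool"
  where "graded_ring R Rg \<longleftrightarrow> cring R \<and> internal_direct_sum R Rg \<and>
    (\<forall>i j. \<forall>a\<in>Rg i. \<forall>b\<in>Rg j. a \<otimes>\<^bsub>R\<^esub> b \<in> Rg (i + j))"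

abbreviation degree_zero_ring :: "('r, 'x) ring_scheme \<Rightarrow> (nat \<Rightarrow> 'r set) \<Rightarrow> ('r, 'x) ring_scheme"
  where "degree_zero_ring R Rg \<equiv> R\<lparr>carrier := Rg 0\<rparr>"

text \<open>The ideal \<open>R\<^sub>+ = \<Oplus>\<^sub>n\<^sub>>\<^sub>0 R\<^sub>n\<close>.\<close>

definition irrelevant_ideal :: "('r, 'x) ring_scheme \<Rightarrow> (nat \<Rightarrow> 'r set) \<Rightarrow> 'r set"
  where "irrelevant_ideal R Rg =
    {finsum R c F | c F. finite F \<and> F \<subseteq> {0<..} \<and> (\<forall>n\<in>F. c n \<in> Rg n)}"

definition generated_in_degree_one :: "('r, 'x) ring_scheme \<Rightarrow> (nat \<Rightarrow> 'r set) \<Rightarrow> bool"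
  where "generated_in_degree_one R Rg \<longleftrightarrow>
    (\<exists>S. finite S \<and> S \<subseteq> Rg 1 \<and> generate_ring R (Rg 0 \<union> S) = carrier R)"

definition graded_module ::
    "('r, 'x) ring_scheme \<Rightarrow> (nat \<Rightarrow> 'r set) \<Rightarrow> ('r, 'm, 'y) module_scheme \<Rightarrow> (int \<Rightarrow> 'm set) \<Rightarrow> bool"
  where "graded_module R Rg M Mg \<longleftrightarrow> module R M \<and> internal_direct_sum M Mg \<and>
    (\<forall>i n. \<forall>a\<in>Rg i. \<forall>x\<in>Mg n. a \<odot>\<^bsub>M\<^esub> x \<in> Mg (int i + n))"

text \<open>Morphisms of graded modules are homogeneous of degree \<open>0\<close>.\<close>

definition graded_hom ::
    "('r, 'x) ring_scheme \<Rightarrow> ('r, 'a, 'y) module_scheme \<Rightarrow> (int \<Rightarrow> 'a set)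
      \<Rightarrow> ('r, 'b, 'z) module_scheme \<Rightarrow> (int \<Rightarrow> 'b set) \<Rightarrow> ('a \<Rightarrow> 'b) \<Rightarrow> bool"
  where "graded_hom R A Ag B Bg f \<longleftrightarrow> module_hom R A B f \<and> (\<forall>n. f ` Ag n \<subseteq> Bg n)"

section \<open>Injective resolutions\<close>

text \<open>
  HOL cannot quantify over all types inside a definition, so the test monomorphisms \<open>A \<rightarrow> B\<close>
  below range over modules whose elements have the type \<open>'r\<close> of the elements of \<open>R\<close>. By Baer's
  criterion, and by its graded version, this is no restriction: the inclusions of ideals into \<open>R\<close>,
  respectively of homogeneous ideals into \<open>R\<close> with all shifts of its grading, are among the
  tests.
\<close>

definition injective_module :: "('r, 'x) ring_scheme \<Rightarrow> ('r, 'e, 'y) module_scheme \<Rightarrow> bool"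
  where "injective_module R E \<longleftrightarrow> module R E \<and>
    (\<forall>(A :: ('r, 'r) module) (B :: ('r, 'r) module) f g.
      module R A \<and> module R B \<and> module_hom R A B f \<and> inj_on f (carrier A) \<and>
      module_hom R A E g \<longrightarrow>
      (\<exists>h. module_hom R B E h \<and> (\<forall>x\<in>carrier A. h (f x) = g x)))"

text \<open>Injective objects of the category of graded modules (``*injective'' modules).\<close>

definition graded_injective_module ::
    "('r, 'x) ring_scheme \<Rightarrow> (nat \<Rightarrow> 'r set) \<Rightarrow> ('r, 'e, 'y) module_scheme \<Rightarrow> (int \<Rightarrow> 'e set) \<Rightarrow> bool"
  where "graded_injective_module R Rg E Eg \<longleftrightarrow> graded_module R Rg E Eg \<and>
    (\<forall>(A :: ('r, 'r) module) Ag (B :: ('r, 'r) module) Bg f g.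
      graded_module R Rg A Ag \<and> graded_module R Rg B Bg \<and>
      graded_hom R A Ag B Bg f \<and> inj_on f (carrier A) \<and> graded_hom R A Ag E Eg g \<longrightarrow>
      (\<exists>h. graded_hom R B Bg E Eg h \<and> (\<forall>x\<in>carrier A. h (f x) = g x)))"

definition cocycles :: "(nat \<Rightarrow> ('r, 'e, 'y) module_scheme) \<Rightarrow> (nat \<Rightarrow> 'e \<Rightarrow> 'e) \<Rightarrow> nat \<Rightarrow> 'e set"
  where "cocycles C d i = {x \<in> carrier (C i). d i x = \<zero>\<^bsub>C (Suc i)\<^esub>}"

definition coboundaries :: "(nat \<Rightarrow> ('r, 'e, 'y) module_scheme) \<Rightarrow> (nat \<Rightarrow> 'e \<Rightarrow> 'e) \<Rightarrow> nat \<Rightarrow> 'e set"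
  where "coboundaries C d i =
    (case i of 0 \<Rightarrow> {\<zero>\<^bsub>C 0\<^esub>} | Suc k \<Rightarrow> d k ` carrier (C k))"

definition cohomology ::
    "(nat \<Rightarrow> ('r, 'e, 'y) module_scheme) \<Rightarrow> (nat \<Rightarrow> 'e \<Rightarrow> 'e) \<Rightarrow> nat \<Rightarrow> ('r, 'e set) module"
  where "cohomology C d i =
    quotient_module ((C i)\<lparr>carrier := cocycles C d i\<rparr>) (coboundaries C d i)"

text \<open>Exactness of \<open>0 \<rightarrow> T \<rightarrow> I\<^sup>0 \<rightarrow> I\<^sup>1 \<rightarrow> \<dots>\<close>, with augmentation \<open>\<epsilon>\<close> and differentials \<open>d\<close>.\<close>

definition exact_coresolution ::
    "('r, 't, 'y) module_scheme \<Rightarrow> (nat \<Rightarrow> ('r, 'e, 'z) module_scheme) \<Rightarrow> (nat \<Rightarrow> 'e \<Rightarrow> 'e)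
      \<Rightarrow> ('t \<Rightarrow> 'e) \<Rightarrow> bool"
  where "exact_coresolution T I d \<epsilon> \<longleftrightarrow>
    inj_on \<epsilon> (carrier T) \<and> \<epsilon> ` carrier T = cocycles I d 0 \<and>
    (\<forall>i. d i ` carrier (I i) = cocycles I d (Suc i))"

definition injective_resolution ::
    "('r, 'x) ring_scheme \<Rightarrow> ('r, 't, 'y) module_scheme \<Rightarrow> (nat \<Rightarrow> ('r, 'e, 'z) module_scheme)
      \<Rightarrow> (nat \<Rightarrow> 'e \<Rightarrow> 'e) \<Rightarrow> ('t \<Rightarrow> 'e) \<Rightarrow> bool"
  where "injective_resolution R T I d \<epsilon> \<longleftrightarrow>
    (\<forall>i. injective_module R (I i)) \<and>
    module_hom R T (I 0) \<epsilon> \<and> (\<forall>i. module_hom R (I i) (I (Suc i)) (d i)) \<and>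
    exact_coresolution T I d \<epsilon>"

definition graded_injective_resolution ::
    "('r, 'x) ring_scheme \<Rightarrow> (nat \<Rightarrow> 'r set) \<Rightarrow> ('r, 't, 'y) module_scheme \<Rightarrow> (int \<Rightarrow> 't set)
      \<Rightarrow> (nat \<Rightarrow> ('r, 'e, 'z) module_scheme) \<Rightarrow> (nat \<Rightarrow> int \<Rightarrow> 'e set)
      \<Rightarrow> (nat \<Rightarrow> 'e \<Rightarrow> 'e) \<Rightarrow> ('t \<Rightarrow> 'e) \<Rightarrow> bool"
  where "graded_injective_resolution R Rg T Tg I Ig d \<epsilon> \<longleftrightarrow>
    (\<forall>i. graded_injective_module R Rg (I i) (Ig i)) \<and>
    graded_hom R T Tg (I 0) (Ig 0) \<epsilon> \<and>
    (\<forall>i. graded_hom R (I i) (Ig i) (I (Suc i)) (Ig (Suc i)) (d i)) \<and>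
    exact_coresolution T I d \<epsilon>"

section \<open>Local cohomology\<close>

text \<open>\<open>\<Gamma>\<^sub>\<bb>(T)\<close>, the submodule of the elements annihilated by some power of \<open>\<bb>\<close>.\<close>

definition torsion_part ::
    "('r, 'x) ring_scheme \<Rightarrow> 'r set \<Rightarrow> ('r, 'm, 'y) module_scheme \<Rightarrow> ('r, 'm, 'y) module_scheme"
  where "torsion_part R \<bb> T = T\<lparr>carrier :=
    {x \<in> carrier T. \<exists>n :: nat. \<forall>a \<in> \<bb> [^]\<^bsub>ideals_set R\<^esub> n. a \<odot>\<^bsub>T\<^esub> x = \<zero>\<^bsub>T\<^esub>}\<rparr>"

text \<open>
  For an injective resolution \<open>(I, d)\<close> of \<open>T\<close> this is \<open>H\<^sup>i\<^sub>\<bb>(T)\<close>, the \<open>i\<close>-th right derived functor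
  of \<open>\<Gamma>\<^sub>\<bb>\<close> at \<open>T\<close>. If \<open>T\<close> and \<open>\<bb>\<close> are graded and \<open>(I, d)\<close> is a graded injective resolution
  with gradings \<open>Ig\<close>, then \<open>local_cohomology_component\<close> gives the homogeneous components
  \<open>H\<^sup>i\<^sub>\<bb>(T)\<^sub>n\<close>: the classes of the homogeneous cocycles of degree \<open>n\<close>.
\<close>

definition local_cohomology ::
    "('r, 'x) ring_scheme \<Rightarrow> 'r set \<Rightarrow> (nat \<Rightarrow> ('r, 'e, 'y) module_scheme) \<Rightarrow> (nat \<Rightarrow> 'e \<Rightarrow> 'e)
      \<Rightarrow> nat \<Rightarrow> ('r, 'e set) module"
  where "local_cohomology R \<bb> I d i = cohomology (\<lambda>k. torsion_part R \<bb> (I k)) d i"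

definition local_cohomology_component ::
    "('r, 'x) ring_scheme \<Rightarrow> 'r set \<Rightarrow> (nat \<Rightarrow> ('r, 'e, 'y) module_scheme)
      \<Rightarrow> (nat \<Rightarrow> int \<Rightarrow> 'e set) \<Rightarrow> (nat \<Rightarrow> 'e \<Rightarrow> 'e) \<Rightarrow> nat \<Rightarrow> int \<Rightarrow> ('r, 'e set) module"
  where "local_cohomology_component R \<bb> I Ig d i n =
    (let C = (\<lambda>k. torsion_part R \<bb> (I k)) in
      (local_cohomology R \<bb> I d i)\<lparr>carrier :=
        (\<lambda>z. coboundaries C d i +>\<^bsub>C i\<^esub> z) ` (cocycles C d i \<inter> Ig i n)\<rparr>)"

text \<open>\<open>g(M)\<close>, computed from a graded injective resolution \<open>(I, Ig, d)\<close> of \<open>M\<close>.\<close>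

definition cohomological_finite_length_dim ::
    "('r, 'x) ring_scheme \<Rightarrow> (nat \<Rightarrow> 'r set) \<Rightarrow> (nat \<Rightarrow> ('r, 'e, 'y) module_scheme)
      \<Rightarrow> (nat \<Rightarrow> int \<Rightarrow> 'e set) \<Rightarrow> (nat \<Rightarrow> 'e \<Rightarrow> 'e) \<Rightarrow> enat"
  where "cohomological_finite_length_dim R Rg I Ig d =
    Sup {enat i | i. \<forall>j<i. \<exists>n0. \<forall>n\<le>n0.
      module_length (degree_zero_ring R Rg)
        (local_cohomology_component R (irrelevant_ideal R Rg) I Ig d j n) < \<infinity>}"

end

theory Submission
  imports Defs
begin

text \<open>
  Everything is expressed by chain conditions on subquotients \<open>Z/W\<close>, which form Serre classes, and
  spectral sequences are replaced by Koszul complexes on \<open>y\<close> = generators of \<open>\<mm>\<^sub>0\<close> and of \<open>R\<^sub>+\<close>.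
  Elements of \<open>R\<^sub>+\<close> act bijectively on the successive quotients of the filtration of an injective
  \<open>I\<close> by torsion submodules, so \<open>I\<close> and its \<open>R\<^sub>+\<close>-torsion part \<open>\<Gamma>(I)\<close> have the same Koszul cohomology.
  Up to \<open>H\<^sup>0 = M\<close> the resolution is exact; hence the Koszul cohomology of \<open>\<Gamma>(I)\<close> is Noetherian and
  killed by powers of \<open>y\<close>, i.e. Artinian. Truncating \<open>\<Gamma>(I)\<close> transfers this to the cohomology \<open>H\<^sup>q\<close> of
  \<open>\<Gamma>(I)\<close>: if \<open>H\<^sup>p\<close> has good Koszul cohomology for all \<open>p < q\<close>, then so has \<open>H\<^sup>q\<close> in degrees 0 and 1.

  With the generators of \<open>R\<^sub>+\<close> alone this shows that the components of \<open>H\<^sup>q\<close> are Noetherian over \<open>R\<^sub>0\<close>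
  and vanish in large degrees. For \<open>q < g(M)\<close> the part \<open>V\<close> of \<open>H\<^sup>q\<close> in degrees at least some \<open>m\<close> is
  therefore Noetherian, while \<open>H\<^sup>q/V\<close> is \<open>y\<close>-torsion with Artinian socle, hence Artinian; so \<open>H\<^sup>q\<close> has
  Artinian Koszul cohomology and the truncation argument reaches \<open>j = g(M)\<close>. Finally a torsion module
  is Artinian if its socle is, which recovers \<open>H\<^sup>0\<close> and \<open>H\<^sup>1\<close> with respect to \<open>\<mm>\<^sub>0 R\<close> from Koszul
  cohomology in degrees 0 and 1.
\<close>

section \<open>Chain conditions on subquotients\<close>

text \<open>Quotients, cohomology modules and iterated cones would each call for a new type, whereas
  a Serre class has to be one predicate. Therefore every module is a pair of families of subgroups
  of one fixed group, and maps are homomorphisms of such ambient groups. A degree index with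
  operators of prescribed degrees makes graded modules over \<open>R\<^sub>0\<close> and plain
  R-modules instances of the same lemmas. The restriction to i = 0, 1 has one source. Dividing
  \<open>\<tau>\<^sup>\<ge>\<^sup>q\<close> by \<open>H\<^sup>q\<close> leaves a complex with
  cohomology only from degree q + 1 on, so in the long exact sequence it reaches the Koszul
  cohomology of \<open>H\<^sup>q\<close> only from Koszul degree 2 on. Finite length enters once,
  through Nakayama's lemma: below some degree each element of \<open>H\<^sup>q\<close> is killed by
  powers of the generators of \<open>\<mm>\<^sub>0\<close>. This is what makes the quotient of
  \<open>H\<^sup>q\<close> by its upper part torsion. It is available for q < g(M), exactly where
  all Koszul degrees are wanted; at j = g(M) the degrees 0 and 1 are enough.\<close>

type_synonym 'a family = "int => 'a set"
type_synonym 'a bifamily = "int => int => 'a set"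

text \<open>A graded submodule: the index is the degree and (r, e) in \<open>Om\<close> acts with
  degree e. Keeping the operators in a parameter lets one family be tested over
  \<open>R\<^sub>0\<close>, over \<open>R\<^sub>0\<close> with some elements of positive degree, or
  over all of R.\<close>

definition osub :: "('r \<times> int) set => ('r => 'a => 'a::ab_group_add) => 'a family => bool" where
  "osub Om act N \<longleftrightarrow> (\<forall>k. 0 \<in> N k \<and> (\<forall>x\<in>N k. \<forall>y\<in>N k. x - y \<in> N k) \<and>
     (\<forall>(r, e)\<in>Om. \<forall>x\<in>N k. act r x \<in> N (k + e)))"

lemma osubD:
  assumes "osub Om act N"
  shows "0 \<in> N k"
    and "x \<in> N k ==> y \<in> N k ==> x - y \<in> N k"
    and "x \<in> N k ==> y \<in> N k ==> x + y \<in> N k"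
    and "x \<in> N k ==> - x \<in> N k"
    and "(r, e) \<in> Om ==> x \<in> N k ==> act r x \<in> N (k + e)"
proof -
  show z: "0 \<in> N k" and d: "x \<in> N k ==> y \<in> N k ==> x - y \<in> N k" for x y
    using assms by (auto simp: osub_def)
  show n: "x \<in> N k ==> - x \<in> N k" for x
    using d[OF z, of x] by simp
  show "x \<in> N k ==> y \<in> N k ==> x + y \<in> N k"
    using d[of x "- y"] n[of y] by simp
  show "(r, e) \<in> Om ==> x \<in> N k ==> act r x \<in> N (k + e)"
    using assms by (fastforce simp: osub_def)
qed

lemma osubI:
  assumes "!!k. 0 \<in> N k"
    and "!!k x y. x \<in> N k ==> y \<in> N k ==> x - y \<in> N k"
    and "!!r e k x. (r, e) \<in> Om ==> x \<in> N k ==> act r x \<in> N (k + e)"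
  shows "osub Om act N"
  using assms by (auto simp: osub_def)

lemma osub_mono: "osub Om act N ==> Om' \<subseteq> Om ==> osub Om' act N"
  by (fastforce simp: osub_def)

lemma osub_cancel:
  assumes "osub Om act N" "y \<in> N k"
  shows "x - y \<in> N k \<longleftrightarrow> x \<in> N k" "x + y \<in> N k \<longleftrightarrow> x \<in> N k" "y + x \<in> N k \<longleftrightarrow> x \<in> N k"
    "y - x \<in> N k \<longleftrightarrow> x \<in> N k"
proof -
  show 1: "x - y \<in> N k \<longleftrightarrow> x \<in> N k" for x
    using assms osubD(2,3)[OF assms(1)] by (metis diff_add_cancel)
  show 2: "x + y \<in> N k \<longleftrightarrow> x \<in> N k" for x
    using 1[of "x + y"] by simp
  show "y + x \<in> N k \<longleftrightarrow> x \<in> N k" using 2[of x] by (simp add: add.commute)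
  show "y - x \<in> N k \<longleftrightarrow> x \<in> N k"
    using assms osubD(2)[OF assms(1)] by (metis diff_diff_eq2 add_diff_cancel_left')
qed

lemma osub_eq_mod:
  assumes "osub Om act N" "x - y \<in> N k"
  shows "x \<in> N k \<longleftrightarrow> y \<in> N k"
  using osub_cancel(2)[OF assms(1), of "x - y" k y] assms(2) by (metis diff_add_cancel osub_cancel(3) assms(1))

text \<open>The Noetherian or, without \<open>asc\<close>, the Artinian condition on Z/W. One flag
  serves both because stability under submodules, quotients and extensions has the same proof for
  either direction.\<close>

definition chain_condition ::
    "bool => ('r \<times> int) set => ('r => 'a => 'a::ab_group_add) => 'a family => 'a family => bool"
  where "chain_condition asc Om act Z W \<longleftrightarrow> (\<forall>N :: nat => int => 'a set.
    (\<forall>i. osub Om act (N i) \<and> W \<le> N i \<and> N i \<le> Z \<and>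
      (if asc then N i \<le> N (Suc i) else N (Suc i) \<le> N i)) --> (\<exists>m. \<forall>i\<ge>m. N i = N m))"

lemma chain_conditionD:
  assumes "chain_condition asc Om act Z W"
    and "!!i. osub Om act (N i)" "!!i k. W k \<subseteq> N i k" "!!i k. N i k \<subseteq> Z k"
    and "!!i k. if asc then N i k \<subseteq> N (Suc i) k else N (Suc i) k \<subseteq> N i k"
  shows "\<exists>m. \<forall>i\<ge>m. N i = N m"
  using assms unfolding chain_condition_def le_fun_def by meson

lemma chain_conditionI:
  assumes "!!N :: nat => int => 'a set. (!!i. osub Om act (N i)) ==> (!!i k. W k \<subseteq> N i k) ==>
     (!!i k. N i k \<subseteq> Z k) ==> (!!i k. if asc then N i k \<subseteq> N (Suc i) k else N (Suc i) k \<subseteq> N i k)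
    ==> \<exists>m. \<forall>i\<ge>m. N i = N m"
  shows "chain_condition asc Om (act :: 'r => 'a => 'a::ab_group_add) Z W"
  unfolding chain_condition_def le_fun_def
proof (intro allI impI, goal_cases)
  case (1 N)
  then show ?case
    by (intro assms) (auto split: if_splits)
qed

lemma stable_image:
  assumes "\<exists>m. \<forall>i\<ge>m. N' i = N' m" "!!i j. N' i = N' j ==> N i = N j"
  shows "\<exists>m::nat. \<forall>i\<ge>m. N i = N m"
  using assms by blast

text \<open>A chain N is pushed to f(N) + W', whose preimage in Z is N again because elements of Z
  mapped into W' already lie in W. Since f may carry W outside W', this also covers the case of a
  quotient of a submodule of Z'/W', which occurs when degrees are cut off.\<close>

lemma chain_condition_inj:
  fixes f :: "'a::ab_group_add => 'b::ab_group_add"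
  assumes f: "additive f" "!!r e k x. (r, e) \<in> Om ==> x \<in> Z k ==> f (act r x) = act' r (f x)"
    and act': "!!r. additive (act' r)"
    and Z: "osub Om act Z" and W': "osub Om act' W'"
    and fZ: "!!k x. x \<in> Z k ==> f x \<in> Z' (k + e)"
    and W'Z': "!!k. W' k \<subseteq> Z' k" and Z': "osub Om act' Z'"
    and inj: "!!k x. x \<in> Z k ==> f x \<in> W' (k + e) ==> x \<in> W k"
    and cc: "chain_condition asc Om act' Z' W'"
  shows "chain_condition asc Om act Z W"
proof (rule chain_conditionI, goal_cases)
  case (1 N)
  define N' where "N' i k = {x. \<exists>n\<in>N i (k - e). x - f n \<in> W' k}" for i k
  interpret f: additive f by fact
  have sub: "osub Om act' (N' i)" for i
  proof (rule osubI)
    fix k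
    show "0 \<in> N' i k"
      unfolding N'_def using osubD(1)[OF 1(1), of i "k - e"] osubD(1)[OF W', of k]
      by (auto intro!: bexI[of _ 0] simp: f.zero)
  next
    fix k x y assume "x \<in> N' i k" "y \<in> N' i k"
    then obtain m n where mn: "m \<in> N i (k - e)" "n \<in> N i (k - e)" "x - f m \<in> W' k" "y - f n \<in> W' k"
      by (auto simp: N'_def)
    have "(x - y) - f (m - n) \<in> W' k"
      using osubD(2)[OF W' mn(3,4)] by (simp add: f.diff algebra_simps)
    then show "x - y \<in> N' i k"
      unfolding N'_def using osubD(2)[OF 1(1) mn(1,2)] by blast
  next
    fix r e' k x assume r: "(r, e') \<in> Om" and "x \<in> N' i k"
    then obtain n where n: "n \<in> N i (k - e)" "x - f n \<in> W' k" by (auto simp: N'_def)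
    interpret ar: additive "act' r" by (rule act')
    have "act' r x - f (act r n) \<in> W' (k + e')"
      using osubD(5)[OF W' r n(2)] f(2)[OF r, of n "k - e"] n(1) 1(3)[of i "k - e"] by (auto simp: ar.diff)
    then show "act' r x \<in> N' i (k + e')"
      unfolding N'_def using osubD(5)[OF 1(1) r n(1)] by (auto simp: algebra_simps)
  qed
  have W: "W' k \<subseteq> N' i k" for i k
    unfolding N'_def using osubD(1)[OF 1(1), of i "k - e"] by (auto intro!: bexI[of _ 0] simp: f.zero)
  have NZ: "N' i k \<subseteq> Z' k" for i k
  proof
    fix x assume "x \<in> N' i k"
    then obtain n where n: "n \<in> N i (k - e)" "x - f n \<in> W' k" by (auto simp: N'_def)
    then show "x \<in> Z' k"
      using osubD(3)[OF Z', of "x - f n" k "f n"] W'Z'[of k] fZ[of n "k - e"] 1(3)[of i "k - e"] by auto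
  qed
  have "\<exists>m. \<forall>i\<ge>m. N' i = N' m"
  proof (rule chain_conditionD[OF cc sub W NZ])
    fix i k show "if asc then N' i k \<subseteq> N' (Suc i) k else N' (Suc i) k \<subseteq> N' i k"
      using 1(4)[of i "k - e"] by (auto simp: N'_def split: if_splits)
  qed
  moreover have "N i k = {x \<in> Z k. f x \<in> N' i (k + e)}" for i k
  proof (intro Set.set_eqI iffI)
    fix x assume "x \<in> N i k"
    then show "x \<in> {x \<in> Z k. f x \<in> N' i (k + e)}"
      using 1(3) osubD(1)[OF W'] by (auto simp: N'_def intro!: bexI[of _ x])
  next
    fix x assume x: "x \<in> {x \<in> Z k. f x \<in> N' i (k + e)}"
    then obtain n where n: "n \<in> N i k" "f x - f n \<in> W' (k + e)" by (auto simp: N'_def)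
    then have "f (x - n) \<in> W' (k + e)" by (simp add: f.diff)
    moreover have "x - n \<in> Z k" using n x 1(3) osubD(2)[OF Z, of x k n] by auto
    ultimately have "x - n \<in> N i k"
      using inj 1(2) by blast
    then show "x \<in> N i k"
      using osub_eq_mod[OF 1(1)] n(1) by blast
  qed
  ultimately show ?case
    by (elim stable_image) (auto simp: fun_eq_iff)
qed

text \<open>Dually, N' is recovered from its preimage in Z as the set of elements congruent modulo
  W' to an image under f, since f hits every class of Z'/W'.\<close>

lemma chain_condition_surj:
  fixes f :: "'a::ab_group_add => 'b::ab_group_add"
  assumes f: "additive f" "!!r e k x. (r, e) \<in> Om ==> x \<in> Z k ==> f (act r x) = act' r (f x)"
    and act': "!!r. additive (act' r)"
    and Z: "osub Om act Z" and W': "osub Om act' W'"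
    and WZ: "!!k. W k \<subseteq> Z k"
    and W: "!!k x. x \<in> W k ==> f x \<in> W' (k + e)"
    and surj: "!!k z. z \<in> Z' (k + e) ==> \<exists>x\<in>Z k. z - f x \<in> W' (k + e)"
    and cc: "chain_condition asc Om act Z W"
  shows "chain_condition asc Om act' Z' W'"
proof (rule chain_conditionI, goal_cases)
  case (1 N')
  define N where "N i k = {x \<in> Z k. f x \<in> N' i (k + e)}" for i k
  interpret f: additive f by fact
  have sub: "osub Om act (N i)" for i
  proof (rule osubI)
    show "0 \<in> N i k" for k
      unfolding N_def using osubD(1)[OF Z] osubD(1)[OF 1(1)] by (simp add: f.zero)
    show "x - y \<in> N i k" if "x \<in> N i k" "y \<in> N i k" for x y k
      using that osubD(2)[OF Z] osubD(2)[OF 1(1)] by (simp add: N_def f.diff)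
    show "act r x \<in> N i (k + e')" if "(r, e') \<in> Om" "x \<in> N i k" for r e' x k
      using that(2) osubD(5)[OF Z that(1), of x k] osubD(5)[OF 1(1) that(1), of "f x" i "k + e"] f(2)[OF that(1), of x k]
      by (simp add: N_def add.commute add.left_commute)
  qed
  have "\<exists>m. \<forall>i\<ge>m. N i = N m"
  proof (rule chain_conditionD[OF cc sub])
    show "W k \<subseteq> N i k" for i k
      unfolding N_def using WZ W 1(2) by blast
    show "N i k \<subseteq> Z k" for i k by (auto simp: N_def)
    show "if asc then N i k \<subseteq> N (Suc i) k else N (Suc i) k \<subseteq> N i k" for i k
      using 1(4)[of i "k + e"] by (auto simp: N_def split: if_splits)
  qed
  moreover have "N' i k = {z \<in> Z' k. \<exists>x\<in>N i (k - e). z - f x \<in> W' k}" for i k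
  proof (intro Set.set_eqI iffI)
    fix z assume z: "z \<in> N' i k"
    then have "z \<in> Z' k" using 1(3) by blast
    then obtain x where x: "x \<in> Z (k - e)" "z - f x \<in> W' k" using surj[of z "k - e"] by auto
    then have "f x \<in> N' i k"
      using osub_eq_mod[OF 1(1)] 1(2) z by blast
    then show "z \<in> {z \<in> Z' k. \<exists>x\<in>N i (k - e). z - f x \<in> W' k}"
      using x \<open>z \<in> Z' k\<close> by (auto simp: N_def)
  next
    fix z assume "z \<in> {z \<in> Z' k. \<exists>x\<in>N i (k - e). z - f x \<in> W' k}"
    then show "z \<in> N' i k"
      using osub_eq_mod[OF 1(1)] 1(2) by (fastforce simp: N_def)
  qed
  ultimately show ?case
    by (elim stable_image) (auto simp: fun_eq_iff)
qed

text \<open>N is controlled by its trace P on Y and by its sum Q with Y, that is, by what it leaves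
  in the two factors.\<close>

lemma chain_condition_ext:
  fixes act :: "'r => 'a::ab_group_add => 'a"
  assumes act: "!!r. additive (act r)"
    and Y: "osub Om act Y" and WY: "!!k. W k \<subseteq> Y k" and YZ: "!!k. Y k \<subseteq> Z k" and Z: "osub Om act Z"
    and cc: "chain_condition asc Om act Z Y" "chain_condition asc Om act Y W"
  shows "chain_condition asc Om act Z W"
proof (rule chain_conditionI, goal_cases)
  case (1 N)
  define P where "P i k = N i k \<inter> Y k" for i k
  define Q where "Q i k = {x. \<exists>y\<in>Y k. x - y \<in> N i k}" for i k
  have subP: "osub Om act (P i)" for i
    using osubD(1,2,5)[OF 1(1)] osubD(1,2,5)[OF Y] by (intro osubI) (auto simp: P_def)
  have subQ: "osub Om act (Q i)" for i
  proof (rule osubI)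
    show "0 \<in> Q i k" for k
      unfolding Q_def using osubD(1)[OF Y] osubD(1)[OF 1(1)] by (auto intro!: bexI[of _ 0])
    show "x - y \<in> Q i k" if xy: "x \<in> Q i k" "y \<in> Q i k" for x y k
    proof -
      obtain u v where "u \<in> Y k" "v \<in> Y k" "x - u \<in> N i k" "y - v \<in> N i k"
        using xy by (auto simp: Q_def)
      then have "u - v \<in> Y k" "(x - y) - (u - v) \<in> N i k"
        using osubD(2)[OF Y] osubD(2)[OF 1(1), of "x - u" i k "y - v"] by (auto simp: algebra_simps)
      then show ?thesis by (auto simp: Q_def)
    qed
    show "act r x \<in> Q i (k + e')" if r: "(r, e') \<in> Om" and x: "x \<in> Q i k" for r e' x k
    proof -
      interpret ar: additive "act r" by (rule act)
      obtain u where "u \<in> Y k" "x - u \<in> N i k" using x by (auto simp: Q_def)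
      then have "act r u \<in> Y (k + e')" "act r x - act r u \<in> N i (k + e')"
        using osubD(5)[OF Y r] osubD(5)[OF 1(1) r, of "x - u"] by (auto simp: ar.diff)
      then show ?thesis by (auto simp: Q_def)
    qed
  qed
  have "\<exists>m. \<forall>i\<ge>m. P i = P m"
  proof (rule chain_conditionD[OF cc(2) subP])
    show "if asc then P i k \<subseteq> P (Suc i) k else P (Suc i) k \<subseteq> P i k" for i k
      using 1(4)[of i k] by (auto simp: P_def split: if_splits)
  qed (use 1 WY in \<open>auto simp: P_def\<close>)
  moreover have "\<exists>m. \<forall>i\<ge>m. Q i = Q m"
  proof (rule chain_conditionD[OF cc(1) subQ])
    show "if asc then Q i k \<subseteq> Q (Suc i) k else Q (Suc i) k \<subseteq> Q i k" for i k
      using 1(4)[of i k] by (auto simp: Q_def split: if_splits)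
    show "Y k \<subseteq> Q i k" for i k
      unfolding Q_def using osubD(1)[OF 1(1)] by (auto intro: rev_bexI)
    show "Q i k \<subseteq> Z k" for i k
    proof
      fix x assume "x \<in> Q i k"
      then obtain u where "u \<in> Y k" "x - u \<in> N i k" by (auto simp: Q_def)
      then show "x \<in> Z k" using osub_eq_mod[OF Z] YZ 1(3) by blast
    qed
  qed
  ultimately obtain m1 m2 where m1: "!!i. i \<ge> m1 ==> P i = P m1" and m2: "!!i. i \<ge> m2 ==> Q i = Q m2"
    by blast
  have mono: "if asc then N i k \<subseteq> N j k else N j k \<subseteq> N i k" if "i \<le> j" for i j k
    using that
  proof (induction rule: dec_induct)
    case (step n) then show ?case using 1(4)[of n k] by (auto split: if_splits)
  qed auto
  \<comment> \<open>Modular law: two nested members with the same trace on Y and the same sum with Y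
    agree.\<close>
  have le: "N i k \<subseteq> N j k" if PQ: "P i = P j" "Q i = Q j" and ji: "N j k \<subseteq> N i k" for i j k
  proof
    fix x assume x: "x \<in> N i k"
    then have "x \<in> Q i k" using osubD(1)[OF Y] by (auto simp: Q_def intro!: bexI[of _ 0])
    then obtain y where y: "y \<in> Y k" "x - y \<in> N j k" unfolding PQ(2) by (auto simp: Q_def)
    then have "y \<in> N i k" using osub_eq_mod[OF 1(1)] x ji by blast
    then have "y \<in> N j k" using PQ(1) y(1) by (fastforce simp: P_def fun_eq_iff)
    then show "x \<in> N j k" using y(2) osub_eq_mod[OF 1(1)] by blast
  qed
  have "N i = N (max m1 m2)" if "i \<ge> max m1 m2" for i
  proof
    fix k
    have "P i = P (max m1 m2)" "Q i = Q (max m1 m2)"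
      using m1[of i] m1[of "max m1 m2"] m2[of i] m2[of "max m1 m2"] that by auto
    then show "N i k = N (max m1 m2) k"
      using mono[OF that, of k] le[of i "max m1 m2" k] le[of "max m1 m2" i k]
      by (cases asc) auto
  qed
  then show ?case by blast
qed

lemma chain_condition_triv:
  assumes "!!k. Z k \<subseteq> W k"
  shows "chain_condition asc Om act Z W"
proof (rule chain_conditionI, goal_cases)
  case (1 N)
  then have "N i = N 0" for i
    using assms by (metis (no_types, opaque_lifting) ext dual_order.eq_iff order_trans)
  then show ?case by blast
qed

section \<open>Commuting operators and Serre classes of subquotients\<close>

locale operators =
  fixes act :: "'r => 'a::ab_group_add => 'a"
  assumes act_additive: "additive (act r)"
    and act_commute: "act r (act s x) = act s (act r x)"
begin

lemma act_simps: "act r (x + y) = act r x + act r y" "act r (x - y) = act r x - act r y" "act r 0 = 0"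
  using additive.add[OF act_additive] additive.diff[OF act_additive] additive.zero[OF act_additive] by auto

definition equivariant :: "('a => 'a) => bool" where
  "equivariant f \<longleftrightarrow> additive f \<and> (\<forall>r x. f (act r x) = act r (f x))"

lemma equivariantD:
  assumes "equivariant f"
  shows "f (x + y) = f x + f y" "f (x - y) = f x - f y" "f 0 = 0" "f (- x) = - f x" "f (act r x) = act r (f x)"
  using assms additive.add additive.diff additive.zero additive.minus unfolding equivariant_def by blast+

lemma equivariant_id: "equivariant (\<lambda>x. x)"
  by (simp add: equivariant_def additive_def)

end

text \<open>\<open>sm Z W\<close> reads: Z/W belongs to the class. Without quotient objects,
  submodules and quotients are described by equivariant endomorphisms of degree e that are
  injective, respectively surjective, on the subquotients. The families are stable under
  \<open>Om\<close>, while the class itself may refer to fewer operators.\<close>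

locale serre_class = operators act for act :: "'r => 'a::ab_group_add => 'a" +
  fixes Om :: "('r \<times> int) set" and sm :: "'a family => 'a family => bool"
  assumes sm_inj: "equivariant f ==> osub Om act Z ==> osub Om act W ==> osub Om act Z' ==> osub Om act W' ==>
      (!!k. W k \<subseteq> Z k) ==> (!!k. W' k \<subseteq> Z' k) ==> (!!k x. x \<in> Z k ==> f x \<in> Z' (k + e)) ==>
      (!!k x. x \<in> Z k ==> f x \<in> W' (k + e) ==> x \<in> W k) ==> sm Z' W' ==> sm Z W"
    and sm_surj: "equivariant f ==> osub Om act Z ==> osub Om act W ==> osub Om act Z' ==> osub Om act W' ==>
      (!!k. W k \<subseteq> Z k) ==> (!!k. W' k \<subseteq> Z' k) ==> (!!k x. x \<in> W k ==> f x \<in> W' (k + e)) ==>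
      (!!k z. z \<in> Z' (k + e) ==> \<exists>x\<in>Z k. z - f x \<in> W' (k + e)) ==> sm Z W ==> sm Z' W'"
    and sm_ext: "osub Om act Z ==> osub Om act Y ==> osub Om act W ==> (!!k. W k \<subseteq> Y k) ==>
      (!!k. Y k \<subseteq> Z k) ==> sm Z Y ==> sm Y W ==> sm Z W"
    and sm_triv: "(!!k. Z k = W k) ==> sm Z W"

text \<open>Chains are tested with the operators in \<open>Om'\<close> only. Fewer operators admit
  more chains; with those of \<open>R\<^sub>0\<close> this expresses finiteness over
  \<open>R\<^sub>0\<close> for modules that carry a larger action.\<close>

lemma (in operators) serre_chain_condition:
  assumes "Om' \<subseteq> Om"
  shows "serre_class act Om (chain_condition asc Om' act)"
proof (unfold_locales, goal_cases)
  case (1 f Z W Z' W' e)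
  have "additive f" "!!r x. f (act r x) = act r (f x)" using 1(1) by (auto simp: equivariant_def)
  moreover note osub_mono[OF 1(2) assms] osub_mono[OF 1(5) assms]
  ultimately show ?case
    by (rule chain_condition_inj[OF _ _ act_additive _ _ 1(8) 1(7) osub_mono[OF 1(4) assms] 1(9,10)])
next
  case (2 f Z W Z' W' e)
  have "additive f" "!!r x. f (act r x) = act r (f x)" using 2(1) by (auto simp: equivariant_def)
  moreover note osub_mono[OF 2(2) assms] osub_mono[OF 2(5) assms]
  ultimately show ?case
    by (rule chain_condition_surj[OF _ _ act_additive _ _ 2(6,8,9,10)])
next
  case (3 Z Y W)
  show ?case
    by (rule chain_condition_ext[OF act_additive osub_mono[OF 3(2) assms] 3(4,5) osub_mono[OF 3(1) assms] 3(6,7)])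
next
  case (4 Z W)
  then show ?case by (intro chain_condition_triv) simp
qed

text \<open>The class of zero modules: through it, results about Serre classes specialise to
  statements on vanishing and acyclicity.\<close>

lemma (in operators) serre_zero: "serre_class act Om (\<lambda>Z W. \<forall>k. Z k \<subseteq> W k)"
proof (unfold_locales, goal_cases)
  case (1 f Z W Z' W' e)
  then show ?case by (metis subset_iff)
next
  case (2 f Z W Z' W' e)
  show ?case
  proof (intro allI subsetI)
    fix k z assume z: "z \<in> Z' k"
    then obtain x where "x \<in> Z (k - e)" "z - f x \<in> W' k" using 2(9)[of z "k - e"] by auto
    then show "z \<in> W' k"
      using 2(8)[of x "k - e"] 2(10) osub_eq_mod[OF 2(5)] by (metis diff_add_cancel subset_iff)
  qed
next
  case (3 Z Y W)
  then show ?case by (meson order_trans)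
next
  case (4 Z W)
  then show ?case by simp
qed

definition power_torsion :: "('r => 'a => 'a) => 'r \<times> int => 'a family => 'a family => bool" where
  "power_torsion act y Z W \<longleftrightarrow> (\<forall>k. \<forall>x\<in>Z k. \<exists>n::nat. (act (fst y) ^^ n) x \<in> W (k + int n * snd y))"

context operators
begin

lemma act_funpow_diff: "(act r ^^ n) (x - y) = (act r ^^ n) x - (act r ^^ n) y"
  by (induction n) (auto simp: act_simps)

lemma act_funpow_commute: "(act r ^^ n) (act s x) = act s ((act r ^^ n) x)"
  by (induction n) (auto simp: act_commute)

lemma equivariant_funpow: "equivariant f ==> f ((act r ^^ n) x) = (act r ^^ n) (f x)"
  by (induction n) (auto simp: equivariantD)

lemma osub_funpow:
  assumes "osub Om act N" "(r, e) \<in> Om" "x \<in> N k"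
  shows "(act r ^^ n) x \<in> N (k + int n * e)"
proof (induction n)
  case (Suc n)
  then show ?case using osubD(5)[OF assms(1,2) Suc] by (simp add: algebra_simps)
qed (use assms in auto)

text \<open>Torsion is tested elementwise, with an exponent depending on the element. In this form,
  unlike annihilation by y, it is stable under extensions: the exponents of the two factors add
  up.\<close>

lemma serre_power_torsion:
  assumes y: "(r, e0) \<in> Om"
  shows "serre_class act Om (power_torsion act (r, e0))"
proof (unfold_locales, goal_cases)
  case (1 f Z W Z' W' e)
  show ?case
    unfolding power_torsion_def fst_conv snd_conv
  proof (intro allI ballI)
    fix k x assume x: "x \<in> Z k"
    then obtain n where "(act r ^^ n) (f x) \<in> W' (k + e + int n * e0)"
      using 1(10) 1(8)[OF x] unfolding power_torsion_def by auto
    then have "f ((act r ^^ n) x) \<in> W' ((k + int n * e0) + e)"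
      using equivariant_funpow[OF 1(1)] by (simp add: algebra_simps)
    then show "\<exists>n. (act r ^^ n) x \<in> W (k + int n * e0)"
      using 1(9) osub_funpow[OF 1(2) y x] by blast
  qed
next
  case (2 f Z W Z' W' e)
  show ?case
    unfolding power_torsion_def fst_conv snd_conv
  proof (intro allI ballI)
    fix k z assume "z \<in> Z' k"
    then obtain x where x: "x \<in> Z (k - e)" "z - f x \<in> W' k" using 2(9)[of z "k - e"] by auto
    then obtain n where "(act r ^^ n) x \<in> W (k - e + int n * e0)"
      using 2(10) unfolding power_torsion_def by auto
    from 2(8)[OF this] have "(act r ^^ n) (f x) \<in> W' (k + int n * e0)"
      using equivariant_funpow[OF 2(1)] by (simp add: algebra_simps)
    moreover have "(act r ^^ n) z - (act r ^^ n) (f x) \<in> W' (k + int n * e0)"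
      using osub_funpow[OF 2(5) y x(2)] by (simp add: act_funpow_diff)
    ultimately show "\<exists>n. (act r ^^ n) z \<in> W' (k + int n * e0)"
      using osub_eq_mod[OF 2(5)] by blast
  qed
next
  case (3 Z Y W)
  show ?case
    unfolding power_torsion_def fst_conv snd_conv
  proof (intro allI ballI)
    fix k x assume x: "x \<in> Z k"
    then obtain n where n: "(act r ^^ n) x \<in> Y (k + int n * e0)"
      using 3(6) unfolding power_torsion_def by auto
    then obtain m where "(act r ^^ m) ((act r ^^ n) x) \<in> W (k + int n * e0 + int m * e0)"
      using 3(7) unfolding power_torsion_def by auto
    then have "(act r ^^ (m + n)) x \<in> W (k + int (m + n) * e0)"
      by (simp add: funpow_add algebra_simps)
    then show "\<exists>n. (act r ^^ n) x \<in> W (k + int n * e0)" by blast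
  qed
next
  case (4 Z W)
  show ?case
    unfolding power_torsion_def using 4 by (auto intro: exI[of _ "0::nat"])
qed

end

section \<open>Cohomology of a complex A/B in terms of representatives\<close>

definition cyc :: "('a => 'a::ab_group_add) => 'a bifamily => 'a bifamily => int => int => 'a set" where
  "cyc D A B n k = {x \<in> A n k. D x \<in> B (n + 1) k}"

definition bnd :: "('a => 'a::ab_group_add) => 'a bifamily => 'a bifamily => int => int => 'a set" where
  "bnd D A B n k = {x \<in> A n k. \<exists>w\<in>A (n - 1) k. x - D w \<in> B n k}"

context operators
begin

text \<open>\<open>(A, B)\<close> stands for the complex \<open>A/B\<close>, hence \<open>D \<circ> D\<close> vanishes only modulo \<open>B\<close>.\<close>

definition cpx :: "('r \<times> int) set => ('a => 'a) => 'a bifamily => 'a bifamily => bool" where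
  "cpx Om D A B \<longleftrightarrow> equivariant D \<and> (\<forall>n. osub Om act (A n) \<and> osub Om act (B n) \<and> (\<forall>k. B n k \<subseteq> A n k \<and>
     (\<forall>x\<in>A n k. D x \<in> A (n + 1) k \<and> D (D x) \<in> B (n + 2) k) \<and> (\<forall>x\<in>B n k. D x \<in> B (n + 1) k)))"

lemma cpxD:
  assumes "cpx Om D A B"
  shows "equivariant D" "osub Om act (A n)" "osub Om act (B n)" "x \<in> B n k ==> x \<in> A n k"
    "x \<in> A n k ==> D x \<in> A (n + 1) k" "x \<in> A n k ==> D (D x) \<in> B (n + 2) k" "x \<in> B n k ==> D x \<in> B (n + 1) k"
    "x \<in> A (n - 1) k ==> D x \<in> A n k" "x \<in> A (n - 1) k ==> D (D x) \<in> B (n + 1) k" "x \<in> B (n - 1) k ==> D x \<in> B n k"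
proof -
  have *: "equivariant D" "osub Om act (A n) \<and> osub Om act (B n) \<and> (\<forall>k. B n k \<subseteq> A n k \<and>
     (\<forall>x\<in>A n k. D x \<in> A (n + 1) k \<and> D (D x) \<in> B (n + 2) k) \<and> (\<forall>x\<in>B n k. D x \<in> B (n + 1) k))" for n
    using assms by (simp_all add: cpx_def)
  show "equivariant D" "osub Om act (A n)" "osub Om act (B n)"
    "x \<in> B n k ==> x \<in> A n k" "x \<in> A n k ==> D x \<in> A (n + 1) k"
    "x \<in> A n k ==> D (D x) \<in> B (n + 2) k" "x \<in> B n k ==> D x \<in> B (n + 1) k"
    using *(1) *(2)[of n] by auto
  show "x \<in> A (n - 1) k ==> D x \<in> A n k" "x \<in> A (n - 1) k ==> D (D x) \<in> B (n + 1) k" "x \<in> B (n - 1) k ==> D x \<in> B n k"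
    using *(2)[of "n - 1"] by (simp_all add: add.commute[of 1])
qed

lemma osub_cyc:
  assumes c: "cpx Om D A B"
  shows "osub Om act (cyc D A B n)"
proof (rule osubI)
  note eq = equivariantD[OF cpxD(1)[OF c]]
  show "0 \<in> cyc D A B n k" for k
    using osubD(1)[OF cpxD(2)[OF c]] osubD(1)[OF cpxD(3)[OF c]] by (simp add: cyc_def eq)
  show "x - y \<in> cyc D A B n k" if "x \<in> cyc D A B n k" "y \<in> cyc D A B n k" for x y k
    using that osubD(2)[OF cpxD(2)[OF c]] osubD(2)[OF cpxD(3)[OF c]] by (simp add: cyc_def eq)
  show "act r x \<in> cyc D A B n (k + e)" if "(r, e) \<in> Om" "x \<in> cyc D A B n k" for r e x k
    using that(2) osubD(5)[OF cpxD(2)[OF c] that(1)] osubD(5)[OF cpxD(3)[OF c] that(1)] by (simp add: cyc_def eq)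
qed

lemma osub_bnd: 
  assumes c: "cpx Om D A B"
  shows "osub Om act (bnd D A B n)"
proof (rule osubI)
  note eq = equivariantD[OF cpxD(1)[OF c]]
  show "0 \<in> bnd D A B n k" for k
    using osubD(1)[OF cpxD(2)[OF c]] osubD(1)[OF cpxD(3)[OF c]]
    by (auto simp: bnd_def eq intro!: bexI[of _ 0])
  show "x - y \<in> bnd D A B n k" if xy: "x \<in> bnd D A B n k" "y \<in> bnd D A B n k" for x y k
  proof -
    obtain u v where *: "u \<in> A (n - 1) k" "v \<in> A (n - 1) k" "x - D u \<in> B n k" "y - D v \<in> B n k"
      using xy by (auto simp: bnd_def)
    then have "x - y - D (u - v) \<in> B n k"
      using osubD(2)[OF cpxD(3)[OF c] *(3,4)] by (simp add: eq algebra_simps)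
    then show ?thesis
      using * xy osubD(2)[OF cpxD(2)[OF c]] by (auto simp: bnd_def)
  qed
  show "act r x \<in> bnd D A B n (k + e)" if r: "(r, e) \<in> Om" and x: "x \<in> bnd D A B n k" for r e x k
  proof -
    obtain u where *: "u \<in> A (n - 1) k" "x - D u \<in> B n k"
      using x by (auto simp: bnd_def)
    then have "act r x - D (act r u) \<in> B n (k + e)"
      using osubD(5)[OF cpxD(3)[OF c] r *(2)] by (simp add: eq act_simps)
    then show ?thesis
      using osubD(5)[OF cpxD(2)[OF c] r] x * by (auto simp: bnd_def)
  qed
qed

lemma bnd_cyc: 
  assumes c: "cpx Om D A B" and x: "x \<in> bnd D A B n k"
  shows "x \<in> cyc D A B n k"
proof -
  obtain u where *: "u \<in> A (n - 1) k" "x - D u \<in> B n k" "x \<in> A n k"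
    using x by (auto simp: bnd_def)
  have "D (x - D u) \<in> B (n + 1) k" "D (D u) \<in> B (n + 1) k"
    using cpxD(7)[OF c *(2)] cpxD(9)[OF c *(1)] by auto
  then have "D x \<in> B (n + 1) k"
    using osub_eq_mod[OF cpxD(3)[OF c]] by (simp add: equivariantD[OF cpxD(1)[OF c]])
  then show ?thesis using * by (simp add: cyc_def)
qed

lemma sub_bnd: "cpx Om D A B ==> x \<in> B n k ==> x \<in> bnd D A B n k"
  using osubD(1)[OF cpxD(2)] cpxD(4) by (auto simp: bnd_def equivariantD[OF cpxD(1)] intro!: bexI[of _ 0])

lemma D_bnd: "cpx Om D A B ==> x \<in> A (n - 1) k ==> D x \<in> bnd D A B n k"
  using osubD(1)[OF cpxD(3)] cpxD(8) by (auto simp: bnd_def intro!: bexI[of _ x])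

lemma bnd_iff: "cpx Om D A B ==> x \<in> bnd D A B n k \<longleftrightarrow> (\<exists>w\<in>A (n - 1) k. x - D w \<in> B n k)"
proof -
  assume c: "cpx Om D A B"
  have "x \<in> A n k" if "w \<in> A (n - 1) k" "x - D w \<in> B n k" for w
    using osub_eq_mod[OF cpxD(2)[OF c]] cpxD(4,8)[OF c] that by blast
  then show ?thesis by (auto simp: bnd_def)
qed

end

context serre_class
begin

definition hs :: "('a => 'a) => 'a bifamily => 'a bifamily => int => bool" where
  "hs D A B n \<longleftrightarrow> sm (cyc D A B n) (bnd D A B n)"

lemma sm_sub: 
  assumes "osub Om act Z" "osub Om act W" "osub Om act Z'" "osub Om act W'"
    "!!k. W k \<subseteq> Z k" "!!k. W' k \<subseteq> Z' k" "!!k. Z k \<subseteq> Z' k" "!!k x. x \<in> Z k ==> x \<in> W' k ==> x \<in> W k" "sm Z' W'"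
  shows "sm Z W"
  using sm_inj[OF equivariant_id assms(1-6), of 0] assms(7-9) by auto

lemma sm_quot: 
  assumes "osub Om act Z" "osub Om act W" "osub Om act Z'" "osub Om act W'"
    "!!k. W k \<subseteq> Z k" "!!k. W' k \<subseteq> Z' k" "!!k. W k \<subseteq> W' k" "!!k z. z \<in> Z' k ==> \<exists>x\<in>Z k. z - x \<in> W' k" "sm Z W"
  shows "sm Z' W'"
  using sm_surj[OF equivariant_id assms(1-6), of 0] assms(7-9) by auto

text \<open>Exactness of H^n(B/C) -> H^n(A/C) -> H^n(A/B). Y consists of the cocycles of A/C that
  bound in A/B, so the upper factor embeds in the cohomology of A/B and the lower one is a quotient
  of a module from B/C.\<close>

lemma hs_les1:
  assumes AB: "cpx Om D A B" and BC: "cpx Om D B C" and AC: "cpx Om D A C"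
    and s: "hs D B C n" "hs D A B n"
  shows "hs D A C n"
proof -
  define Y where "Y k = cyc D A C n k \<inter> bnd D A B n k" for k
  have oY: "osub Om act Y"
    using osubD(1,2,5)[OF osub_cyc[OF AC]] osubD(1,2,5)[OF osub_bnd[OF AB]] by (intro osubI) (auto simp: Y_def)
  have WY: "bnd D A C n k \<subseteq> Y k" for k
  proof
    fix x assume x: "x \<in> bnd D A C n k"
    have "x \<in> bnd D A B n k" using x cpxD(4)[OF BC] by (auto simp: bnd_iff[OF AB] bnd_iff[OF AC])
    then show "x \<in> Y k" using bnd_cyc[OF AC x] by (simp add: Y_def)
  qed
  have 1: "sm (cyc D A C n) Y"
  proof (rule sm_sub[OF osub_cyc[OF AC] oY osub_cyc[OF AB] osub_bnd[OF AB] _ _ _ _ s(2)[unfolded hs_def]])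
    show "bnd D A B n k \<subseteq> cyc D A B n k" for k using bnd_cyc[OF AB] by blast
    show "cyc D A C n k \<subseteq> cyc D A B n k" for k using cpxD(4)[OF BC] unfolding cyc_def by blast
  qed (auto simp: Y_def)
  have 2: "sm Y (bnd D A C n)"
  proof (rule sm_quot[OF osub_cyc[OF BC] osub_bnd[OF BC] oY osub_bnd[OF AC] _ _ _ _ s(1)[unfolded hs_def]])
    show "bnd D B C n k \<subseteq> cyc D B C n k" for k using bnd_cyc[OF BC] by auto
    show "bnd D A C n k \<subseteq> Y k" for k by (rule WY)
    show "bnd D B C n k \<subseteq> bnd D A C n k" for k
      using cpxD(4)[OF AB] unfolding bnd_iff[OF AC] bnd_iff[OF BC] subset_iff by blast
    fix k z assume z: "z \<in> Y k"
    then obtain w where w: "w \<in> A (n - 1) k" "z - D w \<in> B n k" by (auto simp: Y_def bnd_iff[OF AB])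
    have "D z \<in> C (n + 1) k" using z by (auto simp: Y_def cyc_def)
    then have "D (z - D w) \<in> C (n + 1) k"
      using cpxD(9)[OF AC w(1)] osubD(2)[OF cpxD(3)[OF AC]] by (simp add: equivariantD[OF cpxD(1)[OF AC]])
    then have "z - D w \<in> cyc D B C n k" using w by (simp add: cyc_def)
    moreover have "z - (z - D w) \<in> bnd D A C n k" using D_bnd[OF AC w(1)] by simp
    ultimately show "\<exists>x\<in>cyc D B C n k. z - x \<in> bnd D A C n k" by blast
  qed
  show ?thesis
    unfolding hs_def
    by (rule sm_ext[OF osub_cyc[OF AC] oY osub_bnd[OF AC] WY _ 1 2]) (auto simp: Y_def)
qed

text \<open>Exactness of H^n(A/C) -> H^n(A/B) -> H^(n+1)(B/C). Y is the image of the first map, and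
  D itself represents the connecting map, injective modulo Y.\<close>

lemma hs_les2:
  assumes AB: "cpx Om D A B" and BC: "cpx Om D B C" and AC: "cpx Om D A C"
    and s: "hs D A C n" "hs D B C (n + 1)"
  shows "hs D A B n"
proof -
  note eq = equivariantD[OF cpxD(1)[OF AC]]
  define Y where "Y k = {x. \<exists>b\<in>B n k. x - b \<in> cyc D A C n k}" for k
  have oY: "osub Om act Y"
  proof (rule osubI)
    show "0 \<in> Y k" for k
      unfolding Y_def using osubD(1)[OF osub_cyc[OF AC]] osubD(1)[OF cpxD(3)[OF AB]] by (auto intro!: bexI[of _ 0])
    show "x - y \<in> Y k" if xy: "x \<in> Y k" "y \<in> Y k" for x y k
    proof -
      obtain u v where "u \<in> B n k" "v \<in> B n k" "x - u \<in> cyc D A C n k" "y - v \<in> cyc D A C n k"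
        using xy by (auto simp: Y_def)
      then have "u - v \<in> B n k" "(x - y) - (u - v) \<in> cyc D A C n k"
        using osubD(2)[OF cpxD(3)[OF AB]] osubD(2)[OF osub_cyc[OF AC], of "x - u" n k "y - v"] by (auto simp: algebra_simps)
      then show ?thesis by (auto simp: Y_def)
    qed
    show "act r x \<in> Y (k + e')" if r: "(r, e') \<in> Om" and x: "x \<in> Y k" for r e' x k
    proof -
      obtain u where "u \<in> B n k" "x - u \<in> cyc D A C n k" using x by (auto simp: Y_def)
      then have "act r u \<in> B n (k + e')" "act r x - act r u \<in> cyc D A C n (k + e')"
        using osubD(5)[OF cpxD(3)[OF AB] r] osubD(5)[OF osub_cyc[OF AC] r, of "x - u"] by (auto simp: act_simps)
      then show ?thesis by (auto simp: Y_def)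
    qed
  qed
  have BcA: "B n k \<subseteq> cyc D A B n k" for k using cpxD(4,7)[OF AB] by (auto simp: cyc_def)
  have cAC: "cyc D A C n k \<subseteq> cyc D A B n k" for k using cpxD(4)[OF BC] by (auto simp: cyc_def)
  have WY: "bnd D A B n k \<subseteq> Y k" for k
  proof
    fix x assume "x \<in> bnd D A B n k"
    then obtain w where w: "w \<in> A (n - 1) k" "x - D w \<in> B n k" by (auto simp: bnd_iff[OF AB])
    have "D w \<in> cyc D A C n k" using bnd_cyc[OF AC D_bnd[OF AC w(1)]] .
    then show "x \<in> Y k" using w by (auto simp: Y_def intro!: bexI[of _ "x - D w"])
  qed
  have YZ: "Y k \<subseteq> cyc D A B n k" for k
    using osub_eq_mod[OF osub_cyc[OF AB]] BcA cAC osubD(3)[OF osub_cyc[OF AB]]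
    by (auto simp: Y_def) (metis diff_add_cancel subset_iff)
  have 1: "sm (cyc D A B n) Y"
  proof (rule sm_inj[OF cpxD(1)[OF AC] osub_cyc[OF AB] oY osub_cyc[OF BC] osub_bnd[OF BC] YZ, where e = 0])
    show "bnd D B C (n + 1) k \<subseteq> cyc D B C (n + 1) k" for k using bnd_cyc[OF BC] by auto
    show "D x \<in> cyc D B C (n + 1) (k + 0)" if "x \<in> cyc D A B n k" for k x
      using that cpxD(6)[OF AC, of x n k] by (simp add: cyc_def add.commute)
    show "sm (cyc D B C (n + 1)) (bnd D B C (n + 1))" using s(2) by (simp add: hs_def)
    fix k x assume x: "x \<in> cyc D A B n k" "D x \<in> bnd D B C (n + 1) (k + 0)"
    then obtain b where b: "b \<in> B n k" "D x - D b \<in> C (n + 1) k" by (auto simp: bnd_def)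
    then have "x - b \<in> cyc D A C n k"
      using x osubD(2)[OF cpxD(2)[OF AB]] cpxD(4)[OF AB] by (auto simp: cyc_def eq)
    then show "x \<in> Y k" using b by (auto simp: Y_def)
  qed
  have 2: "sm Y (bnd D A B n)"
  proof (rule sm_quot[OF osub_cyc[OF AC] osub_bnd[OF AC] oY osub_bnd[OF AB] _ WY _ _ s(1)[unfolded hs_def]])
    show "bnd D A C n k \<subseteq> cyc D A C n k" for k using bnd_cyc[OF AC] by auto
    show "bnd D A C n k \<subseteq> bnd D A B n k" for k
      using cpxD(4)[OF BC] unfolding bnd_iff[OF AC] bnd_iff[OF AB] subset_iff by blast
    show "\<exists>x\<in>cyc D A C n k. z - x \<in> bnd D A B n k" if "z \<in> Y k" for k z
      using that sub_bnd[OF AB] by (force simp: Y_def)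
  qed
  show ?thesis
    unfolding hs_def
    by (rule sm_ext[OF osub_cyc[OF AB] oY osub_bnd[OF AB] WY YZ 1 2])
qed

text \<open>Exactness of H^(n-1)(A/B) -> H^n(B/C) -> H^n(A/C). Y is the kernel of the second map,
  and D maps the cohomology of A/B onto it.\<close>

lemma hs_les3:
  assumes AB: "cpx Om D A B" and BC: "cpx Om D B C" and AC: "cpx Om D A C"
    and s: "hs D A B (n - 1)" "hs D A C n"
  shows "hs D B C n"
proof -
  note eq = equivariantD[OF cpxD(1)[OF AC]]
  define Y where "Y k = cyc D B C n k \<inter> bnd D A C n k" for k
  have oY: "osub Om act Y"
    using osubD(1,2,5)[OF osub_cyc[OF BC]] osubD(1,2,5)[OF osub_bnd[OF AC]] by (intro osubI) (auto simp: Y_def)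
  have WY: "bnd D B C n k \<subseteq> Y k" for k
  proof
    fix x assume x: "x \<in> bnd D B C n k"
    then have "x \<in> bnd D A C n k" using cpxD(4)[OF AB] unfolding bnd_iff[OF AC] bnd_iff[OF BC] by blast
    then show "x \<in> Y k" using bnd_cyc[OF BC x] by (simp add: Y_def)
  qed
  have 1: "sm (cyc D B C n) Y"
  proof (rule sm_sub[OF osub_cyc[OF BC] oY osub_cyc[OF AC] osub_bnd[OF AC] _ _ _ _ s(2)[unfolded hs_def]])
    show "bnd D A C n k \<subseteq> cyc D A C n k" for k using bnd_cyc[OF AC] by blast
    show "cyc D B C n k \<subseteq> cyc D A C n k" for k using cpxD(4)[OF AB] unfolding cyc_def by blast
  qed (auto simp: Y_def)
  have 2: "sm Y (bnd D B C n)"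
  proof (rule sm_surj[OF cpxD(1)[OF AC] osub_cyc[OF AB] osub_bnd[OF AB] oY osub_bnd[OF BC] _ WY, where e = 0])
    show "bnd D A B (n - 1) k \<subseteq> cyc D A B (n - 1) k" for k using bnd_cyc[OF AB] by auto
    show "sm (cyc D A B (n - 1)) (bnd D A B (n - 1))" using s(1) by (simp add: hs_def)
    fix k z
    show "D z \<in> bnd D B C n (k + 0)" if z: "z \<in> bnd D A B (n - 1) k"
    proof -
      obtain w where w: "w \<in> A (n - 2) k" "z - D w \<in> B (n - 1) k" using z by (auto simp: bnd_def)
      have "D (D w) \<in> C n k" using cpxD(6)[OF AC w(1)] by simp
      then have "D z - D (z - D w) \<in> C n k" by (simp add: eq)
      then show ?thesis unfolding bnd_iff[OF BC] using w(2) by (intro bexI[of _ "z - D w"]) simp_all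
    qed
    show "\<exists>x\<in>cyc D A B (n - 1) k. z - D x \<in> bnd D B C n (k + 0)" if z: "z \<in> Y (k + 0)"
    proof -
      obtain w where w: "w \<in> A (n - 1) k" "z - D w \<in> C n k" using z by (auto simp: Y_def bnd_def)
      have "z \<in> B n k" using z by (auto simp: Y_def cyc_def)
      then have "D w \<in> B n k" using cpxD(4)[OF BC w(2)] osub_eq_mod[OF cpxD(3)[OF AB]] by blast
      then show ?thesis using w sub_bnd[OF BC w(2)] by (intro bexI[of _ w]) (simp_all add: cyc_def)
    qed
  qed
  show ?thesis
    unfolding hs_def
    by (rule sm_ext[OF osub_cyc[OF BC] oY osub_bnd[OF BC] WY _ 1 2]) (auto simp: Y_def)
qed

end

section \<open>Koszul complexes\<close>

text \<open>Two copies of the ambient group inside itself, so that a mapping cone is again a family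
  in the same group and cones can be iterated. The copies do not have to exhaust the group, which is
  why \<open>mcone\<close> asks explicitly that an element be the sum of its two parts.\<close>

locale pairing = operators act for act :: "'r => 'a::ab_group_add => 'a" +
  fixes inl inr ev od :: "'a => 'a"
  assumes inl: "equivariant inl" and inr: "equivariant inr" and ev: "equivariant ev" and od: "equivariant od"
    and pairing_simps [simp]: "ev (inl x) = x" "ev (inr x) = 0" "od (inl x) = 0" "od (inr x) = x"
begin

lemmas pairing_eq = equivariantD[OF inl] equivariantD[OF inr] equivariantD[OF ev] equivariantD[OF od]

definition coneD :: "'r \<times> int => ('a => 'a) => 'a => 'a" where
  "coneD y D w = inl (D (ev w)) + inr (act (fst y) (ev w) - D (od w))"

text \<open>The two slots may come from different families. Filling them with B and A gives a
  complex between the cones of B and of A whose two factors are copies of A/B, one of them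
  shifted.\<close>

definition mcone :: "'r \<times> int => 'a bifamily => 'a bifamily => int => int => 'a set" where
  "mcone y A B n k = {w. w = inl (ev w) + inr (od w) \<and> ev w \<in> A n k \<and> od w \<in> B (n - 1) (k + snd y)}"

lemma mconeE:
  assumes "w \<in> mcone y A B n k"
  obtains u v where "w = inl u + inr v" "u \<in> A n k" "v \<in> B (n - 1) (k + snd y)"
  using assms by (auto simp: mcone_def)

lemma mcone_iff: "inl u + inr v \<in> mcone y A B n k \<longleftrightarrow> u \<in> A n k \<and> v \<in> B (n - 1) (k + snd y)"
  by (simp add: mcone_def pairing_eq)

lemma coneD_eq: "equivariant D ==> coneD y D (inl u + inr v) = inl (D u) + inr (act (fst y) u - D v)"
  by (simp add: coneD_def pairing_eq)

lemma equivariant_coneD: "equivariant D ==> equivariant (coneD y D)"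
  unfolding equivariant_def[of "coneD y D"]
  by (auto simp: coneD_def pairing_eq additive_def equivariantD act_simps act_commute[of "fst y"] algebra_simps)

lemma osub_mcone:
  assumes "!!n. osub Om act (A n)" "!!n. osub Om act (B n)"
  shows "osub Om act (mcone y A B n)"
proof (rule osubI)
  show "0 \<in> mcone y A B n k" for k
    using osubD(1)[OF assms(1)] osubD(1)[OF assms(2)] by (simp add: mcone_def pairing_eq)
  show "x - z \<in> mcone y A B n k" if x: "x \<in> mcone y A B n k" and z: "z \<in> mcone y A B n k" for x z k
  proof -
    obtain u v where 1: "x = inl u + inr v" "u \<in> A n k" "v \<in> B (n - 1) (k + snd y)"
      using x by (rule mconeE)
    obtain u' v' where 2: "z = inl u' + inr v'" "u' \<in> A n k" "v' \<in> B (n - 1) (k + snd y)"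
      using z by (rule mconeE)
    note 1 2
    moreover from this have "x - z = inl (u - u') + inr (v - v')" by (simp add: pairing_eq)
    ultimately show ?thesis
      using osubD(2)[OF assms(1)] osubD(2)[OF assms(2)] by (simp only: mcone_iff)
  qed
  show "act r x \<in> mcone y A B n (k + e)" if r: "(r, e) \<in> Om" and x: "x \<in> mcone y A B n k" for r e x k
  proof -
    obtain u v where "x = inl u + inr v" "u \<in> A n k" "v \<in> B (n - 1) (k + snd y)"
      using x by (auto elim!: mconeE)
    moreover from this have "act r x = inl (act r u) + inr (act r v)" by (simp add: pairing_eq act_simps)
    ultimately show ?thesis
      using osubD(5)[OF assms(1) r, of u n k] osubD(5)[OF assms(2) r, of v "n - 1" "k + snd y"]
      by (simp only: mcone_iff) (simp add: algebra_simps)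
  qed
qed

text \<open>The first slot has to be contained in the second because the differential sends u in the
  first slot to y u in the second.\<close>

lemma cpx_mcone:
  assumes D: "equivariant D" and y: "y \<in> Om"
    and os: "!!n. osub Om act (A1 n)" "!!n. osub Om act (A2 n)" "!!n. osub Om act (B1 n)" "!!n. osub Om act (B2 n)"
    and sub: "!!n k. B1 n k \<subseteq> A1 n k" "!!n k. B2 n k \<subseteq> A2 n k" "!!n k. A1 n k \<subseteq> A2 n k" "!!n k. B1 n k \<subseteq> B2 n k"
    and st: "!!n k x. x \<in> A1 n k ==> D x \<in> A1 (n + 1) k" "!!n k x. x \<in> A2 n k ==> D x \<in> A2 (n + 1) k"
      "!!n k x. x \<in> B1 n k ==> D x \<in> B1 (n + 1) k" "!!n k x. x \<in> B2 n k ==> D x \<in> B2 (n + 1) k"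
    and sq: "!!n k x. x \<in> A1 n k ==> D (D x) \<in> B1 (n + 2) k" "!!n k x. x \<in> A2 n k ==> D (D x) \<in> B2 (n + 2) k"
  shows "cpx Om (coneD y D) (mcone y A1 A2) (mcone y B1 B2)"
proof -
  note eq = equivariantD[OF D]
  obtain r e where y': "y = (r, e)" "(r, e) \<in> Om" using y by (cases y) auto
  have ya: "act r x \<in> A n (k + e)" if "!!n. osub Om act (A n)" "x \<in> A n k" for A :: "int => int => 'a set" and n k x
    using osubD(5)[OF that(1) y'(2)] that(2) by blast
  have D1: "coneD y D w \<in> mcone y A1' A2' (n + 1) k"
    if w: "w \<in> mcone y A1' A2' n k" and os: "!!n. osub Om act (A1' n)" "!!n. osub Om act (A2' n)"
      and s: "!!n k. A1' n k \<subseteq> A2' n k"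
      "!!n k x. x \<in> A1' n k ==> D x \<in> A1' (n + 1) k" "!!n k x. x \<in> A2' n k ==> D x \<in> A2' (n + 1) k" for w A1' A2' n k
  proof -
    obtain u v where uv: "w = inl u + inr v" "u \<in> A1' n k" "v \<in> A2' (n - 1) (k + e)"
      using w unfolding y'(1) by (auto elim!: mconeE)
    have "act r u \<in> A2' n (k + e)" using ya[of A1', OF os(1) uv(2)] s(1) by blast
    moreover have "D v \<in> A2' n (k + e)" using s(3)[OF uv(3)] by simp
    ultimately have "act r u - D v \<in> A2' n (k + e)" using osubD(2)[OF os(2)] by blast
    then show ?thesis
      unfolding uv(1) coneD_eq[OF D] mcone_iff using s(2)[OF uv(2)] by (simp add: y')
  qed
  have D2: "coneD y D (coneD y D w) \<in> mcone y B1 B2 (n + 2) k" if w: "w \<in> mcone y A1 A2 n k" for w n k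
  proof -
    obtain u v where uv: "w = inl u + inr v" "u \<in> A1 n k" "v \<in> A2 (n - 1) (k + e)"
      using w unfolding y'(1) by (auto elim!: mconeE)
    have "coneD y D (coneD y D w) = inl (D (D u)) + inr (D (D v))"
      by (simp add: uv(1) coneD_eq[OF D] eq y')
    then show ?thesis
      using sq(1)[OF uv(2)] sq(2)[OF uv(3)] by (simp add: mcone_iff y' add.commute[of 1])
  qed
  have "mcone y B1 B2 n k \<subseteq> mcone y A1 A2 n k" for n k
    using sub(1)[of n k] sub(2)[of "n - 1" "k + snd y"] by (auto simp: mcone_def)
  moreover have "coneD y D w \<in> mcone y A1 A2 (n + 1) k" if "w \<in> mcone y A1 A2 n k" for w n k
    using that os(1,2) sub(3) st(1,2) by (rule D1)
  moreover have "coneD y D w \<in> mcone y B1 B2 (n + 1) k" if "w \<in> mcone y B1 B2 n k" for w n k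
    using that os(3,4) sub(4) st(3,4) by (rule D1)
  moreover have "osub Om act (mcone y A1 A2 n)" "osub Om act (mcone y B1 B2 n)" for n
    using os by (auto intro: osub_mcone)
  ultimately show ?thesis
    unfolding cpx_def using equivariant_coneD[OF D] D2 by blast
qed

lemma cpx_cone:
  assumes c: "cpx Om D A B" and y: "y \<in> Om"
  shows "cpx Om (coneD y D) (mcone y A A) (mcone y B B)" "cpx Om (coneD y D) (mcone y A A) (mcone y B A)"
    "cpx Om (coneD y D) (mcone y B A) (mcone y B B)"
proof -
  have *: "B n k \<subseteq> A n k" for n k using cpxD(4)[OF c] by blast
  have **: "x \<in> B n k ==> D (D x) \<in> B (n + 2) k" for x n k using cpxD(6)[OF c] cpxD(4)[OF c] by blast
  have ***: "x \<in> A n k ==> D (D x) \<in> A (n + 2) k" for x n k using cpxD(6)[OF c] cpxD(4)[OF c] by blast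
  show "cpx Om (coneD y D) (mcone y A A) (mcone y B B)"
    by (intro cpx_mcone cpxD(1-3,5-7)[OF c] y * subset_refl)
  show "cpx Om (coneD y D) (mcone y A A) (mcone y B A)"
    by (intro cpx_mcone cpxD(1-3,5-7)[OF c] y * *** subset_refl)
  show "cpx Om (coneD y D) (mcone y B A) (mcone y B B)"
    by (intro cpx_mcone cpxD(1-3,5-7)[OF c] y * ** subset_refl)
qed

text \<open>The Koszul complex of a list with coefficients in a complex, as an iterated cone. The
  head of the list gives the innermost cone, so inductions over the list vary D and the
  families.\<close>

primrec kosD :: "('r \<times> int) list => ('a => 'a) => 'a => 'a" where
  "kosD [] D = D"
| "kosD (y # ys) D = kosD ys (coneD y D)"

primrec kos :: "('r \<times> int) list => 'a bifamily => int => int => 'a set" where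
  "kos [] A = A"
| "kos (y # ys) A = kos ys (mcone y A A)"

lemma cpx_kos: "set ys \<subseteq> Om ==> cpx Om D A B ==> cpx Om (kosD ys D) (kos ys A) (kos ys B)"
  by (induction ys arbitrary: D A B) (auto intro: cpx_cone)

end

locale koszul_class = pairing act inl inr ev od + serre_class act Om sm
  for act :: "'r => 'a::ab_group_add => 'a" and inl inr ev od Om sm
begin

text \<open>Filter the cone by the subcomplex with first slot B. The factors contribute A/B in
  degrees n and n - 1, and multiplication by y enters only through the connecting map.\<close>

lemma hs_cone:
  assumes c: "cpx Om D A B" and y: "y \<in> Om" and s: "hs D A B n" "hs D A B (n - 1)"
  shows "hs (coneD y D) (mcone y A A) (mcone y B B) n"
proof (rule hs_les1[OF cpx_cone(2,3,1)[OF c y]])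
  note eq = equivariantD[OF cpxD(1)[OF c]]
  note cA = cpx_cone(2)[OF c y] and cB = cpx_cone(3)[OF c y]
  obtain r e where y': "y = (r, e)" "(r, e) \<in> Om" using y by (cases y) auto
  have yA: "act r x \<in> A n (k + e)" if "x \<in> A n k" for x n k
    using osubD(5)[OF cpxD(2)[OF c] y'(2) that] .
  have yB: "act r x \<in> B n (k + e)" if "x \<in> B n k" for x n k
    using osubD(5)[OF cpxD(3)[OF c] y'(2) that] .
  have A0: "0 \<in> A n k" for n k using osubD(1)[OF cpxD(2)[OF c]] .
  have B0: "0 \<in> B n k" for n k using osubD(1)[OF cpxD(3)[OF c]] .
  show "hs (coneD y D) (mcone y B A) (mcone y B B) n"
    unfolding hs_def
  proof (rule sm_surj[OF inr osub_cyc[OF c] osub_bnd[OF c] osub_cyc[OF cB] osub_bnd[OF cB], where e = "- e"])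
    show "bnd D A B (n - 1) k \<subseteq> cyc D A B (n - 1) k" for k using bnd_cyc[OF c] by blast
    show "bnd (coneD y D) (mcone y B A) (mcone y B B) n k \<subseteq> cyc (coneD y D) (mcone y B A) (mcone y B B) n k" for k
      using bnd_cyc[OF cB] by blast
    show "sm (cyc D A B (n - 1)) (bnd D A B (n - 1))" using s(2) by (simp add: hs_def)
    fix k x
    show "inr x \<in> bnd (coneD y D) (mcone y B A) (mcone y B B) n (k + - e)" if x: "x \<in> bnd D A B (n - 1) k"
    proof -
      obtain u where u: "u \<in> A (n - 2) k" "x - D u \<in> B (n - 1) k" using x by (auto simp: bnd_def)
      \<comment> \<open>The second slot carries the differential -D, so the primitive for D u is
        -u.\<close>
      have "- u \<in> A (n - 2) k" using osubD(4)[OF cpxD(2)[OF c] u(1)] .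
      then have "inl 0 + inr (- u) \<in> mcone y B A (n - 1) (k - e)"
        unfolding mcone_iff by (simp add: y' B0)
      moreover have "inr x - coneD y D (inl 0 + inr (- u)) = inl 0 + inr (x - D u)"
        by (simp only: coneD_eq[OF cpxD(1)[OF c]]) (simp add: eq pairing_eq act_simps)
      moreover have "\<dots> \<in> mcone y B B n (k - e)"
        unfolding mcone_iff using u(2) by (simp add: y' B0)
      ultimately show ?thesis unfolding bnd_iff[OF cB] by (metis add_uminus_conv_diff)
    qed
    show "\<exists>v\<in>cyc D A B (n - 1) k. x - inr v \<in> bnd (coneD y D) (mcone y B A) (mcone y B B) n (k + - e)"
      if x: "x \<in> cyc (coneD y D) (mcone y B A) (mcone y B B) n (k + - e)"
    proof -
      obtain u v where uv: "x = inl u + inr v" "u \<in> B n (k - e)" "v \<in> A (n - 1) k"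
        using x by (auto simp: cyc_def y' elim!: mconeE)
      have "act r u - D v \<in> B n k"
        using x unfolding uv(1) cyc_def mem_Collect_eq coneD_eq[OF cpxD(1)[OF c]] mcone_iff by (simp add: y')
      moreover have "act r u \<in> B n k" using yB[OF uv(2)] by simp
      ultimately have "D v \<in> B n k" using osub_cancel(4)[OF cpxD(3)[OF c]] by blast
      then have "v \<in> cyc D A B (n - 1) k" using uv by (simp add: cyc_def)
      moreover have "inl u + inr 0 \<in> mcone y B B n (k - e)" unfolding mcone_iff using uv B0 by (simp add: y')
      from sub_bnd[OF cB this] have "x - inr v \<in> bnd (coneD y D) (mcone y B A) (mcone y B B) n (k + - e)"
        using uv(1) by (simp add: pairing_eq)
      ultimately show ?thesis by blast
    qed
  qed
  show "hs (coneD y D) (mcone y A A) (mcone y B A) n"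
    unfolding hs_def
  proof (rule sm_surj[OF inl osub_cyc[OF c] osub_bnd[OF c] osub_cyc[OF cA] osub_bnd[OF cA], where e = 0])
    show "bnd D A B n k \<subseteq> cyc D A B n k" for k using bnd_cyc[OF c] by blast
    show "bnd (coneD y D) (mcone y A A) (mcone y B A) n k \<subseteq> cyc (coneD y D) (mcone y A A) (mcone y B A) n k" for k
      using bnd_cyc[OF cA] by blast
    show "sm (cyc D A B n) (bnd D A B n)" using s(1) by (simp add: hs_def)
    fix k x
    show "inl x \<in> bnd (coneD y D) (mcone y A A) (mcone y B A) n (k + 0)" if x: "x \<in> bnd D A B n k"
    proof -
      obtain u where u: "u \<in> A (n - 1) k" "x - D u \<in> B n k" using x by (auto simp: bnd_def)
      have "inl u + inr 0 \<in> mcone y A A (n - 1) k"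
        unfolding mcone_iff by (simp add: A0 u)
      \<comment> \<open>The leftover -r u sits in the second slot, which is divided out
        here.\<close>
      moreover have "inl x - coneD y D (inl u + inr 0) = inl (x - D u) + inr (- act r u)"
        by (simp only: coneD_eq[OF cpxD(1)[OF c]]) (simp add: eq pairing_eq act_simps y')
      moreover have "\<dots> \<in> mcone y B A n k"
        unfolding mcone_iff using u osubD(4)[OF cpxD(2)[OF c] yA[OF u(1)]] by (simp add: y')
      ultimately show ?thesis unfolding bnd_iff[OF cA] by (metis add.right_neutral)
    qed
    show "\<exists>v\<in>cyc D A B n k. x - inl v \<in> bnd (coneD y D) (mcone y A A) (mcone y B A) n (k + 0)"
      if x: "x \<in> cyc (coneD y D) (mcone y A A) (mcone y B A) n (k + 0)"
    proof -
      obtain u v where uv: "x = inl u + inr v" "u \<in> A n k" "v \<in> A (n - 1) (k + e)"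
        using x by (auto simp: cyc_def y' elim!: mconeE)
      have "D u \<in> B (n + 1) k"
        using x unfolding uv(1) cyc_def mem_Collect_eq coneD_eq[OF cpxD(1)[OF c]] mcone_iff by (simp add: y')
      then have "u \<in> cyc D A B n k" using uv by (simp add: cyc_def)
      moreover have "inl 0 + inr v \<in> mcone y B A n k" unfolding mcone_iff using uv B0 by (simp add: y')
      from sub_bnd[OF cA this] have "x - inl u \<in> bnd (coneD y D) (mcone y A A) (mcone y B A) n (k + 0)"
        using uv(1) by (simp add: pairing_eq)
      ultimately show ?thesis by blast
    qed
  qed
qed

definition khs :: "('r \<times> int) list => ('a => 'a) => 'a bifamily => 'a bifamily => int => bool" where
  "khs ys D A B n \<longleftrightarrow> hs (kosD ys D) (kos ys A) (kos ys B) n"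

text \<open>One cone draws on the degrees n and n - 1, an iterated one possibly on all degrees up to
  n.\<close>

lemma khs_if_hs:
  assumes "set ys \<subseteq> Om" "cpx Om D A B" "!!m. m \<le> n ==> hs D A B m"
  shows "khs ys D A B n"
  unfolding khs_def using assms
proof (induction ys arbitrary: D A B)
  case (Cons y ys)
  show ?case
    unfolding kosD.simps kos.simps
    by (rule Cons.IH) (use Cons.prems in \<open>auto intro!: cpx_cone(1) hs_cone\<close>)
qed auto

lemmas khs_les1 = hs_les1[OF cpx_kos cpx_kos cpx_kos, folded khs_def]
lemmas khs_les2 = hs_les2[OF cpx_kos cpx_kos cpx_kos, folded khs_def]
lemmas khs_les3 = hs_les3[OF cpx_kos cpx_kos cpx_kos, folded khs_def]

end

section \<open>Acyclicity, socles and torsion of Koszul complexes\<close>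

context operators
begin

definition acyc :: "('a => 'a) => 'a bifamily => 'a bifamily => int => bool" where
  "acyc D A B n \<longleftrightarrow> (\<forall>k. cyc D A B n k \<subseteq> bnd D A B n k)"

text \<open>The annihilator of \<open>ys\<close> in Z/W, which is the Koszul cohomology of Z/W in
  degree 0.\<close>

definition socle :: "('r \<times> int) list => 'a family => 'a family => int => 'a set" where
  "socle ys Z W k = {v \<in> Z k. \<forall>(r, e)\<in>set ys. act r v \<in> W (k + e)}"

lemma osub_socle:
  assumes Z: "osub Om act Z" and W: "osub Om act W"
  shows "osub Om act (socle ys Z W)"
proof (rule osubI)
  show "0 \<in> socle ys Z W k" for k
    using osubD(1)[OF Z] osubD(1)[OF W] by (auto simp: socle_def act_simps)
  show "x - y \<in> socle ys Z W k" if "x \<in> socle ys Z W k" "y \<in> socle ys Z W k" for x y k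
    using that osubD(2)[OF Z] osubD(2)[OF W] unfolding socle_def by (fastforce simp: act_simps)
  show "act r x \<in> socle ys Z W (k + e)" if r: "(r, e) \<in> Om" and x: "x \<in> socle ys Z W k" for r e x k
  proof -
    have "act s (act r x) \<in> W (k + e + e')" if "(s, e') \<in> set ys" for s e'
    proof -
      have "act s x \<in> W (k + e')" using x that by (auto simp: socle_def)
      from osubD(5)[OF W r this] show ?thesis by (simp add: act_commute[of s] algebra_simps)
    qed
    then show ?thesis using osubD(5)[OF Z r] x by (auto simp: socle_def)
  qed
qed

lemma sub_socle:
  assumes W: "osub Om act W" and ys: "set ys \<subseteq> Om" and "W k \<subseteq> Z k"
  shows "W k \<subseteq> socle ys Z W k"
  using osubD(5)[OF W] ys assms(3) by (auto simp: socle_def)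

end

context pairing
begin

definition kacyc :: "('r \<times> int) list => ('a => 'a) => 'a bifamily => 'a bifamily => int => bool" where
  "kacyc ys D A B n \<longleftrightarrow> acyc (kosD ys D) (kos ys A) (kos ys B) n"

lemma kacyc_if_acyc:
  assumes "set ys \<subseteq> Om" "cpx Om D A B" "!!m. m \<le> n ==> acyc D A B m"
  shows "kacyc ys D A B n"
proof -
  interpret Z: koszul_class act inl inr ev od Om "\<lambda>Z W. \<forall>k. Z k \<subseteq> W k"
    by (intro koszul_class.intro pairing_axioms serre_zero)
  show ?thesis
    using Z.khs_if_hs[OF assms(1,2)] assms(3)
    by (simp add: Z.khs_def Z.hs_def kacyc_def acyc_def)
qed

lemma acyc_cone:
  assumes "cpx Om D A B" "y \<in> Om" "acyc D A B n" "acyc D A B (n - 1)"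
  shows "acyc (coneD y D) (mcone y A A) (mcone y B B) n"
proof -
  interpret Z: koszul_class act inl inr ev od Om "\<lambda>Z W. \<forall>k. Z k \<subseteq> W k"
    by (intro koszul_class.intro pairing_axioms serre_zero)
  show ?thesis
    using Z.hs_cone[OF assms(1,2)] assms(3,4) by (simp add: Z.hs_def acyc_def)
qed

text \<open>Bijectivity of y on A/B in each complex degree, before cohomology is taken. Being
  levelwise, it passes to cones slot by slot.\<close>

definition level_bij :: "'r \<times> int => 'a bifamily => 'a bifamily => bool" where
  "level_bij y A B \<longleftrightarrow> (\<forall>n k. (\<forall>v\<in>A n k. act (fst y) v \<in> B n (k + snd y) --> v \<in> B n k) \<and>
     (\<forall>v\<in>A n (k + snd y). \<exists>u\<in>A n k. v - act (fst y) u \<in> B n (k + snd y)))"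

lemma level_bij_cone:
  assumes "level_bij y A B"
  shows "level_bij y (mcone z A A) (mcone z B B)"
  unfolding level_bij_def
proof (intro allI conjI ballI impI)
  fix n k v
  assume v: "v \<in> mcone z A A n k" and yv: "act (fst y) v \<in> mcone z B B n (k + snd y)"
  obtain u w where uw: "v = inl u + inr w" "u \<in> A n k" "w \<in> A (n - 1) (k + snd z)"
    using v by (rule mconeE)
  have "act (fst y) v = inl (act (fst y) u) + inr (act (fst y) w)"
    by (simp add: uw(1) act_simps pairing_eq)
  then have "act (fst y) u \<in> B n (k + snd y)" "act (fst y) w \<in> B (n - 1) (k + snd z + snd y)"
    using yv by (simp_all add: mcone_iff algebra_simps)
  then show "v \<in> mcone z B B n k"
    unfolding uw(1) mcone_iff using assms uw by (auto simp: level_bij_def)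
next
  fix n k v
  assume v: "v \<in> mcone z A A n (k + snd y)"
  obtain u w where uw: "v = inl u + inr w" "u \<in> A n (k + snd y)" "w \<in> A (n - 1) (k + snd z + snd y)"
    using v by (rule mconeE) (auto simp: algebra_simps)
  then obtain u' w' where "u' \<in> A n k" "u - act (fst y) u' \<in> B n (k + snd y)"
    "w' \<in> A (n - 1) (k + snd z)" "w - act (fst y) w' \<in> B (n - 1) (k + snd z + snd y)"
    using assms unfolding level_bij_def by metis
  moreover have "v - act (fst y) (inl u' + inr w') = inl (u - act (fst y) u') + inr (w - act (fst y) w')"
    by (simp add: uw(1) act_simps pairing_eq)
  ultimately show "\<exists>u\<in>mcone z A A n k. v - act (fst y) u \<in> mcone z B B n (k + snd y)"
    by (intro bexI[of _ "inl u' + inr w'"]) (simp_all add: mcone_iff algebra_simps)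
qed

text \<open>The cone of an isomorphism is acyclic: dividing the second slot by y gives a, and the
  cocycle condition with injectivity of y shows that u is D a modulo B.\<close>

lemma acyc_cone_level_bij:
  assumes c: "cpx Om D A B" and y: "y \<in> Om" and lb: "level_bij y A B"
  shows "acyc (coneD y D) (mcone y A A) (mcone y B B) n"
  unfolding acyc_def
proof (intro allI subsetI)
  note eq = equivariantD[OF cpxD(1)[OF c]]
  fix k x assume x: "x \<in> cyc (coneD y D) (mcone y A A) (mcone y B B) n k"
  obtain r e where y': "y = (r, e)" "(r, e) \<in> Om" using y by (cases y) auto
  obtain u v where uv: "x = inl u + inr v" "u \<in> A n k" "v \<in> A (n - 1) (k + e)"
    using x by (auto simp: cyc_def y' elim!: mconeE)
  have cy: "D u \<in> B (n + 1) k" "act r u - D v \<in> B n (k + e)"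
    using x unfolding uv(1) cyc_def mem_Collect_eq coneD_eq[OF cpxD(1)[OF c]] mcone_iff by (simp_all add: y')
  obtain a where a: "a \<in> A (n - 1) k" "v - act r a \<in> B (n - 1) (k + e)"
    using lb uv(3) unfolding level_bij_def y' fst_conv snd_conv by blast
  have "D (v - act r a) \<in> B n (k + e)" using cpxD(10)[OF c a(2)] .
  from osubD(3)[OF cpxD(3)[OF c] cy(2) this] have "act r (u - D a) \<in> B n (k + e)"
    by (simp add: eq act_simps)
  moreover have "u - D a \<in> A n k" using osubD(2)[OF cpxD(2)[OF c] uv(2) cpxD(8)[OF c a(1)]] .
  ultimately have ua: "u - D a \<in> B n k" using lb unfolding level_bij_def y' by simp
  have "inl a + inr 0 \<in> mcone y A A (n - 1) k"
    unfolding mcone_iff using a(1) osubD(1)[OF cpxD(2)[OF c]] by simp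
  moreover have "x - coneD y D (inl a + inr 0) = inl (u - D a) + inr (v - act r a)"
    by (simp only: coneD_eq[OF cpxD(1)[OF c]] uv(1)) (simp add: eq pairing_eq act_simps y')
  moreover have "\<dots> \<in> mcone y B B n k"
    unfolding mcone_iff using ua a(2) by (simp add: y')
  ultimately show "x \<in> bnd (coneD y D) (mcone y A A) (mcone y B B) n k"
    unfolding bnd_iff[OF cpx_cone(1)[OF c y]] by metis
qed

text \<open>Cones taken before y keep it bijective, and once the cone over y is acyclic all later
  cones are.\<close>

lemma kacyc_level_bij:
  assumes "set ys \<subseteq> Om" "cpx Om D A B" "y \<in> set ys" "level_bij y A B"
  shows "kacyc ys D A B n"
  using assms
proof (induction ys arbitrary: D A B)
  case (Cons z ys)
  show ?case
  proof (cases "y = z")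
    case True
    have "kacyc ys (coneD z D) (mcone z A A) (mcone z B B) n"
      by (rule kacyc_if_acyc[where Om = Om])
        (use Cons.prems True in \<open>auto intro!: cpx_cone(1) acyc_cone_level_bij\<close>)
    then show ?thesis by (simp add: kacyc_def)
  next
    case False
    have "kacyc ys (coneD z D) (mcone z A A) (mcone z B B) n"
      by (rule Cons.IH) (use Cons.prems False in \<open>auto intro!: cpx_cone(1) level_bij_cone\<close>)
    then show ?thesis by (simp add: kacyc_def)
  qed
qed auto

text \<open>Moving the second slot to the first is a homotopy between multiplication by r and zero
  on the cone over r.\<close>

lemma act_bnd_cone:
  assumes c: "cpx Om D A B" and y: "(r, e) \<in> Om"
    and x: "x \<in> cyc (coneD (r, e) D) (mcone (r, e) A A) (mcone (r, e) B B) n k"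
  shows "act r x \<in> bnd (coneD (r, e) D) (mcone (r, e) A A) (mcone (r, e) B B) n (k + e)"
proof -
  note eq = equivariantD[OF cpxD(1)[OF c]]
  obtain u v where uv: "x = inl u + inr v" "u \<in> A n k" "v \<in> A (n - 1) (k + e)"
    using x by (auto simp: cyc_def elim!: mconeE)
  have cy: "act r u - D v \<in> B n (k + e)"
    using x unfolding uv(1) cyc_def mem_Collect_eq coneD_eq[OF cpxD(1)[OF c]] mcone_iff by simp_all
  have "inl v + inr 0 \<in> mcone (r, e) A A (n - 1) (k + e)"
    unfolding mcone_iff using uv osubD(1)[OF cpxD(2)[OF c]] by simp
  moreover have "act r x - coneD (r, e) D (inl v + inr 0) = inl (act r u - D v) + inr 0"
    by (simp only: coneD_eq[OF cpxD(1)[OF c]] uv(1)) (simp add: eq pairing_eq act_simps)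
  moreover have "\<dots> \<in> mcone (r, e) B B n (k + e)"
    unfolding mcone_iff using cy osubD(1)[OF cpxD(3)[OF c]] by simp
  ultimately show ?thesis
    unfolding bnd_iff[OF cpx_cone(1)[OF c y]] by metis
qed

definition ktors :: "'r \<times> int => ('r \<times> int) list => ('a => 'a) => 'a bifamily => 'a bifamily => int => bool" where
  "ktors y ys D A B n \<longleftrightarrow> power_torsion act y (cyc (kosD ys D) (kos ys A) (kos ys B) n) (bnd (kosD ys D) (kos ys A) (kos ys B) n)"

text \<open>On the cohomology of its own cone y acts as zero. Later cones introduce extensions,
  through which torsion persists because it is a Serre class.\<close>

lemma kos_power_torsion:
  assumes "set ys \<subseteq> Om" "cpx Om D A B" "y \<in> set ys"
  shows "ktors y ys D A B n"
proof -
  obtain r e where y': "y = (r, e)" "(r, e) \<in> Om" using assms by (cases y) auto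
  interpret T: koszul_class act inl inr ev od Om "power_torsion act (r, e)"
    by (intro koszul_class.intro pairing_axioms serre_power_torsion y'(2))
  have "T.khs ys D A B n"
    using assms
  proof (induction ys arbitrary: D A B)
    case (Cons z ys)
    show ?case
    proof (cases "y = z")
      case True
      have "T.khs ys (coneD z D) (mcone z A A) (mcone z B B) n"
      proof (rule T.khs_if_hs)
        show "set ys \<subseteq> Om" "cpx Om (coneD z D) (mcone z A A) (mcone z B B)"
          using Cons.prems by (auto intro: cpx_cone(1))
        show "T.hs (coneD z D) (mcone z A A) (mcone z B B) m" for m
          unfolding T.hs_def power_torsion_def
          using act_bnd_cone[OF Cons.prems(2) y'(2)] True y'(1) by (auto intro!: exI[of _ "1::nat"])
      qed
      then show ?thesis by (simp add: T.khs_def)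
    next
      case False
      have "T.khs ys (coneD z D) (mcone z A A) (mcone z B B) n"
        by (rule Cons.IH) (use Cons.prems False in \<open>auto intro!: cpx_cone(1)\<close>)
      then show ?thesis by (simp add: T.khs_def)
    qed
  qed auto
  then show ?thesis by (simp add: ktors_def T.khs_def T.hs_def y')
qed

end

context koszul_class
begin

lemma khs_if_kacyc: "set ys \<subseteq> Om ==> cpx Om D A B ==> kacyc ys D A B n ==> khs ys D A B n"
proof -
  assume *: "set ys \<subseteq> Om" "cpx Om D A B" "kacyc ys D A B n"
  have "cyc (kosD ys D) (kos ys A) (kos ys B) n k = bnd (kosD ys D) (kos ys A) (kos ys B) n k" for k
    using * bnd_cyc[OF cpx_kos[OF *(1,2)]] unfolding kacyc_def acyc_def by blast
  then show ?thesis
    unfolding khs_def hs_def by (rule sm_triv)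
qed

text \<open>If A/B is acyclic below q, its lowest Koszul cohomology is the socle of H^q(A/B).
  Inductively \<open>ev\<close> identifies H^q of the cone over y with the annihilator of y in
  H^q(A/B), and the remaining elements of the list cut out the socle inside it.\<close>

lemma sm_socle_if_khs:
  assumes "set ys \<subseteq> Om" "cpx Om D A B" "!!m. m < q ==> acyc D A B m" "khs ys D A B q"
  shows "sm (socle ys (cyc D A B q) (bnd D A B q)) (bnd D A B q)"
  using assms
proof (induction ys arbitrary: D A B)
  case Nil
  then show ?case by (simp add: khs_def hs_def socle_def)
next
  case (Cons y ys)
  obtain r e where y': "y = (r, e)" "(r, e) \<in> Om" using Cons.prems by (cases y) auto
  have yO: "y \<in> Om" and ysO: "set ys \<subseteq> Om" using Cons.prems by auto
  note c = Cons.prems(2)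
  note eq = equivariantD[OF cpxD(1)[OF c]]
  let ?D = "coneD y D" and ?A = "mcone y A A" and ?B = "mcone y B B"
  note cc = cpx_cone(1)[OF c yO]
  have IH: "sm (socle ys (cyc ?D ?A ?B q) (bnd ?D ?A ?B q)) (bnd ?D ?A ?B q)"
    using Cons.prems by (intro Cons.IH ysO cc acyc_cone[OF c yO]) (auto simp: khs_def)
  \<comment> \<open>The kernel of \<open>ev\<close> on cohomology comes from H^(q-1)(A/B), which
    vanishes.\<close>
  have inj: "w \<in> bnd ?D ?A ?B q k" if w: "w \<in> cyc ?D ?A ?B q k" "ev w \<in> bnd D A B q k" for w k
  proof -
    obtain u v where uv: "w = inl u + inr v" "u \<in> A q k" "v \<in> A (q - 1) (k + e)"
      using w by (auto simp: cyc_def y' elim!: mconeE)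
    have cy: "act r u - D v \<in> B q (k + e)"
      using w(1) unfolding uv(1) cyc_def mem_Collect_eq coneD_eq[OF cpxD(1)[OF c]] mcone_iff by (simp add: y')
    obtain a where a: "a \<in> A (q - 1) k" "u - D a \<in> B q k"
      using w(2) unfolding uv(1) by (auto simp: bnd_def pairing_eq)
    have yu: "act r (u - D a) \<in> B q (k + e)" using osubD(5)[OF cpxD(3)[OF c] y'(2) a(2)] .
    have ya: "act r a \<in> A (q - 1) (k + e)" using osubD(5)[OF cpxD(2)[OF c] y'(2) a(1)] .
    have "D (v - act r a) \<in> B q (k + e)"
      using osubD(2)[OF cpxD(3)[OF c] yu cy] by (simp add: eq act_simps)
    then have "v - act r a \<in> cyc D A B (q - 1) (k + e)"
      using osubD(2)[OF cpxD(2)[OF c] uv(3) ya] by (simp add: cyc_def)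
    then have "v - act r a \<in> bnd D A B (q - 1) (k + e)"
      using Cons.prems(3)[of "q - 1"] by (auto simp: acyc_def)
    then obtain z where z: "z \<in> A (q - 1 - 1) (k + e)" "v - act r a - D z \<in> B (q - 1) (k + e)"
      by (auto simp: bnd_def)
    have "inl a + inr (- z) \<in> ?A (q - 1) k"
      unfolding mcone_iff using a(1) osubD(4)[OF cpxD(2)[OF c] z(1)] by (simp add: y')
    moreover have "w - ?D (inl a + inr (- z)) = inl (u - D a) + inr (v - act r a - D z)"
      by (simp only: coneD_eq[OF cpxD(1)[OF c]] uv(1)) (simp add: eq pairing_eq act_simps y' algebra_simps)
    moreover have "\<dots> \<in> ?B q k"
      unfolding mcone_iff using z(2) a(2) by (simp add: y')
    ultimately show ?thesis
      unfolding bnd_iff[OF cc] by metis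
  qed
  have evb: "ev w \<in> bnd D A B q k" if w: "w \<in> bnd ?D ?A ?B q k" for w k
  proof -
    obtain x where x: "x \<in> ?A (q - 1) k" "w - ?D x \<in> ?B q k" using w by (auto simp: bnd_def)
    obtain u v where uv: "x = inl u + inr v" "u \<in> A (q - 1) k" 
      using x(1) by (auto elim!: mconeE)
    have "ev w - D u = ev (w - ?D x)"
      by (simp add: uv(1) coneD_eq[OF cpxD(1)[OF c]] pairing_eq act_simps)
    also have "\<dots> \<in> B q k" using x(2) by (auto simp: mcone_def)
    finally show ?thesis using uv(2) by (auto simp: bnd_iff[OF c])
  qed
  show ?case
  proof (rule sm_surj[OF ev osub_socle[OF osub_cyc[OF cc] osub_bnd[OF cc]] osub_bnd[OF cc]
        osub_socle[OF osub_cyc[OF c] osub_bnd[OF c]] osub_bnd[OF c], where e = 0])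
    show "bnd ?D ?A ?B q k \<subseteq> socle ys (cyc ?D ?A ?B q) (bnd ?D ?A ?B q) k" for k
      using bnd_cyc[OF cc] by (intro sub_socle[OF osub_bnd[OF cc] ysO]) blast
    show "bnd D A B q k \<subseteq> socle (y # ys) (cyc D A B q) (bnd D A B q) k" for k
      using bnd_cyc[OF c] by (intro sub_socle[OF osub_bnd[OF c] Cons.prems(1)]) blast
    show "ev x \<in> bnd D A B q (k + 0)" if "x \<in> bnd ?D ?A ?B q k" for k x
      using evb[OF that] by simp
    show "sm (socle ys (cyc ?D ?A ?B q) (bnd ?D ?A ?B q)) (bnd ?D ?A ?B q)" by (rule IH)
    fix k z assume "z \<in> socle (y # ys) (cyc D A B q) (bnd D A B q) (k + 0)"
    then have z: "z \<in> cyc D A B q k" "act r z \<in> bnd D A B q (k + e)"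
      "!!s e. (s, e) \<in> set ys ==> act s z \<in> bnd D A B q (k + e)"
      by (auto simp: socle_def y')
    \<comment> \<open>A primitive v of r z exists because r kills the class of z; the pair (z, v) is
      then a cocycle of the cone.\<close>
    obtain v where v: "v \<in> A (q - 1) (k + e)" "act r z - D v \<in> B q (k + e)"
      using z(2) by (auto simp: bnd_def)
    define w where "w = inl z + inr v"
    have ew: "ev w = z" by (simp add: w_def pairing_eq)
    have wc: "w \<in> cyc ?D ?A ?B q k"
      unfolding cyc_def mem_Collect_eq w_def coneD_eq[OF cpxD(1)[OF c]] mcone_iff
      using z v by (auto simp: cyc_def y')
    have "act s w \<in> bnd ?D ?A ?B q (k + e')" if s: "(s, e') \<in> set ys" for s e'
    proof (rule inj)
      show "act s w \<in> cyc ?D ?A ?B q (k + e')"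
        using osubD(5)[OF osub_cyc[OF cc] _ wc] s ysO by auto
      show "ev (act s w) \<in> bnd D A B q (k + e')"
        using z(3)[OF s] by (simp add: equivariantD[OF ev] ew)
    qed
    then have "w \<in> socle ys (cyc ?D ?A ?B q) (bnd ?D ?A ?B q) k"
      using wc by (auto simp: socle_def)
    moreover have "z - ev w \<in> bnd D A B q (k + 0)"
      using osubD(1)[OF osub_bnd[OF c]] by (simp add: ew)
    ultimately show "\<exists>x\<in>socle ys (cyc ?D ?A ?B q) (bnd ?D ?A ?B q) k. z - ev x \<in> bnd D A B q (k + 0)"
      by blast
  qed
qed

end

section \<open>Truncations\<close>

context operators
begin

definition subcomplex :: "('r \<times> int) set => ('a => 'a) => 'a bifamily => 'a bifamily
    => 'a bifamily => bool" where
  "subcomplex Om D C N E \<longleftrightarrow> (\<forall>n. osub Om act (E n) \<and> (\<forall>k. N n k \<subseteq> E n k \<and> E n k \<subseteq> C n k \<and>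
     (\<forall>x\<in>E n k. D x \<in> E (n + 1) k)))"

lemma cpx_subcomplex:
  assumes c: "cpx Om D C N" and E: "subcomplex Om D C N E" and F: "subcomplex Om D C N F"
    and FE: "!!n k. F n k \<subseteq> E n k"
  shows "cpx Om D E F"
proof -
  have "D (D x) \<in> F (n + 2) k" if "x \<in> E n k" for x n k
    using cpxD(6)[OF c, of x n k] that E F unfolding subcomplex_def by blast
  then show ?thesis
    using cpxD(1)[OF c] E F FE unfolding subcomplex_def cpx_def by blast
qed

lemma subcomplex_self:
  assumes "cpx Om D C N"
  shows "subcomplex Om D C N C" "subcomplex Om D C N N"
  unfolding subcomplex_def using cpxD(2-5,7)[OF assms] by blast+

text \<open>
  The truncations of \<open>C/N\<close> are encoded as subcomplexes: \<open>truncT q / N\<close> is \<open>\<tau>\<^sup><\<^sup>q\<close>, \<open>C / truncT q\<close> is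
  \<open>\<tau>\<^sup>\<ge>\<^sup>q\<close>, and \<open>truncU q / truncT q\<close> is the cohomology \<open>H\<^sup>q\<close> placed in degree \<open>q\<close>.
\<close>

definition splice :: "'a bifamily => int => 'a family => 'a bifamily => int => int => 'a set" where
  "splice C q Z N n = (if n < q then C n else if n = q then Z else N n)"

abbreviation truncT :: "('a => 'a) => 'a bifamily => 'a bifamily => int => int => int => 'a set" where
  "truncT D C N q == splice C q (bnd D C N q) N"

abbreviation truncU :: "('a => 'a) => 'a bifamily => 'a bifamily => int => int => int => 'a set" where
  "truncU D C N q == splice C q (cyc D C N q) N"

lemma subcomplex_between:
  assumes c: "cpx Om D C N" and Z: "osub Om act Z" "!!k. bnd D C N q k \<subseteq> Z k" "!!k. Z k \<subseteq> cyc D C N q k"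
  shows "subcomplex Om D C N (splice C q Z N)"
  unfolding subcomplex_def
proof (intro allI conjI ballI)
  let ?E = "splice C q Z N"
  show "osub Om act (?E n)" for n using cpxD(2,3)[OF c] Z(1) by (auto simp: splice_def)
  show "N n k \<subseteq> ?E n k" for n k
    using cpxD(4)[OF c, of _ n k] sub_bnd[OF c, of _ q k] Z(2)[of k] by (auto simp: splice_def)
  show "?E n k \<subseteq> C n k" for n k
    using cpxD(4)[OF c] Z(3)[of k] by (auto simp: cyc_def splice_def)
  fix n k x assume x: "x \<in> ?E n k"
  consider "n + 1 < q" | "n + 1 = q" | "n = q" | "n > q" by linarith
  then show "D x \<in> ?E (n + 1) k"
  proof cases
    case 2
    then have "x \<in> C (q - 1) k" using x by (auto simp: splice_def)
    then show ?thesis using 2 D_bnd[OF c, of x q k] Z(2)[of k] by (auto simp: splice_def)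
  next
    case 3
    then show ?thesis using x Z(3)[of k] by (auto simp: cyc_def splice_def)
  qed (use x cpxD(5,7)[OF c] in \<open>auto simp: splice_def\<close>)
qed

lemma subcomplex_trunc:
  assumes c: "cpx Om D C N"
  shows "subcomplex Om D C N (truncT D C N q)" "subcomplex Om D C N (truncU D C N q)"
proof -
  have "bnd D C N q k \<subseteq> cyc D C N q k" for k using bnd_cyc[OF c] by blast
  then show "subcomplex Om D C N (truncT D C N q)" "subcomplex Om D C N (truncU D C N q)"
    using subcomplex_between[OF c osub_bnd[OF c, of q], of q] subcomplex_between[OF c osub_cyc[OF c, of q], of q]
    by blast+
qed

lemma acyc_if_eq:
  assumes "cpx Om D A B" "!!k. A n k \<subseteq> B n k"
  shows "acyc D A B n"
  using assms(2) sub_bnd[OF assms(1)] unfolding acyc_def cyc_def by blast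

lemma trunc_le:
  assumes c: "cpx Om D C N"
  shows "truncT D C N q n k \<subseteq> truncU D C N q n k" "truncU D C N q n k \<subseteq> truncT D C N (q + 1) n k"
    "N n k \<subseteq> truncT D C N q n k" "truncU D C N q n k \<subseteq> C n k" "truncT D C N q n k \<subseteq> C n k"
proof -
  show "truncT D C N q n k \<subseteq> truncU D C N q n k"
    using bnd_cyc[OF c] by (auto simp: splice_def)
  have "N (q + 1) k \<subseteq> bnd D C N (q + 1) k" using sub_bnd[OF c] by blast
  then show "truncU D C N q n k \<subseteq> truncT D C N (q + 1) n k"
    by (auto simp: splice_def cyc_def)
  show "N n k \<subseteq> truncT D C N q n k" "truncU D C N q n k \<subseteq> C n k" "truncT D C N q n k \<subseteq> C n k"
    using subcomplex_trunc[OF c, of q] unfolding subcomplex_def by blast+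
qed

lemma cpx_trunc:
  assumes c: "cpx Om D C N"
  shows "cpx Om D C (truncT D C N q)" "cpx Om D C (truncU D C N q)" "cpx Om D (truncT D C N q) N"
    "cpx Om D (truncU D C N q) (truncT D C N q)" "cpx Om D (truncT D C N (q + 1)) (truncU D C N q)"
    "cpx Om D (truncU D C N q) N"
  by (intro cpx_subcomplex[OF c] subcomplex_trunc[OF c] subcomplex_self[OF c] trunc_le[OF c]
      order_trans[OF trunc_le(3,1)[OF c]])+

text \<open>D maps degree q of this quotient isomorphically onto degree q + 1, and all other degrees
  are zero.\<close>

lemma acyc_trunc_step:
  assumes c: "cpx Om D C N"
  shows "acyc D (truncT D C N (q + 1)) (truncU D C N q) n"
proof -
  note cc = cpx_trunc(5)[OF c, of q]
  consider "n < q" | "n = q" | "n = q + 1" | "n > q + 1" by linarith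
  then show ?thesis
  proof cases
    case 2
    have "cyc D (truncT D C N (q + 1)) (truncU D C N q) q k \<subseteq> truncU D C N q q k" for k
      by (auto simp: cyc_def splice_def)
    then show ?thesis unfolding acyc_def 2 using sub_bnd[OF cc] by blast
  next
    case 3
    show ?thesis
      unfolding acyc_def 3 by (auto simp: cyc_def splice_def bnd_def)
  qed (auto intro!: acyc_if_eq[OF cc] simp: splice_def)
qed

text \<open>Below q nothing is left after division, and in degree q the cocycles have been divided
  out.\<close>

lemma acyc_truncU:
  assumes c: "cpx Om D C N" and n: "n \<le> q"
  shows "acyc D C (truncU D C N q) n"
proof (cases "n = q")
  case True
  have "cyc D C (truncU D C N q) q k \<subseteq> truncU D C N q q k" for k
    by (auto simp: cyc_def splice_def)
  then show ?thesis unfolding acyc_def True using sub_bnd[OF cpx_trunc(2)[OF c]] by blast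
qed (use n in \<open>auto intro!: acyc_if_eq[OF cpx_trunc(2)[OF c]] simp: splice_def\<close>)

text \<open>Any Z/W between coboundaries and cocycles becomes a complex with Z/W alone in degree q.
  Submodules of \<open>H\<^sup>q\<close>, such as its part in high degrees, can thus be placed
  between the truncations and treated by the long exact sequences.\<close>

lemma cyc_bnd_between:
  assumes c: "cpx Om D C N"
    and Z: "osub Om act Z" "!!k. bnd D C N q k \<subseteq> Z k" "!!k. Z k \<subseteq> cyc D C N q k"
    and W: "osub Om act W" "!!k. bnd D C N q k \<subseteq> W k" "!!k. W k \<subseteq> Z k"
  defines "E == splice C q Z N"
    and "F == splice C q W N"
  shows "cpx Om D E F" "cyc D E F q k = Z k" "bnd D E F q k = W k"
proof -
  have "subcomplex Om D C N E" "subcomplex Om D C N F"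
    unfolding E_def F_def using W Z by (intro subcomplex_between[OF c]; blast)+
  then show EF: "cpx Om D E F"
    by (rule cpx_subcomplex[OF c]) (use W(3) in \<open>auto simp: E_def F_def splice_def\<close>)
  show "cyc D E F q k = Z k" using Z(3)[of k] by (auto simp: cyc_def E_def F_def splice_def)
  have "x \<in> W k" if "w \<in> C (q - 1) k" "x - D w \<in> W k" for x w
    using D_bnd[OF c that(1)] W(2) that(2) osub_eq_mod[OF W(1)] by blast
  then have "bnd D E F q k \<subseteq> W k" by (auto simp: bnd_def E_def F_def splice_def)
  moreover have "W k \<subseteq> bnd D E F q k" using sub_bnd[OF EF, of _ q] by (auto simp: F_def splice_def)
  ultimately show "bnd D E F q k = W k" by blast
qed

end

context koszul_class
begin

text \<open>The truncation is assembled from the cohomology below q: each step adds one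
  \<open>H\<^sup>p\<close> and then an acyclic quotient. Vanishing in negative degrees starts the
  induction.\<close>

lemma khs_truncT:
  assumes ys: "set ys \<subseteq> Om" and c: "cpx Om D C N" and neg: "!!n k. n < 0 ==> C n k \<subseteq> N n k"
    and U: "!!q' n. q' < q ==> khs ys D (truncU D C N (int q')) (truncT D C N (int q')) n"
  shows "khs ys D (truncT D C N (int q)) N n"
  using U
proof (induction q arbitrary: n)
  case 0
  have "truncT D C N 0 m k \<subseteq> N m k" for m k
  proof -
    have "x \<in> N 0 k" if "w \<in> C (- 1) k" "x - D w \<in> N 0 k" for x w
      using neg[of "-1" k] cpxD(7)[OF c, of w "-1" k] that osub_eq_mod[OF cpxD(3)[OF c]] by auto
    then show ?thesis using neg[of m k] by (auto simp: splice_def bnd_def)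
  qed
  then show ?case
    by (intro khs_if_kacyc kacyc_if_acyc[OF ys] acyc_if_eq[OF cpx_trunc(3)[OF c]] ys cpx_trunc(3)[OF c]) auto
next
  case (Suc q)
  let ?T = "truncT D C N (int q)" and ?U = "truncU D C N (int q)" and ?T1 = "truncT D C N (int q + 1)"
  have 1: "khs ys D ?T N n" for n using Suc by simp
  have 2: "khs ys D ?U ?T n" for n using Suc.prems by simp
  have 3: "khs ys D ?U N n" for n
    using khs_les1[OF ys cpx_trunc(4)[OF c] ys cpx_trunc(3)[OF c] ys cpx_trunc(6)[OF c] 1 2] .
  have 4: "khs ys D ?T1 ?U n" for n
    by (intro khs_if_kacyc kacyc_if_acyc[OF ys] acyc_trunc_step[OF c] ys cpx_trunc(5)[OF c])
  have "khs ys D ?T1 N n" for n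
    using khs_les1[OF ys cpx_trunc(5)[OF c] ys cpx_trunc(6)[OF c] ys cpx_trunc(3)[OF c] 3 4] .
  then show ?case by (simp add: add.commute)
qed

text \<open>The bound is q + 1 because \<open>C / truncU q\<close> is acyclic, hence Koszul acyclic,
  up to degree q and affects \<open>truncU q / truncT q\<close> one degree later. As
  \<open>H\<^sup>q\<close> sits in degree q, this means Koszul degrees up to 1.\<close>

lemma khs_cohomology_low:
  assumes ys: "set ys \<subseteq> Om" and c: "cpx Om D C N" and neg: "!!n k. n < 0 ==> C n k \<subseteq> N n k"
    and CN: "!!n. khs ys D C N n"
    and U: "!!q' n. q' < q ==> khs ys D (truncU D C N (int q')) (truncT D C N (int q')) n"
    and n: "n \<le> int q + 1"
  shows "khs ys D (truncU D C N (int q)) (truncT D C N (int q)) n"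
proof -
  have "khs ys D (truncT D C N (int q)) N m" for m
    by (rule khs_truncT[OF ys c neg U])
  then have 1: "khs ys D C (truncT D C N (int q)) n"
    using khs_les2[OF ys cpx_trunc(1)[OF c] ys cpx_trunc(3)[OF c] ys c CN] by simp
  have "kacyc ys D C (truncU D C N (int q)) (n - 1)"
    using n by (intro kacyc_if_acyc[OF ys cpx_trunc(2)[OF c]] acyc_truncU[OF c]) simp
  then have "khs ys D C (truncU D C N (int q)) (n - 1)"
    by (rule khs_if_kacyc[OF ys cpx_trunc(2)[OF c]])
  from khs_les3[OF ys cpx_trunc(2)[OF c] ys cpx_trunc(4)[OF c] ys cpx_trunc(1)[OF c] this 1]
  show ?thesis .
qed

text \<open>A module placed alone in degree q has no cohomology below q, so its Koszul cohomology in
  degree q is its socle.\<close>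

lemma sm_socle_between:
  assumes ys: "set ys \<subseteq> Om" and c: "cpx Om D C N"
    and Z: "osub Om act Z" "!!k. bnd D C N q k \<subseteq> Z k" "!!k. Z k \<subseteq> cyc D C N q k"
    and W: "osub Om act W" "!!k. bnd D C N q k \<subseteq> W k" "!!k. W k \<subseteq> Z k"
    and s: "khs ys D (splice C q Z N) (splice C q W N) q"
  shows "sm (socle ys Z W) W"
proof -
  note * = cyc_bnd_between[OF c Z W]
  have "cyc D (splice C q Z N) (splice C q W N) q = Z" "bnd D (splice C q Z N) (splice C q W N) q = W"
    using *(2,3) by (auto simp: fun_eq_iff)
  moreover have "sm (socle ys (cyc D (splice C q Z N) (splice C q W N) q) (bnd D (splice C q Z N) (splice C q W N) q))
      (bnd D (splice C q Z N) (splice C q W N) q)"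
    by (intro sm_socle_if_khs ys *(1) s acyc_if_eq[OF *(1)]) (auto simp: splice_def)
  ultimately show ?thesis by simp
qed

lemma hs_between:
  assumes c: "cpx Om D C N"
    and Z: "osub Om act Z" "!!k. bnd D C N q k \<subseteq> Z k" "!!k. Z k \<subseteq> cyc D C N q k"
    and W: "osub Om act W" "!!k. bnd D C N q k \<subseteq> W k" "!!k. W k \<subseteq> Z k"
    and s: "sm Z W"
  shows "hs D (splice C q Z N) (splice C q W N) m"
proof -
  note * = cyc_bnd_between[OF c Z W]
  show ?thesis
  proof (cases "m = q")
    case True
    have "cyc D (splice C q Z N) (splice C q W N) q = Z"
      "bnd D (splice C q Z N) (splice C q W N) q = W"
      using *(2,3) by (auto simp: fun_eq_iff)
    then show ?thesis using s True by (simp add: hs_def)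
  next
    case False
    then have "acyc D (splice C q Z N) (splice C q W N) m"
      by (intro acyc_if_eq[OF *(1)]) (auto simp: splice_def)
    then show ?thesis
      unfolding hs_def acyc_def using bnd_cyc[OF *(1)] by (intro sm_triv) blast
  qed
qed

lemma khs_between:
  assumes ys: "set ys \<subseteq> Om" and c: "cpx Om D C N"
    and Z: "osub Om act Z" "!!k. bnd D C N q k \<subseteq> Z k" "!!k. Z k \<subseteq> cyc D C N q k"
    and W: "osub Om act W" "!!k. bnd D C N q k \<subseteq> W k" "!!k. W k \<subseteq> Z k"
    and s: "sm Z W"
  shows "khs ys D (splice C q Z N) (splice C q W N) n"
  by (rule khs_if_hs[OF ys cyc_bnd_between(1)[OF c Z W] hs_between[OF c Z W s]])

end

section \<open>Levelwise isomorphisms\<close>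

text \<open>The two ambient groups may differ: the resolution of M and that of its cohomology module
  live in different ones.\<close>

locale pairing_hom = A: pairing act inl inr ev od + B: pairing act' inl' inr' ev' od'
  for act :: "'r => 'a::ab_group_add => 'a" and inl inr ev od
    and act' :: "'r => 'b::ab_group_add => 'b" and inl' inr' ev' od' +
  fixes f :: "'a => 'b"
  assumes f_additive: "additive f"
    and f_simps: "f (inl x) = inl' (f x)" "f (inr x) = inr' (f x)"
begin

lemma f_add: "f (x + y) = f x + f y" "f (x - y) = f x - f y"
  using f_additive additive.add additive.diff by blast+

text \<open>f induces isomorphisms A/B -> A'/B' in every complex degree. It commutes with the
  differentials modulo B' but strictly with the operators on A, as the transfer of chain conditions
  asks. Being levelwise, the condition passes to cones.\<close>

definition level_iso :: "('a => 'a) => 'a bifamily => 'a bifamily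
    => ('b => 'b) => 'b bifamily => 'b bifamily => bool" where
  "level_iso D A B D' A' B' \<longleftrightarrow> (\<forall>n k. (\<forall>v\<in>A n k. f v \<in> A' n k \<and> (f v \<in> B' n k --> v \<in> B n k) \<and>
       f (D v) - D' (f v) \<in> B' (n + 1) k \<and> (\<forall>r. f (act r v) = act' r (f v))) \<and> (\<forall>v\<in>B n k. f v \<in> B' n k) \<and>
     (\<forall>v'\<in>A' n k. \<exists>v\<in>A n k. v' - f v \<in> B' n k))"

lemma level_isoD:
  assumes "level_iso D A B D' A' B'"
  shows "v \<in> A n k ==> f v \<in> A' n k" "v \<in> A n k ==> f v \<in> B' n k ==> v \<in> B n k"
    "v \<in> A n k ==> f (D v) - D' (f v) \<in> B' (n + 1) k" "v \<in> B n k ==> f v \<in> B' n k"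
    "v' \<in> A' n k ==> \<exists>v\<in>A n k. v' - f v \<in> B' n k"
    "v \<in> A (n - 1) k ==> f (D v) - D' (f v) \<in> B' n k" "v \<in> A n k ==> f (act r v) = act' r (f v)"
proof -
  note * = assms[unfolded level_iso_def]
  show "v \<in> A n k ==> f v \<in> A' n k" "v \<in> A n k ==> f v \<in> B' n k ==> v \<in> B n k"
    "v \<in> A n k ==> f (D v) - D' (f v) \<in> B' (n + 1) k" "v \<in> B n k ==> f v \<in> B' n k"
    "v' \<in> A' n k ==> \<exists>v\<in>A n k. v' - f v \<in> B' n k" "v \<in> A n k ==> f (act r v) = act' r (f v)"
    using *[THEN spec, of n, THEN spec, of k] by auto
  show "v \<in> A (n - 1) k ==> f (D v) - D' (f v) \<in> B' n k"
    using *[THEN spec, of "n - 1", THEN spec, of k] by auto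
qed

lemma level_iso_cone:
  assumes c: "A.cpx Om D A B" and c': "B.cpx Om D' A' B'" and li: "level_iso D A B D' A' B'"
  shows "level_iso (A.coneD y D) (A.mcone y A A) (A.mcone y B B) (B.coneD y D') (B.mcone y A' A') (B.mcone y B' B')"
proof -
  note li' = level_isoD[OF li]
  let ?A = "A.mcone y A A" and ?B = "A.mcone y B B" and ?A' = "B.mcone y A' A'" and ?B' = "B.mcone y B' B'"
  have 1: "f v \<in> ?A' n k" "f v \<in> ?B' n k ==> v \<in> ?B n k" "f (A.coneD y D v) - B.coneD y D' (f v) \<in> ?B' (n + 1) k"
      "f (act r v) = act' r (f v)"
    if v: "v \<in> ?A n k" for n k v r
  proof -
    obtain u w where uw: "v = inl u + inr w" "u \<in> A n k" "w \<in> A (n - 1) (k + snd y)"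
      using v by (rule A.mconeE)
    have fv: "f v = inl' (f u) + inr' (f w)" by (simp add: uw(1) f_add f_simps)
    show "f v \<in> ?A' n k"
      unfolding fv B.mcone_iff using li'(1)[OF uw(2)] li'(1)[OF uw(3)] ..
    show "v \<in> ?B n k" if b: "f v \<in> ?B' n k"
      using b[unfolded fv B.mcone_iff] li'(2)[OF uw(2)] li'(2)[OF uw(3)] unfolding uw(1) A.mcone_iff by simp
    show "f (act r v) = act' r (f v)"
      unfolding fv unfolding uw(1) using li'(7)[OF uw(2), of r] li'(7)[OF uw(3), of r]
      by (simp add: f_add f_simps A.act_simps B.act_simps A.equivariantD(5)[OF A.inl, symmetric] A.equivariantD(5)[OF A.inr, symmetric]
          B.equivariantD(5)[OF B.inl, symmetric] B.equivariantD(5)[OF B.inr, symmetric])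
    have "f (A.coneD y D v) = inl' (f (D u)) + inr' (act' (fst y) (f u) - f (D w))"
      unfolding uw(1) A.coneD_eq[OF A.cpxD(1)[OF c]] using li'(7)[OF uw(2)] by (simp add: f_add f_simps)
    moreover have "B.coneD y D' (f v) = inl' (D' (f u)) + inr' (act' (fst y) (f u) - D' (f w))"
      unfolding fv by (rule B.coneD_eq[OF B.cpxD(1)[OF c']])
    ultimately have *: "f (A.coneD y D v) - B.coneD y D' (f v) = inl' (f (D u) - D' (f u)) + inr' (- (f (D w) - D' (f w)))"
      by (simp add: B.equivariantD(2,4)[OF B.inl] B.equivariantD(2,4)[OF B.inr])
    have "f (D u) - D' (f u) \<in> B' (n + 1) k" "f (D w) - D' (f w) \<in> B' n (k + snd y)"
      using li'(3)[OF uw(2)] li'(3)[OF uw(3)] by simp_all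
    then show "f (A.coneD y D v) - B.coneD y D' (f v) \<in> ?B' (n + 1) k"
      unfolding * B.mcone_iff using osubD(4)[OF B.cpxD(3)[OF c'], of "f (D w) - D' (f w)" n] by simp
  qed
  have 2: "f v \<in> ?B' n k" if v: "v \<in> ?B n k" for n k v
  proof -
    obtain u w where uw: "v = inl u + inr w" "u \<in> B n k" "w \<in> B (n - 1) (k + snd y)"
      using v by (rule A.mconeE)
    have fv: "f v = inl' (f u) + inr' (f w)" by (simp add: uw(1) f_add f_simps)
    show ?thesis
      unfolding fv B.mcone_iff using li'(4)[OF uw(2)] li'(4)[OF uw(3)] ..
  qed
  have 3: "\<exists>v\<in>?A n k. v' - f v \<in> ?B' n k" if v': "v' \<in> ?A' n k" for n k v'
  proof -
    obtain u w where uw: "v' = inl' u + inr' w" "u \<in> A' n k" "w \<in> A' (n - 1) (k + snd y)"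
      using v' by (rule B.mconeE)
    obtain a where a: "a \<in> A n k" "u - f a \<in> B' n k"
      using li'(5)[OF uw(2)] by auto
    obtain b where b: "b \<in> A (n - 1) (k + snd y)" "w - f b \<in> B' (n - 1) (k + snd y)"
      using li'(5)[OF uw(3)] by auto
    have "v' - f (inl a + inr b) = inl' (u - f a) + inr' (w - f b)"
      by (simp add: uw(1) f_add f_simps B.pairing_eq)
    then have "v' - f (inl a + inr b) \<in> ?B' n k" using a b by (simp only: B.mcone_iff)
    moreover have "inl a + inr b \<in> ?A n k" using a b by (simp only: A.mcone_iff)
    ultimately show ?thesis by blast
  qed
  show ?thesis unfolding level_iso_def using 1 2 3 by blast
qed

lemma chain_condition_level_iso:
  assumes c: "A.cpx Om D A B" and c': "B.cpx Om D' A' B'" and li: "level_iso D A B D' A' B'"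
    and Om': "Om' \<subseteq> Om" and s: "chain_condition asc Om' act (cyc D A B n) (bnd D A B n)"
  shows "chain_condition asc Om' act' (cyc D' A' B' n) (bnd D' A' B' n)"
proof -
  note li' = level_isoD[OF li]
  note eq = A.equivariantD[OF A.cpxD(1)[OF c]] B.equivariantD[OF B.cpxD(1)[OF c']]
  have "bnd D A B n k \<subseteq> cyc D A B n k" for k using A.bnd_cyc[OF c] by blast
  moreover have "f x \<in> bnd D' A' B' n (k + 0)" if x: "x \<in> bnd D A B n k" for k x
  proof -
    obtain w where w: "w \<in> A (n - 1) k" "x - D w \<in> B n k" using x by (auto simp: bnd_def)
    have "f (x - D w) \<in> B' n k" "f (D w) - D' (f w) \<in> B' n k" "f w \<in> A' (n - 1) k"
      using li'(4)[OF w(2)] li'(6)[OF w(1)] li'(1)[OF w(1)] by auto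
    from osubD(3)[OF B.cpxD(3)[OF c'] this(1,2)] this(3)
    show ?thesis by (auto simp: B.bnd_iff[OF c'] f_add)
  qed
  moreover have "\<exists>x\<in>cyc D A B n k. z - f x \<in> bnd D' A' B' n (k + 0)" if z: "z \<in> cyc D' A' B' n (k + 0)" for k z
  proof -
    obtain v where v: "v \<in> A n k" "z - f v \<in> B' n k" using z li'(5)[of z n k] by (auto simp: cyc_def)
    have "D' (z - f v) \<in> B' (n + 1) k" "D' z \<in> B' (n + 1) k"
      using B.cpxD(7)[OF c' v(2)] z by (auto simp: cyc_def)
    then have "D' (f v) \<in> B' (n + 1) k"
      using osub_cancel(4)[OF B.cpxD(3)[OF c']] by (auto simp: eq)
    then have "f (D v) \<in> B' (n + 1) k" using li'(3)[OF v(1)] osub_eq_mod[OF B.cpxD(3)[OF c']] by blast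
    then have "v \<in> cyc D A B n k" using li'(2)[OF A.cpxD(5)[OF c v(1)]] v(1) by (auto simp: cyc_def)
    then show ?thesis using B.sub_bnd[OF c' v(2)] by auto
  qed
  ultimately show ?thesis
    by (intro chain_condition_surj[where f = f and Z = "cyc D A B n" and W = "bnd D A B n" and act = act and e = 0] s)
      (auto intro: f_additive li'(7)[of _ n] B.act_additive osub_mono[OF A.osub_cyc[OF c] Om'] osub_mono[OF B.osub_bnd[OF c'] Om']
        simp: cyc_def[of D])
qed

text \<open>The same isomorphism on cohomology, used through its injectivity: f has an inverse only
  modulo relations, so the condition is carried back along f itself.\<close>

lemma chain_condition_level_iso_rev:
  assumes c: "A.cpx Om D A B" and c': "B.cpx Om D' A' B'" and li: "level_iso D A B D' A' B'"
    and Om': "Om' \<subseteq> Om" and s: "chain_condition asc Om' act' (cyc D' A' B' n) (bnd D' A' B' n)"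
  shows "chain_condition asc Om' act (cyc D A B n) (bnd D A B n)"
proof -
  note li' = level_isoD[OF li]
  note eq = A.equivariantD[OF A.cpxD(1)[OF c]] B.equivariantD[OF B.cpxD(1)[OF c']]
  have "bnd D' A' B' n k \<subseteq> cyc D' A' B' n k" for k using B.bnd_cyc[OF c'] by blast
  moreover have "f x \<in> cyc D' A' B' n (k + 0)" if x: "x \<in> cyc D A B n k" for k x
  proof -
    have x': "x \<in> A n k" "D x \<in> B (n + 1) k" using x by (auto simp: cyc_def)
    have "D' (f x) \<in> B' (n + 1) k"
      using li'(3)[OF x'(1)] li'(4)[OF x'(2)] osub_cancel(4)[OF B.cpxD(3)[OF c']] by blast
    then show ?thesis using li'(1)[OF x'(1)] by (simp add: cyc_def)
  qed
  moreover have "x \<in> bnd D A B n k" if x: "x \<in> cyc D A B n k" and fx: "f x \<in> bnd D' A' B' n (k + 0)" for k x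
  proof -
    have x': "x \<in> A n k" using x by (auto simp: cyc_def)
    obtain w' where w': "w' \<in> A' (n - 1) k" "f x - D' w' \<in> B' n k" using fx by (auto simp: bnd_def)
    obtain w where w: "w \<in> A (n - 1) k" "w' - f w \<in> B' (n - 1) k" using li'(5)[OF w'(1)] by blast
    have 1: "D' w' - D' (f w) \<in> B' n k" using B.cpxD(10)[OF c' w(2)] by (simp add: eq)
    have "(f x - D' w') + (D' w' - D' (f w)) - (f (D w) - D' (f w)) \<in> B' n k"
      by (intro osubD(2,3)[OF B.cpxD(3)[OF c']] w'(2) 1 li'(6)[OF w(1)])
    then have "f (x - D w) \<in> B' n k" by (simp add: f_add algebra_simps)
    moreover have "x - D w \<in> A n k" using osubD(2)[OF A.cpxD(2)[OF c] x' A.cpxD(8)[OF c w(1)]] .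
    ultimately show ?thesis unfolding A.bnd_iff[OF c] using li'(2) w(1) by blast
  qed
  ultimately show ?thesis
    by (intro chain_condition_inj[where f = f and Z' = "cyc D' A' B' n" and W' = "bnd D' A' B' n" and act' = act' and e = 0] s)
      (auto intro: f_additive li'(7)[of _ n] B.act_additive osub_mono[OF A.osub_cyc[OF c] Om'] osub_mono[OF B.osub_bnd[OF c'] Om']
        osub_mono[OF B.osub_cyc[OF c'] Om'] simp: cyc_def[of D])
qed

lemma level_iso_kos:
  assumes "set ys \<subseteq> Om" "A.cpx Om D A B" "B.cpx Om D' A' B'" "level_iso D A B D' A' B'"
  shows "level_iso (A.kosD ys D) (A.kos ys A) (A.kos ys B) (B.kosD ys D') (B.kos ys A') (B.kos ys B')"
  using assms
proof (induction ys arbitrary: D A B D' A' B')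
  case (Cons y ys)
  show ?case
    unfolding A.kosD.simps A.kos.simps B.kosD.simps B.kos.simps
    by (rule Cons.IH) (use Cons.prems in \<open>auto intro!: A.cpx_cone(1) B.cpx_cone(1) level_iso_cone[of Om]\<close>)
qed simp

lemma kos_level_iso:
  assumes ys: "set ys \<subseteq> Om" and c: "A.cpx Om D A B" "B.cpx Om D' A' B'" and li: "level_iso D A B D' A' B'" and Om': "Om' \<subseteq> Om"
  shows "chain_condition asc Om' act (cyc (A.kosD ys D) (A.kos ys A) (A.kos ys B) n) (bnd (A.kosD ys D) (A.kos ys A) (A.kos ys B) n)
    \<longleftrightarrow> chain_condition asc Om' act' (cyc (B.kosD ys D') (B.kos ys A') (B.kos ys B') n) (bnd (B.kosD ys D') (B.kos ys A') (B.kos ys B') n)"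
proof -
  note * = A.cpx_kos[OF ys c(1)] B.cpx_kos[OF ys c(2)] level_iso_kos[OF ys c li] Om'
  show ?thesis using chain_condition_level_iso[OF *] chain_condition_level_iso_rev[OF *] by blast
qed

end

text \<open>An operator that is zero on Z/W preserves every family between W and Z, so it imposes no
  condition on chains.\<close>

lemma chain_condition_strip:
  assumes "chain_condition asc (insert (r, e) Om) act Z W" and "!!k x. x \<in> Z k ==> act r x \<in> W (k + e)"
  shows "chain_condition asc Om act Z W"
proof (rule chain_conditionI, goal_cases)
  case (1 N)
  have "osub (insert (r, e) Om) act (N i)" for i
    using osubD(1,2,5)[OF 1(1)[of i]] assms(2) 1(2,3) by (intro osubI) blast+
  then show ?case
    using chain_conditionD[OF assms(1)] 1(2-4) by blast
qed

section \<open>Torsion modules and socles\<close>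

context operators
begin

lemma act_funpow_zero: "(act r ^^ n) 0 = 0"
  by (induction n) (auto simp: act_simps)

definition ann1 :: "'r \<times> int => 'a family => 'a family => int => 'a set" where
  "ann1 y Z W k = {v \<in> Z k. act (fst y) v \<in> W (k + snd y)}"

text \<open>
  For a descending chain \<open>N\<close> between \<open>W\<close> and \<open>Z\<close>, the submodules \<open>y\<^sup>j (N i \<inter> (W : y\<^sup>j\<^sup>+\<^sup>1)) + W\<close> of \<open>(W : y)\<close>
  decrease in \<open>i\<close> and in \<open>j\<close>, so they become stationary simultaneously for all \<open>j\<close>, and they
  determine \<open>N i\<close>.
\<close>

lemma artinian_if_ann1:
  assumes y: "(r, e) \<in> Om" and Z: "osub Om act Z" and W: "osub Om act W" and WZ: "!!k. W k \<subseteq> Z k"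
    and tors: "power_torsion act (r, e) Z W"
    and cc: "chain_condition False Om act (ann1 (r, e) Z W) W"
  shows "chain_condition False Om act Z W"
proof (rule chain_conditionI, goal_cases)
  case (1 N)
  let ?S = "ann1 (r, e) Z W"
  define L where "L j i k = {u \<in> ?S k. \<exists>v\<in>N i (k - int j * e).
      (act r ^^ Suc j) v \<in> W (k + e) \<and> u - (act r ^^ j) v \<in> W k}" for j i k
  have S: "osub Om act ?S"
    using osub_socle[OF Z W, of "[(r, e)]"] by (simp add: socle_def[abs_def] ann1_def[abs_def])
  have desc: "N i' k \<subseteq> N i k" if "i \<le> i'" for i i' k
    using that by (induction rule: dec_induct) (use 1(4) in auto)
  have sub: "osub Om act (L j i)" for i j
  proof (rule osubI)
    show "0 \<in> L j i k" for k
      using osubD(1)[OF S] osubD(1)[OF 1(1)] osubD(1)[OF W]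
      unfolding L_def by (auto simp: act_simps act_funpow_zero intro!: bexI[of _ 0])
    show "x - x' \<in> L j i k" if x: "x \<in> L j i k" and x': "x' \<in> L j i k" for x x' k
    proof -
      obtain v where v: "v \<in> N i (k - int j * e)" "(act r ^^ Suc j) v \<in> W (k + e)" "x - (act r ^^ j) v \<in> W k"
        using x by (auto simp: L_def)
      obtain v' where v': "v' \<in> N i (k - int j * e)" "(act r ^^ Suc j) v' \<in> W (k + e)" "x' - (act r ^^ j) v' \<in> W k"
        using x' by (auto simp: L_def)
      have "v - v' \<in> N i (k - int j * e)" using osubD(2)[OF 1(1) v(1) v'(1)] .
      moreover have "(act r ^^ Suc j) (v - v') \<in> W (k + e)"
        unfolding act_funpow_diff using osubD(2)[OF W v(2) v'(2)] .
      moreover have "(x - x') - (act r ^^ j) (v - v') = (x - (act r ^^ j) v) - (x' - (act r ^^ j) v')"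
        by (simp add: act_funpow_diff)
      then have "(x - x') - (act r ^^ j) (v - v') \<in> W k"
        using osubD(2)[OF W v(3) v'(3)] by (simp only:)
      ultimately show ?thesis
        using x x' osubD(2)[OF S, of x k x'] unfolding L_def by blast
    qed
    show "act s x \<in> L j i (k + e')" if s: "(s, e') \<in> Om" and x: "x \<in> L j i k" for s e' x k
    proof -
      obtain v where v: "v \<in> N i (k - int j * e)" "(act r ^^ Suc j) v \<in> W (k + e)" "x - (act r ^^ j) v \<in> W k"
        using x by (auto simp: L_def)
      have "act s v \<in> N i (k + e' - int j * e)" using osubD(5)[OF 1(1) s v(1)] by (simp add: algebra_simps)
      moreover have "(act r ^^ Suc j) (act s v) \<in> W (k + e' + e)"
        unfolding act_funpow_commute using osubD(5)[OF W s v(2)] by (simp add: algebra_simps)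
      moreover have "act s x - (act r ^^ j) (act s v) \<in> W (k + e')"
        unfolding act_funpow_commute using osubD(5)[OF W s v(3)] by (simp add: act_simps)
      ultimately show ?thesis
        using x osubD(5)[OF S s, of x k] unfolding L_def by blast
    qed
  qed
  have WL: "W k \<subseteq> L j i k" for i j k
  proof
    fix w assume w: "w \<in> W k"
    have "w \<in> ?S k" using w WZ osubD(5)[OF W y w] by (auto simp: ann1_def)
    then show "w \<in> L j i k"
      using w osubD(1)[OF 1(1)] osubD(1)[OF W] unfolding L_def by (auto intro!: bexI[of _ 0] simp: act_simps act_funpow_zero)
  qed
  have Li: "L j i' k \<subseteq> L j i k" if "i \<le> i'" for i i' j k
    using desc[OF that] unfolding L_def by blast
  have Lj1: "L (Suc j) i k \<subseteq> L j i k" for i j k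
  proof
    fix u assume u: "u \<in> L (Suc j) i k"
    then obtain v where v: "v \<in> N i (k - int (Suc j) * e)" "(act r ^^ Suc (Suc j)) v \<in> W (k + e)" "u - (act r ^^ Suc j) v \<in> W k"
      by (auto simp: L_def)
    have "act r v \<in> N i (k - int j * e)" using osubD(5)[OF 1(1) y v(1)] by (simp add: algebra_simps)
    moreover have "(act r ^^ Suc j) (act r v) \<in> W (k + e)" "u - (act r ^^ j) (act r v) \<in> W k"
      using v(2,3) by (simp_all only: funpow_Suc_right o_def)
    ultimately show "u \<in> L j i k" using u unfolding L_def by blast
  qed
  have Lj: "L j' i k \<subseteq> L j i k" if "j \<le> j'" for i j j' k
    using that by (induction rule: dec_induct) (use Lj1 in \<open>blast+\<close>)
  \<comment> \<open>For nondecreasing g the chain \<open>L (g i) i\<close> moves down in both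
    indices at once.\<close>
  have stab: "\<exists>m. \<forall>i\<ge>m. L (g i) i = L (g m) m" if g: "!!i. g i \<le> g (Suc i)" for g
  proof (rule chain_conditionD[OF cc, where N = "\<lambda>i. L (g i) i"])
    show "if False then L (g i) i k \<subseteq> L (g (Suc i)) (Suc i) k else L (g (Suc i)) (Suc i) k \<subseteq> L (g i) i k" for i k
      using Li[of i "Suc i" "g (Suc i)" k] Lj[OF g, of i i k] by auto
  qed (use sub WL in \<open>auto simp: L_def\<close>)
  \<comment> \<open>The diagonal settles all j from m on together. The finitely many smaller j are
    settled one by one, and I bounds all the indices involved.\<close>
  obtain m where m: "!!i. i \<ge> m ==> L i i = L m m" using stab[of "\<lambda>i. i"] by auto
  have m': "L j i = L m m" if "j \<ge> m" "i \<ge> m" for i j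
  proof
    fix k
    have "L (max i j) (max i j) k \<subseteq> L j i k" "L j i k \<subseteq> L m m k"
      using Li[of i "max i j" "max i j" k] Lj[of j "max i j" i k] Li[of m i j k] Lj[of m j m k] that by auto
    then show "L j i k = L m m k" using m[of "max i j"] that by auto
  qed
  have "\<exists>m. \<forall>i\<ge>m. L j i = L j m" for j using stab[of "\<lambda>_. j"] by auto
  then obtain M where M: "!!j i. i \<ge> M j ==> L j i = L j (M j)" by metis
  define I where "I = Max (insert m (M ` {..m}))"
  have I: "m \<le> I" "j \<le> m ==> M j \<le> I" for j
    unfolding I_def by (rule Max_ge; simp)+
  have LI: "L j i = L j I" if "i \<ge> I" for i j
    using m'[of j i] m'[of j I] M[of j i] M[of j I] that I(1) I(2)[of j] by (cases "j \<ge> m") auto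
  have "N i = N I" if i: "i \<ge> I" for i
  proof
    fix k
    \<comment> \<open>Induction on the exponent that kills v: the power u of v just before lies in
      \<open>L n I = L n i\<close>, so an element of \<open>N i\<close> with the same power modulo W
      can be subtracted.\<close>
    have *: "v \<in> N i k" if "v \<in> N I k" "(act r ^^ n) v \<in> W (k + int n * e)" for n v
      using that
    proof (induction n arbitrary: v)
      case 0 then show ?case using 1(2) by auto
    next
      case (Suc n)
      define u where "u = (act r ^^ n) v"
      have "u \<in> Z (k + int n * e)" unfolding u_def using osub_funpow[OF Z y] Suc(2) 1(3) by blast
      moreover have "act r u \<in> W (k + int n * e + e)" using Suc(3) by (simp add: u_def algebra_simps)
      ultimately have "u \<in> L n I (k + int n * e)"
        unfolding L_def using Suc(2) osubD(1)[OF W]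
        by (auto simp: ann1_def u_def intro!: bexI[of _ v])
      then have "u \<in> L n i (k + int n * e)" using LI[OF i] by simp
      then obtain v' where v': "v' \<in> N i k" "u - (act r ^^ n) v' \<in> W (k + int n * e)" by (auto simp: L_def)
      have "v - v' \<in> N I k" using Suc(2) v'(1) desc[OF i] osubD(2)[OF 1(1)] by blast
      moreover have "(act r ^^ n) (v - v') \<in> W (k + int n * e)" using v'(2) by (simp add: act_funpow_diff u_def)
      ultimately have "v - v' \<in> N i k" by (rule Suc.IH)
      then show ?case using osub_eq_mod[OF 1(1)] v'(1) by blast
    qed
    have "N I k \<subseteq> N i k"
    proof
      fix v assume v: "v \<in> N I k"
      then have "v \<in> Z k" using 1(3) by blast
      then obtain n where "(act r ^^ n) v \<in> W (k + int n * e)" using tors unfolding power_torsion_def by auto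
      then show "v \<in> N i k" using * v by blast
    qed
    then show "N i k = N I k" using desc[OF i] by blast
  qed
  then show ?case by blast
qed

text \<open>The elements of \<open>ys\<close> are removed one at a time: the annihilator of y in the
  socle for \<open>ys\<close> is the socle for \<open>y # ys\<close>.\<close>

lemma artinian_if_socle:
  assumes "set ys \<subseteq> Om" and Z: "osub Om act Z" and W: "osub Om act W" and WZ: "!!k. W k \<subseteq> Z k"
    and "!!y. y \<in> set ys ==> power_torsion act y Z W"
    and "chain_condition False Om act (socle ys Z W) W"
  shows "chain_condition False Om act Z W"
  using assms(1,5,6)
proof (induction ys)
  case Nil
  have "socle [] Z W = Z" by (auto simp: socle_def fun_eq_iff)
  then show ?case using Nil by simp
next
  case (Cons y ys)
  obtain r e where y: "y = (r, e)" "(r, e) \<in> Om" using Cons.prems by (cases y) auto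
  have "chain_condition False Om act (socle ys Z W) W"
  proof (rule artinian_if_ann1[OF y(2) osub_socle[OF Z W] W])
    show "W k \<subseteq> socle ys Z W k" for k using Cons.prems by (intro sub_socle[OF W _ WZ]) auto
    show "power_torsion act (r, e) (socle ys Z W) W"
      using Cons.prems(2)[of y] unfolding power_torsion_def by (auto simp: y socle_def)
    have "ann1 (r, e) (socle ys Z W) W = socle (y # ys) Z W"
      by (auto simp: ann1_def socle_def y fun_eq_iff)
    then show "chain_condition False Om act (ann1 (r, e) (socle ys Z W) W) W"
      using Cons.prems(3) by simp
  qed
  then show ?case using Cons by auto
qed

text \<open>Multiply v in turn by the highest power of each element that leaves it nonzero modulo W.
  The degree can only rise, so a socle that vanishes in high degrees forces Z/W to vanish
  there.\<close>

lemma socle_nontrivial: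
  assumes "set ys \<subseteq> Om" and Z: "osub Om act Z" and W: "osub Om act W"
    and "!!y. y \<in> set ys ==> power_torsion act y Z W \<and> snd y \<ge> 0"
    and "v \<in> Z k" "v \<notin> W k"
  shows "\<exists>k'\<ge>k. \<exists>v'\<in>socle ys Z W k'. v' \<notin> W k'"
  using assms(1,4)
proof (induction ys)
  case Nil
  then show ?case using assms(5,6) by (auto simp: socle_def)
next
  case (Cons y ys)
  obtain r e where y: "y = (r, e)" "(r, e) \<in> Om" "e \<ge> 0" using Cons.prems by (cases y) force
  obtain k' v' where v': "k' \<ge> k" "v' \<in> socle ys Z W k'" "v' \<notin> W k'" using Cons by auto
  have "v' \<in> Z k'" using v' by (auto simp: socle_def)
  then have "\<exists>n. (act r ^^ n) v' \<in> W (k' + int n * e)"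
    using Cons.prems(2)[of y] unfolding power_torsion_def by (auto simp: y)
  moreover define n where "n = (LEAST n. (act r ^^ n) v' \<in> W (k' + int n * e))"
  ultimately have n: "(act r ^^ n) v' \<in> W (k' + int n * e)" "!!m. m < n ==> (act r ^^ m) v' \<notin> W (k' + int m * e)"
    by (auto intro: LeastI_ex dest: not_less_Least)
  then obtain m where m: "n = Suc m" using v'(3) by (cases n) auto
  define w where "w = (act r ^^ m) v'"
  have ysO: "set ys \<subseteq> Om" using Cons.prems by auto
  have "w \<in> socle ys Z W (k' + int m * e)"
    unfolding w_def by (rule osub_funpow[OF osub_socle[OF Z W] y(2) v'(2)])
  moreover have "act r w \<in> W (k' + int m * e + e)" using n(1) by (simp add: m w_def algebra_simps)
  ultimately have "w \<in> socle (y # ys) Z W (k' + int m * e)" by (auto simp: socle_def y)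
  moreover have "w \<notin> W (k' + int m * e)" using n(2)[of m] by (simp add: m w_def)
  moreover have "k' + int m * e \<ge> k" using v'(1) y(3) by (simp add: add_increasing2)
  ultimately show ?case by blast
qed

end

section \<open>Noetherian conditions in degrees bounded below\<close>

definition trunc_ge :: "int => 'a family => int => 'a::zero set" where
  "trunc_ge m Z k = (if k \<ge> m then Z k else {0})"

text \<open>With operators of degree 0 this says that each component of Z/W is Noetherian and that
  the components vanish in large degrees. All bounds m occur so that maps of nonzero degree preserve
  the property.\<close>

definition bounded_noetherian ::
    "('r \<times> int) set => ('r => 'a => 'a::ab_group_add) => 'a family => 'a family => bool" where
  "bounded_noetherian Om act Z W \<longleftrightarrow> (\<forall>m. chain_condition True Om act (trunc_ge m Z) (trunc_ge m W))"

context operators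
begin

lemma osub_zero: "osub Om act (\<lambda>k. {0})"
  by (intro osubI) (auto simp: act_simps)

text \<open>Operators of degree 0 do not connect different degrees, so families can be pasted degree
  by degree.\<close>

lemma osub_piecewise:
  assumes deg: "snd ` Om \<subseteq> {0}" and N: "!!k. \<exists>N. osub Om act N \<and> F k = N k"
  shows "osub Om act F"
proof (intro osubI)
  show "0 \<in> F k" for k using N[of k] osubD(1) by metis
  show "x - y \<in> F k" if "x \<in> F k" "y \<in> F k" for x y k using N[of k] that osubD(2) by metis
  show "act r x \<in> F (k + e)" if r: "(r, e) \<in> Om" and x: "x \<in> F k" for r e x k
  proof -
    obtain N where N: "osub Om act N" "F k = N k" using N by blast
    have "e = 0" using r deg by force
    then show ?thesis using osubD(5)[OF N(1) r, of x k] x N(2) by simp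
  qed
qed

lemma osub_trunc_ge:
  assumes "osub Om act Z" "snd ` Om \<subseteq> {0}"
  shows "osub Om act (trunc_ge m Z)"
proof (rule osub_piecewise[OF assms(2)])
  show "\<exists>N. osub Om act N \<and> trunc_ge m Z k = N k" for k
    using assms(1) osub_zero by (cases "k \<ge> m") (auto simp: trunc_ge_def)
qed

lemma serre_bounded_noetherian:
  assumes sub: "Om' \<subseteq> Om" and deg: "snd ` Om' \<subseteq> {0}"
  shows "serre_class act Om (bounded_noetherian Om' act)"
proof (unfold_locales, goal_cases)
  case (1 f Z W Z' W' e)
  note o = osub_trunc_ge[OF osub_mono[OF _ sub] deg]
  note eq = equivariantD[OF 1(1)]
  show ?case
    unfolding bounded_noetherian_def
  proof
    fix m
    show "chain_condition True Om' act (trunc_ge m Z) (trunc_ge m W)"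
    proof (rule chain_condition_inj[where f = f and act' = act and e = e, OF _ _ act_additive o[OF 1(2)] o[OF 1(5)] _ _ o[OF 1(4)]])
      show "additive f" using 1(1) by (simp add: equivariant_def)
      show "chain_condition True Om' act (trunc_ge (m + e) Z') (trunc_ge (m + e) W')"
        using 1(10) by (simp add: bounded_noetherian_def)
      show "f (act r x) = act r (f x)" for r x by (rule eq)
      show "f x \<in> trunc_ge (m + e) Z' (k + e)" if "x \<in> trunc_ge m Z k" for k x
        using that 1(8)[of x k] by (cases "k \<ge> m") (simp_all add: trunc_ge_def eq)
      show "trunc_ge (m + e) W' k \<subseteq> trunc_ge (m + e) Z' k" for k
        using 1(7)[of k] by (simp add: trunc_ge_def)
      show "x \<in> trunc_ge m W k" if "x \<in> trunc_ge m Z k" "f x \<in> trunc_ge (m + e) W' (k + e)" for k x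
        using that 1(9)[of x k] by (cases "k \<ge> m") (simp_all add: trunc_ge_def)
    qed
  qed
next
  case (2 f Z W Z' W' e)
  note o = osub_trunc_ge[OF osub_mono[OF _ sub] deg]
  note eq = equivariantD[OF 2(1)]
  show ?case
    unfolding bounded_noetherian_def
  proof
    fix m
    show "chain_condition True Om' act (trunc_ge m Z') (trunc_ge m W')"
    proof (rule chain_condition_surj[where f = f and act = act and e = e, OF _ _ act_additive o[OF 2(2)] o[OF 2(5)]])
      show "additive f" using 2(1) by (simp add: equivariant_def)
      show "chain_condition True Om' act (trunc_ge (m - e) Z) (trunc_ge (m - e) W)"
        using 2(10) by (simp add: bounded_noetherian_def)
      show "f (act r x) = act r (f x)" for r x by (rule eq)
      show "trunc_ge (m - e) W k \<subseteq> trunc_ge (m - e) Z k" for k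
        using 2(6)[of k] by (simp add: trunc_ge_def)
      show "f x \<in> trunc_ge m W' (k + e)" if "x \<in> trunc_ge (m - e) W k" for k x
        using that 2(8)[of x k] by (cases "k \<ge> m - e") (simp_all add: trunc_ge_def eq)
      show "\<exists>x\<in>trunc_ge (m - e) Z k. z - f x \<in> trunc_ge m W' (k + e)" if "z \<in> trunc_ge m Z' (k + e)" for k z
        using that 2(9)[of z k] by (cases "k \<ge> m - e") (simp_all add: trunc_ge_def eq)
    qed
  qed
next
  case (3 Z Y W)
  note o = osub_trunc_ge[OF osub_mono[OF _ sub] deg]
  show ?case
    unfolding bounded_noetherian_def
  proof
    fix m
    show "chain_condition True Om' act (trunc_ge m Z) (trunc_ge m W)"
    proof (rule chain_condition_ext[OF act_additive o[OF 3(2)] _ _ o[OF 3(1)]])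
      show "trunc_ge m W k \<subseteq> trunc_ge m Y k" "trunc_ge m Y k \<subseteq> trunc_ge m Z k" for k
        using 3(4,5)[of k] by (simp_all add: trunc_ge_def)
    qed (use 3(6,7) in \<open>simp_all add: bounded_noetherian_def\<close>)
  qed
next
  case (4 Z W)
  then show ?case
    unfolding bounded_noetherian_def by (intro allI chain_condition_triv) (auto simp: trunc_ge_def)
qed

text \<open>Filling in Z one degree after another gives an ascending chain, which becomes stationary
  only if Z and W agree from some degree on.\<close>

lemma bounded_noetherian_vanish:
  assumes "osub Om act Z" "osub Om act W" "snd ` Om \<subseteq> {0}" "!!k. W k \<subseteq> Z k"
    and cc: "chain_condition True Om act (trunc_ge m Z) (trunc_ge m W)"
  shows "\<exists>k0. \<forall>k\<ge>k0. Z k = W k"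
proof -
  define N where "N i k = (if m \<le> k \<and> k \<le> m + int i then Z k else trunc_ge m W k)" for i k
  have "\<exists>l. \<forall>i\<ge>l. N i = N l"
  proof (rule chain_conditionD[OF cc])
    show "osub Om act (N i)" for i
    proof (rule osub_piecewise[OF assms(3)])
      show "\<exists>M. osub Om act M \<and> N i k = M k" for k
        using assms(1) osub_trunc_ge[OF assms(2,3)] by (cases "m \<le> k \<and> k \<le> m + int i") (auto simp: N_def)
    qed
  qed (use assms(4) in \<open>auto simp: N_def trunc_ge_def split: if_splits\<close>)
  then obtain l where l: "!!i. i \<ge> l ==> N i = N l" by blast
  have "Z k = W k" if k: "k \<ge> m + int l + 1" for k
  proof -
    have "N (nat (k - m)) k = N l k" using l[of "nat (k - m)"] k by (simp add: le_nat_iff)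
    then show ?thesis using k by (auto simp: N_def trunc_ge_def)
  qed
  then show ?thesis by blast
qed

text \<open>Descending induction on the degree, using the injection of \<open>T\<^sub>m / soc T\<^sub>m\<close> into a power of \<open>T\<^sub>m\<^sub>+\<^sub>1\<close>.\<close>

lemma bounded_noetherian_if_socle:
  assumes Om': "Om' \<subseteq> Om" "snd ` Om' \<subseteq> {0}" and ys: "set ys \<subseteq> Om" "!!y. y \<in> set ys ==> snd y = 1"
    and Z: "osub Om act Z" and W: "osub Om act W" and WZ: "!!k. W k \<subseteq> Z k"
    and tors: "!!y. y \<in> set ys ==> power_torsion act y Z W"
    and soc: "bounded_noetherian Om' act (socle ys Z W) W"
  shows "bounded_noetherian Om' act Z W"
proof -
  have Z': "osub Om' act Z" and W': "osub Om' act W" using Z W Om'(1) by (auto intro: osub_mono)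
  note S = osub_socle[OF Z W]
  have S': "osub Om' act (socle ys Z W)" using S Om'(1) by (rule osub_mono)
  have WS: "W k \<subseteq> socle zs Z W k" if "set zs \<subseteq> Om" for k zs using sub_socle[OF W that WZ] .
  obtain k0 where k0: "!!k. k \<ge> k0 ==> socle ys Z W k = W k"
    using bounded_noetherian_vanish[OF S' W' Om'(2) WS[OF ys(1)]] soc unfolding bounded_noetherian_def by blast
  have van: "Z k = W k" if k: "k \<ge> k0" for k
  proof (rule ccontr)
    assume "Z k \<noteq> W k"
    then obtain v where "v \<in> Z k" "v \<notin> W k" using WZ by blast
    from socle_nontrivial[OF ys(1) Z W _ this] tors ys(2)
    obtain k' v' where "k' \<ge> k" "v' \<in> socle ys Z W k'" "v' \<notin> W k'" by fastforce
    then show False using k0[of k'] k by auto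
  qed
  \<comment> \<open>Equal to Z above m and to the socle for \<open>zs\<close> in degree m: a
    staircase from \<open>trunc_ge m Z\<close>, at \<open>zs = []\<close>, down to the socle for
    \<open>ys\<close>.\<close>
  define P where "P zs m k = (if k > m then Z k else if k = m then socle zs Z W m else {0})" for zs m k
  have osP: "osub Om' act (P zs m)" for zs m
  proof (rule osub_piecewise[OF Om'(2)])
    show "\<exists>N. osub Om' act N \<and> P zs m k = N k" for k
      using Z' osub_mono[OF osub_socle[OF Z W] Om'(1)] osub_zero unfolding P_def
      by (cases "k > m"; cases "k = m") auto
  qed
  have step: "chain_condition True Om' act (trunc_ge m Z) (trunc_ge m W)"
    if IH: "chain_condition True Om' act (trunc_ge (m + 1) Z) (trunc_ge (m + 1) W)" for m
  proof -
    define Y where "Y k = (if k > m then Z k else if k = m then W k else {0})" for k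
    have osY: "osub Om' act Y"
    proof (rule osub_piecewise[OF Om'(2)])
      show "\<exists>N. osub Om' act N \<and> Y k = N k" for k
        using Z' W' osub_zero unfolding Y_def by (cases "k > m"; cases "k = m") auto
    qed
    note oZ = osub_trunc_ge[OF Z' Om'(2)] and oW = osub_trunc_ge[OF W' Om'(2)]
    have 1: "chain_condition True Om' act Y (trunc_ge m W)"
    proof (rule chain_condition_surj[where f = "\<lambda>x. x" and act = act and e = 0, OF _ _ act_additive oZ oW _ _ _ IH])
      show "\<exists>x\<in>trunc_ge (m + 1) Z k. z - x \<in> trunc_ge m W (k + 0)" if "z \<in> Y (k + 0)" for k z
        using that osubD(1)[OF W'] by (intro bexI[of _ "if k > m then z else 0"]) (auto simp: Y_def trunc_ge_def split: if_splits)
    qed (use WZ osubD(1)[OF W'] in \<open>auto simp: trunc_ge_def additive_def split: if_splits\<close>)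
    have 2: "chain_condition True Om' act (P ys m) Y"
    proof (rule chain_condition_surj[where f = "\<lambda>x. x" and act = act and e = 0, OF _ _ act_additive])
      show "osub Om' act (trunc_ge m (socle ys Z W))" by (rule osub_trunc_ge[OF S' Om'(2)])
      show "chain_condition True Om' act (trunc_ge m (socle ys Z W)) (trunc_ge m W)"
        using soc by (simp add: bounded_noetherian_def)
      show "osub Om' act Y" by (rule osY)
      show "trunc_ge m W k \<subseteq> trunc_ge m (socle ys Z W) k" for k using WS[OF ys(1)] by (auto simp: trunc_ge_def)
      show "\<exists>x\<in>trunc_ge m (socle ys Z W) k. z - x \<in> Y (k + 0)" if z: "z \<in> P ys m (k + 0)" for k z
      proof (cases "k = m")
        case True
        then show ?thesis using z osubD(1)[OF osY] by (auto simp: P_def trunc_ge_def intro!: bexI[of _ z])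
      next
        case False
        then show ?thesis using z osubD(1)[OF S'] by (auto simp: P_def Y_def trunc_ge_def intro!: bexI[of _ 0] split: if_splits)
      qed
    qed (use WZ in \<open>auto simp: trunc_ge_def Y_def additive_def split: if_splits\<close>)
    \<comment> \<open>Multiplication by z embeds the factor of \<open>P zs m\<close> by
      \<open>P (z # zs) m\<close> into degree m + 1, where the chain condition is the induction
      hypothesis.\<close>
    have 3: "chain_condition True Om' act (trunc_ge m Z) (P zs m)" if "set zs \<subseteq> set ys" for zs
      using that
    proof (induction zs)
      case Nil
      show ?case by (rule chain_condition_triv) (auto simp: P_def socle_def trunc_ge_def)
    next
      case (Cons z zs)
      obtain r where z: "z = (r, 1)" "(r, 1) \<in> Om" using Cons.prems ys by (cases z) force
      have "chain_condition True Om' act (P zs m) (P (z # zs) m)"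
      proof (rule chain_condition_inj[where f = "act r" and act' = act and e = 1, OF act_additive _ act_additive osP oW[of "m + 1"] _ _ oZ[of "m + 1"] _ IH])
        show "act r x \<in> trunc_ge (m + 1) Z (k + 1)" if "x \<in> P zs m k" for k x
          using that osubD(5)[OF Z z(2)] by (auto simp: P_def trunc_ge_def socle_def act_simps split: if_splits)
        show "x \<in> P (z # zs) m k" if "x \<in> P zs m k" "act r x \<in> trunc_ge (m + 1) W (k + 1)" for k x
          using that by (auto simp: P_def trunc_ge_def socle_def z split: if_splits)
      qed (use WZ in \<open>auto simp: trunc_ge_def act_commute\<close>)
      moreover have "P (z # zs) m k \<subseteq> P zs m k" "P zs m k \<subseteq> trunc_ge m Z k" for k
        by (auto simp: P_def trunc_ge_def socle_def)
      moreover have "chain_condition True Om' act (trunc_ge m Z) (P zs m)" using Cons by simp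
      ultimately show ?case
        using chain_condition_ext[OF act_additive osP[of zs m] _ _ oZ] by blast
    qed
    have 4: "chain_condition True Om' act (P ys m) (trunc_ge m W)"
      by (rule chain_condition_ext[OF act_additive osY _ _ osP 2 1])
        (use WZ WS[OF ys(1)] in \<open>auto simp: P_def Y_def trunc_ge_def socle_def split: if_splits\<close>)
    show ?thesis
      by (rule chain_condition_ext[OF act_additive osP _ _ oZ 3[OF subset_refl] 4])
        (use WZ WS[OF ys(1)] in \<open>auto simp: P_def trunc_ge_def socle_def split: if_splits\<close>)
  qed
  have low: "chain_condition True Om' act (trunc_ge (k0 - int n) Z) (trunc_ge (k0 - int n) W)" for n
  proof (induction n)
    case 0
    show ?case by (rule chain_condition_triv) (use van in \<open>auto simp: trunc_ge_def\<close>)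
  next
    case (Suc n)
    then show ?case using step[of "k0 - int (Suc n)"] by simp
  qed
  have high: "chain_condition True Om' act (trunc_ge m Z) (trunc_ge m W)" if "m \<ge> k0" for m
    by (rule chain_condition_triv) (use van that in \<open>auto simp: trunc_ge_def\<close>)
  have "chain_condition True Om' act (trunc_ge m Z) (trunc_ge m W)" for m
    using low[of "nat (k0 - m)"] high[of m] by (cases "m \<ge> k0") simp_all
  then show ?thesis
    unfolding bounded_noetherian_def by blast
qed

end

section \<open>Plain R-modules: Noetherian and Artinian\<close>

locale ring_operators = operators act + R: cring R
  for act :: "'r => 'a::ab_group_add => 'a" and R :: "('r, 'x) ring_scheme" (structure) +
  assumes act_one: "act \<one> x = x"
    and act_mult: "r \<in> carrier R ==> s \<in> carrier R ==> act (r \<otimes> s) x = act r (act s x)"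
begin

text \<open>Families closed under these operators are constant, that is, they are plain \<open>R\<close>-submodules.\<close>

definition const_ops :: "('r \<times> int) set" where
  "const_ops = {(a, 0) | a. a \<in> carrier R} \<union> {(\<one>, 1), (\<one>, -1)}"

text \<open>Additivity in the ring element, modulo W. On the ambient group used later it fails
  strictly, because the free generators attached to (r + s) x, to r x and to s x are unrelated
  there.\<close>

definition radd :: "'a family => 'a family => bool" where
  "radd Z W \<longleftrightarrow> (\<forall>k. \<forall>v\<in>Z k. \<forall>r\<in>carrier R. \<forall>s\<in>carrier R. act (r \<oplus> s) v - act r v - act s v \<in> W k)"

lemma osub_const:
  assumes "osub const_ops act N"
  shows "N k = N 0"
proof -
  have *: "x \<in> N (k + 1) \<longleftrightarrow> x \<in> N k" for k x
    using osubD(5)[OF assms, of \<one> 1 x k] osubD(5)[OF assms, of \<one> "-1" x "k + 1"]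
    by (auto simp: const_ops_def act_one)
  have "N (int n) = N 0" "N (- int n) = N 0" for n
  proof (induction n)
    case (Suc n)
    { case 1 then show ?case using *[of _ "int n"] Suc(1) by (auto simp: add.commute) }
    { case 2 then show ?case using *[of _ "- int (Suc n)"] Suc(2) by auto }
  qed auto
  then show ?thesis by (cases k rule: int_cases2) auto
qed

lemma radd_zero:
  assumes "radd Z W" "osub Om act W" "v \<in> Z k"
  shows "act \<zero> v \<in> W k"
proof -
  have "act (\<zero> \<oplus> \<zero>) v - act \<zero> v - act \<zero> v \<in> W k"
    using assms(1,3) unfolding radd_def by blast
  then show ?thesis using osubD(4)[OF assms(2)] by fastforce
qed

lemma radd_minus:
  assumes "radd Z W" "osub Om act W" "v \<in> Z k" "r \<in> carrier R" "s \<in> carrier R"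
  shows "act (r \<ominus> s) v - (act r v - act s v) \<in> W k"
proof -
  have "act ((r \<ominus> s) \<oplus> s) v - act (r \<ominus> s) v - act s v \<in> W k"
    using assms(1,3,4,5) unfolding radd_def by blast
  moreover have "(r \<ominus> s) \<oplus> s = r" using assms(4,5) by (simp add: R.minus_eq R.a_assoc R.l_neg)
  ultimately have "- (act r v - act (r \<ominus> s) v - act s v) \<in> W k"
    by (metis osubD(4)[OF assms(2)])
  moreover have "act (r \<ominus> s) v - (act r v - act s v) = - (act r v - act (r \<ominus> s) v - act s v)" by (simp add: algebra_simps)
  ultimately show ?thesis by (simp only:)
qed

text \<open>The submodule Y + R s. Adjoining one element at a time reduces chain conditions to
  cyclic quotients.\<close>

definition span1 :: "'a family => 'a => int => 'a set" where
  "span1 Y s k = {x. \<exists>a\<in>carrier R. x - act a s \<in> Y k}"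

lemma span1:
  assumes Y: "osub const_ops act Y" and Z: "osub const_ops act Z" and YZ: "!!k. Y k \<subseteq> Z k" and s: "s \<in> Z 0"
    and ra: "radd Z Y"
  shows "osub const_ops act (span1 Y s)" "Y k \<subseteq> span1 Y s k" "span1 Y s k \<subseteq> Z k" "s \<in> span1 Y s k"
proof -
  note Yc = osub_const[OF Y] and Zc = osub_const[OF Z]
  have s0: "act \<zero> s \<in> Y k" for k using radd_zero[OF ra Y s] Yc[of k] by simp
  show Ys: "Y k \<subseteq> span1 Y s k" for k
    using osubD(2)[OF Y _ s0] by (auto simp: span1_def)
  show "s \<in> span1 Y s k"
    using osubD(1)[OF Y] by (auto simp: span1_def act_one intro!: bexI[of _ \<one>])
  have as: "act a s \<in> Z k" if "a \<in> carrier R" for a k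
    using osubD(5)[OF Z, of a 0 s k] that s Zc[of k] by (auto simp: const_ops_def)
  show "span1 Y s k \<subseteq> Z k"
    using as osub_eq_mod[OF Z] YZ by (auto simp: span1_def) blast
  show "osub const_ops act (span1 Y s)"
  proof (rule osubI)
    show "0 \<in> span1 Y s k" for k using Ys osubD(1)[OF Y] by blast
    show "x - y \<in> span1 Y s k" if x: "x \<in> span1 Y s k" and y: "y \<in> span1 Y s k" for x y k
    proof -
      obtain a b where ab: "a \<in> carrier R" "x - act a s \<in> Y k" "b \<in> carrier R" "y - act b s \<in> Y k"
        using x y by (auto simp: span1_def)
      have 1: "act (a \<ominus> b) s - (act a s - act b s) \<in> Y k"
        using radd_minus[OF ra Y s ab(1,3)] Yc[of k] by simp
      have "(x - act a s) - (y - act b s) - (act (a \<ominus> b) s - (act a s - act b s)) \<in> Y k"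
        by (intro osubD(2)[OF Y] ab 1)
      then have "x - y - act (a \<ominus> b) s \<in> Y k" by (simp add: algebra_simps)
      then show ?thesis unfolding span1_def using ab by blast
    qed
    show "act r x \<in> span1 Y s (k + e)" if r: "(r, e) \<in> const_ops" and x: "x \<in> span1 Y s k" for r e x k
    proof -
      obtain a where a: "a \<in> carrier R" "x - act a s \<in> Y k" using x by (auto simp: span1_def)
      have "r \<in> carrier R" using r by (auto simp: const_ops_def)
      moreover have "act r x - act (r \<otimes> a) s \<in> Y (k + e)"
        using osubD(5)[OF Y r a(2)] a(1) \<open>r \<in> carrier R\<close> by (simp add: act_simps act_mult)
      ultimately show ?thesis unfolding span1_def using a by blast
    qed
  qed
qed

text \<open>A maximal Artinian submodule is everything: one more element would only add a simple quotient.\<close>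

lemma artinian_if_noetherian_simple:
  assumes Z: "osub const_ops act Z" and W: "osub const_ops act W" and WZ: "!!k. W k \<subseteq> Z k"
    and ra: "radd Z W"
    and fld: "!!r. r \<in> carrier R ==> (\<forall>v\<in>Z 0. act r v \<in> W 0) \<or> (\<exists>r'\<in>carrier R. \<forall>v\<in>Z 0. act r' (act r v) - v \<in> W 0)"
    and cc: "chain_condition True const_ops act Z W"
  shows "chain_condition False const_ops act Z W"
proof (rule ccontr)
  assume neg: "\<not> chain_condition False const_ops act Z W"
  define P where "P N \<longleftrightarrow> osub const_ops act N \<and> W \<le> N \<and> N \<le> Z \<and> chain_condition False const_ops act N W" for N
  note Zc = osub_const[OF Z]
  have step: "\<exists>N'. P N' \<and> N \<le> N' \<and> N \<noteq> N'" if PN: "P N" for N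
  proof -
    have N: "osub const_ops act N" "!!k. W k \<subseteq> N k" "!!k. N k \<subseteq> Z k"
      and ccN: "chain_condition False const_ops act N W"
      using PN by (auto simp: P_def le_fun_def)
    note Nc = osub_const[OF N(1)]
    have "N \<noteq> Z" using ccN neg by auto
    then obtain k where "N k \<noteq> Z k" by (auto simp: fun_eq_iff)
    then obtain s where s: "s \<in> Z 0" "s \<notin> N 0"
      using Nc[of k] Zc[of k] N(3)[of k] by auto
    have ra': "radd Z N" using ra N(2) unfolding radd_def by blast
    note sp = span1[OF N(1) Z N(3) s(1) ra']
    have "chain_condition False const_ops act (span1 N s) N"
    proof (rule chain_conditionI, goal_cases)
      case (1 Q)
      \<comment> \<open>A member larger than N contains some a s outside N; by \<open>fld\<close> a
        multiple of a s is s modulo W, so the member is everything.\<close>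
      have Q: "Q i = N \<or> Q i = span1 N s" for i
      proof (cases "Q i = N")
        case False
        then obtain k where "Q i k \<noteq> N k" by (auto simp: fun_eq_iff)
        then obtain x where "x \<in> Q i k" "x \<notin> N k" using 1(2)[of k i] by auto
        then have x: "x \<in> Q i 0" "x \<notin> N 0" using osub_const[OF 1(1), of i k] Nc[of k] by auto
        obtain a where a: "a \<in> carrier R" "x - act a s \<in> N 0" using x(1) 1(3) by (force simp: span1_def)
        have "act a s \<notin> N 0" using x(2) a(2) osub_eq_mod[OF N(1)] by blast
        then obtain a' where a': "a' \<in> carrier R" "act a' (act a s) - s \<in> W 0"
          using fld[OF a(1)] s(1) N(2) by blast
        have "act a s \<in> Q i 0" using x(1) a(2) 1(2) osub_eq_mod[OF 1(1)] by blast
        then have "act a' (act a s) \<in> Q i 0"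
          using osubD(5)[OF 1(1), of a' 0 _ i 0] a'(1) by (auto simp: const_ops_def)
        then have sQ: "s \<in> Q i 0" using a'(2) N(2) 1(2) osub_eq_mod[OF 1(1)] by blast
        have "span1 N s k \<subseteq> Q i k" for k
        proof
          fix z assume "z \<in> span1 N s k"
          then obtain b where b: "b \<in> carrier R" "z - act b s \<in> N k" by (auto simp: span1_def)
          have "act b s \<in> Q i k"
            using osubD(5)[OF 1(1), of b 0 s i 0] b(1) sQ osub_const[OF 1(1), of i k] by (auto simp: const_ops_def)
          then show "z \<in> Q i k" using b(2) 1(2) osub_eq_mod[OF 1(1)] by blast
        qed
        then have "Q i k = span1 N s k" for k using 1(3)[of i k] by blast
        then show ?thesis by (simp add: fun_eq_iff)
      qed auto
      have desc: "Q j k \<subseteq> Q i k" if "i \<le> j" for i j k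
        using that by (induction rule: dec_induct) (use 1(4) in \<open>simp_all, blast\<close>)
      show ?case
      proof (cases "\<exists>i. Q i = N")
        case True
        then obtain i where i: "Q i = N" by blast
        have "Q j = N" if "j \<ge> i" for j
        proof
          fix k show "Q j k = N k" using desc[OF that, of k] 1(2)[of k j] i by auto
        qed
        then show ?thesis using i by (intro exI[of _ i]) simp
      next
        case False
        then have "Q i = span1 N s" for i using Q by blast
        then show ?thesis by simp
      qed
    qed
    then have "chain_condition False const_ops act (span1 N s) W"
      by (rule chain_condition_ext[OF act_additive N(1,2) sp(2) sp(1) _ ccN])
    then have "P (span1 N s)"
      unfolding P_def le_fun_def using sp(1,3) N(2) sp(2) by blast
    moreover have "N \<le> span1 N s" using sp(2) by (simp add: le_fun_def)
    moreover have "N \<noteq> span1 N s" using sp(4)[of 0] s(2) by auto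
    ultimately show ?thesis by blast
  qed
  have "chain_condition False const_ops act W W" by (rule chain_condition_triv) simp
  then have PW: "P W" using W WZ by (simp add: P_def le_fun_def)
  \<comment> \<open>If every Artinian submodule could be enlarged, dependent choice would give a
    strictly ascending chain in the Noetherian Z/W.\<close>
  have "\<exists>N. \<forall>i::nat. P (N i) \<and> (N i \<le> N (Suc i) \<and> N i \<noteq> N (Suc i))"
  proof (rule dependent_nat_choice)
    show "\<exists>N. P N" using PW by blast
    show "\<exists>N'. P N' \<and> N \<le> N' \<and> N \<noteq> N'" if "P N" for N using step[OF that] .
  qed
  then obtain N :: "nat => int => 'a set" where N: "!!i. P (N i)" "!!i. N i \<le> N (Suc i)" "!!i. N i \<noteq> N (Suc i)"
    by metis
  have "\<exists>m. \<forall>i\<ge>m. N i = N m"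
  proof (rule chain_conditionD[OF cc])
    show "osub const_ops act (N i)" "W k \<subseteq> N i k" "N i k \<subseteq> Z k" for i k
      using N(1)[of i] by (simp_all add: P_def le_fun_def)
    show "if True then N i k \<subseteq> N (Suc i) k else N (Suc i) k \<subseteq> N i k" for i k
      using N(2)[of i] by (simp add: le_fun_def)
  qed
  then obtain m where m: "!!i. i \<ge> m ==> N i = N m" by blast
  have "N (Suc m) = N m" by (rule m) simp
  then show False using N(3)[of m] by simp
qed

lemma ideal_transporter_act:
  assumes W: "osub const_ops act W" and ra: "radd Z W" and s: "s \<in> Z 0"
  shows "ideal {a \<in> carrier R. act a s \<in> W 0} R"
proof -
  have sa: "act (a \<oplus> b) s - act a s - act b s \<in> W 0" if "a \<in> carrier R" "b \<in> carrier R" for a b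
    using ra s that unfolding radd_def by blast
  have s0: "act \<zero> s \<in> W 0" by (rule radd_zero[OF ra W s])
  show ?thesis
  proof (rule idealI)
    show "ring R" by (rule R.ring_axioms)
    show "subgroup {a \<in> carrier R. act a s \<in> W 0} (add_monoid R)"
    proof (rule R.add.subgroupI)
      show "{a \<in> carrier R. act a s \<in> W 0} \<subseteq> carrier R" by auto
      show "{a \<in> carrier R. act a s \<in> W 0} \<noteq> {}" using s0 by auto
      show "\<ominus> a \<in> {a \<in> carrier R. act a s \<in> W 0}" if a: "a \<in> {a \<in> carrier R. act a s \<in> W 0}" for a
      proof -
        have a': "a \<in> carrier R" "act a s \<in> W 0" using a by auto
        have "act (\<ominus> a \<oplus> a) s - act (\<ominus> a) s - act a s \<in> W 0" using sa a' by simp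
        then have d: "act \<zero> s - act (\<ominus> a) s - act a s \<in> W 0" using a'(1) by (simp add: R.l_neg)
        have "act \<zero> s - act a s - (act \<zero> s - act (\<ominus> a) s - act a s) \<in> W 0"
          by (intro osubD(2)[OF W] s0 a' d)
        then show ?thesis using a' by simp
      qed
      show "a \<oplus> b \<in> {a \<in> carrier R. act a s \<in> W 0}" if a: "a \<in> {a \<in> carrier R. act a s \<in> W 0}" "b \<in> {a \<in> carrier R. act a s \<in> W 0}" for a b
      proof -
        have *: "a \<in> carrier R" "b \<in> carrier R" "act a s \<in> W 0" "act b s \<in> W 0" using a by auto
        have "act (a \<oplus> b) s - act a s - act b s + act b s + act a s \<in> W 0"
          by (intro osubD(3)[OF W] sa *)
        then show ?thesis using * by simp
      qed
    qed
    show "x \<otimes> a \<in> {a \<in> carrier R. act a s \<in> W 0}" "a \<otimes> x \<in> {a \<in> carrier R. act a s \<in> W 0}"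
      if "a \<in> {a \<in> carrier R. act a s \<in> W 0}" "x \<in> carrier R" for a x
    proof -
      have "act x (act a s) \<in> W 0"
        using that osubD(5)[OF W, of x 0 _ 0] by (auto simp: const_ops_def)
      then show "x \<otimes> a \<in> {a \<in> carrier R. act a s \<in> W 0}" using that by (auto simp: act_mult)
      then show "a \<otimes> x \<in> {a \<in> carrier R. act a s \<in> W 0}" using that by (auto simp: R.m_comm)
    qed
  qed
qed

text \<open>A family between Y and Y + R s is determined by the ideal of all a for which it contains
  a s, so a chain of families is a chain of ideals of R.\<close>

lemma noetherian_span1:
  assumes noeth: "noetherian_ring R"
    and Y: "osub const_ops act Y" and Z: "osub const_ops act Z" and YZ: "!!k. Y k \<subseteq> Z k" and s: "s \<in> Z 0"
    and ra: "radd Z Y"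
  shows "chain_condition True const_ops act (span1 Y s) Y"
proof (rule chain_conditionI, goal_cases)
  case (1 N)
  define I where "I i = {a \<in> carrier R. act a s \<in> N i 0}" for i
  have ideal: "ideal (I i) R" for i
    unfolding I_def by (rule ideal_transporter_act[where Z = Z, OF 1(1) _ s]) (use ra 1(2)[of 0 i] 1(2) in \<open>unfold radd_def, blast\<close>)
  have I_mono: "I i \<subseteq> I j" if "i \<le> j" for i j
    using that
  proof (induction rule: dec_induct)
    case (step n)
    then show ?case using 1(4)[of n 0] by (auto simp: I_def)
  qed auto
  have "I i \<subseteq> I j \<or> I j \<subseteq> I i" for i j using I_mono by (cases "i \<le> j") auto
  then have "range I \<noteq> {} \<and> subset.chain {I. ideal I R} (range I)"
    using ideal unfolding subset_chain_def by blast
  then have "\<Union> (range I) \<in> range I"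
    by (intro noetherian_ring.ideal_chain_is_trivial[OF noeth]) simp_all
  then obtain m where m: "\<Union> (range I) = I m" by (rule rangeE)
  have Im: "I i = I m" if "i \<ge> m" for i using m I_mono[OF that] by blast
  have Ni: "x \<in> N i k \<longleftrightarrow> (\<exists>a\<in>I i. x - act a s \<in> Y k)" for x i k
  proof
    assume x: "x \<in> N i k"
    then obtain a where a: "a \<in> carrier R" "x - act a s \<in> Y k" using 1(3) by (force simp: span1_def)
    then have "act a s \<in> N i k" using x 1(2) osub_eq_mod[OF 1(1)] by blast
    then have "a \<in> I i" using a(1) osub_const[OF 1(1), of i k] by (simp add: I_def)
    then show "\<exists>a\<in>I i. x - act a s \<in> Y k" using a by blast
  next
    assume "\<exists>a\<in>I i. x - act a s \<in> Y k"
    then obtain a where a: "a \<in> I i" "x - act a s \<in> Y k" by blast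
    then have "act a s \<in> N i k" using osub_const[OF 1(1), of i k] by (simp add: I_def)
    then show "x \<in> N i k" using a(2) 1(2) osub_eq_mod[OF 1(1)] by blast
  qed
  have "N i = N m" if "i \<ge> m" for i
  proof (rule ext)
    show "N i k = N m k" for k by (rule Set.set_eqI) (simp only: Ni Im[OF that])
  qed
  then show ?case by blast
qed

end

lemma frag_ext:
  assumes "additive f" "additive g" "!!b. f (frag_of b) = g (frag_of b)"
  shows "f x = g x"
proof (rule frag_induction[where S = UNIV and P = "\<lambda>x. f x = g x"])
  show "f (a - b) = g (a - b)" if "f a = g a" "f b = g b" for a b
    using that additive.diff[OF assms(1)] additive.diff[OF assms(2)] by simp
qed (use assms additive.zero[OF assms(1)] additive.zero[OF assms(2)] in auto)

lemma additive_frag_extend: "additive (frag_extend f)"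
  by (simp add: additive_def frag_extend_add)

section \<open>Modules as subquotients of a free abelian group\<close>

type_synonym 'e ambient = "nat \<times> nat \<times> 'e \<Rightarrow>\<^sub>0 int"

locale module_family = R: cring R for R :: "('r, 'x) ring_scheme" (structure) +
  fixes E :: "nat => ('r, 'e) module"
  assumes modules: "module R (E n)"
begin

abbreviation xadd ("(_ \<oplus>[_]/ _)" [65, 0, 66] 65) where "v \<oplus>[n] w == v \<oplus>\<^bsub>E n\<^esub> w"
abbreviation xdiff ("(_ \<ominus>[_]/ _)" [65, 0, 66] 65) where "v \<ominus>[n] w == v \<ominus>\<^bsub>E n\<^esub> w"
abbreviation xminus ("(\<ominus>[_] _)" [0, 81] 80) where "\<ominus>[n] v == \<ominus>\<^bsub>E n\<^esub> v"
abbreviation xsmult ("(_ \<odot>[_]/ _)" [70, 0, 71] 70) where "r \<odot>[n] v == r \<odot>\<^bsub>E n\<^esub> v"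
abbreviation xzero ("\<zero>[_]") where "\<zero>[n] == \<zero>\<^bsub>E n\<^esub>"

text \<open>
  The ambient group is free on triples (tag, index, element). The tag only serves to make room for
  the iterated cones; an element of \<open>E n\<close> is represented by \<open>(0, n, e)\<close>, up to the relations of \<open>E n\<close>.
\<close>

definition fact :: "'r => 'e ambient => 'e ambient" where
  "fact r = frag_extend (\<lambda>(t, n, e). if r \<in> carrier R then frag_of (t, n, if e \<in> carrier (E n) then r \<odot>[n] e else e) else 0)"

text \<open>Even and odd tags give two disjoint copies of the ambient group inside itself, as the
  natural numbers split into two copies of themselves.\<close>

definition finl :: "'e ambient => 'e ambient" where
  "finl = frag_extend (\<lambda>(t, n, e). frag_of (2 * t, n, e))"

definition finr :: "'e ambient => 'e ambient" where
  "finr = frag_extend (\<lambda>(t, n, e). frag_of (2 * t + 1, n, e))"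

definition fev :: "'e ambient => 'e ambient" where
  "fev = frag_extend (\<lambda>(t, n, e). if even t then frag_of (t div 2, n, e) else 0)"

definition fod :: "'e ambient => 'e ambient" where
  "fod = frag_extend (\<lambda>(t, n, e). if odd t then frag_of (t div 2, n, e) else 0)"

lemmas f_defs = fact_def finl_def finr_def fev_def fod_def

lemma f_additive: "additive (fact r)" "additive finl" "additive finr" "additive fev" "additive fod"
  by (simp_all add: f_defs additive_frag_extend)

lemmas f_zero = f_additive[THEN additive.zero]

lemma additive_comp: "additive f ==> additive g ==> additive (\<lambda>x. f (g x))"
  by (simp add: additive_def)

lemma fact_of: "fact r (frag_of (t, n, e)) =
  (if r \<in> carrier R then frag_of (t, n, if e \<in> carrier (E n) then r \<odot>[n] e else e) else 0)"
  by (simp add: fact_def)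

text \<open>Total in r and s: an operator from outside the carrier of R is 0, and generators whose
  entry is outside \<open>E n\<close> are fixed by the others. This keeps the laws of
  \<open>operators\<close> free of side conditions.\<close>

lemma fact_commute: "fact r (fact s x) = fact s (fact r x)"
proof (rule frag_ext[where f = "\<lambda>x. fact r (fact s x)" and g = "\<lambda>x. fact s (fact r x)"])
  fix b :: "nat \<times> nat \<times> 'e"
  obtain t n e where b: "b = (t, n, e)" by (cases b) auto
  interpret X: module R "E n" by (rule modules)
  have "r \<odot>[n] (s \<odot>[n] e) = s \<odot>[n] (r \<odot>[n] e)"
    if "r \<in> carrier R" "s \<in> carrier R" "e \<in> carrier (E n)"
    unfolding X.smult_assoc1[OF that(1,2,3), symmetric] X.smult_assoc1[OF that(2,1,3), symmetric] R.m_comm[OF that(1,2)] ..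
  then show "fact r (fact s (frag_of b)) = fact s (fact r (frag_of b))"
    unfolding b by (cases "r \<in> carrier R"; cases "s \<in> carrier R"; cases "e \<in> carrier (E n)")
      (simp_all add: fact_of additive.zero[OF f_additive(1)])
qed (rule additive_comp[OF f_additive(1) f_additive(1)])+

sublocale F: operators fact
  by (intro operators.intro f_additive fact_commute)

lemma fact_one: "fact \<one> x = x"
proof (rule frag_ext[where f = "fact \<one>" and g = "\<lambda>x. x"])
  fix b :: "nat \<times> nat \<times> 'e"
  obtain t n e where b: "b = (t, n, e)" by (cases b) auto
  show "fact \<one> (frag_of b) = frag_of b"
    unfolding b fact_of using module.smult_one[OF modules] by simp
qed (rule f_additive, simp add: additive_def)

lemma fact_mult:
  assumes rs: "r \<in> carrier R" "s \<in> carrier R"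
  shows "fact (r \<otimes> s) x = fact r (fact s x)"
proof (rule frag_ext[where f = "fact (r \<otimes> s)" and g = "\<lambda>x. fact r (fact s x)"])
  fix b :: "nat \<times> nat \<times> 'e"
  obtain t n e where b: "b = (t, n, e)" by (cases b) auto
  show "fact (r \<otimes> s) (frag_of b) = fact r (fact s (frag_of b))"
    unfolding b using rs module.smult_closed[OF modules rs(2)] module.smult_assoc1[OF modules rs]
    by (cases "e \<in> carrier (E n)") (simp_all add: fact_of)
qed (rule f_additive, rule additive_comp[OF f_additive(1) f_additive(1)])

sublocale F: ring_operators fact R
  by (intro ring_operators.intro ring_operators_axioms.intro F.operators_axioms R.is_cring fact_one fact_mult)

lemma f_of:
  "finl (frag_of (t, n, e)) = frag_of (2 * t, n, e)" "finr (frag_of (t, n, e)) = frag_of (2 * t + 1, n, e)"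
  "fev (frag_of (t, n, e)) = (if even t then frag_of (t div 2, n, e) else 0)"
  "fod (frag_of (t, n, e)) = (if odd t then frag_of (t div 2, n, e) else 0)"
  by (simp_all add: f_defs)

lemma equivariant_basis:
  assumes "additive f" "!!r t n e. f (fact r (frag_of (t, n, e))) = fact r (f (frag_of (t, n, e)))"
  shows "F.equivariant f"
proof -
  have "f (fact r x) = fact r (f x)" for r x
  proof (rule frag_ext[of "\<lambda>x. f (fact r x)" "\<lambda>x. fact r (f x)"])
    show "f (fact r (frag_of b)) = fact r (f (frag_of b))" for b
      using assms(2) by (cases b) simp
  qed (rule additive_comp[OF assms(1) f_additive(1)] additive_comp[OF f_additive(1) assms(1)])+
  then show ?thesis using assms(1) by (simp add: F.equivariant_def)
qed

lemma f_equivariant: "F.equivariant finl" "F.equivariant finr" "F.equivariant fev" "F.equivariant fod"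
  by (rule equivariant_basis, rule f_additive, simp add: f_of fact_of f_zero)+

lemma f_pairing: "fev (finl x) = x" "fev (finr x) = 0" "fod (finl x) = 0" "fod (finr x) = x"
proof -
  have id: "additive (\<lambda>x. x)" "additive (\<lambda>x. 0)" by (auto simp: additive_def)
  note comp = f_additive(4,5)[THEN additive_comp, OF f_additive(2)] f_additive(4,5)[THEN additive_comp, OF f_additive(3)]
  show "fev (finl x) = x" "fod (finl x) = 0" "fev (finr x) = 0" "fod (finr x) = x"
    by (rule frag_ext, rule comp, rule id, force simp: f_of)+
qed

sublocale F: pairing fact finl finr fev fod
  by (intro pairing.intro pairing_axioms.intro F.operators_axioms f_equivariant f_pairing)

definition basis :: "nat => 'e set => (nat \<times> nat \<times> 'e) set" where
  "basis n S = {(0, n, e) | e. e \<in> S}"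

text \<open>Evaluation of formal sums of elements of \<open>E n\<close>, obtained from the universal
  property of the free abelian group. Its kernel \<open>lift n {\<zero>[n]}\<close> is the group of
  relations of \<open>E n\<close>.\<close>

definition val :: "nat => 'e ambient => 'e" where
  "val n = (SOME h. h \<in> hom (free_Abelian_group (basis n (carrier (E n)))) (add_monoid (E n)) \<and>
     (\<forall>e\<in>carrier (E n). h (frag_of (0, n, e)) = e))"

lemma val_spec: "val n \<in> hom (free_Abelian_group (basis n (carrier (E n)))) (add_monoid (E n)) \<and>
     (\<forall>e\<in>carrier (E n). val n (frag_of (0, n, e)) = e)"
proof -
  interpret X: module R "E n" by (rule modules)
  have "(\<lambda>(t, n, e). e) ` basis n (carrier (E n)) \<subseteq> carrier (add_monoid (E n))"
    by (auto simp: basis_def)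
  from comm_group.free_Abelian_group_universal[OF X.M.a_comm_group this]
  obtain h where h: "h \<in> hom (free_Abelian_group (basis n (carrier (E n)))) (add_monoid (E n))"
    "!!x. x \<in> basis n (carrier (E n)) ==> h (frag_of x) = (\<lambda>(t, n, e). e) x"
    by blast
  have "h (frag_of (0, n, e)) = e" if "e \<in> carrier (E n)" for e
    using h(2)[of "(0, n, e)"] that by (simp add: basis_def)
  then have "\<exists>h. h \<in> hom (free_Abelian_group (basis n (carrier (E n)))) (add_monoid (E n)) \<and>
     (\<forall>e\<in>carrier (E n). h (frag_of (0, n, e)) = e)"
    using h(1) by blast
  from someI_ex[OF this] show ?thesis unfolding val_def .
qed

abbreviation fdom :: "nat => 'e ambient set" where
  "fdom n == {f. Poly_Mapping.keys f \<subseteq> basis n (carrier (E n))}"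

lemma dom_add: "f \<in> fdom n ==> g \<in> fdom n ==> f + g \<in> fdom n" "f \<in> fdom n ==> g \<in> fdom n ==> f - g \<in> fdom n" "0 \<in> fdom n"
  using Poly_Mapping.keys_add[of f g] keys_diff[of f g] by auto

lemma val_of: "e \<in> carrier (E n) ==> val n (frag_of (0, n, e)) = e"
  using val_spec by blast

lemma val_closed: "f \<in> fdom n ==> val n f \<in> carrier (E n)"
  using val_spec[of n] by (auto simp: hom_def)

lemma val_add: "f \<in> fdom n ==> g \<in> fdom n ==> val n (f + g) = val n f \<oplus>[n] val n g"
  using val_spec[of n] by (auto simp: hom_def)

lemma val_zero: "val n 0 = \<zero>[n]"
proof -
  interpret X: module R "E n" by (rule modules)
  have "val n 0 = val n 0 \<oplus>[n] val n 0" using val_add[OF dom_add(3) dom_add(3), of n] by simp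
  then show ?thesis using val_closed[OF dom_add(3), of n] by (metis X.M.add.l_cancel_one')
qed

lemma val_diff:
  assumes "f \<in> fdom n" "g \<in> fdom n"
  shows "val n (f - g) = val n f \<ominus>[n] val n g"
proof -
  interpret X: module R "E n" by (rule modules)
  have "val n f = val n (f - g) \<oplus>[n] val n g"
    using val_add[OF dom_add(2)[OF assms] assms(2)] by simp
  then show ?thesis
    using val_closed[OF assms(1)] val_closed[OF assms(2)] val_closed[OF dom_add(2)[OF assms]]
    by (simp add: X.M.minus_eq X.M.add.m_assoc X.M.r_neg)
qed

lemma dom_induct [consumes 1, case_names zero of diff]:
  assumes "f \<in> fdom n" "P 0" "!!e. e \<in> carrier (E n) ==> P (frag_of (0, n, e))"
    "!!a b. a \<in> fdom n ==> b \<in> fdom n ==> P a ==> P b ==> P (a - b)"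
  shows "P f"
proof -
  have "f \<in> fdom n \<and> P f"
  proof (rule frag_induction[where S = "basis n (carrier (E n))"])
    show "Poly_Mapping.keys f \<subseteq> basis n (carrier (E n))" using assms(1) by simp
    show "0 \<in> fdom n \<and> P 0" using assms(2) dom_add(3) by blast
    show "frag_of x \<in> fdom n \<and> P (frag_of x)" if "x \<in> basis n (carrier (E n))" for x
      using that assms(3) by (auto simp: basis_def)
    show "a - b \<in> fdom n \<and> P (a - b)" if "a \<in> fdom n \<and> P a" "b \<in> fdom n \<and> P b" for a b
      using that assms(4) dom_add(2) by blast
  qed
  then show ?thesis by blast
qed

lemma fact_dom:
  assumes "f \<in> fdom n" "r \<in> carrier R"
  shows "fact r f \<in> fdom n \<and> val n (fact r f) = r \<odot>[n] val n f"
proof -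
  interpret X: module R "E n" by (rule modules)
  show ?thesis
    using assms(1)
  proof (induction rule: dom_induct)
    case zero
    then show ?case using F.act_simps(3)[of r] val_zero assms(2) by simp
  next
    case (of e)
    have "frag_of (0, n, r \<odot>[n] e) \<in> fdom n" using of assms(2) by (auto simp: basis_def)
    then show ?case using of assms(2) val_of by (simp add: fact_of)
  next
    case (diff a b)
    then have *: "fact r a \<in> fdom n" "fact r b \<in> fdom n" by blast+
    have "fact r a - fact r b \<in> fdom n" using dom_add(2)[OF *] .
    then show ?case
      using diff val_diff[OF *] val_diff[OF diff(1,2)] val_closed[OF diff(1)] val_closed[OF diff(2)] assms(2)
      by (simp add: F.act_simps X.M.minus_eq X.smult_r_distr X.smult_r_minus)
  qed
qed

definition lift :: "nat => 'e set => 'e ambient set" where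
  "lift n S = {f \<in> fdom n. val n f \<in> S}"

abbreviation noetherian :: "nat => 'e set => 'e set => bool" where
  "noetherian n Z W == chain_condition True F.const_ops fact (\<lambda>k. lift n Z) (\<lambda>k. lift n W)"

abbreviation artinian :: "nat => 'e set => 'e set => bool" where
  "artinian n Z W == chain_condition False F.const_ops fact (\<lambda>k. lift n Z) (\<lambda>k. lift n W)"

text \<open>\<open>lift\<close> embeds the lattice of submodules of \<open>E n\<close> as the submodules above the relations.\<close>

lemma lift_rep: "x \<in> carrier (E n) ==> frag_of (0, n, x) \<in> lift n S \<longleftrightarrow> x \<in> S"
  by (auto simp: lift_def val_of basis_def)

lemma lift_mono: "S \<subseteq> T ==> lift n S \<subseteq> lift n T"
  by (auto simp: lift_def)

text \<open>The index stored in a generator lets one endomorphism carry all the differentials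
  \<open>d n\<close>. Sending generators with foreign entries to 0 makes it strictly equivariant on
  the whole group.\<close>

definition dmap :: "(nat => 'e => 'e) => 'e ambient => 'e ambient" where
  "dmap d = frag_extend (\<lambda>(t, n, e). if e \<in> carrier (E n) then frag_of (t, Suc n, d n e) else 0)"

lemma osub_lift:
  assumes S: "!!k. S k \<subseteq> carrier (E n)" "!!k. \<zero>[n] \<in> S k"
    "!!k x y. x \<in> S k ==> y \<in> S k ==> x \<ominus>[n] y \<in> S k"
    and Om: "!!r e k x. (r, e) \<in> Om ==> x \<in> S k ==> r \<in> carrier R \<and> r \<odot>[n] x \<in> S (k + e)"
  shows "osub Om fact (\<lambda>k. lift n (S k))"
proof (rule osubI)
  show "0 \<in> lift n (S k)" for k
    using dom_add(3) S(2) by (simp add: lift_def val_zero)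
  show "x - y \<in> lift n (S k)" if "x \<in> lift n (S k)" "y \<in> lift n (S k)" for x y k
    using that dom_add(2)[of x n y] S(3) by (simp add: lift_def val_diff)
  show "fact r x \<in> lift n (S (k + e))" if "(r, e) \<in> Om" "x \<in> lift n (S k)" for r e x k
    using that Om[of r e "val n x" k] fact_dom[of x n r] by (simp add: lift_def)
qed

lemma osub_lift_submodule:
  assumes "submodule S R (E n)"
  shows "osub F.const_ops fact (\<lambda>k. lift n S)"
proof -
  interpret X: module R "E n" by (rule modules)
  note s = X.submoduleE[OF assms]
  show ?thesis
  proof (rule osub_lift)
    show "\<zero>[n] \<in> S" using subgroup.one_closed[OF submodule.axioms(1)[OF assms]] by simp
    show "x \<ominus>[n] y \<in> S" if "x \<in> S" "y \<in> S" for x y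
      using that s(3,5) by (simp add: X.M.minus_eq)
  qed (use s in \<open>auto simp: F.const_ops_def\<close>)
qed

definition down :: "nat => 'e ambient set => 'e set" where
  "down n N = {x \<in> carrier (E n). frag_of (0, n, x) \<in> N}"

lemma rep_diff: "f \<in> fdom n ==> f - frag_of (0, n, val n f) \<in> lift n {\<zero>[n]}"
proof -
  assume f: "f \<in> fdom n"
  interpret X: module R "E n" by (rule modules)
  have "frag_of (0, n, val n f) \<in> fdom n" using val_closed[OF f] by (auto simp: basis_def)
  then show ?thesis
    using val_diff[OF f] dom_add(2)[OF f] val_of[OF val_closed[OF f]] val_closed[OF f]
    by (simp add: lift_def X.M.r_neg X.M.minus_eq)
qed

lemma lift_zero_iff:
  assumes "osub Om fact N" "lift n {\<zero>[n]} \<subseteq> N k" "f \<in> fdom n"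
  shows "f \<in> N k \<longleftrightarrow> val n f \<in> down n (N k)"
  using osub_eq_mod[OF assms(1), of f "frag_of (0, n, val n f)" k] rep_diff[OF assms(3)] assms(2) val_closed[OF assms(3)]
  by (auto simp: down_def)

lemma lift_down:
  assumes "osub Om fact N" "lift n {\<zero>[n]} \<subseteq> N k" "N k \<subseteq> fdom n"
  shows "lift n (down n (N k)) = N k"
proof (rule Set.set_eqI)
  fix f show "f \<in> lift n (down n (N k)) \<longleftrightarrow> f \<in> N k"
    using lift_zero_iff[OF assms(1,2), of f] assms(3) unfolding lift_def by blast
qed

lemma down_lift: "S \<subseteq> carrier (E n) ==> down n (lift n S) = S"
  using lift_rep by (auto simp: down_def)

lemma rep_simps:
  assumes "x \<in> carrier (E n)" "y \<in> carrier (E n)"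
  shows "frag_of (0, n, x \<oplus>[n] y) - (frag_of (0, n, x) + frag_of (0, n, y)) \<in> lift n {\<zero>[n]}"
    "frag_of (0, n, x \<ominus>[n] y) - (frag_of (0, n, x) - frag_of (0, n, y)) \<in> lift n {\<zero>[n]}"
    "frag_of (0, n, \<zero>[n]) \<in> lift n {\<zero>[n]}"
proof -
  interpret X: module R "E n" by (rule modules)
  have d: "frag_of (0, n, x) \<in> fdom n" if "x \<in> carrier (E n)" for x using that by (auto simp: basis_def)
  note dd = dom_add(1,2)[OF d[OF assms(1)] d[OF assms(2)]]
  have 1: "frag_of (0, n, x \<oplus>[n] y) \<in> fdom n" "frag_of (0, n, x \<ominus>[n] y) \<in> fdom n"
    by (rule d; simp add: assms)+
  show "frag_of (0, n, x \<oplus>[n] y) - (frag_of (0, n, x) + frag_of (0, n, y)) \<in> lift n {\<zero>[n]}"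
    using dom_add(2)[OF 1(1) dd(1)] val_diff[OF 1(1) dd(1)] val_add[OF d[OF assms(1)] d[OF assms(2)]] assms
    by (simp add: lift_def val_of X.M.minus_eq X.M.r_neg)
  show "frag_of (0, n, x \<ominus>[n] y) - (frag_of (0, n, x) - frag_of (0, n, y)) \<in> lift n {\<zero>[n]}"
    using dom_add(2)[OF 1(2) dd(2)] val_diff[OF 1(2) dd(2)] val_diff[OF d[OF assms(1)] d[OF assms(2)]] assms
      val_of[OF X.M.minus_closed[OF assms]] X.M.minus_closed[OF assms]
    by (simp add: lift_def val_of X.M.minus_eq X.M.r_neg)
  show "frag_of (0, n, \<zero>[n]) \<in> lift n {\<zero>[n]}"
    by (simp add: lift_rep)
qed

lemma rep_smult:
  "x \<in> carrier (E n) ==> r \<in> carrier R ==> fact r (frag_of (0, n, x)) = frag_of (0, n, r \<odot>[n] x)"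
  by (simp add: fact_of)

lemma down_closed:
  assumes N: "osub Om fact N" "lift n {\<zero>[n]} \<subseteq> N k"
  shows "down n (N k) \<subseteq> carrier (E n)" "\<zero>[n] \<in> down n (N k)"
    "x \<in> down n (N k) ==> y \<in> down n (N k) ==> x \<oplus>[n] y \<in> down n (N k)"
    "x \<in> down n (N k) ==> y \<in> down n (N k) ==> x \<ominus>[n] y \<in> down n (N k)"
    "x \<in> down n (N k) ==> (r, e) \<in> Om ==> r \<in> carrier R ==> r \<odot>[n] x \<in> down n (N (k + e))"
proof -
  interpret X: module R "E n" by (rule modules)
  show "down n (N k) \<subseteq> carrier (E n)" by (auto simp: down_def)
  show "\<zero>[n] \<in> down n (N k)" using rep_simps(3)[of "\<zero>[n]" n] N(2) by (auto simp: down_def)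
  show "x \<oplus>[n] y \<in> down n (N k)" if xy: "x \<in> down n (N k)" "y \<in> down n (N k)"
  proof -
    have c: "x \<in> carrier (E n)" "y \<in> carrier (E n)" "frag_of (0, n, x) \<in> N k" "frag_of (0, n, y) \<in> N k"
      using xy by (auto simp: down_def)
    have "frag_of (0, n, x \<oplus>[n] y) - (frag_of (0, n, x) + frag_of (0, n, y)) \<in> N k"
      using rep_simps(1)[OF c(1,2)] N(2) by blast
    then show ?thesis
      using osub_eq_mod[OF N(1)] osubD(3)[OF N(1) c(3,4)] c by (auto simp: down_def)
  qed
  show "x \<ominus>[n] y \<in> down n (N k)" if xy: "x \<in> down n (N k)" "y \<in> down n (N k)"
  proof -
    have c: "x \<in> carrier (E n)" "y \<in> carrier (E n)" "frag_of (0, n, x) \<in> N k" "frag_of (0, n, y) \<in> N k"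
      using xy by (auto simp: down_def)
    have "frag_of (0, n, x \<ominus>[n] y) - (frag_of (0, n, x) - frag_of (0, n, y)) \<in> N k"
      using rep_simps(2)[OF c(1,2)] N(2) by blast
    then show ?thesis
      using osub_eq_mod[OF N(1)] osubD(2)[OF N(1) c(3,4)] c by (auto simp: down_def)
  qed
  show "x \<in> down n (N k) ==> (r, e) \<in> Om ==> r \<in> carrier R ==> r \<odot>[n] x \<in> down n (N (k + e))"
    using osubD(5)[OF N(1), of r e "frag_of (0, n, x)" k] rep_smult by (simp add: down_def)
qed

lemma submodule_down:
  assumes N: "osub F.const_ops fact N" "lift n {\<zero>[n]} \<subseteq> N 0"
  shows "submodule (down n (N 0)) R (E n)"
proof -
  interpret X: module R "E n" by (rule modules)
  note d = down_closed[OF N]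
  show ?thesis
  proof (rule X.submoduleI)
    show "\<ominus>[n] a \<in> down n (N 0)" if a: "a \<in> down n (N 0)" for a
      using d(4)[OF d(2) a] d(1) a by (simp add: X.M.minus_eq subsetD)
    show "r \<odot>[n] x \<in> down n (N 0)" if "r \<in> carrier R" "x \<in> down n (N 0)" for r x
      using d(5)[OF that(2), of r 0] that(1) by (simp add: F.const_ops_def)
  qed (use d in auto)
qed

text \<open>\<open>down\<close> and \<open>lift\<close> are inverse to each other on families above
  the relations, and \<open>const_ops\<close> makes such families constant, so a chain of families
  is a chain of submodules of \<open>E n\<close>.\<close>

lemma chain_condition_lift:
  assumes K: "\<zero>[n] \<in> K" "K \<subseteq> carrier (E n)" and Z: "Z \<subseteq> carrier (E n)"
    and stat: "!!P :: nat => 'e set. (!!i. submodule (P i) R (E n)) ==> (!!i. K \<subseteq> P i) ==> (!!i. P i \<subseteq> Z) ==>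
      (!!i. if asc then P i \<subseteq> P (Suc i) else P (Suc i) \<subseteq> P i) ==> \<exists>m. \<forall>i\<ge>m. P i = P m"
  shows "chain_condition asc F.const_ops fact (\<lambda>k. lift n Z) (\<lambda>k. lift n K)"
proof (rule chain_conditionI, goal_cases)
  case (1 N)
  define P where "P i = down n (N i 0)" for i
  have B0: "lift n {\<zero>[n]} \<subseteq> N i k" for i k
    by (rule subset_trans[OF lift_mono 1(2)]) (use K(1) in simp)
  have NP: "N i k = lift n (P i)" for i k
  proof -
    have "N i 0 \<subseteq> fdom n" by (rule subset_trans[OF 1(3)]) (auto simp: lift_def)
    then show ?thesis using lift_down[OF 1(1) B0, of i 0] F.osub_const[OF 1(1), of i k] by (simp add: P_def)
  qed
  have "\<exists>m. \<forall>i\<ge>m. P i = P m"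
  proof (rule stat)
    show "submodule (P i) R (E n)" for i unfolding P_def by (rule submodule_down[OF 1(1) B0])
    have "K \<subseteq> down n (N i 0)" for i using down_lift[OF K(2)] 1(2)[of i 0] by (auto simp: down_def)
    then show "K \<subseteq> P i" for i by (simp add: P_def)
    have "down n (N i 0) \<subseteq> Z" for i using down_lift[OF Z] 1(3)[of i 0] by (auto simp: down_def)
    then show "P i \<subseteq> Z" for i by (simp add: P_def)
    show "if asc then P i \<subseteq> P (Suc i) else P (Suc i) \<subseteq> P i" for i
      using 1(4)[of i 0] by (auto simp: P_def down_def split: if_splits)
  qed
  then show ?case by (rule stable_image) (simp add: NP fun_eq_iff)
qed

text \<open>Evaluation is linear, so the failure of additivity is a relation of
  \<open>E n\<close>.\<close>

lemma radd_lift: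
  assumes "!!k. Z k \<subseteq> fdom n" "!!k. lift n {\<zero>[n]} \<subseteq> W k"
  shows "F.radd Z W"
  unfolding F.radd_def
proof (intro allI ballI)
  interpret X: module R "E n" by (rule modules)
  fix k v r s assume v: "v \<in> Z k" and r: "r \<in> carrier R" and s: "s \<in> carrier R"
  have v': "v \<in> fdom n" using v assms(1) by blast
  note f = fact_dom[OF v' r] fact_dom[OF v' s] fact_dom[OF v' R.a_closed[OF r s]]
  have 1: "fact (r \<oplus> s) v - fact r v \<in> fdom n" using dom_add(2) f by blast
  have 2: "fact (r \<oplus> s) v - fact r v - fact s v \<in> fdom n" using dom_add(2) f 1 by blast
  have "val n (fact (r \<oplus> s) v - fact r v - fact s v) = \<zero>[n]"
  proof -
    have cancel: "a \<oplus>[n] b \<ominus>[n] a \<ominus>[n] b = \<zero>[n]"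
      if "a \<in> carrier (E n)" "b \<in> carrier (E n)" for a b
      using that X.M.a_comm[of a b] by (simp add: X.M.minus_eq X.M.a_assoc X.M.r_neg)
    have "val n (fact (r \<oplus> s) v - fact r v - fact s v) =
        (r \<odot>[n] val n v \<oplus>[n] s \<odot>[n] val n v) \<ominus>[n] r \<odot>[n] val n v \<ominus>[n] s \<odot>[n] val n v"
      using val_diff[OF 1, of "fact s v"] val_diff[of "fact (r \<oplus> s) v" n "fact r v"] f val_closed[OF v'] r s
      by (simp add: X.smult_l_distr)
    then show ?thesis using cancel val_closed[OF v'] r s by simp
  qed
  then show "fact (r \<oplus> s) v - fact r v - fact s v \<in> W k"
    using 2 assms(2) by (auto simp: lift_def)
qed

lemma dmap_additive: "additive (dmap d)"
  by (simp add: dmap_def additive_frag_extend)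

lemma dmap_of: "dmap d (frag_of (t, n, e)) = (if e \<in> carrier (E n) then frag_of (t, Suc n, d n e) else 0)"
  by (simp add: dmap_def)

lemma equivariant_dmap:
  assumes d: "!!n. module_hom R (E n) (E (Suc n)) (d n)"
  shows "F.equivariant (dmap d)"
proof (rule equivariant_basis[OF dmap_additive])
  fix r t n e
  have z: "fact r 0 = 0" "dmap d 0 = 0" using additive.zero[OF f_additive(1)] additive.zero[OF dmap_additive] by auto
  show "dmap d (fact r (frag_of (t, n, e))) = fact r (dmap d (frag_of (t, n, e)))"
  proof (cases "r \<in> carrier R \<and> e \<in> carrier (E n)")
    case True
    then have "d n e \<in> carrier (E (Suc n))" "d n (r \<odot>[n] e) = r \<odot>\<^bsub>E (Suc n)\<^esub> d n e"
      using d[of n] unfolding module_hom_def by auto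
    then show ?thesis using True module.smult_closed[OF modules] by (simp add: dmap_of fact_of)
  next
    case False
    then show ?thesis by (auto simp: dmap_of fact_of z)
  qed
qed

lemma module_hom_diff:
  assumes A: "module R A" and B: "module R B" and f: "module_hom R A B f" and x: "x \<in> carrier A" "y \<in> carrier A"
  shows "f (x \<ominus>\<^bsub>A\<^esub> y) = f x \<ominus>\<^bsub>B\<^esub> f y" "f \<zero>\<^bsub>A\<^esub> = \<zero>\<^bsub>B\<^esub>"
proof -
  interpret A: module R A by (rule A)
  interpret B: module R B by (rule B)
  have fc: "f z \<in> carrier B" if "z \<in> carrier A" for z using f that by (auto simp: module_hom_def)
  have add: "f (u \<oplus>\<^bsub>A\<^esub> v) = f u \<oplus>\<^bsub>B\<^esub> f v" if "u \<in> carrier A" "v \<in> carrier A" for u v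
    using f that by (auto simp: module_hom_def)
  have "f x = f (x \<ominus>\<^bsub>A\<^esub> y) \<oplus>\<^bsub>B\<^esub> f y"
    using add[of "x \<ominus>\<^bsub>A\<^esub> y" y] x by (simp add: A.M.minus_eq A.M.a_assoc A.M.l_neg)
  then show "f (x \<ominus>\<^bsub>A\<^esub> y) = f x \<ominus>\<^bsub>B\<^esub> f y"
    using fc x by (simp add: B.M.minus_eq B.M.a_assoc B.M.r_neg)
  have "f \<zero>\<^bsub>A\<^esub> = f \<zero>\<^bsub>A\<^esub> \<oplus>\<^bsub>B\<^esub> f \<zero>\<^bsub>A\<^esub>" using add[of "\<zero>\<^bsub>A\<^esub>" "\<zero>\<^bsub>A\<^esub>"] by simp
  then show "f \<zero>\<^bsub>A\<^esub> = \<zero>\<^bsub>B\<^esub>" using fc[of "\<zero>\<^bsub>A\<^esub>"] by (metis A.M.zero_closed B.M.add.l_cancel_one')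
qed

lemma dmap_dom:
  assumes d: "!!n. module_hom R (E n) (E (Suc n)) (d n)" and f: "f \<in> fdom n"
  shows "dmap d f \<in> fdom (Suc n) \<and> val (Suc n) (dmap d f) = d n (val n f)"
  using f
proof (induction rule: dom_induct)
  case zero
  then show ?case
    using additive.zero[OF dmap_additive] val_zero module_hom_diff(2)[OF modules modules d[of n], of "\<zero>[n]" "\<zero>[n]"]
      abelian_monoid.zero_closed[OF abelian_group.axioms(1)[OF module.axioms(2)[OF modules]]] by simp
next
  case (of e)
  have "d n e \<in> carrier (E (Suc n))" using of d[of n] by (auto simp: module_hom_def)
  then show ?case using of by (auto simp: dmap_of val_of basis_def)
next
  case (diff a b)
  then have *: "dmap d a \<in> fdom (Suc n)" "dmap d b \<in> fdom (Suc n)" by blast+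
  have "dmap d a - dmap d b \<in> fdom (Suc n)" using dom_add(2)[OF *] .
  then show ?case
    using diff val_diff[OF *] val_diff[OF diff(1,2)] module_hom_diff(1)[OF modules modules d[of n] val_closed[OF diff(1)] val_closed[OF diff(2)]]
    by (simp add: additive.diff[OF dmap_additive])
qed

lemma radd_mcone:
  assumes "!!n. F.radd (A n) (B n)"
  shows "F.radd (F.mcone y A A n) (F.mcone y B B n)"
  unfolding F.radd_def
proof (intro allI ballI)
  fix k w r s assume w: "w \<in> F.mcone y A A n k" and rs: "r \<in> carrier R" "s \<in> carrier R"
  obtain u v where uv: "w = finl u + finr v" "u \<in> A n k" "v \<in> A (n - 1) (k + snd y)"
    using w by (rule F.mconeE)
  have "fact (r \<oplus> s) w - fact r w - fact s w =
      finl (fact (r \<oplus> s) u - fact r u - fact s u) + finr (fact (r \<oplus> s) v - fact r v - fact s v)"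
    by (simp add: uv(1) F.act_simps F.pairing_eq)
  then show "fact (r \<oplus> s) w - fact r w - fact s w \<in> F.mcone y B B n k"
    using assms uv(2,3) rs unfolding F.radd_def by (simp add: F.mcone_iff)
qed

lemma radd_kos:
  assumes "!!n. F.radd (A n) (B n)"
  shows "F.radd (F.kos ys A n) (F.kos ys B n)"
  using assms
proof (induction ys arbitrary: A B n)
  case (Cons y ys)
  show ?case unfolding F.kos.simps by (rule Cons.IH) (rule radd_mcone[OF Cons.prems])
qed simp

lemma radd_cyc_bnd:
  assumes "F.cpx Om D A B" "F.radd (A n) (B n)"
  shows "F.radd (cyc D A B n) (bnd D A B n)"
  using assms(2) F.sub_bnd[OF assms(1)] unfolding F.radd_def cyc_def by blast

end

section \<open>Graded modules and graded injective modules\<close>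

text \<open>A direct sum decomposition given by its component functions, with which homogeneous
  parts can be computed; it is shown to be equivalent to \<open>internal_direct_sum\<close>.\<close>

definition projections :: "('a, 'x) ring_scheme => ('i => 'a set) => ('i => 'a => 'a) => bool" where
  "projections G A p \<longleftrightarrow> (\<forall>i. additive_subgroup (A i) G) \<and>
     (\<forall>i. \<forall>x\<in>carrier G. p i x \<in> A i) \<and>
     (\<forall>i. \<forall>x\<in>carrier G. \<forall>y\<in>carrier G. p i (x \<oplus>\<^bsub>G\<^esub> y) = p i x \<oplus>\<^bsub>G\<^esub> p i y) \<and>
     (\<forall>i. \<forall>x\<in>A i. p i x = x) \<and> (\<forall>i j. i \<noteq> j --> (\<forall>x\<in>A i. p j x = \<zero>\<^bsub>G\<^esub>)) \<and>
     (\<forall>x\<in>carrier G. finite {i. p i x \<noteq> \<zero>\<^bsub>G\<^esub>} \<and> ((\<forall>i. p i x = \<zero>\<^bsub>G\<^esub>) --> x = \<zero>\<^bsub>G\<^esub>))"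

lemma additive_subgroupD:
  assumes "abelian_group G" "additive_subgroup H G"
  shows "H \<subseteq> carrier G" "\<zero>\<^bsub>G\<^esub> \<in> H" "x \<in> H ==> y \<in> H ==> x \<oplus>\<^bsub>G\<^esub> y \<in> H" "x \<in> H ==> \<ominus>\<^bsub>G\<^esub> x \<in> H"
    "x \<in> H ==> y \<in> H ==> x \<ominus>\<^bsub>G\<^esub> y \<in> H"
proof -
  interpret G: abelian_group G by fact
  interpret H: additive_subgroup H G by fact
  show "H \<subseteq> carrier G" "\<zero>\<^bsub>G\<^esub> \<in> H" "x \<in> H ==> y \<in> H ==> x \<oplus>\<^bsub>G\<^esub> y \<in> H"
    using H.a_subset H.zero_closed H.a_closed by auto
  show m: "x \<in> H ==> \<ominus>\<^bsub>G\<^esub> x \<in> H" for x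
    using subgroup.m_inv_closed[OF H.a_subgroup] by (simp add: a_inv_def)
  show "x \<in> H ==> y \<in> H ==> x \<ominus>\<^bsub>G\<^esub> y \<in> H"
    using m[of y] H.a_closed by (simp add: G.minus_eq)
qed

context abelian_group
begin

lemma finsum_mem:
  assumes "finite F" "\<zero> \<in> S" "!!x y. x \<in> S ==> y \<in> S ==> x \<oplus> y \<in> S" "S \<subseteq> carrier G"
    "!!i. i \<in> F ==> c i \<in> S"
  shows "finsum G c F \<in> S"
  using assms(1,5)
proof (induction rule: finite_induct)
  case (insert i F)
  have "finsum G c (insert i F) = c i \<oplus> finsum G c F"
    using insert assms(4) by (intro finsum_insert) auto
  then show ?case using insert assms(3) by simp
qed (use assms(2) in simp)

lemma additive_zero:
  assumes "!!x y. x \<in> carrier G ==> y \<in> carrier G ==> f (x \<oplus> y) = f x \<oplus> f y" "f \<zero> \<in> carrier G"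
  shows "f \<zero> = \<zero>"
  using assms(1)[of \<zero> \<zero>] assms(2) by (metis add.l_cancel_one' l_zero zero_closed)

lemma additive_finsum:
  assumes f: "!!x y. x \<in> carrier G ==> y \<in> carrier G ==> f (x \<oplus> y) = f x \<oplus> f y"
    "!!x. x \<in> carrier G ==> f x \<in> carrier G"
    and F: "finite F" "!!i. i \<in> F ==> c i \<in> carrier G"
  shows "f (finsum G c F) = finsum G (\<lambda>i. f (c i)) F"
  using F
proof (induction rule: finite_induct)
  case empty
  then show ?case using additive_zero[of f, OF f(1)] f(2) by simp
next
  case (insert i F)
  then have "finsum G c (insert i F) = c i \<oplus> finsum G c F" "finsum G c F \<in> carrier G"
    "finsum G (\<lambda>i. f (c i)) (insert i F) = f (c i) \<oplus> finsum G (\<lambda>i. f (c i)) F"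
    using f(2) by (auto intro!: finsum_insert finsum_closed)
  then show ?case using insert f(1) by simp
qed

lemma projectionsD:
  assumes "projections G A p"
  shows "additive_subgroup (A i) G" "A i \<subseteq> carrier G" "x \<in> carrier G ==> p i x \<in> A i" "x \<in> carrier G ==> p i x \<in> carrier G"
    "x \<in> carrier G ==> y \<in> carrier G ==> p i (x \<oplus> y) = p i x \<oplus> p i y"
    "x \<in> A i ==> p i x = x" "x \<in> A i ==> i \<noteq> j ==> p j x = \<zero>" "x \<in> carrier G ==> finite {i. p i x \<noteq> \<zero>}"
    "x \<in> carrier G ==> (!!i. p i x = \<zero>) ==> x = \<zero>" "p i \<zero> = \<zero>"
proof -
  show a: "additive_subgroup (A i) G" and b: "x \<in> carrier G ==> p i x \<in> A i" for x
    using assms unfolding projections_def by blast+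
  show c: "A i \<subseteq> carrier G" using additive_subgroupD(1)[OF abelian_group_axioms a] .
  show "x \<in> carrier G ==> p i x \<in> carrier G" using b c by blast
  show "x \<in> carrier G ==> y \<in> carrier G ==> p i (x \<oplus> y) = p i x \<oplus> p i y" and e: "x \<in> A i ==> p i x = x"
    "x \<in> A i ==> i \<noteq> j ==> p j x = \<zero>" "x \<in> carrier G ==> finite {i. p i x \<noteq> \<zero>}"
    "x \<in> carrier G ==> (!!i. p i x = \<zero>) ==> x = \<zero>" for x y
    using assms unfolding projections_def by blast+
  show "p i \<zero> = \<zero>" using e(1)[of \<zero>] additive_subgroupD(2)[OF abelian_group_axioms a] by blast
qed

lemma projections_unique_finsum:
  assumes pr: "projections G A p" and c: "!!i. c i \<in> A i" "finite {i. c i \<noteq> \<zero>}"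
  shows "p j (finsum G c {i. c i \<noteq> \<zero>}) = c j"
proof -
  note p = projectionsD[OF pr]
  have cc: "c i \<in> carrier G" for i using c(1) p(2) by blast
  let ?F = "{i. c i \<noteq> \<zero>}"
  have "p j (finsum G c ?F) = finsum G (\<lambda>i. p j (c i)) ?F"
    using p(4,5) cc c(2) by (intro additive_finsum) auto
  also have "\<dots> = finsum G (\<lambda>i. if j = i then c i else \<zero>) ?F"
  proof (rule finsum_cong')
    show "p j (c i) = (if j = i then c i else \<zero>)" for i
      using p(6)[OF c(1), of i] p(7)[OF c(1), of i j] by simp
  qed (use cc in auto)
  also have "\<dots> = c j"
  proof (cases "j \<in> ?F")
    case True
    then show ?thesis using c(2) cc finsum_singleton[of j ?F c] by (simp add: eq_commute)
  next
    case False
    then have "finsum G (\<lambda>i. if j = i then c i else \<zero>) ?F = finsum G (\<lambda>i. \<zero>) ?F"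
      by (intro finsum_cong') auto
    then show ?thesis using False finsum_zero by simp
  qed
  finally show ?thesis .
qed

lemma projections_finsum:
  assumes "projections G A p" "x \<in> carrier G"
  shows "x = finsum G (\<lambda>i. p i x) {i. p i x \<noteq> \<zero>}"
proof -
  note p = projectionsD[OF assms(1)]
  define y where "y = finsum G (\<lambda>i. p i x) {i. p i x \<noteq> \<zero>}"
  have y: "y \<in> carrier G" using p(4)[OF assms(2)] unfolding y_def by (intro finsum_closed) auto
  have pj: "p j y = p j x" for j
    unfolding y_def by (rule projections_unique_finsum[OF assms(1) p(3,8)[OF assms(2)]])
  have pz: "p j (x \<oplus> \<ominus> y) = \<zero>" for j
  proof -
    have "p j y \<oplus> p j (\<ominus> y) = \<zero>" using p(5)[OF y a_inv_closed[OF y], of j] p(10)[of j] y by (simp add: r_neg)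
    then show ?thesis using p(5)[OF assms(2) a_inv_closed[OF y], of j] pj by simp
  qed
  have "x \<oplus> \<ominus> y \<in> carrier G" using assms(2) y by simp
  from p(9)[OF this pz] have "x \<oplus> \<ominus> y = \<zero>" .
  from minus_equality[OF this] have "\<ominus> (\<ominus> y) = x" using assms(2) y by blast
  with minus_minus[OF y] have "x = y" by simp
  then show ?thesis unfolding y_def .
qed

text \<open>An element is the sum of its components, so a property stable under sums is tested on
  these.\<close>

lemma projections_induct:
  assumes "projections G A p" "x \<in> carrier G"
    and S: "\<zero> \<in> S" "!!x y. x \<in> S ==> y \<in> S ==> x \<oplus> y \<in> S" "S \<subseteq> carrier G" "!!i. p i x \<in> S"
  shows "x \<in> S"
  using finsum_mem[OF projectionsD(8)[OF assms(1,2)] S(1-3), of "\<lambda>i. p i x"] S(4) projections_finsum[OF assms(1,2)]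
  by simp

lemma internal_direct_sum_if_projections:
  assumes pr: "projections G A p"
  shows "internal_direct_sum G A"
  unfolding internal_direct_sum_def
proof (intro conjI allI ballI)
  note p = projectionsD[OF pr]
  show "additive_subgroup (A i) G" for i by (rule p(1))
  fix x assume x: "x \<in> carrier G"
  show "\<exists>!c. (\<forall>i. c i \<in> A i) \<and> finite {i. c i \<noteq> \<zero>} \<and> x = finsum G c {i. c i \<noteq> \<zero>}"
  proof (rule ex1I)
    show "(\<forall>i. p i x \<in> A i) \<and> finite {i. p i x \<noteq> \<zero>} \<and> x = finsum G (\<lambda>i. p i x) {i. p i x \<noteq> \<zero>}"
      using p(3)[OF x] p(8)[OF x] projections_finsum[OF pr x] by blast
    show "c = (\<lambda>i. p i x)" if "(\<forall>i. c i \<in> A i) \<and> finite {i. c i \<noteq> \<zero>} \<and> x = finsum G c {i. c i \<noteq> \<zero>}" for c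
      using projections_unique_finsum[OF pr, of c] that by auto
  qed
qed

lemma projections_if_internal_direct_sum:
  assumes ids: "internal_direct_sum G A"
  shows "\<exists>p. projections G A p"
proof -
  define D where "D x c \<longleftrightarrow> (\<forall>i. c i \<in> A i) \<and> finite {i. c i \<noteq> \<zero>} \<and> x = finsum G c {i. c i \<noteq> \<zero>}" for x c
  have as: "additive_subgroup (A i) G" for i using ids by (simp add: internal_direct_sum_def)
  note A = additive_subgroupD[OF abelian_group_axioms as]
  have ex1: "\<exists>!c. D x c" if "x \<in> carrier G" for x
    using ids that unfolding internal_direct_sum_def D_def by blast
  define p where "p i x = (THE c. D x c) i" for i x
  have Dp: "D x (\<lambda>i. p i x)" if "x \<in> carrier G" for x
    using theI'[OF ex1[OF that]] by (simp add: p_def)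
  have uniq: "p i x = c i" if "D x c" for x c i
  proof -
    have "!!i. c i \<in> carrier G" using that A(1) unfolding D_def by blast
    then have "x \<in> carrier G" using that unfolding D_def by (auto intro!: finsum_closed)
    then have "c = (\<lambda>i. p i x)" using ex1[of x] Dp[of x] that by blast
    then show ?thesis by simp
  qed
  have fin_ext: "finsum G c F = finsum G c {i. c i \<noteq> \<zero>}" if "finite F" "{i. c i \<noteq> \<zero>} \<subseteq> F" "!!i. c i \<in> A i" for c F
    using that A(1) by (intro add.finprod_mono_neutral_cong_right) auto
  have padd: "p i (x \<oplus> y) = p i x \<oplus> p i y" if xy: "x \<in> carrier G" "y \<in> carrier G" for x y i
  proof (rule uniq)
    let ?c = "\<lambda>i. p i x \<oplus> p i y" and ?F = "{i. p i x \<noteq> \<zero>} \<union> {i. p i y \<noteq> \<zero>}"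
    have c: "!!i. p i x \<in> A i" "!!i. p i y \<in> A i" using Dp xy by (auto simp: D_def)
    then have cc: "!!i. p i x \<in> carrier G" "!!i. p i y \<in> carrier G" using A(1) by blast+
    have fF: "finite ?F" using Dp xy by (auto simp: D_def)
    have sub: "{i. ?c i \<noteq> \<zero>} \<subseteq> ?F" by auto
    have "finsum G ?c {i. ?c i \<noteq> \<zero>} = finsum G ?c ?F"
      using fin_ext[OF fF sub] c A(3) by simp
    also have "\<dots> = finsum G (\<lambda>i. p i x) ?F \<oplus> finsum G (\<lambda>i. p i y) ?F"
      using cc by (intro finsum_addf) auto
    also have "\<dots> = x \<oplus> y"
      using fin_ext[OF fF, of "\<lambda>i. p i x"] fin_ext[OF fF, of "\<lambda>i. p i y"] c Dp xy by (auto simp: D_def)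
    finally show "D (x \<oplus> y) ?c"
      unfolding D_def using c A(3) finite_subset[OF sub fF] by simp
  qed
  have psingle: "D x (\<lambda>j. if j = i then x else \<zero>)" if x: "x \<in> A i" for x i
  proof -
    have xc: "x \<in> carrier G" using x A(1) by blast
    have "finsum G (\<lambda>j. if j = i then x else \<zero>) {j. (if j = i then x else \<zero>) \<noteq> \<zero>} = x"
    proof (cases "x = \<zero>")
      case False
      then have *: "{j. (if j = i then x else \<zero>) \<noteq> \<zero>} = {i}" by auto
      show ?thesis unfolding * using xc finsum_insert[of "{}" i "\<lambda>j. if j = i then x else \<zero>"] by simp
    qed auto
    moreover have "finite {j. (if j = i then x else \<zero>) \<noteq> \<zero>}" by (rule finite_subset[of _ "{i}"]) auto
    ultimately show ?thesis using x A(2) by (simp add: D_def)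
  qed
  have "projections G A p"
    unfolding projections_def
  proof (intro conjI allI ballI impI)
    show "x = \<zero>" if "x \<in> carrier G" "\<forall>i. p i x = \<zero>" for x
      using Dp[OF that(1)] that(2) by (simp add: D_def)
    show "additive_subgroup (A i) G" for i by (rule as)
    show "p i x \<in> A i" "finite {i. p i x \<noteq> \<zero>}" if "x \<in> carrier G" for i x
      using Dp[OF that] unfolding D_def by blast+
    show "p i (x \<oplus> y) = p i x \<oplus> p i y" if "x \<in> carrier G" "y \<in> carrier G" for x y i
      using that by (rule padd)
    show "p i x = x" if "x \<in> A i" for i x using uniq[OF psingle[OF that], of i] by simp
    show "p j x = \<zero>" if "i \<noteq> j" "x \<in> A i" for i j x using uniq[OF psingle[OF that(2)], of j] that(1) by simp
  qed
  then show ?thesis by (rule exI[of _ p])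
qed

end

text \<open>Used with s a translation for multiplication by a homogeneous element, and with s the
  identity for homogeneous maps.\<close>

lemma projections_map:
  assumes G: "abelian_group G" and H: "abelian_group H" and pr: "projections G A p" and pr': "projections H B q"
    and f: "!!x. x \<in> carrier G ==> f x \<in> carrier H" "!!x y. x \<in> carrier G ==> y \<in> carrier G ==> f (x \<oplus>\<^bsub>G\<^esub> y) = f x \<oplus>\<^bsub>H\<^esub> f y"
    and deg: "!!i x. x \<in> A i ==> f x \<in> B (s i)" and s: "inj s"
    and x: "x \<in> carrier G"
  shows "q (s i) (f x) = f (p i x)" "!!j. j \<notin> range s ==> q j (f x) = \<zero>\<^bsub>H\<^esub>"
proof -
  interpret G: abelian_group G by fact
  interpret H: abelian_group H by fact
  note p = G.projectionsD[OF pr] and q = H.projectionsD[OF pr']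
  have f0: "f \<zero>\<^bsub>G\<^esub> = \<zero>\<^bsub>H\<^esub>"
    using f(2)[of "\<zero>\<^bsub>G\<^esub>" "\<zero>\<^bsub>G\<^esub>"] f(1)[of "\<zero>\<^bsub>G\<^esub>"] by (metis G.l_zero G.zero_closed H.add.l_cancel_one')
  define S where "S = {x \<in> carrier G. (\<forall>i. q (s i) (f x) = f (p i x)) \<and> (\<forall>j. j \<notin> range s --> q j (f x) = \<zero>\<^bsub>H\<^esub>)}"
  have "x \<in> S"
  proof (rule G.projections_induct[OF pr x])
    show "\<zero>\<^bsub>G\<^esub> \<in> S" using p(10) q(10) f0 by (simp add: S_def)
    show "x \<oplus>\<^bsub>G\<^esub> y \<in> S" if "x \<in> S" "y \<in> S" for x y
      using that p(4,5) q(5) f by (simp add: S_def)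
    show "S \<subseteq> carrier G" by (auto simp: S_def)
    fix k
    have k: "p k x \<in> A k" "p k x \<in> carrier G" using p(3,4) x by auto
    have "q (s i) (f (p k x)) = f (p i (p k x))" for i
      using q(6)[OF deg[OF k(1)]] q(7)[OF deg[OF k(1)], of "s i"] p(6)[OF k(1)] p(7)[OF k(1), of i] f0 injD[OF s, of k i]
      by (cases "i = k") auto
    moreover have "q j (f (p k x)) = \<zero>\<^bsub>H\<^esub>" if "j \<notin> range s" for j
      using q(7)[OF deg[OF k(1)], of j] that by auto
    ultimately show "p k x \<in> S" using k by (simp add: S_def)
  qed
  then show "q (s i) (f x) = f (p i x)" "!!j. j \<notin> range s ==> q j (f x) = \<zero>\<^bsub>H\<^esub>"
    by (auto simp: S_def)
qed

lemma (in module) ideal_transporter: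
  assumes K: "submodule K R M" and v: "v \<in> carrier M"
  shows "ideal {a \<in> carrier R. a \<odot>\<^bsub>M\<^esub> v \<in> K} R"
proof -
  note k = submoduleE[OF K]
  have k0: "\<zero>\<^bsub>M\<^esub> \<in> K" using subgroup.one_closed[OF submodule.axioms(1)[OF K]] by simp
  show ?thesis
  proof (rule idealI)
    show "ring R" by (rule R.ring_axioms)
    show "subgroup {a \<in> carrier R. a \<odot>\<^bsub>M\<^esub> v \<in> K} (add_monoid R)"
    proof (rule R.add.subgroupI)
      show "{a \<in> carrier R. a \<odot>\<^bsub>M\<^esub> v \<in> K} \<noteq> {}" using v k0 by (auto intro!: exI[of _ \<zero>])
    qed (use v k in \<open>auto simp: smult_l_minus smult_l_distr\<close>)
    show "x \<otimes> a \<in> {a \<in> carrier R. a \<odot>\<^bsub>M\<^esub> v \<in> K}" "a \<otimes> x \<in> {a \<in> carrier R. a \<odot>\<^bsub>M\<^esub> v \<in> K}"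
      if "a \<in> {a \<in> carrier R. a \<odot>\<^bsub>M\<^esub> v \<in> K}" "x \<in> carrier R" for a x
      using that v k(4) by (auto simp: smult_assoc1 R.m_comm[of a x])
  qed
qed

text \<open>Ideals as modules over the element type of R, the shape of the test objects in the
  definition of injectivity.\<close>

definition ideal_module :: "('r, 'x) ring_scheme => 'r set => ('r, 'r) module" where
  "ideal_module R c = \<lparr>carrier = c, monoid.mult = monoid.mult R, one = one R, ring.zero = ring.zero R, add = add R,
     smult = monoid.mult R\<rparr>"

lemma ideal_module_simps [simp]:
  "carrier (ideal_module R c) = c" "ring.zero (ideal_module R c) = ring.zero R" "add (ideal_module R c) = add R"
  "smult (ideal_module R c) = monoid.mult R"
  by (simp_all add: ideal_module_def)

lemma (in cring) ideal_module:
  assumes "ideal c R"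
  shows "module R (ideal_module R c)"
proof -
  interpret c: ideal c R by fact
  show ?thesis
  proof (intro moduleI is_cring abelian_groupI)
    show "\<exists>y\<in>carrier (ideal_module R c). y \<oplus>\<^bsub>ideal_module R c\<^esub> x = \<zero>\<^bsub>ideal_module R c\<^esub>"
      if "x \<in> carrier (ideal_module R c)" for x
      using that c.a_inv_closed c.Icarr by (auto intro!: bexI[of _ "\<ominus> x"] simp: l_neg)
  qed (use c.I_l_closed c.Icarr in \<open>auto simp: a_ac l_distr r_distr m_assoc\<close>)
qed

section \<open>Homogeneous ideals and graded injectivity\<close>

locale standard_graded =
  fixes R :: "('r, 'x) ring_scheme" (structure) and Rg :: "nat => 'r set"
  assumes graded: "graded_ring R Rg" and one_Rg: "\<one> \<in> Rg 0"
begin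

sublocale R: cring R
  using graded by (simp add: graded_ring_def)

definition rcomp :: "nat => 'r => 'r" where
  "rcomp = (SOME q. projections R Rg q)"

lemma rcomp: "projections R Rg rcomp"
proof -
  have "\<exists>q. projections R Rg q"
    using R.projections_if_internal_direct_sum[of Rg] graded by (simp add: graded_ring_def)
  then show ?thesis unfolding rcomp_def by (rule someI_ex)
qed

lemmas rcompD = R.projectionsD[OF rcomp]

lemma Rg_mult: "a \<in> Rg i ==> b \<in> Rg j ==> a \<otimes> b \<in> Rg (i + j)"
  using graded by (auto simp: graded_ring_def)

lemma Rg_carrier: "a \<in> Rg i ==> a \<in> carrier R"
  using rcompD(2) by blast

lemma Rg_pow: "x \<in> Rg d ==> x [^] (n::nat) \<in> Rg (n * d)"
proof (induction n)
  case (Suc n)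
  then show ?case using Rg_mult[of "x [^] n" "n * d" x d] by (simp add: add.commute)
qed (simp add: one_Rg)

lemma rcomp_mult:
  assumes y: "y \<in> Rg d" and r: "r \<in> carrier R"
  shows "rcomp m (r \<otimes> y) = (if m \<ge> d then rcomp (m - d) r \<otimes> y else \<zero>)"
proof -
  have yc: "y \<in> carrier R" using Rg_carrier[OF y] .
  have deg: "a \<otimes> y \<in> Rg (d + i)" if "a \<in> Rg i" for a i
    using Rg_mult[OF that y] by (simp add: add.commute)
  note * = projections_map[OF R.abelian_group_axioms R.abelian_group_axioms rcomp rcomp, of "\<lambda>r. r \<otimes> y" "(+) d" r]
  have "rcomp (d + i) (r \<otimes> y) = rcomp i r \<otimes> y" for i
    by (rule *(1)) (use deg yc r in \<open>auto simp: R.l_distr\<close>)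
  moreover have "rcomp j (r \<otimes> y) = \<zero>" if "j \<notin> range ((+) d)" for j
    by (rule *(2)) (use deg yc r that in \<open>auto simp: R.l_distr\<close>)
  ultimately have "rcomp (d + i) (r \<otimes> y) = rcomp i r \<otimes> y" "!!j. j \<notin> range ((+) d) ==> rcomp j (r \<otimes> y) = \<zero>" for i
    by blast+
  note this(1)[of "m - d"] this(2)[of m]
  moreover have "m \<in> range ((+) d)" if "m \<ge> d" using that by (metis le_add_diff_inverse rangeI)
  moreover have "m \<notin> range ((+) d)" if "\<not> m \<ge> d" using that by auto
  ultimately show ?thesis by auto
qed

text \<open>The ring elements all of whose components lie in the ideal form an ideal that contains
  S.\<close>

lemma genideal_homogeneous:
  assumes S: "!!s. s \<in> S ==> \<exists>n. s \<in> Rg n" and b: "b \<in> genideal R S"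
  shows "rcomp n b \<in> genideal R S"
proof -
  have Sc: "S \<subseteq> carrier R" using S Rg_carrier by blast
  interpret I: ideal "genideal R S" R by (rule R.genideal_ideal[OF Sc])
  define P where "P = {b \<in> carrier R. \<forall>n. rcomp n b \<in> genideal R S}"
  have padd: "b \<oplus> b' \<in> P" if "b \<in> P" "b' \<in> P" for b b'
    using that rcompD(5) I.a_closed by (auto simp: P_def)
  have pmult: "a \<otimes> b \<in> P" if a: "a \<in> carrier R" and b: "b \<in> P" for a b
  proof -
    have bc: "b \<in> carrier R" using b by (simp add: P_def)
    have "a \<in> {a \<in> carrier R. a \<otimes> b \<in> P}"
    proof (rule R.projections_induct[OF rcomp a])
      show "\<zero> \<in> {a \<in> carrier R. a \<otimes> b \<in> P}" using bc rcompD(10) by (simp add: P_def)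
      show "x \<oplus> y \<in> {a \<in> carrier R. a \<otimes> b \<in> P}" if "x \<in> {a \<in> carrier R. a \<otimes> b \<in> P}" "y \<in> {a \<in> carrier R. a \<otimes> b \<in> P}" for x y
        using that padd bc by (simp add: R.l_distr)
      show "rcomp i a \<in> {a \<in> carrier R. a \<otimes> b \<in> P}" for i
      proof -
        have ai: "rcomp i a \<in> Rg i" "rcomp i a \<in> carrier R" using rcompD(3,4) a by auto
        have "rcomp m (rcomp i a \<otimes> b) \<in> genideal R S" for m
          using rcomp_mult[OF ai(1) bc, of m] b ai(2) bc I.I_l_closed I.zero_closed rcompD(4)[OF bc]
          by (auto simp: P_def R.m_comm[of "rcomp i a" b] I.I_r_closed)
        then show ?thesis using ai bc by (simp add: P_def)
      qed
    qed auto
    then show ?thesis by simp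
  qed
  have "ideal P R"
  proof (rule idealI)
    show "ring R" by (rule R.ring_axioms)
    show "subgroup P (add_monoid R)"
    proof (rule R.add.subgroupI)
      show "P \<noteq> {}" using rcompD(10) by (auto simp: P_def intro!: exI[of _ \<zero>])
      show "\<ominus> a \<in> P" if "a \<in> P" for a
        using pmult[of "\<ominus> \<one>" a] that by (simp add: P_def R.l_minus)
    qed (use padd in \<open>auto simp: P_def\<close>)
    show "x \<otimes> a \<in> P" "a \<otimes> x \<in> P" if "a \<in> P" "x \<in> carrier R" for a x
      using pmult[OF that(2,1)] that R.m_comm[of x a] by (auto simp: P_def)
  qed
  moreover have "S \<subseteq> P"
  proof
    fix s assume s: "s \<in> S"
    then obtain m where m: "s \<in> Rg m" using S by blast
    have "rcomp i s \<in> genideal R S" for i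
      using rcompD(6)[OF m] rcompD(7)[OF m, of i] R.genideal_self[OF Sc] s I.zero_closed by (cases "i = m") auto
    then show "s \<in> P" using s Sc by (auto simp: P_def)
  qed
  ultimately have "genideal R S \<subseteq> P" by (rule R.genideal_minimal)
  then show ?thesis using b by (auto simp: P_def)
qed

text \<open>For c = R the unit gets degree s, so homogeneous maps from this module to E correspond
  to elements of E of degree s.\<close>

definition shifted :: "'r set => int => int => 'r set" where
  "shifted c s n = (if n \<ge> s then c \<inter> Rg (nat (n - s)) else {\<zero>})"

lemma graded_module_shifted:
  assumes c: "ideal c R" and hom: "!!b n. b \<in> c ==> rcomp n b \<in> c"
  shows "graded_module R Rg (ideal_module R c) (shifted c s)"
proof -
  let ?C = "ideal_module R c"
  interpret c: ideal c R by fact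
  have m: "module R (?C)" by (rule R.ideal_module[OF c])
  interpret M: module R ?C by (rule m)
  have cR: "c \<subseteq> carrier R" using c.Icarr by blast
  define p where "p n x = (if n \<ge> s then rcomp (nat (n - s)) x else \<zero>)" for n x
  have inv: "\<ominus>\<^bsub>?C\<^esub> x = \<ominus> x" if "x \<in> c" for x
    using M.M.minus_equality[of "\<ominus> x" x] that c.a_inv_closed c.Icarr by (simp add: R.l_neg)
  have "projections (?C) (shifted c s) p"
    unfolding projections_def
  proof (intro conjI allI ballI impI)
    fix n
    show "additive_subgroup (shifted c s n) (?C)"
    proof (intro additive_subgroup.intro M.M.add.subgroupI)
      note Rn = additive_subgroupD[OF R.abelian_group_axioms rcompD(1)[of "nat (n - s)"]]
      show "shifted c s n \<subseteq> carrier (?C)" by (auto simp: shifted_def)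
      have "\<zero> \<in> shifted c s n" using Rn(2) c.zero_closed by (simp add: shifted_def)
      then show "shifted c s n \<noteq> {}" by blast
      show "\<ominus>\<^bsub>?C\<^esub> a \<in> shifted c s n" if "a \<in> shifted c s n" for a
        using that inv[of a] Rn(4)[of a] c.a_inv_closed
        by (auto simp: shifted_def split: if_splits)
      show "a \<oplus>\<^bsub>?C\<^esub> b \<in> shifted c s n" if "a \<in> shifted c s n" "b \<in> shifted c s n" for a b
        using that Rn(3) by (auto simp: shifted_def split: if_splits)
    qed
    fix x assume x: "x \<in> carrier (?C)"
    then have xR: "x \<in> carrier R" "x \<in> c" using c.Icarr by auto
    show "p n x \<in> shifted c s n" using rcompD(3)[OF xR(1)] hom[OF xR(2)] by (simp add: p_def shifted_def)
    show "p n (x \<oplus>\<^bsub>?C\<^esub> y) = p n x \<oplus>\<^bsub>?C\<^esub> p n y" if "y \<in> carrier (?C)" for y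
      using rcompD(5)[OF xR(1), of y] that c.Icarr by (simp add: p_def)
    have "{i. p i x \<noteq> \<zero>\<^bsub>?C\<^esub>} \<subseteq> (\<lambda>i. int i + s) ` {i. rcomp i x \<noteq> \<zero>}"
    proof
      fix i assume i: "i \<in> {i. p i x \<noteq> \<zero>\<^bsub>?C\<^esub>}"
      then have "i \<ge> s" "rcomp (nat (i - s)) x \<noteq> \<zero>" by (auto simp: p_def split: if_splits)
      then show "i \<in> (\<lambda>i. int i + s) ` {i. rcomp i x \<noteq> \<zero>}" by (intro image_eqI[of _ _ "nat (i - s)"]) auto
    qed
    then show "finite {i. p i x \<noteq> \<zero>\<^bsub>?C\<^esub>}"
      by (rule finite_subset) (use rcompD(8)[OF xR(1)] in simp)
    show "x = \<zero>\<^bsub>?C\<^esub>" if z: "\<forall>i. p i x = \<zero>\<^bsub>?C\<^esub>"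
    proof -
      have "rcomp i x = \<zero>" for i using z[THEN spec, of "int i + s"] by (simp add: p_def)
      then show ?thesis using rcompD(9)[OF xR(1)] by simp
    qed
  next
    show "p n x = x" if "x \<in> shifted c s n" for n x
      using that rcompD(6)[of x "nat (n - s)"] by (auto simp: p_def shifted_def split: if_splits)
    show "p n' x = \<zero>\<^bsub>?C\<^esub>" if "n \<noteq> n'" "x \<in> shifted c s n" for n n' x
      using that rcompD(7)[of x "nat (n - s)" "nat (n' - s)"] rcompD(10) by (auto simp: p_def shifted_def split: if_splits)
  qed
  then have "internal_direct_sum (?C) (shifted c s)"
    by (rule M.M.internal_direct_sum_if_projections)
  moreover have "a \<odot>\<^bsub>?C\<^esub> x \<in> shifted c s (int i + n)" if a: "a \<in> Rg i" and x: "x \<in> shifted c s n" for i n a x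
  proof (cases "n \<ge> s")
    case True
    then have "x \<in> c" "x \<in> Rg (nat (n - s))" using x by (auto simp: shifted_def)
    moreover have "nat (int i + n - s) = i + nat (n - s)" using True by simp
    ultimately show ?thesis using Rg_mult[OF a] c.I_l_closed Rg_carrier[OF a] True by (simp add: shifted_def)
  next
    case False
    then show ?thesis using x Rg_carrier[OF a] additive_subgroupD(2)[OF R.abelian_group_axioms rcompD(1)] c.zero_closed
      by (auto simp: shifted_def)
  qed
  ultimately show ?thesis using m by (simp add: graded_module_def)
qed

text \<open>Graded Baer criterion in terms of elements: extend g to R shifted by s and take the
  image of the unit.\<close>

lemma graded_injective_extend:
  assumes E: "graded_injective_module R Rg E Eg" and c: "ideal c R" and hom: "!!b n. b \<in> c ==> rcomp n b \<in> c"
    and g: "module_hom R (ideal_module R c) E g" and deg: "!!m a. a \<in> c ==> a \<in> Rg m ==> g a \<in> Eg (int m + s)"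
  shows "\<exists>w\<in>Eg s. \<forall>a\<in>c. a \<odot>\<^bsub>E\<^esub> w = g a"
proof -
  interpret c: ideal c R by fact
  let ?A = "ideal_module R c" and ?B = "ideal_module R (carrier R)"
  have gE: "graded_module R Rg E Eg" using E by (simp add: graded_injective_module_def)
  then interpret E: module R E by (simp add: graded_module_def)
  have A: "graded_module R Rg ?A (shifted c s)" by (rule graded_module_shifted[OF c hom])
  have B: "graded_module R Rg ?B (shifted (carrier R) s)"
    by (rule graded_module_shifted[OF R.oneideal]) (rule rcompD(4))
  have inc: "graded_hom R ?A (shifted c s) ?B (shifted (carrier R) s) (\<lambda>x. x)"
    using c.Icarr by (auto simp: graded_hom_def module_hom_def shifted_def)
  have "additive_subgroup (Eg n) E" for n using gE by (simp add: graded_module_def internal_direct_sum_def)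
  note En = additive_subgroupD[OF E.abelian_group_axioms this]
  have g0: "g \<zero> = \<zero>\<^bsub>E\<^esub>"
  proof -
    have "g (\<zero> \<odot>\<^bsub>?A\<^esub> \<zero>) = \<zero> \<odot>\<^bsub>E\<^esub> g \<zero>" "g \<zero> \<in> carrier E"
      using g c.zero_closed R.zero_closed unfolding module_hom_def ideal_module_simps by blast+
    then show ?thesis by simp
  qed
  have gg: "graded_hom R ?A (shifted c s) E Eg g"
    unfolding graded_hom_def
  proof (intro conjI g allI subsetI)
    fix n y assume "y \<in> g ` shifted c s n"
    then obtain a where a: "a \<in> shifted c s n" "y = g a" by blast
    show "y \<in> Eg n"
    proof (cases "n \<ge> s")
      case True
      then show ?thesis using a deg[of a "nat (n - s)"] by (auto simp: shifted_def)
    next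
      case False
      then show ?thesis using a g0 En(2) by (auto simp: shifted_def)
    qed
  qed
  have "\<exists>h. graded_hom R ?B (shifted (carrier R) s) E Eg h \<and> (\<forall>x\<in>carrier ?A. h x = g x)"
    using E[unfolded graded_injective_module_def, THEN conjunct2, rule_format, of ?A "shifted c s" ?B "shifted (carrier R) s" "\<lambda>x. x" g]
      A B inc gg by (auto simp: inj_on_def)
  then obtain h where h: "graded_hom R ?B (shifted (carrier R) s) E Eg h" "!!x. x \<in> c ==> h x = g x"
    by auto
  have "\<one> \<in> shifted (carrier R) s s" using one_Rg by (simp add: shifted_def)
  then have "h \<one> \<in> Eg s" using h(1) unfolding graded_hom_def by blast
  moreover have "a \<odot>\<^bsub>E\<^esub> h \<one> = g a" if "a \<in> c" for a
  proof -
    have "h (a \<odot>\<^bsub>?B\<^esub> \<one>) = a \<odot>\<^bsub>E\<^esub> h \<one>"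
      using h(1) c.Icarr[OF that] R.one_closed unfolding graded_hom_def module_hom_def ideal_module_simps by blast
    then show ?thesis using h(2)[OF that] c.Icarr[OF that] by simp
  qed
  ultimately show ?thesis by blast
qed

lemma ideal_ann:
  assumes E: "module R E" and v: "v \<in> carrier E"
  shows "ideal {a \<in> carrier R. a \<odot>\<^bsub>E\<^esub> v = \<zero>\<^bsub>E\<^esub>} R"
proof -
  interpret E: module R E by (rule E)
  have "submodule {\<zero>\<^bsub>E\<^esub>} R E" by (rule E.submoduleI) auto
  from E.ideal_transporter[OF this v] show ?thesis by simp
qed

text \<open>
  Since \<open>(b : x\<^sup>N)\<close> is eventually constant for \<open>b = (T)\<close>, the map \<open>r x\<^sup>N\<^sup>+\<^sup>1 + b \<mapsto> r x\<^sup>N v\<close> on the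
  homogeneous ideal \<open>(x\<^sup>N\<^sup>+\<^sup>1) + b\<close> is well defined; extend it to \<open>R\<close>.
\<close>

lemma graded_injective_divide:
  assumes noeth: "noetherian_ring R" and E: "graded_injective_module R Rg E Eg"
    and v: "v \<in> Eg k" and T: "!!t. t \<in> T ==> \<exists>n. t \<in> Rg n" "!!t. t \<in> T ==> t \<odot>\<^bsub>E\<^esub> v = \<zero>\<^bsub>E\<^esub>" and x: "x \<in> Rg e"
  shows "\<exists>w\<in>Eg (k - int e). \<exists>N::nat. x [^] Suc N \<odot>\<^bsub>E\<^esub> w = x [^] N \<odot>\<^bsub>E\<^esub> v \<and> (\<forall>t\<in>T. t \<odot>\<^bsub>E\<^esub> w = \<zero>\<^bsub>E\<^esub>)"
proof -
  have gE: "graded_module R Rg E Eg" using E by (simp add: graded_injective_module_def)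
  then interpret E: module R E by (simp add: graded_module_def)
  have "additive_subgroup (Eg n) E" for n using gE by (simp add: graded_module_def internal_direct_sum_def)
  note En = additive_subgroupD[OF E.abelian_group_axioms this]
  have vc: "v \<in> carrier E" using v En(1) by blast
  have Tc: "T \<subseteq> carrier R" using T(1) Rg_carrier by blast
  have xc: "x \<in> carrier R" using Rg_carrier[OF x] .
  have xN: "x [^] N \<in> carrier R" for N :: nat using xc by simp
  have xNg: "x [^] N \<in> Rg (N * e)" for N :: nat using Rg_pow[OF x] .
  define b where "b = genideal R T"
  interpret b: ideal b R unfolding b_def by (rule R.genideal_ideal[OF Tc])
  have Tb: "T \<subseteq> b" unfolding b_def by (rule R.genideal_self[OF Tc])
  have bhom: "rcomp n a \<in> b" if "a \<in> b" for n a
    using genideal_homogeneous[OF T(1)] that by (simp add: b_def)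
  have "b \<subseteq> {a \<in> carrier R. a \<odot>\<^bsub>E\<^esub> v = \<zero>\<^bsub>E\<^esub>}"
    unfolding b_def using T(2) Tc by (intro R.genideal_minimal ideal_ann[OF E.module_axioms vc]) auto
  then have bv: "a \<odot>\<^bsub>E\<^esub> v = \<zero>\<^bsub>E\<^esub>" if "a \<in> b" for a using that by blast
  define C where "C N = {r \<in> carrier R. r \<otimes> x [^] N \<in> b}" for N :: nat
  have idC: "ideal (C N) R" for N
  proof (rule idealI)
    show "ring R" by (rule R.ring_axioms)
    show "subgroup (C N) (add_monoid R)"
    proof (rule R.add.subgroupI)
      show "C N \<noteq> {}" using b.zero_closed xN by (auto simp: C_def intro!: exI[of _ \<zero>])
    qed (use xN[of N] b.a_inv_closed b.a_closed in \<open>auto simp: C_def R.l_minus R.l_distr\<close>)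
    show "y \<otimes> a \<in> C N" "a \<otimes> y \<in> C N" if "a \<in> C N" "y \<in> carrier R" for a y
      using that xN[of N] b.I_l_closed by (auto simp: C_def R.m_assoc R.m_comm[of a y])
  qed
  have Cmono1: "C N \<subseteq> C (Suc N)" for N
    using b.I_r_closed xc xN[of N] by (auto simp: C_def R.m_assoc[symmetric])
  have Cmono: "C N \<subseteq> C N'" if "N \<le> N'" for N N'
    using that by (induction rule: dec_induct) (use Cmono1 in \<open>blast+\<close>)
  have "C N \<subseteq> C N' \<or> C N' \<subseteq> C N" for N N' using Cmono[of N N'] Cmono[of N' N] by linarith
  then have "subset.chain {I. ideal I R} (range C)"
    using idC unfolding subset_chain_def by blast
  then have "\<Union> (range C) \<in> range C"
    by (intro noetherian_ring.ideal_chain_is_trivial[OF noeth]) simp_all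
  then obtain N where "\<Union> (range C) = C N" by (rule rangeE)
  \<comment> \<open>At this N the chain (b : x^N) is stationary, so one factor x can be cancelled
    modulo b.\<close>
  then have stab: "r \<otimes> x [^] N \<in> b" if "r \<in> carrier R" "r \<otimes> x [^] Suc N \<in> b" for r
    using that unfolding C_def by blast
  define y where "y = x [^] Suc N"
  have yc: "y \<in> carrier R" "y \<in> Rg (Suc N * e)" unfolding y_def using xN xNg by blast+
  define c where "c = {a \<in> carrier R. \<exists>r\<in>carrier R. a \<ominus> r \<otimes> y \<in> b}"
  have c_add: "(a \<oplus> a') \<ominus> (r \<oplus> r') \<otimes> y \<in> b"
    if "a \<in> carrier R" "a' \<in> carrier R" "r \<in> carrier R" "r' \<in> carrier R" "a \<ominus> r \<otimes> y \<in> b" "a' \<ominus> r' \<otimes> y \<in> b" for a a' r r'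
  proof -
    have "(a \<ominus> r \<otimes> y) \<oplus> (a' \<ominus> r' \<otimes> y) \<in> b" using that b.a_closed by blast
    moreover have "(a \<ominus> r \<otimes> y) \<oplus> (a' \<ominus> r' \<otimes> y) = (a \<oplus> a') \<ominus> (r \<oplus> r') \<otimes> y"
      using that(1-4) yc(1) by (simp add: R.minus_eq R.l_distr R.minus_add R.a_ac)
    ultimately show ?thesis by simp
  qed
  have c_mult: "(s \<otimes> a) \<ominus> (s \<otimes> r) \<otimes> y \<in> b"
    if "a \<in> carrier R" "r \<in> carrier R" "s \<in> carrier R" "a \<ominus> r \<otimes> y \<in> b" for a r s
  proof -
    have "s \<otimes> (a \<ominus> r \<otimes> y) \<in> b" using that b.I_l_closed by blast
    moreover have "s \<otimes> (a \<ominus> r \<otimes> y) = (s \<otimes> a) \<ominus> (s \<otimes> r) \<otimes> y"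
      using that(1-3) yc(1) by (simp add: R.minus_eq R.r_distr R.r_minus R.m_assoc)
    ultimately show ?thesis by simp
  qed
  have c_mult': "s \<otimes> a \<in> c" if "a \<in> c" "s \<in> carrier R" for a s
    using that c_mult[of a _ s] by (auto simp: c_def)
  have idc: "ideal c R"
  proof (rule idealI)
    show "ring R" by (rule R.ring_axioms)
    show "subgroup c (add_monoid R)"
    proof (rule R.add.subgroupI)
      have "\<zero> \<ominus> \<zero> \<otimes> y \<in> b" using yc b.zero_closed by (simp add: R.minus_eq)
      then show "c \<noteq> {}" by (auto simp: c_def)
      show "\<ominus> a \<in> c" if "a \<in> c" for a
        using c_mult'[OF that, of "\<ominus> \<one>"] that by (simp add: c_def R.l_minus)
      show "a \<oplus> a' \<in> c" if "a \<in> c" "a' \<in> c" for a a'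
        using that c_add[of a a'] unfolding c_def by blast
    qed (auto simp: c_def)
    show "s \<otimes> a \<in> c" "a \<otimes> s \<in> c" if "a \<in> c" "s \<in> carrier R" for a s
      using c_mult'[OF that] R.m_comm[of a s] that by (auto simp: c_def)
  qed
  have comp: "rcomp n a \<ominus> (if n \<ge> Suc N * e then rcomp (n - Suc N * e) r else \<zero>) \<otimes> y \<in> b"
    if "a \<in> carrier R" "r \<in> carrier R" "a \<ominus> r \<otimes> y \<in> b" for a r n
  proof -
    have d: "a \<ominus> r \<otimes> y \<in> carrier R" "r \<otimes> y \<in> carrier R" using that yc(1) by auto
    have "a = (a \<ominus> r \<otimes> y) \<oplus> r \<otimes> y"
      using that(1) d(2) by (simp add: R.minus_eq R.a_assoc R.l_neg)
    then have "rcomp n a = rcomp n (a \<ominus> r \<otimes> y) \<oplus> rcomp n (r \<otimes> y)"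
      using rcompD(5)[OF d, of n] by simp
    then have "rcomp n a \<ominus> rcomp n (r \<otimes> y) = rcomp n (a \<ominus> r \<otimes> y)"
      using rcompD(4)[OF d(1), of n] rcompD(4)[OF d(2), of n] by (simp add: R.minus_eq R.a_assoc R.r_neg)
    moreover have "rcomp n (r \<otimes> y) = (if n \<ge> Suc N * e then rcomp (n - Suc N * e) r else \<zero>) \<otimes> y"
      using rcomp_mult[OF yc(2) that(2), of n] yc(1) by auto
    ultimately show ?thesis using bhom[OF that(3), of n] by simp
  qed
  have chom: "rcomp n a \<in> c" if "a \<in> c" for n a
  proof -
    obtain r where r: "r \<in> carrier R" "a \<in> carrier R" "a \<ominus> r \<otimes> y \<in> b" using \<open>a \<in> c\<close> by (auto simp: c_def)
    have "(if n \<ge> Suc N * e then rcomp (n - Suc N * e) r else \<zero>) \<in> carrier R" using rcompD(4)[OF r(1)] by auto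
    then show ?thesis using comp[OF r(2,1,3), of n] rcompD(4)[OF r(2), of n] unfolding c_def by blast
  qed
  define g where "g a = ((SOME r. r \<in> carrier R \<and> a \<ominus> r \<otimes> y \<in> b) \<otimes> x [^] N) \<odot>\<^bsub>E\<^esub> v" for a
  have gval: "g a = (r \<otimes> x [^] N) \<odot>\<^bsub>E\<^esub> v" if r: "r \<in> carrier R" "a \<in> carrier R" "a \<ominus> r \<otimes> y \<in> b" for a r
  proof -
    define r' where "r' = (SOME r. r \<in> carrier R \<and> a \<ominus> r \<otimes> y \<in> b)"
    have r': "r' \<in> carrier R \<and> a \<ominus> r' \<otimes> y \<in> b"
      unfolding r'_def by (rule someI[of _ r]) (use r in simp)
    \<comment> \<open>Two coefficients of a differ by an element whose product with x^(N+1) lies in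
      b. Cancelling one x, its product with x^N lies in b as well and therefore kills v.\<close>
    have "(a \<ominus> r \<otimes> y) \<ominus> (a \<ominus> r' \<otimes> y) \<in> b" using r r' b.a_closed b.a_inv_closed by (simp add: R.minus_eq)
    moreover have "(a \<ominus> r \<otimes> y) \<ominus> (a \<ominus> r' \<otimes> y) = (r' \<ominus> r) \<otimes> y"
      using r r' yc(1) by (simp add: R.minus_eq R.l_distr R.l_minus R.minus_add R.a_ac R.r_neg1 R.r_neg2)
    ultimately have "(r' \<ominus> r) \<otimes> x [^] N \<in> b" using stab[of "r' \<ominus> r"] r r' by (simp add: y_def)
    from bv[OF this] have "(r' \<otimes> x [^] N \<ominus> r \<otimes> x [^] N) \<odot>\<^bsub>E\<^esub> v = \<zero>\<^bsub>E\<^esub>"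
      using r r' xN[of N] by (simp add: R.minus_eq R.l_distr R.l_minus)
    then have "(r' \<otimes> x [^] N) \<odot>\<^bsub>E\<^esub> v \<oplus>\<^bsub>E\<^esub> \<ominus>\<^bsub>E\<^esub> ((r \<otimes> x [^] N) \<odot>\<^bsub>E\<^esub> v) = \<zero>\<^bsub>E\<^esub>"
      using r r' xN[of N] vc by (simp add: R.minus_eq E.smult_l_distr E.smult_l_minus)
    then have "(r' \<otimes> x [^] N) \<odot>\<^bsub>E\<^esub> v = (r \<otimes> x [^] N) \<odot>\<^bsub>E\<^esub> v"
      using r r' xN[of N] vc E.M.minus_equality[of "(r' \<otimes> x [^] N) \<odot>\<^bsub>E\<^esub> v" "\<ominus>\<^bsub>E\<^esub> ((r \<otimes> x [^] N) \<odot>\<^bsub>E\<^esub> v)"] by simp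
    then show ?thesis by (simp add: g_def r'_def)
  qed
  have "module_hom R (ideal_module R c) E g"
    unfolding module_hom_def ideal_module_simps
  proof (intro conjI ballI funcsetI)
    fix a assume a: "a \<in> c"
    then obtain r where r: "r \<in> carrier R" "a \<in> carrier R" "a \<ominus> r \<otimes> y \<in> b" by (auto simp: c_def)
    show "g a \<in> carrier E" using gval[OF r] r(1) xN[of N] vc by simp
    show "g (a \<oplus> a') = g a \<oplus>\<^bsub>E\<^esub> g a'" if a': "a' \<in> c" for a'
    proof -
      obtain r' where r': "r' \<in> carrier R" "a' \<in> carrier R" "a' \<ominus> r' \<otimes> y \<in> b" using a' by (auto simp: c_def)
      show ?thesis
        using gval[OF r] gval[OF r'] gval[of "r \<oplus> r'" "a \<oplus> a'"] c_add[OF r(2) r'(2) r(1) r'(1) r(3) r'(3)] r r' xN[of N] vc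
        by (simp add: R.l_distr E.smult_l_distr)
    qed
  next
    fix s a assume s: "s \<in> carrier R" and a: "a \<in> c"
    then obtain r where r: "r \<in> carrier R" "a \<in> carrier R" "a \<ominus> r \<otimes> y \<in> b" by (auto simp: c_def)
    show "g (s \<otimes> a) = s \<odot>\<^bsub>E\<^esub> g a"
      using gval[OF r] gval[of "s \<otimes> r" "s \<otimes> a"] c_mult[OF r(2,1) s r(3)] r s xN[of N] vc
      by (simp add: R.m_assoc E.smult_assoc1)
  qed
  moreover have "g a \<in> Eg (int m + (k - int e))" if a: "a \<in> c" "a \<in> Rg m" for m a
  proof -
    obtain r where r: "r \<in> carrier R" "a \<in> carrier R" "a \<ominus> r \<otimes> y \<in> b" using a(1) by (auto simp: c_def)
    have am: "rcomp m a = a" using rcompD(6)[OF a(2)] .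
    show ?thesis
    proof (cases "m \<ge> Suc N * e")
      case True
      \<comment> \<open>A homogeneous a has a homogeneous coefficient, so g is homogeneous of the
        required degree.\<close>
      have "g a = (rcomp (m - Suc N * e) r \<otimes> x [^] N) \<odot>\<^bsub>E\<^esub> v"
        using gval[of "rcomp (m - Suc N * e) r" a] comp[OF r(2,1,3), of m] True am r(2) rcompD(4)[OF r(1)] by simp
      moreover have "rcomp (m - Suc N * e) r \<otimes> x [^] N \<in> Rg (m - Suc N * e + N * e)"
        using Rg_mult[OF rcompD(3)[OF r(1)] xNg] .
      then have "(rcomp (m - Suc N * e) r \<otimes> x [^] N) \<odot>\<^bsub>E\<^esub> v \<in> Eg (int (m - Suc N * e + N * e) + k)"
        using gE v unfolding graded_module_def by blast
      moreover have "int (m - Suc N * e + N * e) + k = int m + (k - int e)" using True by (simp add: of_nat_diff)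
      ultimately show ?thesis by (simp only:)
    next
      case False
      then have "g a = (\<zero> \<otimes> x [^] N) \<odot>\<^bsub>E\<^esub> v"
        using gval[of \<zero> a] comp[OF r(2,1,3), of m] am r(2) by simp
      then show ?thesis using vc En(2) xN[of N] by simp
    qed
  qed
  ultimately obtain w where w: "w \<in> Eg (k - int e)" "!!a. a \<in> c ==> a \<odot>\<^bsub>E\<^esub> w = g a"
    using graded_injective_extend[OF E idc chom] by blast
  \<comment> \<open>y lies in c with coefficient 1, which gives the equation for w. Elements of T
    lie in c with coefficient 0, so they kill w.\<close>
  have "y \<ominus> \<one> \<otimes> y \<in> b" using yc b.zero_closed by (simp add: R.minus_eq R.r_neg)
  moreover from this have "y \<in> c" unfolding c_def using yc(1) by blast
  ultimately have "y \<odot>\<^bsub>E\<^esub> w = x [^] N \<odot>\<^bsub>E\<^esub> v"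
    using w(2)[of y] gval[of \<one> y] yc(1) xN[of N] by simp
  moreover have "t \<odot>\<^bsub>E\<^esub> w = \<zero>\<^bsub>E\<^esub>" if "t \<in> T" for t
  proof -
    have t: "t \<ominus> \<zero> \<otimes> y \<in> b" "t \<in> carrier R" using that Tb Tc yc by (auto simp: R.minus_eq)
    then show ?thesis using w(2)[of t] gval[of \<zero> t] vc xN[of N] by (auto simp: c_def)
  qed
  ultimately show ?thesis using w(1) unfolding y_def by blast
qed

end

text \<open>For finite S this is the torsion submodule of the ideal generated by S. In the
  elementwise form, adjoining x to S just intersects with the torsion for x, so generators can be
  treated one at a time.\<close>

definition tors_set :: "('r, 'x) ring_scheme => 'r set => ('r, 'm, 'y) module_scheme => 'm set" where
  "tors_set R S E = {v \<in> carrier E. \<forall>x\<in>S. \<exists>n::nat. x [^]\<^bsub>R\<^esub> n \<odot>\<^bsub>E\<^esub> v = \<zero>\<^bsub>E\<^esub>}"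

context module
begin

lemma pow_ann_mono:
  assumes x: "x \<in> carrier R" and v: "v \<in> carrier M" and z: "x [^] (n::nat) \<odot>\<^bsub>M\<^esub> v = \<zero>\<^bsub>M\<^esub>" and nm: "n \<le> m"
  shows "x [^] m \<odot>\<^bsub>M\<^esub> v = \<zero>\<^bsub>M\<^esub>"
proof -
  have "x [^] m = x [^] (m - n) \<otimes> x [^] n" using x nm by (simp add: R.nat_pow_mult)
  then show ?thesis using x v z by (simp add: smult_assoc1)
qed

lemma smult_swap: "a \<in> carrier R ==> b \<in> carrier R ==> v \<in> carrier M ==> a \<odot>\<^bsub>M\<^esub> (b \<odot>\<^bsub>M\<^esub> v) = b \<odot>\<^bsub>M\<^esub> (a \<odot>\<^bsub>M\<^esub> v)"
  using smult_assoc1[of a b v] smult_assoc1[of b a v] R.m_comm[of a b] by simp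

lemma submodule_tors_set:
  assumes S: "S \<subseteq> carrier R"
  shows "submodule (tors_set R S M) R M"
proof (rule submoduleI)
  show "tors_set R S M \<subseteq> carrier M" by (auto simp: tors_set_def)
  show "\<zero>\<^bsub>M\<^esub> \<in> tors_set R S M" using S by (auto simp: tors_set_def)
  show "a \<odot>\<^bsub>M\<^esub> v \<in> tors_set R S M" if a: "a \<in> carrier R" and v: "v \<in> tors_set R S M" for a v
  proof -
    have "\<exists>n::nat. x [^] n \<odot>\<^bsub>M\<^esub> (a \<odot>\<^bsub>M\<^esub> v) = \<zero>\<^bsub>M\<^esub>" if x: "x \<in> S" for x
    proof -
      obtain n :: nat where "x [^] n \<odot>\<^bsub>M\<^esub> v = \<zero>\<^bsub>M\<^esub>" using v x by (auto simp: tors_set_def)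
      then have "x [^] n \<odot>\<^bsub>M\<^esub> (a \<odot>\<^bsub>M\<^esub> v) = \<zero>\<^bsub>M\<^esub>"
        using smult_swap[of "x [^] n" a v] a v x S by (auto simp: tors_set_def)
      then show ?thesis ..
    qed
    then show ?thesis using a v by (auto simp: tors_set_def)
  qed
  then have m: "\<ominus> \<one> \<odot>\<^bsub>M\<^esub> v \<in> tors_set R S M" if "v \<in> tors_set R S M" for v using that by blast
  show "\<ominus>\<^bsub>M\<^esub> v \<in> tors_set R S M" if v: "v \<in> tors_set R S M" for v
  proof -
    have "\<ominus> \<one> \<odot>\<^bsub>M\<^esub> v = \<ominus>\<^bsub>M\<^esub> v" using v smult_l_minus[of \<one> v] by (simp add: tors_set_def)
    then show ?thesis using m[OF v] by (simp only:)
  qed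
  show "v \<oplus>\<^bsub>M\<^esub> w \<in> tors_set R S M" if v: "v \<in> tors_set R S M" and w: "w \<in> tors_set R S M" for v w
  proof -
    have "\<exists>n::nat. x [^] n \<odot>\<^bsub>M\<^esub> (v \<oplus>\<^bsub>M\<^esub> w) = \<zero>\<^bsub>M\<^esub>" if x: "x \<in> S" for x
    proof -
      obtain n :: nat where n: "x [^] n \<odot>\<^bsub>M\<^esub> v = \<zero>\<^bsub>M\<^esub>" using v x by (auto simp: tors_set_def)
      obtain m :: nat where m: "x [^] m \<odot>\<^bsub>M\<^esub> w = \<zero>\<^bsub>M\<^esub>" using w x by (auto simp: tors_set_def)
      note nm = n m
      have c: "x \<in> carrier R" "v \<in> carrier M" "w \<in> carrier M" using v w x S by (auto simp: tors_set_def)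
      have "x [^] (max n m) \<odot>\<^bsub>M\<^esub> (v \<oplus>\<^bsub>M\<^esub> w) = \<zero>\<^bsub>M\<^esub>"
        using pow_ann_mono[OF c(1,2) nm(1), of "max n m"] pow_ann_mono[OF c(1,3) nm(2), of "max n m"] c
        by (simp add: smult_r_distr)
      then show ?thesis ..
    qed
    then show ?thesis using v w by (auto simp: tors_set_def)
  qed
qed

lemma genideal_smult:
  assumes K: "submodule K R M" and v: "v \<in> carrier M" and S: "S \<subseteq> carrier R" "!!x. x \<in> S ==> x \<odot>\<^bsub>M\<^esub> v \<in> K"
    and a: "a \<in> genideal R S"
  shows "a \<odot>\<^bsub>M\<^esub> v \<in> K"
proof -
  have "genideal R S \<subseteq> {a \<in> carrier R. a \<odot>\<^bsub>M\<^esub> v \<in> K}"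
    using S by (intro R.genideal_minimal ideal_transporter[OF K v]) auto
  then show ?thesis using a by blast
qed

lemma ideal_power_carrier:
  assumes "b \<subseteq> carrier R"
  shows "b [^]\<^bsub>ideals_set R\<^esub> (n::nat) \<subseteq> carrier R"
proof (induction n)
  case (Suc n)
  have "a \<in> carrier R" if "a \<in> ideal_prod R (b [^]\<^bsub>ideals_set R\<^esub> n) b" for a
    using that by (induction rule: ideal_prod.induct) (use Suc assms in auto)
  then show ?case by (auto simp: ideals_set_def)
qed (simp add: ideals_set_def)

text \<open>Among N + 1 factors from S some x occurs at least f x times. The induction takes off one
  factor x, passing to x v with the exponent of x lowered by one.\<close>

lemma ideal_power_ann:
  assumes S: "finite S" "S \<subseteq> carrier R" and b: "b \<subseteq> genideal R S"
    and v: "v \<in> carrier M" and f: "!!x. x \<in> S ==> x [^] (f x :: nat) \<odot>\<^bsub>M\<^esub> v = \<zero>\<^bsub>M\<^esub>" "sum f S \<le> N"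
    and a: "a \<in> b [^]\<^bsub>ideals_set R\<^esub> (Suc N)"
  shows "a \<odot>\<^bsub>M\<^esub> v = \<zero>\<^bsub>M\<^esub>"
  using v f a
proof (induction N arbitrary: v f a)
  have bc: "b \<subseteq> carrier R" using b ideal.Icarr[OF R.genideal_ideal[OF S(2)]] by blast
  note pc = ideal_power_carrier[OF bc]
  have step: "a \<odot>\<^bsub>M\<^esub> v = \<zero>\<^bsub>M\<^esub>"
    if v: "v \<in> carrier M" and k: "!!x i. x \<in> S ==> i \<in> b [^]\<^bsub>ideals_set R\<^esub> N ==> i \<odot>\<^bsub>M\<^esub> (x \<odot>\<^bsub>M\<^esub> v) = \<zero>\<^bsub>M\<^esub>"
      and a: "a \<in> b [^]\<^bsub>ideals_set R\<^esub> (Suc N)" for v a and N :: nat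
  proof -
    define K where "K = {u \<in> carrier M. \<forall>i\<in>b [^]\<^bsub>ideals_set R\<^esub> N. i \<odot>\<^bsub>M\<^esub> u = \<zero>\<^bsub>M\<^esub>}"
    have K: "submodule K R M"
      by (rule submoduleI) (use pc[of N] in \<open>auto simp: K_def smult_r_distr smult_r_minus smult_swap subset_iff\<close>)
    have xK: "x \<odot>\<^bsub>M\<^esub> v \<in> K" if x: "x \<in> S" for x
    proof -
      have "x \<in> carrier R" using x S(2) by blast
      then show ?thesis unfolding K_def using k[OF x] v by simp
    qed
    have jK: "j \<odot>\<^bsub>M\<^esub> v \<in> K" if j: "j \<in> b" for j
    proof -
      have j': "j \<in> genideal R S" using j b by blast
      show ?thesis by (rule genideal_smult[OF K v S(2) _ j']) (rule xK)
    qed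
    have "a \<in> ideal_prod R (b [^]\<^bsub>ideals_set R\<^esub> N) b" using a by (simp add: ideals_set_def)
    then have "a \<in> carrier R \<and> a \<odot>\<^bsub>M\<^esub> v = \<zero>\<^bsub>M\<^esub>"
    proof (induction rule: ideal_prod.induct)
      case (prod i j)
      have "i \<in> carrier R" "j \<in> carrier R" using prod pc[of N] bc by auto
      then show ?case using jK[OF prod(2)] prod(1) v by (auto simp: K_def smult_assoc1)
    next
      case (sum s1 s2)
      then show ?case using v by (simp add: smult_l_distr)
    qed
    then show ?thesis by blast
  qed
  {
    case (0 v f a)
    have "x \<odot>\<^bsub>M\<^esub> v = \<zero>\<^bsub>M\<^esub>" if "x \<in> S" for x
    proof -
      have "f x = 0" using 0(3) S(1) that by simp
      then show ?thesis using 0(2)[OF that] 0(1) S(2) that by auto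
    qed
    then show ?case
      using pc[of 0] by (intro step[OF 0(1) _ 0(4)]) auto
  next
    case (Suc N v f a)
    show ?case
    proof (rule step[OF Suc.prems(1) _ Suc.prems(4)])
      fix x i assume x: "x \<in> S" and i: "i \<in> b [^]\<^bsub>ideals_set R\<^esub> (Suc N)"
      have xc: "x \<in> carrier R" using x S(2) by blast
      have ic: "i \<in> carrier R" using i pc[of "Suc N"] by blast
      show "i \<odot>\<^bsub>M\<^esub> (x \<odot>\<^bsub>M\<^esub> v) = \<zero>\<^bsub>M\<^esub>"
      proof (cases "f x")
        case 0
        then have "v = \<zero>\<^bsub>M\<^esub>" using Suc.prems(2)[OF x] Suc.prems(1) by simp
        then show ?thesis using xc ic by simp
      next
        case (Suc m)
        define f' where "f' = f(x := m)"
        have "sum f' S \<le> N"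
        proof -
          have "sum f S = f x + sum f (S - {x})" "sum f' S = m + sum f' (S - {x})"
            using S(1) x by (simp_all add: sum.remove f'_def)
          moreover have "sum f' (S - {x}) = sum f (S - {x})" by (rule sum.cong) (auto simp: f'_def)
          ultimately show ?thesis using Suc.prems(3) Suc by simp
        qed
        moreover have "z [^] f' z \<odot>\<^bsub>M\<^esub> (x \<odot>\<^bsub>M\<^esub> v) = \<zero>\<^bsub>M\<^esub>" if z: "z \<in> S" for z
        proof (cases "z = x")
          case True
          then show ?thesis using Suc.prems(2)[OF x] Suc xc Suc.prems(1) by (simp add: f'_def smult_assoc1)
        next
          case False
          then have "z [^] f' z \<odot>\<^bsub>M\<^esub> (x \<odot>\<^bsub>M\<^esub> v) = x \<odot>\<^bsub>M\<^esub> (z [^] f z \<odot>\<^bsub>M\<^esub> v)"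
            using smult_swap[of "z [^] f z" x v] xc z S(2) Suc.prems(1) by (auto simp: f'_def)
          then show ?thesis using Suc.prems(2)[OF z] xc by simp
        qed
        ultimately show ?thesis
          using Suc.IH[of "x \<odot>\<^bsub>M\<^esub> v" f' i] i xc Suc.prems(1) by simp
      qed
    qed
  }
qed

lemma carrier_torsion_part_eq: "carrier (torsion_part R b M) =
    {v \<in> carrier M. \<exists>n::nat. \<forall>a\<in>b [^]\<^bsub>ideals_set R\<^esub> n. a \<odot>\<^bsub>M\<^esub> v = \<zero>\<^bsub>M\<^esub>}"
  by (simp add: torsion_part_def)

text \<open>Powers of generators are products in the power of b; conversely finiteness of S bounds
  all exponents at once, through \<open>ideal_power_ann\<close>.\<close>

lemma carrier_torsion_part:
  assumes S: "finite S" "S \<subseteq> b" and b: "b \<subseteq> genideal R S" "b \<subseteq> carrier R"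
  shows "carrier (torsion_part R b M) = tors_set R S M"
proof (intro Set.set_eqI iffI)
  fix v assume "v \<in> carrier (torsion_part R b M)"
  then obtain n :: nat where v: "v \<in> carrier M" and n: "!!a. a \<in> b [^]\<^bsub>ideals_set R\<^esub> n ==> a \<odot>\<^bsub>M\<^esub> v = \<zero>\<^bsub>M\<^esub>"
    by (auto simp: torsion_part_def)
  have "x [^] (m::nat) \<in> b [^]\<^bsub>ideals_set R\<^esub> m" if "x \<in> S" for x m
  proof (induction m)
    case (Suc m)
    then show ?case using that S(2) by (auto simp: ideals_set_def intro: ideal_prod.prod)
  qed (simp add: ideals_set_def)
  then show "v \<in> tors_set R S M" using v n by (auto simp: tors_set_def)
next
  fix v assume v: "v \<in> tors_set R S M"
  then have "\<forall>x\<in>S. \<exists>n::nat. x [^] n \<odot>\<^bsub>M\<^esub> v = \<zero>\<^bsub>M\<^esub>" by (simp add: tors_set_def)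
  then obtain f :: "'a => nat" where f: "!!x. x \<in> S ==> x [^] f x \<odot>\<^bsub>M\<^esub> v = \<zero>\<^bsub>M\<^esub>" by metis
  have vc: "v \<in> carrier M" using v by (simp add: tors_set_def)
  have "\<forall>a\<in>b [^]\<^bsub>ideals_set R\<^esub> (Suc (sum f S)). a \<odot>\<^bsub>M\<^esub> v = \<zero>\<^bsub>M\<^esub>"
    using ideal_power_ann[OF S(1) subset_trans[OF S(2) b(2)] b(1) vc f order_refl] by (intro ballI)
  then have "\<exists>n::nat. \<forall>a\<in>b [^]\<^bsub>ideals_set R\<^esub> n. a \<odot>\<^bsub>M\<^esub> v = \<zero>\<^bsub>M\<^esub>" by (rule exI)
  then show "v \<in> carrier (torsion_part R b M)"
    unfolding carrier_torsion_part_eq by (intro CollectI conjI vc)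
qed

end

context standard_graded
begin

lemma irrelevant_ideal_generators:
  assumes S: "S \<subseteq> Rg 1" and gen: "generate_ring R (Rg 0 \<union> S) = carrier R"
  shows "S \<subseteq> irrelevant_ideal R Rg" "irrelevant_ideal R Rg \<subseteq> carrier R" "irrelevant_ideal R Rg \<subseteq> genideal R S"
    "r \<in> carrier R ==> \<exists>r0\<in>Rg 0. r \<ominus> r0 \<in> genideal R S"
proof -
  let ?I = "genideal R S"
  have Sc: "S \<subseteq> carrier R" using S Rg_carrier by blast
  interpret I: ideal ?I R by (rule R.genideal_ideal[OF Sc])
  note R0 = additive_subgroupD[OF R.abelian_group_axioms rcompD(1)[of 0]]
  show "S \<subseteq> irrelevant_ideal R Rg"
  proof
    fix s assume s: "s \<in> S"
    have "s = finsum R (\<lambda>_. s) {1::nat}" using s Sc R.finsum_insert[of "{}" "1::nat" "\<lambda>_. s"] by auto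
    then show "s \<in> irrelevant_ideal R Rg"
      unfolding irrelevant_ideal_def using s S by (intro CollectI exI[of _ "\<lambda>_. s"] exI[of _ "{1}"]) auto
  qed
  show "irrelevant_ideal R Rg \<subseteq> carrier R"
    unfolding irrelevant_ideal_def using Rg_carrier by (auto intro!: R.finsum_closed)
  have dec: "\<exists>r0\<in>Rg 0. r \<ominus> r0 \<in> ?I" if "r \<in> carrier R" for r
  proof -
    have "r \<in> generate_ring R (Rg 0 \<union> S)" using gen that by simp
    then show ?thesis
    proof (induction rule: generate_ring.induct)
      case one
      then show ?case using one_Rg I.zero_closed by (auto intro!: bexI[of _ \<one>] simp: R.minus_eq R.r_neg)
    next
      case (incl h)
      show ?case
      proof (cases "h \<in> Rg 0")
        case True
        then show ?thesis using I.zero_closed Rg_carrier by (auto intro!: bexI[of _ h] simp: R.minus_eq R.r_neg)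
      next
        case False
        then have h: "h \<in> S" using incl by auto
        have "h \<in> ?I" using R.genideal_self[OF Sc] h by blast
        then show ?thesis using R0(2) Sc h by (intro bexI[of _ \<zero>]) (auto simp: R.minus_eq)
      qed
    next
      case (a_inv h)
      then obtain r0 where r0: "r0 \<in> Rg 0" "h \<ominus> r0 \<in> ?I" by blast
      have h: "h \<in> carrier R" using a_inv gen by simp
      have "\<ominus> (h \<ominus> r0) \<in> ?I" using r0 I.a_inv_closed by blast
      moreover have "\<ominus> (h \<ominus> r0) = \<ominus> h \<ominus> \<ominus> r0" using h Rg_carrier[OF r0(1)] by (simp add: R.minus_eq R.minus_add)
      ultimately show ?case using R0(4)[OF r0(1)] by (intro bexI[of _ "\<ominus> r0"]) auto
    next
      case (eng_add h1 h2)
      then obtain r1 r2 where r: "r1 \<in> Rg 0" "h1 \<ominus> r1 \<in> ?I" "r2 \<in> Rg 0" "h2 \<ominus> r2 \<in> ?I" by blast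
      have h: "h1 \<in> carrier R" "h2 \<in> carrier R" using eng_add gen by auto
      note rc = Rg_carrier[OF r(1)] Rg_carrier[OF r(3)]
      have "(h1 \<ominus> r1) \<oplus> (h2 \<ominus> r2) \<in> ?I" by (rule I.a_closed[OF r(2,4)])
      moreover have "(h1 \<ominus> r1) \<oplus> (h2 \<ominus> r2) = (h1 \<oplus> h2) \<ominus> (r1 \<oplus> r2)" using h rc by (simp add: R.minus_eq R.minus_add R.a_ac)
      ultimately show ?case using R0(3)[OF r(1,3)] by (intro bexI[of _ "r1 \<oplus> r2"]) auto
    next
      case (eng_mult h1 h2)
      then obtain r1 r2 where r: "r1 \<in> Rg 0" "h1 \<ominus> r1 \<in> ?I" "r2 \<in> Rg 0" "h2 \<ominus> r2 \<in> ?I" by blast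
      have h: "h1 \<in> carrier R" "h2 \<in> carrier R" using eng_mult gen by auto
      note rc = Rg_carrier[OF r(1)] Rg_carrier[OF r(3)]
      have "(h1 \<ominus> r1) \<otimes> h2 \<oplus> r1 \<otimes> (h2 \<ominus> r2) \<in> ?I"
        by (rule I.a_closed[OF I.I_r_closed[OF r(2) h(2)] I.I_l_closed[OF r(4) rc(1)]])
      moreover have "(h1 \<ominus> r1) \<otimes> h2 \<oplus> r1 \<otimes> (h2 \<ominus> r2) = h1 \<otimes> h2 \<ominus> r1 \<otimes> r2"
        using h rc by (simp add: R.minus_eq R.l_distr R.r_distr R.l_minus R.r_minus R.a_assoc R.r_neg1 R.r_neg2)
      moreover have "r1 \<otimes> r2 \<in> Rg 0" using Rg_mult[OF r(1,3)] by simp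
      ultimately show ?case by (intro bexI[of _ "r1 \<otimes> r2"]) auto
    qed
  qed
  show "r \<in> carrier R ==> \<exists>r0\<in>Rg 0. r \<ominus> r0 \<in> ?I" by (rule dec)
  \<comment> \<open>Modulo the ideal c is some r0 of degree 0. The component of degree n of c - r0
    is c itself, and the ideal is homogeneous.\<close>
  have "c \<in> ?I" if c: "c \<in> Rg n" and n: "n > 0" for c n
  proof -
    have cc: "c \<in> carrier R" using Rg_carrier[OF c] .
    obtain r0 where r0: "r0 \<in> Rg 0" "c \<ominus> r0 \<in> ?I" using dec[OF cc] by blast
    have r0c: "r0 \<in> carrier R" using Rg_carrier[OF r0(1)] .
    have "rcomp n (c \<ominus> r0) \<in> ?I"
      using genideal_homogeneous[OF _ r0(2), of n] S by blast
    moreover have "c = (c \<ominus> r0) \<oplus> r0" using cc r0c by (simp add: R.minus_eq R.a_assoc R.l_neg)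
    then have "rcomp n c = rcomp n (c \<ominus> r0) \<oplus> rcomp n r0"
      using rcompD(5)[of "c \<ominus> r0" r0 n] cc r0c by simp
    moreover have "rcomp n r0 = \<zero>" using rcompD(7)[OF r0(1), of n] n by simp
    ultimately show ?thesis using rcompD(6)[OF c] cc r0c rcompD(4)[of "c \<ominus> r0" n] by simp
  qed
  then have pos: "c \<in> ?I" if "c \<in> Rg n" "n > 0" for c n using that by blast
  show "irrelevant_ideal R Rg \<subseteq> ?I"
  proof
    fix z assume "z \<in> irrelevant_ideal R Rg"
    then obtain c F where F: "z = finsum R c F" "finite F" "F \<subseteq> {0<..}" "!!n. n \<in> F ==> c n \<in> Rg n"
      unfolding irrelevant_ideal_def by blast
    have "c n \<in> ?I" if "n \<in> F" for n using pos[OF F(4)[OF that]] F(3) that by auto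
    then show "z \<in> ?I"
      unfolding F(1) using R.finsum_mem[OF F(2) I.zero_closed I.a_closed I.a_subset] by blast
  qed
qed

lemma component_smult:
  assumes gE: "graded_module R Rg E Eg" and p: "projections E Eg p" and a: "a \<in> Rg d" and v: "v \<in> carrier E"
  shows "p (int d + n) (a \<odot>\<^bsub>E\<^esub> v) = a \<odot>\<^bsub>E\<^esub> p n v"
proof -
  interpret E: module R E using gE by (simp add: graded_module_def)
  have "a \<odot>\<^bsub>E\<^esub> x \<in> Eg (int d + i)" if "x \<in> Eg i" for i x
    using gE a that by (auto simp: graded_module_def)
  then show ?thesis
    using Rg_carrier[OF a] v
    by (intro projections_map(1)[OF E.abelian_group_axioms E.abelian_group_axioms p p, where s = "\<lambda>i. int d + i" and f = "\<lambda>v. a \<odot>\<^bsub>E\<^esub> v"])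
      (auto simp: E.smult_r_distr inj_def)
qed

lemma component_tors_set:
  assumes gE: "graded_module R Rg E Eg" and p: "projections E Eg p" and S: "S \<subseteq> Rg d" and v: "v \<in> tors_set R S E"
  shows "p n v \<in> tors_set R S E"
proof -
  interpret E: module R E using gE by (simp add: graded_module_def)
  note pD = E.M.projectionsD[OF p]
  have vc: "v \<in> carrier E" using v by (simp add: tors_set_def)
  have "\<exists>m::nat. x [^] m \<odot>\<^bsub>E\<^esub> p n v = \<zero>\<^bsub>E\<^esub>" if x: "x \<in> S" for x
  proof -
    obtain m :: nat where m: "x [^] m \<odot>\<^bsub>E\<^esub> v = \<zero>\<^bsub>E\<^esub>" using v x by (auto simp: tors_set_def)
    have "x [^] m \<in> Rg (m * d)" using Rg_pow S x by blast
    from component_smult[OF gE p this vc, of n] have "x [^] m \<odot>\<^bsub>E\<^esub> p n v = \<zero>\<^bsub>E\<^esub>"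
      using m pD(10) by simp
    then show ?thesis ..
  qed
  then show ?thesis using pD(4)[OF vc] by (simp add: tors_set_def)
qed

text \<open>The surjectivity of x on torsion for T modulo torsion for T and x, degree by degree.
  Powers of elements of T that kill v are fed into \<open>graded_injective_divide\<close>, so the
  quotient w is again torsion for T.\<close>

lemma tors_set_divide:
  assumes noeth: "noetherian_ring R" and E: "graded_injective_module R Rg E Eg"
    and T: "T \<subseteq> Rg e" and x: "x \<in> Rg e" and v: "v \<in> tors_set R T E" "v \<in> Eg k"
  shows "\<exists>w\<in>tors_set R T E \<inter> Eg (k - int e). x \<odot>\<^bsub>E\<^esub> w \<ominus>\<^bsub>E\<^esub> v \<in> tors_set R {x} E"
proof -
  have gE: "graded_module R Rg E Eg" using E by (simp add: graded_injective_module_def)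
  then interpret E: module R E by (simp add: graded_module_def)
  have "additive_subgroup (Eg n) E" for n using gE by (simp add: graded_module_def internal_direct_sum_def)
  note En = additive_subgroupD[OF E.abelian_group_axioms this]
  have "\<forall>t\<in>T. \<exists>n::nat. t [^] n \<odot>\<^bsub>E\<^esub> v = \<zero>\<^bsub>E\<^esub>" using v by (simp add: tors_set_def)
  then obtain f :: "'r => nat" where f: "!!t. t \<in> T ==> t [^] f t \<odot>\<^bsub>E\<^esub> v = \<zero>\<^bsub>E\<^esub>" by metis
  define T' where "T' = (\<lambda>t. t [^] f t) ` T"
  have 1: "\<exists>n. t \<in> Rg n" if "t \<in> T'" for t using that T Rg_pow unfolding T'_def by blast
  have 2: "t \<odot>\<^bsub>E\<^esub> v = \<zero>\<^bsub>E\<^esub>" if "t \<in> T'" for t using that f unfolding T'_def by blast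
  have "\<exists>w\<in>Eg (k - int e). \<exists>N::nat. x [^] Suc N \<odot>\<^bsub>E\<^esub> w = x [^] N \<odot>\<^bsub>E\<^esub> v \<and> (\<forall>t\<in>T'. t \<odot>\<^bsub>E\<^esub> w = \<zero>\<^bsub>E\<^esub>)"
    by (rule graded_injective_divide[OF noeth E v(2) 1 2 x])
  then obtain w N where w: "w \<in> Eg (k - int e)" "x [^] Suc N \<odot>\<^bsub>E\<^esub> w = x [^] (N::nat) \<odot>\<^bsub>E\<^esub> v"
    "\<forall>t\<in>T'. t \<odot>\<^bsub>E\<^esub> w = \<zero>\<^bsub>E\<^esub>"
    by (elim bexE exE conjE)
  have c: "w \<in> carrier E" "v \<in> carrier E" "x \<in> carrier R" using w(1) v(2) En(1) Rg_carrier[OF x] by blast+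
  have "\<exists>n::nat. t [^] n \<odot>\<^bsub>E\<^esub> w = \<zero>\<^bsub>E\<^esub>" if "t \<in> T" for t
    using w(3) that by (intro exI[of _ "f t"]) (simp add: T'_def)
  then have "w \<in> tors_set R T E" using c(1) by (simp add: tors_set_def)
  moreover have "x [^] N \<odot>\<^bsub>E\<^esub> (x \<odot>\<^bsub>E\<^esub> w \<ominus>\<^bsub>E\<^esub> v) = \<zero>\<^bsub>E\<^esub>"
    using w(2) c by (simp add: E.M.minus_eq E.smult_r_distr E.smult_r_minus E.smult_assoc1 E.M.r_neg)
  then have "x \<odot>\<^bsub>E\<^esub> w \<ominus>\<^bsub>E\<^esub> v \<in> tors_set R {x} E" using c by (auto simp: tors_set_def)
  ultimately show ?thesis using w(1) by blast
qed

text \<open>The homogeneous components are divided separately and the results added.\<close>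

lemma tors_set_divide_total:
  assumes noeth: "noetherian_ring R" and E: "graded_injective_module R Rg E Eg"
    and T: "T \<subseteq> Rg e" and x: "x \<in> Rg e" and v: "v \<in> tors_set R T E"
  shows "\<exists>w\<in>tors_set R T E. x \<odot>\<^bsub>E\<^esub> w \<ominus>\<^bsub>E\<^esub> v \<in> tors_set R {x} E"
proof -
  have gE: "graded_module R Rg E Eg" using E by (simp add: graded_injective_module_def)
  then interpret E: module R E by (simp add: graded_module_def)
  obtain p where p: "projections E Eg p"
    using E.M.projections_if_internal_direct_sum[of Eg] gE unfolding graded_module_def by blast
  note pD = E.M.projectionsD[OF p]
  have xc: "x \<in> carrier R" using Rg_carrier[OF x] .
  have Tc: "T \<subseteq> carrier R" "{x} \<subseteq> carrier R" using T x Rg_carrier by auto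
  note sT = E.submoduleE[OF E.submodule_tors_set[OF Tc(1)]] and sx = E.submoduleE[OF E.submodule_tors_set[OF Tc(2)]]
  have vc: "v \<in> carrier E" using v by (simp add: tors_set_def)
  define D where "D = {v \<in> carrier E. \<exists>w\<in>tors_set R T E. x \<odot>\<^bsub>E\<^esub> w \<ominus>\<^bsub>E\<^esub> v \<in> tors_set R {x} E}"
  have "v \<in> D"
  proof (rule E.M.projections_induct[OF p vc])
    show "D \<subseteq> carrier E" by (auto simp: D_def)
    have z: "\<zero>\<^bsub>E\<^esub> \<in> tors_set R A E" if "A \<subseteq> carrier R" for A using that by (auto simp: tors_set_def)
    show "\<zero>\<^bsub>E\<^esub> \<in> D" using z[OF Tc(1)] sx(3)[OF z[OF Tc(2)]] z[OF Tc(2)] xc by (auto simp: D_def E.M.minus_eq intro!: bexI[of _ "\<zero>\<^bsub>E\<^esub>"])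
    show "a \<oplus>\<^bsub>E\<^esub> b \<in> D" if a: "a \<in> D" and b: "b \<in> D" for a b
    proof -
      obtain w w' where w: "w \<in> tors_set R T E" "x \<odot>\<^bsub>E\<^esub> w \<ominus>\<^bsub>E\<^esub> a \<in> tors_set R {x} E"
        "w' \<in> tors_set R T E" "x \<odot>\<^bsub>E\<^esub> w' \<ominus>\<^bsub>E\<^esub> b \<in> tors_set R {x} E" using a b by (auto simp: D_def)
      have c: "a \<in> carrier E" "b \<in> carrier E" "w \<in> carrier E" "w' \<in> carrier E" using a b w sT(1) by (auto simp: D_def)
      have "(x \<odot>\<^bsub>E\<^esub> w \<ominus>\<^bsub>E\<^esub> a) \<oplus>\<^bsub>E\<^esub> (x \<odot>\<^bsub>E\<^esub> w' \<ominus>\<^bsub>E\<^esub> b) = x \<odot>\<^bsub>E\<^esub> (w \<oplus>\<^bsub>E\<^esub> w') \<ominus>\<^bsub>E\<^esub> (a \<oplus>\<^bsub>E\<^esub> b)"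
        using c xc by (simp add: E.M.minus_eq E.smult_r_distr E.M.minus_add E.M.a_ac)
      then have "x \<odot>\<^bsub>E\<^esub> (w \<oplus>\<^bsub>E\<^esub> w') \<ominus>\<^bsub>E\<^esub> (a \<oplus>\<^bsub>E\<^esub> b) \<in> tors_set R {x} E" using sx(5)[OF w(2,4)] by simp
      then show ?thesis using sT(5)[OF w(1,3)] c by (auto simp: D_def)
    qed
    show "p i v \<in> D" for i
    proof -
      obtain w where "w \<in> tors_set R T E" "x \<odot>\<^bsub>E\<^esub> w \<ominus>\<^bsub>E\<^esub> p i v \<in> tors_set R {x} E"
        using tors_set_divide[OF noeth E T x component_tors_set[OF gE p T v] pD(3)[OF vc, of i]] by (elim bexE IntE)
      then show ?thesis unfolding D_def using pD(4)[OF vc] by blast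
    qed
  qed
  then show ?thesis by (auto simp: D_def)
qed

end

section \<open>Torsion in an injective resolution\<close>

text \<open>The module that is resolved is represented by the kernel of \<open>d 0\<close>, so the
  locale speaks of the complex alone. It serves both for the resolution of M and for the resolution
  of its local cohomology module.\<close>

locale resolution = standard_graded R Rg + module_family R E
  for R :: "('r, 'x) ring_scheme" (structure) and Rg and E :: "nat => ('r, 'e) module" +
  fixes Eg :: "nat => int => 'e set" and d :: "nat => 'e => 'e"
  assumes noetherian: "noetherian_ring R"
    and injective: "graded_injective_module R Rg (E n) (Eg n)"
    and d_hom: "graded_hom R (E n) (Eg n) (E (Suc n)) (Eg (Suc n)) (d n)"
    and exact: "d n ` carrier (E n) = {x \<in> carrier (E (Suc n)). d (Suc n) x = \<zero>\<^bsub>E (Suc (Suc n))\<^esub>}"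
begin

lemma d_module_hom: "module_hom R (E n) (E (Suc n)) (d n)"
  using d_hom by (simp add: graded_hom_def)

lemma d_closed: "x \<in> carrier (E n) ==> d n x \<in> carrier (E (Suc n))"
  using d_module_hom[of n] unfolding module_hom_def by blast

lemma d_smult: "x \<in> carrier (E n) ==> r \<in> carrier R ==> d n (r \<odot>[n] x) = r \<odot>[Suc n] d n x"
  using d_module_hom[of n] unfolding module_hom_def by blast

lemma d_add: "x \<in> carrier (E n) ==> y \<in> carrier (E n) ==> d n (x \<oplus>[n] y) = d n x \<oplus>[Suc n] d n y"
  using d_module_hom[of n] unfolding module_hom_def by blast

lemma d_diff: "x \<in> carrier (E n) ==> y \<in> carrier (E n) ==> d n (x \<ominus>[n] y) = d n x \<ominus>[Suc n] d n y"
  by (rule module_hom_diff(1)[OF modules modules d_module_hom])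

lemma zero_closed: "\<zero>[n] \<in> carrier (E n)"
proof -
  interpret M: module R "E n" by (rule modules)
  show ?thesis by simp
qed

lemma d_zero: "d n \<zero>[n] = \<zero>[Suc n]"
  by (rule module_hom_diff(2)[OF modules modules d_module_hom zero_closed zero_closed])

lemma d_d: "x \<in> carrier (E n) ==> d (Suc n) (d n x) = \<zero>[Suc (Suc n)]"
  using exact[of n] by blast

lemma d_tors: "T \<subseteq> carrier R ==> x \<in> tors_set R T (E n) ==> d n x \<in> tors_set R T (E (Suc n))"
proof -
  assume T: "T \<subseteq> carrier R" and x: "x \<in> tors_set R T (E n)"
  have xc: "x \<in> carrier (E n)" using x by (simp add: tors_set_def)
  have "\<exists>m::nat. t [^] m \<odot>[Suc n] d n x = \<zero>[Suc n]" if t: "t \<in> T" for t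
  proof -
    obtain m :: nat where m: "t [^] m \<odot>[n] x = \<zero>[n]" using x t by (auto simp: tors_set_def)
    have "t [^] m \<in> carrier R" using t T by (intro R.nat_pow_closed) blast
    then have "t [^] m \<odot>[Suc n] d n x = \<zero>[Suc n]" using d_smult[OF xc, of "t [^] m"] m d_zero by simp
    then show ?thesis ..
  qed
  then show ?thesis using d_closed[OF xc] by (simp add: tors_set_def)
qed

text \<open>Complex degrees are integers so that cones can shift freely; below 0 the complex is
  zero. In this encoding a module is zero when it consists of relations, which is the family
  \<open>base\<close>.\<close>

definition fam :: "(nat => int => 'e set) => int => int => 'e ambient set" where
  "fam S n k = (if n \<ge> 0 then lift (nat n) (S (nat n) k) else {0})"

abbreviation base :: "int => int => 'e ambient set" where
  "base == fam (\<lambda>n k. {\<zero>[n]})"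

abbreviation dd :: "'e ambient => 'e ambient" where
  "dd == dmap d"

lemma dd_dom: "f \<in> fdom n ==> dd f \<in> fdom (Suc n)" "f \<in> fdom n ==> val (Suc n) (dd f) = d n (val n f)"
  using dmap_dom[of d f n, OF d_module_hom] by blast+

lemma dd_zero: "dd 0 = 0"
  using additive.zero[OF dmap_additive] .

lemma module_minus_closed: "submodule S R (E n) ==> x \<in> S ==> y \<in> S ==> x \<ominus>[n] y \<in> S"
proof -
  interpret M: module R "E n" by (rule modules)
  assume "submodule S R (E n)" "x \<in> S" "y \<in> S"
  then show ?thesis using M.submoduleE(3,5) by (simp add: M.M.minus_eq)
qed

lemma module_zero_mem: "submodule S R (E n) ==> \<zero>[n] \<in> S"
  using subgroup.one_closed[OF submodule.axioms(1), of S R "E n"] by simp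

lemma d_minus: "x \<in> carrier (E n) ==> d n (\<ominus>[n] x) = \<ominus>[Suc n] d n x"
proof -
  interpret M: module R "E n" by (rule modules)
  interpret N: module R "E (Suc n)" by (rule modules)
  assume "x \<in> carrier (E n)"
  then show ?thesis using d_diff[OF zero_closed, of x n] d_zero d_closed[of x n] by (simp add: M.M.minus_eq N.M.minus_eq)
qed

lemma submodule_zero: "submodule {\<zero>[n]} R (E n)"
proof -
  interpret M: module R "E n" by (rule modules)
  show ?thesis by (rule M.submoduleI) auto
qed

lemma submodule_preimage_d:
  assumes S: "submodule S R (E (Suc n))" and T: "submodule T R (E n)"
  shows "submodule {v \<in> T. d n v \<in> S} R (E n)"
proof -
  interpret M: module R "E n" by (rule modules)
  note s = module.submoduleE[OF modules S] and t = M.submoduleE[OF T]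
  show ?thesis
    by (rule M.submoduleI) (use s t module_zero_mem[OF S] module_zero_mem[OF T] d_zero d_minus d_add d_smult in \<open>auto simp: subset_iff\<close>)
qed

end

text \<open>
  The graded and the total version of the argument are treated at the same time: \<open>A n k\<close> is the
  component of degree \<open>k\<close> of \<open>E n\<close>, respectively all of \<open>E n\<close>.
\<close>

locale graded_or_total = resolution R Rg E Eg d
  for R :: "('r, 'x) ring_scheme" (structure) and Rg and E :: "nat => ('r, 'e) module" and Eg d +
  fixes Om :: "('r \<times> int) set" and A :: "nat => int => 'e set" and \<delta> :: int and xs :: "'r list"
  assumes A_carrier: "A n k \<subseteq> carrier (E n)" and A_zero: "\<zero>[n] \<in> A n k"
    and A_minus: "v \<in> A n k ==> w \<in> A n k ==> v \<ominus>[n] w \<in> A n k"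
    and Om_carrier: "(r, e) \<in> Om ==> r \<in> carrier R"
    and A_smult: "(r, e) \<in> Om ==> v \<in> A n k ==> r \<odot>[n] v \<in> A n (k + e)"
    and A_d: "v \<in> A n k ==> d n v \<in> A (Suc n) k"
    and A_exact: "v \<in> A (Suc n) k ==> d (Suc n) v = \<zero>[Suc (Suc n)] ==> \<exists>w\<in>A n k. d n w = v"
    and A_divide: "T \<subseteq> set xs ==> x \<in> set xs ==> v \<in> tors_set R T (E n) ==> v \<in> A n (k + \<delta>) ==>
      \<exists>w\<in>tors_set R T (E n) \<inter> A n k. x \<odot>[n] w \<ominus>[n] v \<in> tors_set R {x} (E n)"
    and xs_carrier: "set xs \<subseteq> carrier R" and xs_Om: "x \<in> set xs ==> (x, \<delta>) \<in> Om"
begin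

definition closed :: "(nat => int => 'e set) => bool" where
  "closed S \<longleftrightarrow> (\<forall>n k. S n k \<subseteq> carrier (E n) \<and> \<zero>[n] \<in> S n k \<and>
     (\<forall>x\<in>S n k. \<forall>y\<in>S n k. x \<ominus>[n] y \<in> S n k) \<and> (\<forall>(r, e)\<in>Om. \<forall>x\<in>S n k. r \<odot>[n] x \<in> S n (k + e)) \<and>
     (\<forall>x\<in>S n k. d n x \<in> S (Suc n) k))"

lemma closedD:
  assumes "closed S"
  shows "S n k \<subseteq> carrier (E n)" "\<zero>[n] \<in> S n k" "x \<in> S n k ==> y \<in> S n k ==> x \<ominus>[n] y \<in> S n k"
    "(r, e) \<in> Om ==> x \<in> S n k ==> r \<odot>[n] x \<in> S n (k + e)" "x \<in> S n k ==> d n x \<in> S (Suc n) k"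
proof -
  note * = assms[unfolded closed_def, THEN spec, of n, THEN spec, of k]
  show "S n k \<subseteq> carrier (E n)" "\<zero>[n] \<in> S n k" "x \<in> S n k ==> y \<in> S n k ==> x \<ominus>[n] y \<in> S n k"
    "x \<in> S n k ==> d n x \<in> S (Suc n) k"
    using * by simp_all
  show "(r, e) \<in> Om ==> x \<in> S n k ==> r \<odot>[n] x \<in> S n (k + e)"
    using * by fastforce
qed

lemma osub_fam:
  assumes S: "closed S"
  shows "osub Om fact (fam S n)"
proof (cases "n \<ge> 0")
  case True
  have "osub Om fact (\<lambda>k. lift (nat n) (S (nat n) k))"
  proof (rule osub_lift)
    show "r \<in> carrier R \<and> r \<odot>\<^bsub>E (nat n)\<^esub> x \<in> S (nat n) (k + e)" if "(r, e) \<in> Om" "x \<in> S (nat n) k" for r e k x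
      using closedD(4)[OF S that] Om_carrier[OF that(1)] by blast
  qed (use closedD(1-3)[OF S, where n = "nat n"] in auto)
  then show ?thesis using True by (simp add: fam_def[abs_def])
next
  case False
  then have "fam S n = (\<lambda>k. {0})" by (auto simp: fam_def)
  then show ?thesis using F.osub_zero by simp
qed

lemma cpx_fam:
  assumes S: "closed S" and T: "closed T" and TS: "!!n k. T n k \<subseteq> S n k"
  shows "F.cpx Om dd (fam S) (fam T)"
proof -
  have st: "dd f \<in> fam U (n + 1) k" if U: "closed U" and f: "f \<in> fam U n k" for U n k f
  proof (cases "n \<ge> 0")
    case True
    then have "f \<in> fdom (nat n)" "val (nat n) f \<in> U (nat n) k" using f by (auto simp: fam_def lift_def)
    then have "dd f \<in> lift (Suc (nat n)) (U (Suc (nat n)) k)"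
      using dd_dom[of f "nat n"] closedD(5)[OF U] by (simp add: lift_def)
    then show ?thesis using True by (simp add: fam_def Suc_nat_eq_nat_zadd1 add.commute)
  next
    case False
    then have "f = 0" using f by (simp add: fam_def)
    then show ?thesis using osubD(1)[OF osub_fam[OF U]] by (simp add: dd_zero)
  qed
  have sq: "dd (dd f) \<in> fam T (n + 2) k" if f: "f \<in> fam S n k" for n k f
  proof (cases "n \<ge> 0")
    case True
    then have f': "f \<in> fdom (nat n)" using f by (auto simp: fam_def lift_def)
    then have "dd (dd f) \<in> lift (Suc (Suc (nat n))) (T (Suc (Suc (nat n))) k)"
      using dd_dom[of "dd f" "Suc (nat n)"] dd_dom[of f "nat n"] d_d[OF val_closed[OF f']] closedD(2)[OF T]
      by (simp add: lift_def)
    moreover have "nat (n + 2) = Suc (Suc (nat n))" using True by simp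
    ultimately show ?thesis using True by (simp only: fam_def) simp
  next
    case False
    then have "f = 0" using f by (simp add: fam_def)
    then show ?thesis using osubD(1)[OF osub_fam[OF T]] by (simp add: dd_zero)
  qed
  have sub: "fam T n k \<subseteq> fam S n k" for n k
    using lift_mono[OF TS] by (auto simp: fam_def)
  show ?thesis
    unfolding F.cpx_def
  proof (intro conjI allI ballI)
    show "F.equivariant dd" by (rule equivariant_dmap) (rule d_module_hom)
    show "osub Om fact (fam S n)" "osub Om fact (fam T n)" for n by (rule osub_fam[OF S], rule osub_fam[OF T])
    show "fam T n k \<subseteq> fam S n k" for n k by (rule sub)
    show "dd x \<in> fam S (n + 1) k" "dd (dd x) \<in> fam T (n + 2) k" if "x \<in> fam S n k" for n k x
      by (rule st[OF S that], rule sq[OF that])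
    show "dd x \<in> fam T (n + 1) k" if "x \<in> fam T n k" for n k x
      using that by (rule st[OF T])
  qed
qed

lemma closed_base: "closed (\<lambda>n k. {\<zero>[n]})"
  unfolding closed_def
proof (intro allI conjI ballI)
  fix n k
  interpret M: module R "E n" by (rule modules)
  show "{\<zero>[n]} \<subseteq> carrier (E n)" "\<zero>[n] \<in> {\<zero>[n]}" by auto
  show "x \<ominus>[n] y \<in> {\<zero>[n]}" if "x \<in> {\<zero>[n]}" "y \<in> {\<zero>[n]}" for x y
    using that by (simp add: M.M.minus_eq)
  show "case p of (r, e) => \<forall>x\<in>{\<zero>[n]}. r \<odot>[n] x \<in> {\<zero>[n]}" if "p \<in> Om" for p
    using Om_carrier that by (cases p) auto
  show "d n x \<in> {\<zero>[Suc n]}" if "x \<in> {\<zero>[n]}" for x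
    using that d_zero by simp
qed

lemma closed_tors:
  assumes T: "T \<subseteq> carrier R"
  shows "closed (\<lambda>n k. tors_set R T (E n) \<inter> A n k)"
  unfolding closed_def
proof (intro allI conjI ballI)
  fix n k
  interpret M: module R "E n" by (rule modules)
  note sT = M.submodule_tors_set[OF T]
  show "tors_set R T (E n) \<inter> A n k \<subseteq> carrier (E n)" using A_carrier by blast
  show "\<zero>[n] \<in> tors_set R T (E n) \<inter> A n k" using module_zero_mem[OF sT] A_zero by blast
  show "x \<ominus>[n] y \<in> tors_set R T (E n) \<inter> A n k" if "x \<in> tors_set R T (E n) \<inter> A n k" "y \<in> tors_set R T (E n) \<inter> A n k" for x y
    using that module_minus_closed[OF sT] A_minus by blast
  show "case p of (r, e) => \<forall>x\<in>tors_set R T (E n) \<inter> A n k. r \<odot>[n] x \<in> tors_set R T (E n) \<inter> A n (k + e)" if "p \<in> Om" for p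
    using Om_carrier A_smult M.submoduleE(4)[OF sT] that by (cases p) auto
  show "d n x \<in> tors_set R T (E (Suc n)) \<inter> A (Suc n) k" if "x \<in> tors_set R T (E n) \<inter> A n k" for x
    using that d_tors[OF T] A_d by blast
qed

abbreviation gam :: "'r set => int => int => 'e ambient set" where
  "gam T == fam (\<lambda>n k. tors_set R T (E n) \<inter> A n k)"

lemma cpx_gam: "T \<subseteq> carrier R ==> F.cpx Om dd (gam T) base"
  by (rule cpx_fam[OF closed_tors closed_base]) (use closedD(2)[OF closed_tors] in auto)

lemma tors_set_empty: "tors_set R {} (E n) = carrier (E n)"
  by (auto simp: tors_set_def)

text \<open>If x v is torsion for x then so is v, which gives injectivity. Surjectivity is where
  injectivity of the modules \<open>E n\<close> enters, in the form \<open>A_divide\<close>.\<close>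

lemma level_bij_gam:
  assumes T: "T \<subseteq> set xs" and x: "x \<in> set xs"
  shows "F.level_bij (x, \<delta>) (gam T) (gam (insert x T))"
  unfolding F.level_bij_def fst_conv snd_conv
proof (intro allI conjI ballI impI)
  fix n k v
  have xc: "x \<in> carrier R" using x xs_carrier by blast
  { 
    assume v: "v \<in> gam T n k" and xv: "fact x v \<in> gam (insert x T) n (k + \<delta>)"
    show "v \<in> gam (insert x T) n k"
    proof (cases "n \<ge> 0")
      case True
      define m where "m = nat n"
      interpret M: module R "E m" by (rule modules)
      have v': "v \<in> fdom m" "val m v \<in> tors_set R T (E m) \<inter> A m k" using v True by (auto simp: fam_def lift_def m_def)
      have "val m (fact x v) \<in> tors_set R (insert x T) (E m)" using xv True by (auto simp: fam_def lift_def m_def)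
      then have "x \<odot>[m] val m v \<in> tors_set R (insert x T) (E m)" using fact_dom[OF v'(1) xc] by simp
      then obtain j :: nat where "x [^] j \<odot>[m] (x \<odot>[m] val m v) = \<zero>[m]" by (auto simp: tors_set_def)
      then have "x [^] Suc j \<odot>[m] val m v = \<zero>[m]" using xc val_closed[OF v'(1)] by (simp add: M.smult_assoc1)
      then have "\<exists>j::nat. x [^] j \<odot>[m] val m v = \<zero>[m]" by (rule exI)
      then have "val m v \<in> tors_set R (insert x T) (E m)" using v'(2) by (auto simp: tors_set_def)
      then show ?thesis using v' True by (simp add: fam_def lift_def m_def)
    next
      case False
      then show ?thesis using v by (simp add: fam_def)
    qed
  }
  assume v: "v \<in> gam T n (k + \<delta>)"
  show "\<exists>u\<in>gam T n k. v - fact x u \<in> gam (insert x T) n (k + \<delta>)"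
  proof (cases "n \<ge> 0")
    case True
    define m where "m = nat n"
    interpret M: module R "E m" by (rule modules)
    have v': "v \<in> fdom m" "val m v \<in> tors_set R T (E m)" "val m v \<in> A m (k + \<delta>)" using v True by (auto simp: fam_def lift_def m_def)
    obtain w where w: "w \<in> tors_set R T (E m)" "w \<in> A m k" "x \<odot>[m] w \<ominus>[m] val m v \<in> tors_set R {x} (E m)"
      using A_divide[OF T x v'(2,3)] by blast
    have wc: "w \<in> carrier (E m)" using w(2) A_carrier by blast
    have Tc: "T \<subseteq> carrier R" "{x} \<subseteq> carrier R" using T x xs_carrier by auto
    have u: "frag_of (0, m, w) \<in> fdom m" using wc by (auto simp: basis_def)
    have xw: "x \<odot>[m] w \<in> tors_set R T (E m)" "x \<odot>[m] w \<in> A m (k + \<delta>)"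
      using M.submoduleE(4)[OF M.submodule_tors_set[OF Tc(1)] xc w(1)] A_smult[OF xs_Om[OF x] w(2)] by auto
    have "val m v \<ominus>[m] x \<odot>[m] w = \<ominus>[m] (x \<odot>[m] w \<ominus>[m] val m v)"
      using wc xc val_closed[OF v'(1)] by (simp add: M.M.minus_eq M.M.minus_add M.M.a_comm)
    then have "val m v \<ominus>[m] x \<odot>[m] w \<in> tors_set R {x} (E m)"
      using M.submoduleE(3)[OF M.submodule_tors_set[OF Tc(2)] w(3)] by simp
    moreover have "val m v \<ominus>[m] x \<odot>[m] w \<in> tors_set R T (E m)" "val m v \<ominus>[m] x \<odot>[m] w \<in> A m (k + \<delta>)"
      using module_minus_closed[OF M.submodule_tors_set[OF Tc(1)] v'(2) xw(1)] A_minus[OF v'(3) xw(2)] by auto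
    ultimately have "val m v \<ominus>[m] x \<odot>[m] w \<in> tors_set R (insert x T) (E m) \<inter> A m (k + \<delta>)"
      by (auto simp: tors_set_def)
    moreover have "v - fact x (frag_of (0, m, w)) \<in> fdom m" "val m (v - fact x (frag_of (0, m, w))) = val m v \<ominus>[m] x \<odot>[m] w"
      using fact_dom[OF u xc] val_of[OF wc] dom_add(2)[OF v'(1)] val_diff[OF v'(1)] by auto
    ultimately have "v - fact x (frag_of (0, m, w)) \<in> gam (insert x T) n (k + \<delta>)"
      using True by (simp add: fam_def lift_def m_def)
    moreover have "frag_of (0, m, w) \<in> gam T n k"
      using True w u val_of[OF wc] by (simp add: fam_def lift_def m_def)
    ultimately show ?thesis by blast
  next
    case False
    then show ?thesis using v F.act_simps(3)[of x] by (simp add: fam_def)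
  qed
qed

text \<open>Dividing a resolution by the kernel in degree 0 leaves an exact complex.\<close>

lemma acyc_resolution: "F.acyc dd (gam {}) (F.truncU dd (gam {}) base 0) n"
proof -
  note c = cpx_gam[of "{}", simplified]
  note cc = F.cpx_trunc(2)[OF c, of 0]
  consider "n \<le> 0" | "n > 0" by linarith
  then show ?thesis
  proof cases
    case 1
    then show ?thesis by (rule F.acyc_truncU[OF c])
  next
    case 2
    show ?thesis
      unfolding F.acyc_def
    proof (intro allI subsetI)
      fix k f assume f: "f \<in> cyc dd (gam {}) (F.truncU dd (gam {}) base 0) n k"
      obtain m where m: "n = int m + 1" using 2 by (metis add.commute int_ops(4) pos_int_cases zero_less_imp_eq_int of_nat_Suc Suc_pred)
      have nn: "nat n = Suc m" "nat (n + 1) = Suc (Suc m)" "nat (n - 1) = m" "n - 1 \<ge> 0" "n \<ge> 0" "n + 1 \<ge> 0" using m by auto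
      have "f \<in> gam {} n k" "dd f \<in> base (n + 1) k"
        using f 2 by (auto simp: cyc_def F.splice_def)
      then have f': "f \<in> lift (Suc m) (tors_set R {} (E (Suc m)) \<inter> A (Suc m) k)" "dd f \<in> lift (Suc (Suc m)) {\<zero>[Suc (Suc m)]}"
        using nn(5,6) unfolding fam_def nn by simp_all
      have f1: "f \<in> fdom (Suc m)" "val (Suc m) f \<in> A (Suc m) k"
        using f'(1) by (simp_all add: lift_def)
      have "d (Suc m) (val (Suc m) f) = \<zero>[Suc (Suc m)]"
        using dd_dom[OF f1(1)] f'(2) by (simp add: lift_def)
      then obtain w where w: "w \<in> A m k" "d m w = val (Suc m) f" using A_exact[OF f1(2)] by blast
      have wc: "w \<in> carrier (E m)" using w(1) A_carrier by blast
      have u: "frag_of (0, m, w) \<in> fdom m" using wc by (auto simp: basis_def)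
      have ug: "frag_of (0, m, w) \<in> gam {} (n - 1) k"
        using u w(1) wc val_of[OF wc] nn by (simp add: fam_def lift_def tors_set_empty)
      interpret M: module R "E (Suc m)" by (rule modules)
      have "f - dd (frag_of (0, m, w)) \<in> fdom (Suc m)"
        "val (Suc m) (f - dd (frag_of (0, m, w))) = \<zero>[Suc m]"
        using dom_add(2)[OF f1(1) dd_dom(1)[OF u]] val_diff[OF f1(1) dd_dom(1)[OF u]] dd_dom(2)[OF u] val_of[OF wc] w(2) val_closed[OF f1(1)]
        by (auto simp: M.M.minus_eq M.M.r_neg)
      then have "f - dd (frag_of (0, m, w)) \<in> lift (Suc m) {\<zero>[Suc m]}" by (simp add: lift_def)
      then have "f - dd (frag_of (0, m, w)) \<in> base n k" using nn(5) unfolding fam_def nn by simp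
      then have "f - dd (frag_of (0, m, w)) \<in> F.truncU dd (gam {}) base 0 n k" using 2 by (simp add: F.splice_def)
      then show "f \<in> bnd dd (gam {}) (F.truncU dd (gam {}) base 0) n k"
        unfolding F.bnd_iff[OF cc] using ug by blast
    qed
  qed
qed

text \<open>Start from the whole resolution, whose Koszul cohomology is that of the resolved module,
  and pass to torsion for one more element at a time. Each factor is Koszul acyclic because that
  element occurs in \<open>ys\<close> and acts bijectively on it.\<close>

lemma khs_gam:
  assumes sm: "serre_class fact Om sm" and ys: "set ys \<subseteq> Om" and xys: "(\<lambda>x. (x, \<delta>)) ` set xs \<subseteq> set ys"
    and M: "!!n. koszul_class.khs fact finl finr fev fod sm ys dd (F.truncU dd (gam {}) base 0) base n"
  shows "koszul_class.khs fact finl finr fev fod sm ys dd (gam (set xs)) base n"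
proof -
  interpret S: koszul_class fact finl finr fev fod Om sm
    by (intro koszul_class.intro F.pairing_axioms sm)
  note c = cpx_gam[of "{}", simplified]
  have "F.kacyc ys dd (gam {}) (F.truncU dd (gam {}) base 0) n" for n
    by (intro F.kacyc_if_acyc[OF ys F.cpx_trunc(2)[OF c]] acyc_resolution)
  then have *: "S.khs ys dd (gam {}) (F.truncU dd (gam {}) base 0) n" for n
    by (rule S.khs_if_kacyc[OF ys F.cpx_trunc(2)[OF c]])
  have 0: "S.khs ys dd (gam {}) base n" for n
    by (rule S.khs_les1[OF ys F.cpx_trunc(2)[OF c] ys F.cpx_trunc(6)[OF c] ys c M *])
  have step: "S.khs ys dd (gam (insert x T)) base n"
    if x: "x \<in> set xs" and T: "T \<subseteq> set xs" and IH: "S.khs ys dd (gam T) base n" for x T n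
  proof -
    have Tc: "T \<subseteq> carrier R" "insert x T \<subseteq> carrier R" using x T xs_carrier by auto
    have xO: "(x, \<delta>) \<in> set ys" using xys x by auto
    have cc: "F.cpx Om dd (gam T) (gam (insert x T))"
      by (rule cpx_fam[OF closed_tors[OF Tc(1)] closed_tors[OF Tc(2)]]) (auto simp: tors_set_def)
    have "F.kacyc ys dd (gam T) (gam (insert x T)) m" for m
      by (rule F.kacyc_level_bij[OF ys cc xO level_bij_gam[OF T x]])
    then have "S.khs ys dd (gam T) (gam (insert x T)) (n - 1)"
      by (rule S.khs_if_kacyc[OF ys cc])
    then show ?thesis
      using IH by (rule S.khs_les3[OF ys cc ys cpx_gam[OF Tc(2)] ys cpx_gam[OF Tc(1)]])
  qed
  have "S.khs ys dd (gam (set l)) base n" if "set l \<subseteq> set xs" for l n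
    using that by (induction l) (use 0 step in auto)
  then show ?thesis by blast
qed

end

section \<open>Finiteness of Koszul cohomology\<close>

lemma chain_condition_mono:
  assumes "chain_condition asc Om act Z W" "!!k. Z' k \<subseteq> Z k" "!!k. W k \<subseteq> W' k"
  shows "chain_condition asc Om act Z' W'"
proof (rule chain_conditionI, goal_cases)
  case (1 N)
  show ?case
  proof (rule chain_conditionD[OF assms(1) 1(1)])
    show "W k \<subseteq> N i k" "N i k \<subseteq> Z k" for i k using 1(2)[of k i] 1(3)[of i k] assms(2,3)[of k] by blast+
  qed (rule 1(4))
qed

text \<open>Turns finiteness over many operators into finiteness over few: y acts as zero on the
  cohomology of its own cone and is dropped right there, before further cones are formed.\<close>

lemma (in pairing) kos_strip:
  assumes "cpx Om D A B" "set ys \<subseteq> Om" "Om' \<subseteq> Om"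
    and "!!n. chain_condition asc (Om' \<union> set ys) act (cyc D A B n) (bnd D A B n)"
  shows "chain_condition asc Om' act (cyc (kosD ys D) (kos ys A) (kos ys B) n) (bnd (kosD ys D) (kos ys A) (kos ys B) n)"
  using assms
proof (induction ys arbitrary: D A B n)
  case Nil
  then show ?case by simp
next
  case (Cons y ys)
  obtain r e where y: "y = (r, e)" by (cases y)
  have yO: "y \<in> Om" "(r, e) \<in> Om" and ysO: "set ys \<subseteq> Om" using Cons.prems y by auto
  have Om: "Om' \<union> set (y # ys) \<subseteq> Om" using Cons.prems by blast
  interpret K: koszul_class act inl inr ev od Om "chain_condition asc (Om' \<union> set (y # ys)) act"
    by (intro koszul_class.intro pairing_axioms serre_chain_condition Om)
  note cc = cpx_cone(1)[OF Cons.prems(1) yO(1)]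
  have "K.hs D A B m" for m
    unfolding K.hs_def by (rule Cons.prems(4))
  then have hs: "K.hs (coneD y D) (mcone y A A) (mcone y B B) m" for m
    by (intro K.hs_cone[OF Cons.prems(1) yO(1)])
  have 1: "chain_condition asc (insert (r, e) (Om' \<union> set ys)) act
      (cyc (coneD y D) (mcone y A A) (mcone y B B) m) (bnd (coneD y D) (mcone y A A) (mcone y B B) m)" for m
    using hs[unfolded K.hs_def] by (simp add: y)
  have "chain_condition asc (Om' \<union> set ys) act
      (cyc (coneD y D) (mcone y A A) (mcone y B B) m) (bnd (coneD y D) (mcone y A A) (mcone y B B) m)" for m
    by (rule chain_condition_strip[OF 1]) (unfold y, rule act_bnd_cone[OF Cons.prems(1) yO(2)])
  then show ?case
    unfolding kosD.simps kos.simps by (rule Cons.IH[OF cc ysO Cons.prems(3)])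
qed

lemma (in operators) bounded_noetherian_if_noetherian:
  assumes Om: "snd ` Om \<subseteq> {0}" and Z: "osub Om act Z" and W: "osub Om act W" and WZ: "!!k. W k \<subseteq> Z k"
    and cc: "chain_condition True Om act Z W"
  shows "bounded_noetherian Om act Z W"
  unfolding bounded_noetherian_def
proof
  fix m
  show "chain_condition True Om act (trunc_ge m Z) (trunc_ge m W)"
    by (rule chain_condition_inj[where f = "\<lambda>x. x" and e = 0, OF _ _ act_additive osub_trunc_ge[OF Z Om] W _ WZ Z _ cc])
      (use osubD(1)[OF W] osubD(1)[OF Z] in \<open>auto simp: trunc_ge_def additive_def split: if_splits\<close>)
qed

context ring_operators
begin

text \<open>On the socle the ideal of \<open>ts\<close> acts as zero, so each ring element acts
  there as 0 or invertibly and the Noetherian socle is Artinian. Torsion carries this to all of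
  Z/W.\<close>

lemma artinian_if_noetherian_torsion:
  assumes Z: "osub const_ops act Z" and W: "osub const_ops act W" and WZ: "!!k. W k \<subseteq> Z k"
    and ra: "radd Z W" and ts: "set ts \<subseteq> carrier R"
    and fld: "!!r. r \<in> carrier R ==> r \<in> genideal R (set ts) \<or> (\<exists>r'\<in>carrier R. r' \<otimes> r \<ominus> \<one> \<in> genideal R (set ts))"
    and tors: "!!t. t \<in> set ts ==> power_torsion act (t, 0) Z W"
    and cc: "chain_condition True const_ops act Z W"
  shows "chain_condition False const_ops act Z W"
proof -
  define ys where "ys = map (\<lambda>t. (t, 0 :: int)) ts"
  have ys: "set ys \<subseteq> const_ops" using ts by (auto simp: ys_def const_ops_def)
  define S where "S = socle ys Z W"
  have S: "osub const_ops act S" unfolding S_def by (rule osub_socle[OF Z W])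
  have WS: "W k \<subseteq> S k" and SZ: "S k \<subseteq> Z k" for k
    unfolding S_def by (rule sub_socle[OF W ys WZ]) (auto simp: socle_def)
  have raS: "radd S W" using ra SZ unfolding radd_def by blast
  have kill: "act a v \<in> W 0" if a: "a \<in> genideal R (set ts)" and v: "v \<in> S 0" for a v
  proof -
    have "set ts \<subseteq> {a \<in> carrier R. act a v \<in> W 0}"
      using v ts by (auto simp: S_def socle_def ys_def)
    then have "genideal R (set ts) \<subseteq> {a \<in> carrier R. act a v \<in> W 0}"
      by (intro R.genideal_minimal ideal_transporter_act[OF W raS v])
    then show ?thesis using a by blast
  qed
  have "chain_condition False const_ops act S W"
  proof (rule artinian_if_noetherian_simple[OF S W WS raS])
    show "chain_condition True const_ops act S W"
      by (rule chain_condition_mono[OF cc SZ]) simp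
    fix r assume r: "r \<in> carrier R"
    from fld[OF r] show "(\<forall>v\<in>S 0. act r v \<in> W 0) \<or> (\<exists>r'\<in>carrier R. \<forall>v\<in>S 0. act r' (act r v) - v \<in> W 0)"
    proof
      assume "r \<in> genideal R (set ts)"
      then show ?thesis using kill by blast
    next
      assume "\<exists>r'\<in>carrier R. r' \<otimes> r \<ominus> \<one> \<in> genideal R (set ts)"
      then obtain r' where r': "r' \<in> carrier R" "r' \<otimes> r \<ominus> \<one> \<in> genideal R (set ts)" by blast
      have "act r' (act r v) - v \<in> W 0" if v: "v \<in> S 0" for v
      proof -
        have "act (r' \<otimes> r \<ominus> \<one>) v - (act (r' \<otimes> r) v - act \<one> v) \<in> W 0"
          using radd_minus[OF raS W v] r r'(1) by simp
        from osub_eq_mod[OF W this] have "act (r' \<otimes> r) v - act \<one> v \<in> W 0" using kill[OF r'(2) v] by simp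
        then show ?thesis using r r'(1) by (simp add: act_mult act_one)
      qed
      then show ?thesis using r'(1) by blast
    qed
  qed
  then show ?thesis
    using tors by (intro artinian_if_socle[OF ys Z W WZ]) (auto simp: ys_def S_def)
qed

end

context module_family
begin

lemma artinian_kos:
  assumes c: "F.cpx F.const_ops D A B" and ra: "!!n. F.radd (A n) (B n)" and ts: "set ts \<subseteq> carrier R"
    and fld: "!!r. r \<in> carrier R ==> r \<in> genideal R (set ts) \<or> (\<exists>r'\<in>carrier R. r' \<otimes> r \<ominus> \<one> \<in> genideal R (set ts))"
    and cc: "!!n. chain_condition True F.const_ops fact (cyc D A B n) (bnd D A B n)"
  shows "koszul_class.khs fact finl finr fev fod (chain_condition False F.const_ops fact) (map (\<lambda>t. (t, 0)) ts) D A B n"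
proof -
  interpret N: koszul_class fact finl finr fev fod F.const_ops "chain_condition True F.const_ops fact"
    by (intro koszul_class.intro F.pairing_axioms F.serre_chain_condition order_refl)
  interpret S: koszul_class fact finl finr fev fod F.const_ops "chain_condition False F.const_ops fact"
    by (intro koszul_class.intro F.pairing_axioms F.serre_chain_condition order_refl)
  define ys where "ys = map (\<lambda>t. (t, 0 :: int)) ts"
  have ys: "set ys \<subseteq> F.const_ops" using ts by (auto simp: ys_def F.const_ops_def)
  note ck = F.cpx_kos[OF ys c]
  have "N.khs ys D A B n"
    using cc by (intro N.khs_if_hs[OF ys c]) (simp add: N.hs_def)
  moreover have "F.ktors (t, 0) ys D A B n" if "t \<in> set ts" for t
    by (rule F.kos_power_torsion[OF ys c]) (use that in \<open>auto simp: ys_def\<close>)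
  ultimately have "chain_condition False F.const_ops fact (cyc (F.kosD ys D) (F.kos ys A) (F.kos ys B) n) (bnd (F.kosD ys D) (F.kos ys A) (F.kos ys B) n)"
    by (intro F.artinian_if_noetherian_torsion[OF F.osub_cyc[OF ck] F.osub_bnd[OF ck] _ radd_cyc_bnd[OF ck radd_kos[OF ra]] ts fld])
      (auto simp: F.ktors_def N.khs_def N.hs_def intro: F.bnd_cyc[OF ck])
  then show ?thesis by (simp add: S.khs_def S.hs_def ys_def)
qed

end

lemma (in abelian_group) minus_zero_iff: "a \<in> carrier G ==> b \<in> carrier G ==> a \<ominus> b = \<zero> \<longleftrightarrow> a = b"
  by (metis minus_eq r_neg minus_equality add.inv_closed minus_minus)

context resolution
begin

lemma fam_nat: "fam S (int q) k = lift q (S q k)"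
  by (simp add: fam_def)

lemma fam_neg: "n < 0 ==> fam S n k = {0}"
  by (simp add: fam_def)

lemma fact_funpow:
  assumes "f \<in> fdom q" "x \<in> carrier R"
  shows "(fact x ^^ n) f \<in> fdom q \<and> val q ((fact x ^^ n) f) = x [^] n \<odot>[q] val q f"
proof (induction n)
  case 0
  interpret M: module R "E q" by (rule modules)
  show ?case using assms val_closed by simp
next
  case (Suc n)
  interpret M: module R "E q" by (rule modules)
  have "x [^] Suc n \<odot>[q] val q f = x \<odot>[q] (x [^] n \<odot>[q] val q f)"
    using assms val_closed[OF assms(1)] R.m_comm[of "x [^] n" x] by (simp add: M.smult_assoc1)
  then show ?case using Suc fact_dom[of "(fact x ^^ n) f" q x] assms(2) by simp
qed

lemma power_torsion_lift:
  assumes x: "x \<in> carrier R" and "!!k v. v \<in> Z k ==> \<exists>n::nat. x [^] n \<odot>[q] v \<in> W (k + int n * e)"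
  shows "power_torsion fact (x, e) (\<lambda>k. lift q (Z k)) (\<lambda>k. lift q (W k))"
  unfolding power_torsion_def fst_conv snd_conv
proof (intro allI ballI)
  fix k f assume "f \<in> lift q (Z k)"
  then have f: "f \<in> fdom q" "val q f \<in> Z k" by (auto simp: lift_def)
  from assms(2)[OF f(2)] obtain n :: nat where "x [^] n \<odot>[q] val q f \<in> W (k + int n * e)" ..
  then have "(fact x ^^ n) f \<in> lift q (W (k + int n * e))"
    using fact_funpow[OF f(1) x] by (simp add: lift_def)
  then show "\<exists>n. (fact x ^^ n) f \<in> lift q (W (k + int n * e))" ..
qed

lemma base_sub_lift: "\<zero>[q] \<in> S ==> lift q {\<zero>[q]} \<subseteq> lift q S"
  by (rule lift_mono) simp

lemma radd_fam:
  assumes "!!n k. base n k \<subseteq> B n k" "!!n k. A n k \<subseteq> fam S n k"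
  shows "F.radd (A n) (B n)"
proof (cases "n \<ge> 0")
  case True
  then obtain q where q: "n = int q" by (metis nonneg_int_cases)
  show ?thesis
  proof (rule radd_lift)
    show "A n k \<subseteq> fdom q" for k using assms(2)[of n k] unfolding q fam_nat lift_def by blast
    show "lift q {\<zero>[q]} \<subseteq> B n k" for k using assms(1)[of n k] unfolding q fam_nat .
  qed
next
  case False
  have "A n k \<subseteq> {0}" "0 \<in> B n k" for k
    using assms(2)[of n k] assms(1)[of n k] False fam_neg by auto
  then show ?thesis unfolding F.radd_def using F.act_simps(3) by (metis diff_zero singletonD subsetD)
qed

end

context graded_or_total
begin

definition bset :: "(nat => int => 'e set) => nat => int => 'e set" where
  "bset S q k = (case q of 0 => {\<zero>[0]} | Suc p => d p ` S p k)"

lemma cyc_fam: "cyc dd (fam S) base (int q) k = lift q {v \<in> S q k. d q v = \<zero>[Suc q]}"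
proof -
  have "f \<in> lift q (S q k) \<and> dd f \<in> lift (Suc q) {\<zero>[Suc q]} \<longleftrightarrow>
      f \<in> lift q {v \<in> S q k. d q v = \<zero>[Suc q]}" for f
    using dd_dom[of f q] unfolding lift_def by auto
  moreover have "int q + 1 = int (Suc q)" by simp
  ultimately show ?thesis unfolding cyc_def by (simp only: fam_nat) blast
qed

lemma bnd_fam:
  assumes S: "closed S"
  shows "bnd dd (fam S) base (int q) k = lift q (bset S q k)"
proof (cases q)
  case 0
  have "bnd dd (fam S) base 0 k = base 0 k"
  proof (intro Set.set_eqI iffI)
    fix f assume "f \<in> bnd dd (fam S) base 0 k"
    then show "f \<in> base 0 k" by (auto simp: bnd_def fam_neg dd_zero)
  next
    fix f assume f: "f \<in> base 0 k"
    have "f \<in> fam S 0 k" using f closedD(2)[OF S, of 0 k] fam_nat[of _ 0] base_sub_lift[of 0 "S 0 k"] by auto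
    then show "f \<in> bnd dd (fam S) base 0 k" using f by (auto simp: bnd_def fam_neg dd_zero)
  qed
  then show ?thesis using 0 fam_nat[of "\<lambda>n k. {\<zero>[n]}" 0 k] by (simp add: bset_def)
next
  case (Suc p)
  interpret M: module R "E (Suc p)" by (rule modules)
  have q1: "int q - 1 = int p" using Suc by simp
  have "f \<in> bnd dd (fam S) base (int q) k \<longleftrightarrow> f \<in> lift (Suc p) (d p ` S p k)" for f
  proof
    assume "f \<in> bnd dd (fam S) base (int q) k"
    then obtain w where w: "f \<in> lift (Suc p) (S (Suc p) k)" "w \<in> lift p (S p k)" "f - dd w \<in> lift (Suc p) {\<zero>[Suc p]}"
      unfolding bnd_def q1 fam_nat by (auto simp: Suc)
    have c: "f \<in> fdom (Suc p)" "w \<in> fdom p" using w by (auto simp: lift_def)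
    have "val (Suc p) f \<ominus>[Suc p] d p (val p w) = \<zero>[Suc p]"
      using w(3) val_diff[OF c(1) dd_dom(1)[OF c(2)]] dd_dom(2)[OF c(2)] by (simp add: lift_def)
    then have "val (Suc p) f = d p (val p w)"
      using M.M.minus_zero_iff[OF val_closed[OF c(1)] d_closed[OF val_closed[OF c(2)]]] by simp
    then show "f \<in> lift (Suc p) (d p ` S p k)" using w(2) c by (auto simp: lift_def)
  next
    assume "f \<in> lift (Suc p) (d p ` S p k)"
    then obtain w where w: "f \<in> fdom (Suc p)" "w \<in> S p k" "val (Suc p) f = d p w" by (auto simp: lift_def)
    have wc: "w \<in> carrier (E p)" using w(2) closedD(1)[OF S] by blast
    have u: "frag_of (0, p, w) \<in> fdom p" using wc by (auto simp: basis_def)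
    note du = dd_dom[OF u]
    have "f - dd (frag_of (0, p, w)) \<in> lift (Suc p) {\<zero>[Suc p]}"
      using dom_add(2)[OF w(1) du(1)] val_diff[OF w(1) du(1)] du(2) val_of[OF wc] w(3) d_closed[OF wc]
      by (simp add: lift_def M.M.minus_eq M.M.r_neg)
    moreover have "frag_of (0, p, w) \<in> lift p (S p k)" using w(2) lift_rep[OF wc] by blast
    moreover have "f \<in> lift (Suc p) (S (Suc p) k)" using w closedD(5)[OF S w(2)] by (simp add: lift_def)
    ultimately show "f \<in> bnd dd (fam S) base (int q) k"
      unfolding bnd_def q1 fam_nat by (auto simp: Suc fam_def)
  qed
  then show ?thesis by (auto simp: Suc bset_def)
qed

text \<open>This truncation is the kernel of \<open>d 0\<close> in degree 0 and consists of
  relations elsewhere, so the resolved module is its only cohomology.\<close>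

lemma hs_augmentation:
  assumes Om': "Om' \<subseteq> Om" and cc: "chain_condition asc Om' fact (\<lambda>k. lift 0 {v \<in> A 0 k. d 0 v = \<zero>[1]}) (\<lambda>k. lift 0 {\<zero>[0]})"
  shows "chain_condition asc Om' fact (cyc dd (F.truncU dd (gam {}) base 0) base n) (bnd dd (F.truncU dd (gam {}) base 0) base n)"
proof -
  note c = F.cpx_trunc(6)[OF cpx_gam[of "{}"], simplified, of 0]
  have sub: "base n k \<subseteq> bnd dd (F.truncU dd (gam {}) base 0) base n k" for k
    using F.sub_bnd[OF c] by blast
  consider "n < 0" | "n = 0" | "n > 0" by linarith
  then show ?thesis
  proof cases
    case 2
    have "cyc dd (F.truncU dd (gam {}) base 0) base n k \<subseteq> F.truncU dd (gam {}) base 0 0 k" for k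
      unfolding 2 cyc_def by blast
    moreover have "F.truncU dd (gam {}) base 0 0 k \<subseteq> lift 0 {v \<in> A 0 k. d 0 v = \<zero>[1]}" for k
      using cyc_fam[of "\<lambda>n k. tors_set R {} (E n) \<inter> A n k" 0 k] unfolding F.splice_def by (auto simp: lift_def)
    moreover have "lift 0 {\<zero>[0]} \<subseteq> base n k" for k using fam_nat[of "\<lambda>n k. {\<zero>[n]}" 0 k] by (simp add: 2)
    ultimately show ?thesis using sub
      by (intro chain_condition_mono[OF cc]) blast+
  next
    case 1
    then have "cyc dd (F.truncU dd (gam {}) base 0) base n k \<subseteq> base n k" for k
      by (auto simp: cyc_def F.splice_def fam_neg)
    then show ?thesis using sub by (intro chain_condition_triv) blast
  next
    case 3
    then have "cyc dd (F.truncU dd (gam {}) base 0) base n k \<subseteq> base n k" for k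
      by (auto simp: cyc_def F.splice_def)
    then show ?thesis using sub by (intro chain_condition_triv) blast
  qed
qed

lemma gam_sub_neg: "n < 0 ==> gam T n k \<subseteq> base n k"
  by (simp add: fam_neg)

end

section \<open>Homogeneous components in the resolution\<close>

context resolution
begin

lemma graded_E: "graded_module R Rg (E n) (Eg n)"
  using injective[of n] by (simp add: graded_injective_module_def)

definition pr :: "nat => int => 'e => 'e" where
  "pr n = (SOME p. projections (E n) (Eg n) p)"

lemma projections_pr: "projections (E n) (Eg n) (pr n)"
proof -
  interpret M: module R "E n" by (rule modules)
  have "\<exists>p. projections (E n) (Eg n) p"
    using M.M.projections_if_internal_direct_sum[of "Eg n"] graded_E[of n] by (simp add: graded_module_def)
  then show ?thesis unfolding pr_def by (rule someI_ex)
qed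

lemma abelian_group_E: "abelian_group (E n)"
  using modules[of n] by (simp add: module_def)

lemmas prD = abelian_group.projectionsD[OF abelian_group_E projections_pr]

lemma Eg_minus: "v \<in> Eg n k ==> w \<in> Eg n k ==> v \<ominus>[n] w \<in> Eg n k"
proof -
  assume v: "v \<in> Eg n k" and w: "w \<in> Eg n k"
  note a = additive_subgroupD[OF abelian_group_E prD(1)[of n k]]
  show ?thesis using a(3)[OF v a(4)[OF w]] by (simp add: a_minus_def)
qed

lemma d_Eg: "v \<in> Eg n k ==> d n v \<in> Eg (Suc n) k"
  using d_hom[of n] unfolding graded_hom_def by blast

lemma pr_d: "v \<in> carrier (E n) ==> pr (Suc n) k (d n v) = d n (pr n k v)"
  using projections_map(1)[OF abelian_group_E abelian_group_E projections_pr projections_pr, where f = "d n" and s = "\<lambda>k. k"]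
    d_closed d_add d_Eg by (simp add: inj_def)

lemma pr_smult: "a \<in> Rg i ==> v \<in> carrier (E n) ==> pr n (int i + k) (a \<odot>[n] v) = a \<odot>[n] pr n k v"
  by (rule component_smult[OF graded_E projections_pr])

lemma Eg_smult: "a \<in> Rg i ==> v \<in> Eg n k ==> a \<odot>[n] v \<in> Eg n (k + int i)"
  using graded_E[of n] by (auto simp: graded_module_def add.commute)

end

text \<open>All of \<open>xs\<close> have one degree e. Two cases occur: generators of the
  irrelevant ideal, with e = 1, and generators of the maximal ideal of \<open>R\<^sub>0\<close> over
  R with the trivial grading, with e = 0.\<close>

locale resolution_elements = resolution R Rg E Eg d
  for R :: "('r, 'x) ring_scheme" (structure) and Rg and E :: "nat => ('r, 'e) module" and Eg d +
  fixes xs :: "'r list" and e :: nat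
  assumes xs_Rg: "set xs \<subseteq> Rg e"
begin

definition Om0 :: "('r \<times> int) set" where "Om0 = {(a, 0) | a. a \<in> Rg 0}"

definition ysg :: "('r \<times> int) list" where "ysg = map (\<lambda>x. (x, int e)) xs"

lemma xs_carrier': "set xs \<subseteq> carrier R"
  using xs_Rg Rg_carrier by blast

text \<open>Even the ungraded reading rests on the grading, since elements are divided by x
  componentwise.\<close>

sublocale T: graded_or_total R Rg E Eg d F.const_ops "\<lambda>n k. carrier (E n)" 0 xs
proof
  fix n k v w r e'
  interpret M: module R "E n" by (rule modules)
  show "carrier (E n) \<subseteq> carrier (E n)" "\<zero>[n] \<in> carrier (E n)" by auto
  show "v \<ominus>[n] w \<in> carrier (E n)" if "v \<in> carrier (E n)" "w \<in> carrier (E n)" using that by simp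
  show "(r, e') \<in> F.const_ops ==> r \<in> carrier R" by (auto simp: F.const_ops_def)
  then show "(r, e') \<in> F.const_ops ==> v \<in> carrier (E n) ==> r \<odot>[n] v \<in> carrier (E n)" by simp
  show "v \<in> carrier (E n) ==> d n v \<in> carrier (E (Suc n))" by (rule d_closed)
  show "v \<in> carrier (E (Suc n)) ==> d (Suc n) v = \<zero>[Suc (Suc n)] ==> \<exists>w\<in>carrier (E n). d n w = v"
    using exact[of n] by (metis (mono_tags, lifting) image_iff mem_Collect_eq)
  show "\<exists>w\<in>tors_set R T (E n) \<inter> carrier (E n). x \<odot>[n] w \<ominus>[n] v \<in> tors_set R {x} (E n)"
    if T: "T \<subseteq> set xs" and x: "x \<in> set xs" and v: "v \<in> tors_set R T (E n)" for T x
  proof -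
    obtain w where "w \<in> tors_set R T (E n)" "x \<odot>[n] w \<ominus>[n] v \<in> tors_set R {x} (E n)"
      using tors_set_divide_total[OF noetherian injective subset_trans[OF T xs_Rg] subsetD[OF xs_Rg x] v] by blast
    then show ?thesis by (auto simp: tors_set_def)
  qed
  show "set xs \<subseteq> carrier R" by (rule xs_carrier')
  show "x \<in> set xs ==> (x, 0) \<in> F.const_ops" for x using xs_carrier' by (auto simp: F.const_ops_def)
qed

sublocale G: graded_or_total R Rg E Eg d "Om0 \<union> set ysg" Eg "int e" xs
proof
  fix n k v w r e'
  show "Eg n k \<subseteq> carrier (E n)" by (rule prD(2))
  show "\<zero>[n] \<in> Eg n k" by (rule additive_subgroupD(2)[OF abelian_group_E prD(1)])
  show "v \<ominus>[n] w \<in> Eg n k" if "v \<in> Eg n k" "w \<in> Eg n k" by (rule Eg_minus[OF that])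
  show "(r, e') \<in> Om0 \<union> set ysg ==> r \<in> carrier R" using Rg_carrier xs_Rg by (auto simp: Om0_def ysg_def)
  show "(r, e') \<in> Om0 \<union> set ysg ==> v \<in> Eg n k ==> r \<odot>[n] v \<in> Eg n (k + e')"
    using Eg_smult[of r 0 v n k] Eg_smult[of r e v n k] xs_Rg by (auto simp: Om0_def ysg_def)
  show "v \<in> Eg n k ==> d n v \<in> Eg (Suc n) k" by (rule d_Eg)
  show "\<exists>w\<in>Eg n k. d n w = v" if v: "v \<in> Eg (Suc n) k" "d (Suc n) v = \<zero>[Suc (Suc n)]"
  proof -
    obtain w where w: "w \<in> carrier (E n)" "d n w = v" using T.A_exact[of v n, OF _ v(2)] v(1) prD(2) by blast
    then have "d n (pr n k w) = v" using pr_d[OF w(1), of k] prD(6)[OF v(1)] by simp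
    then show ?thesis using prD(3)[OF w(1)] by blast
  qed
  show "\<exists>w\<in>tors_set R T (E n) \<inter> Eg n k. x \<odot>[n] w \<ominus>[n] v \<in> tors_set R {x} (E n)"
    if T: "T \<subseteq> set xs" and x: "x \<in> set xs" and v: "v \<in> tors_set R T (E n)" "v \<in> Eg n (k + int e)" for T x
    using tors_set_divide[OF noetherian injective subset_trans[OF T xs_Rg] subsetD[OF xs_Rg x] v] by simp
  show "set xs \<subseteq> carrier R" by (rule xs_carrier')
  show "x \<in> set xs ==> (x, int e) \<in> Om0 \<union> set ysg" for x by (auto simp: ysg_def)
qed

lemma snd_Om0: "snd ` Om0 \<subseteq> {0}"
  by (auto simp: Om0_def)

definition Z0 :: "'e set" where "Z0 = {v \<in> carrier (E 0). d 0 v = \<zero>[1]}"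

lemma submodule_Z0: "submodule Z0 R (E 0)"
  using submodule_preimage_d[OF submodule_zero module.carrier_is_submodule[OF modules], of 0] by (simp add: Z0_def)

text \<open>The generators are adjoined one at a time, each factor being cyclic over the Noetherian
  ring R.\<close>

lemma noetherian_Z0:
  assumes S: "finite S" "S \<subseteq> Z0" "!!N. submodule N R (E 0) ==> S \<subseteq> N ==> Z0 \<subseteq> N"
  shows "noetherian 0 Z0 {\<zero>[0]}"
proof -
  define Z where "Z = (\<lambda>k::int. lift 0 Z0)"
  define B where "B = (\<lambda>k::int. lift 0 {\<zero>[0]})"
  interpret M: module R "E 0" by (rule modules)
  have Zc: "Z0 \<subseteq> carrier (E 0)" "\<zero>[0] \<in> Z0" by (auto simp: Z0_def d_zero[of 0, simplified])
  have Z: "osub F.const_ops fact Z" unfolding Z_def by (rule osub_lift_submodule[OF submodule_Z0])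
  have B: "osub F.const_ops fact B" unfolding B_def by (rule osub_lift_submodule[OF submodule_zero])
  have BZ: "B k \<subseteq> Z k" for k unfolding B_def Z_def by (rule lift_mono) (use Zc in auto)
  obtain l where l: "set l = S" using finite_list[OF S(1)] by blast
  have "\<exists>Y. osub F.const_ops fact Y \<and> (\<forall>k. B k \<subseteq> Y k \<and> Y k \<subseteq> Z k) \<and> (\<forall>s\<in>set l'. frag_of (0, 0, s) \<in> Y 0) \<and>
      chain_condition True F.const_ops fact Y B" if "set l' \<subseteq> Z0" for l'
    using that
  proof (induction l')
    case Nil
    have "chain_condition True F.const_ops fact B B" by (rule chain_condition_triv) simp
    then show ?case using B BZ by (intro exI[of _ B]) simp
  next
    case (Cons s l')
    then obtain Y where Y: "osub F.const_ops fact Y" "!!k. B k \<subseteq> Y k" "!!k. Y k \<subseteq> Z k"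
      "!!s. s \<in> set l' ==> frag_of (0, 0, s) \<in> Y 0" "chain_condition True F.const_ops fact Y B" by auto
    have s: "s \<in> Z0" "s \<in> carrier (E 0)" using Cons.prems Zc by auto
    have sZ: "frag_of (0, 0, s) \<in> Z 0" unfolding Z_def using s lift_rep by blast
    have ra: "F.radd Z Y"
      by (rule radd_lift[of Z 0]) (use Y(2) in \<open>auto simp: Z_def B_def lift_def\<close>)
    note sp = F.span1[OF Y(1) Z Y(3) sZ ra]
    have "chain_condition True F.const_ops fact (F.span1 Y (frag_of (0, 0, s))) B"
      by (rule chain_condition_ext[OF F.act_additive Y(1,2) sp(2,1) F.noetherian_span1[OF noetherian Y(1) Z Y(3) sZ ra] Y(5)])
    then show ?case
      using sp Y(2,4) by (intro exI[of _ "F.span1 Y (frag_of (0, 0, s))"]) (auto, blast+)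
  qed
  from this[of l] obtain Y where Y: "osub F.const_ops fact Y" "!!k. B k \<subseteq> Y k" "!!k. Y k \<subseteq> Z k"
      "!!s. s \<in> S ==> frag_of (0, 0, s) \<in> Y 0" "chain_condition True F.const_ops fact Y B" using S(2) l by auto
  have B0: "lift 0 {\<zero>[0]} \<subseteq> Y k" for k using Y(2)[of k] by (simp add: B_def)
  have "Z0 \<subseteq> down 0 (Y 0)"
  proof (rule S(3)[OF submodule_down[OF Y(1) B0]])
    show "S \<subseteq> down 0 (Y 0)" using Y(4) S(2) Zc by (auto simp: down_def)
  qed
  then have "Z 0 \<subseteq> Y 0"
    using lift_down[OF Y(1) B0, of 0] Y(3)[of 0] lift_mono[of Z0 "down 0 (Y 0)" 0] by (auto simp: Z_def lift_def)
  then have "Z k \<subseteq> Y k" for k using F.osub_const[OF Y(1), of k] by (simp add: Z_def)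
  then have "chain_condition True F.const_ops fact Z B"
    by (rule chain_condition_mono[OF Y(5)]) simp
  then show ?thesis by (simp add: Z_def B_def)
qed

lemma pr_minus: "v \<in> carrier (E n) ==> w \<in> carrier (E n) ==> pr n k (v \<ominus>[n] w) = pr n k v \<ominus>[n] pr n k w"
proof -
  assume v: "v \<in> carrier (E n)" and w: "w \<in> carrier (E n)"
  interpret M: module R "E n" by (rule modules)
  have "pr n k v = pr n k ((v \<ominus>[n] w) \<oplus>[n] w)"
    using v w by (simp add: M.M.minus_eq M.M.a_assoc M.M.l_neg)
  also have "\<dots> = pr n k (v \<ominus>[n] w) \<oplus>[n] pr n k w" using v w by (intro prD(5)) simp_all
  finally show ?thesis
    using prD(4)[OF v] prD(4)[OF w] prD(4)[of "v \<ominus>[n] w" n k] v w by (simp add: M.M.minus_eq M.M.a_assoc M.M.r_neg)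
qed

text \<open>Stability under \<open>Rg 0\<close> and \<open>xs\<close> propagates through sums and
  products in \<open>generate_ring\<close> to all of R.\<close>

lemma submodule_if_generators:
  assumes gen: "generate_ring R (Rg 0 \<union> set xs) = carrier R"
    and P: "P \<subseteq> carrier (E n)" "\<zero>[n] \<in> P" "!!v w. v \<in> P ==> w \<in> P ==> v \<ominus>[n] w \<in> P"
    and sm: "!!h i v. h \<in> Rg i ==> h \<in> Rg 0 \<union> set xs ==> i = 0 \<or> i = e ==> v \<in> P ==> h \<odot>[n] v \<in> P"
  shows "submodule P R (E n)"
proof -
  interpret M: module R "E n" by (rule modules)
  have c: "v \<in> carrier (E n)" if "v \<in> P" for v using that P(1) by blast
  have Pn: "\<ominus>[n] v \<in> P" if "v \<in> P" for v
    using P(3)[OF P(2) that] c[OF that] by (simp add: M.M.minus_eq)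
  have Pa: "v \<oplus>[n] w \<in> P" if "v \<in> P" "w \<in> P" for v w
    using P(3)[OF that(1) Pn[OF that(2)]] c[OF that(1)] c[OF that(2)] by (simp add: M.M.minus_eq)
  have "r \<odot>[n] v \<in> P" if r: "r \<in> carrier R" and v: "v \<in> P" for r v
  proof -
    have "r \<in> generate_ring R (Rg 0 \<union> set xs)" using gen r by simp
    then have "r \<in> carrier R \<and> (\<forall>v\<in>P. r \<odot>[n] v \<in> P)"
    proof (induction rule: generate_ring.induct)
      case one
      then show ?case using c by simp
    next
      case (incl h)
      show ?case
      proof (intro conjI ballI)
        show "h \<in> carrier R" using incl Rg_carrier xs_carrier' by auto
        show "h \<odot>[n] v \<in> P" if "v \<in> P" for v
          using sm[of h 0 v] sm[of h e v] that incl xs_Rg by auto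
      qed
    next
      case (a_inv h)
      then show ?case using Pn c by (simp add: M.smult_l_minus)
    next
      case (eng_add h1 h2)
      then show ?case using Pa c by (simp add: M.smult_l_distr)
    next
      case (eng_mult h1 h2)
      then show ?case using c by (simp add: M.smult_assoc1)
    qed
    then show ?thesis using v by blast
  qed
  then show ?thesis using c P(2) Pn Pa by (intro M.submoduleI) auto
qed

text \<open>A graded chain N is encoded by the R-submodules P i of the elements all of whose
  components lie in N i. The homogeneous elements of P i give N i back.\<close>

lemma noetherian_Z0_graded:
  assumes gen: "generate_ring R (Rg 0 \<union> set xs) = carrier R"
    and cc: "noetherian 0 Z0 {\<zero>[0]}"
  shows "chain_condition True (Om0 \<union> set ysg) fact (\<lambda>k. lift 0 (Z0 \<inter> Eg 0 k)) (\<lambda>k. lift 0 {\<zero>[0]})"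
proof (rule chain_conditionI, goal_cases)
  case (1 N)
  interpret M: module R "E 0" by (rule modules)
  note z = M.submoduleE[OF submodule_Z0]
  have Zz: "\<zero>[0] \<in> Z0" by (rule module_zero_mem[OF submodule_Z0])
  define G where "G i k = down 0 (N i k)" for i k
  have B0: "lift 0 {\<zero>[0]} \<subseteq> N i k" for i k by (rule 1(2))
  have NG: "N i k = lift 0 (G i k)" for i k
    unfolding G_def by (rule lift_down[OF 1(1) B0, symmetric], rule subset_trans[OF 1(3)]) (auto simp: lift_def)
  have GZ: "G i k \<subseteq> Z0" "G i k \<subseteq> Eg 0 k" for i k
    using 1(3)[of i k] lift_rep[of _ 0 "Z0 \<inter> Eg 0 k"] by (auto simp: G_def down_def)
  note Gc = down_closed[OF 1(1) B0, folded G_def]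
  have G0: "a \<odot>[0] v \<in> G i k" if "a \<in> Rg 0" "v \<in> G i k" for a v i k
    using Gc(5)[OF that(2), of a 0] that(1) Rg_carrier by (auto simp: Om0_def)
  have Gx: "x \<odot>[0] v \<in> G i (k + int e)" if "x \<in> set xs" "v \<in> G i k" for x v i k
    using Gc(5)[OF that(2), of x "int e"] that(1) xs_carrier' by (auto simp: ysg_def)
  define P where "P i = {v \<in> Z0. \<forall>k. pr 0 k v \<in> G i k}" for i
  have c: "v \<in> carrier (E 0)" if "v \<in> P i" for v i using that z(1) by (auto simp: P_def)
  have P0: "\<zero>[0] \<in> P i" for i using Zz Gc(2) prD(10) by (simp add: P_def)
  have Pm: "v \<ominus>[0] w \<in> P i" if "v \<in> P i" "w \<in> P i" for v w i
    using that Gc(4) pr_minus[OF c[OF that(1)] c[OF that(2)]] module_minus_closed[OF submodule_Z0] by (simp add: P_def)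
  have sub: "submodule (P i) R (E 0)" for i
  proof (rule submodule_if_generators[OF gen])
    show "P i \<subseteq> carrier (E 0)" using c by blast
    show "v \<ominus>[0] w \<in> P i" if "v \<in> P i" "w \<in> P i" for v w using that by (rule Pm)
    show "h \<odot>[0] v \<in> P i" if h: "h \<in> Rg j" "h \<in> Rg 0 \<union> set xs" and v: "v \<in> P i" for h j v
    proof -
      have hc: "h \<in> carrier R" using Rg_carrier[OF h(1)] .
      have vc: "v \<in> carrier (E 0)" by (rule c[OF v])
      have "pr 0 k (h \<odot>[0] v) \<in> G i k" for k
      proof (cases "h \<in> Rg 0")
        case True
        have "pr 0 k v \<in> G i k" using v by (simp add: P_def)
        then show ?thesis using pr_smult[OF True vc, of k] G0[OF True, of "pr 0 k v" i k] by simp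
      next
        case False
        then have hx: "h \<in> set xs" "h \<in> Rg e" using h(2) xs_Rg by auto
        have "pr 0 (k - int e) v \<in> G i (k - int e)" using v by (simp add: P_def)
        then show ?thesis using pr_smult[OF hx(2) vc, of "k - int e"] Gx[OF hx(1), of "pr 0 (k - int e) v" i "k - int e"] by simp
      qed
      moreover have "h \<odot>[0] v \<in> Z0" using z(4)[OF hc, of v] v by (simp add: P_def)
      ultimately show ?thesis by (simp add: P_def)
    qed
  qed (rule P0)
  have "\<exists>m. \<forall>i\<ge>m. (\<lambda>k::int. lift 0 (P i)) = (\<lambda>k. lift 0 (P m))"
  proof (rule chain_conditionD[OF cc])
    show "osub F.const_ops fact (\<lambda>k. lift 0 (P i))" for i by (rule osub_lift_submodule[OF sub])
    show "lift 0 {\<zero>[0]} \<subseteq> lift 0 (P i)" for i using P0 by (intro lift_mono) simp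
    show "lift 0 (P i) \<subseteq> lift 0 Z0" for i by (rule lift_mono) (auto simp: P_def)
    have "G i k \<subseteq> G (Suc i) k" for i k using 1(4)[of i k] by (auto simp: G_def down_def)
    then have "P i \<subseteq> P (Suc i)" for i by (auto simp: P_def)
    then show "if True then lift 0 (P i) \<subseteq> lift 0 (P (Suc i)) else lift 0 (P (Suc i)) \<subseteq> lift 0 (P i)" for i
      by (simp add: lift_mono)
  qed
  then obtain m where m: "\<forall>i\<ge>m. (\<lambda>k::int. lift 0 (P i)) = (\<lambda>k. lift 0 (P m))" ..
  have Pi: "P i = P m" if "i \<ge> m" for i
  proof -
    have "(\<lambda>k::int. lift 0 (P i)) = (\<lambda>k. lift 0 (P m))" using m that by blast
    then have "lift 0 (P i) = lift 0 (P m)" by (rule fun_cong)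
    moreover have "down 0 (lift 0 (P i)) = P i" for i by (rule down_lift) (use c in blast)
    ultimately show ?thesis by metis
  qed
  have GP: "G i k = P i \<inter> Eg 0 k" for i k
  proof (intro Set.set_eqI iffI)
    fix v assume v: "v \<in> G i k"
    then have v': "v \<in> Z0" "v \<in> Eg 0 k" using GZ by blast+
    have "pr 0 j v \<in> G i j" for j
      using prD(6)[OF v'(2)] prD(7)[OF v'(2), of j] v Gc(2)[of i j] by (cases "j = k") auto
    then show "v \<in> P i \<inter> Eg 0 k" using v' by (simp add: P_def)
  next
    fix v assume v: "v \<in> P i \<inter> Eg 0 k"
    then have "pr 0 k v \<in> G i k" by (simp add: P_def)
    then show "v \<in> G i k" using prD(6)[of v 0 k] v by simp
  qed
  have "N i k = N m k" if "i \<ge> m" for i k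
    unfolding NG GP Pi[OF that] ..
  then have "N i = N m" if "i \<ge> m" for i using that by (intro ext)
  then show ?case by blast
qed

lemma power_torsion_gam:
  shows "x \<in> set xs ==> power_torsion fact (x, int e) (cyc dd (G.gam (set xs)) base (int q)) (bnd dd (G.gam (set xs)) base (int q))"
proof -
  assume x: "x \<in> set xs"
  let ?S = "\<lambda>n k. tors_set R (set xs) (E n) \<inter> Eg n k" and ?Z = "\<lambda>k. {v \<in> tors_set R (set xs) (E q) \<inter> Eg q k. d q v = \<zero>[Suc q]}"
  note cl = G.closed_tors[OF xs_carrier']
  have 1: "cyc dd (G.gam (set xs)) base (int q) = (\<lambda>k. lift q (?Z k))"
    "bnd dd (G.gam (set xs)) base (int q) = (\<lambda>k. lift q (G.bset ?S q k))"
    by (rule ext, rule G.cyc_fam, rule ext, rule G.bnd_fam[OF cl])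
  have z: "\<zero>[q] \<in> G.bset ?S q k" for k
  proof (cases q)
    case (Suc p)
    have "\<zero>[p] \<in> tors_set R (set xs) (E p) \<inter> Eg p k" by (rule G.closedD(2)[OF cl])
    then show ?thesis using d_zero[of p] Suc by (auto simp: G.bset_def intro!: rev_image_eqI)
  qed (simp add: G.bset_def)
  then show ?thesis
    unfolding 1
  proof (intro power_torsion_lift)
    show "x \<in> carrier R" using x xs_carrier' by blast
    fix k v assume "v \<in> ?Z k"
    then obtain n :: nat where "x [^] n \<odot>[q] v = \<zero>[q]" using x by (auto simp: tors_set_def)
    then show "\<exists>n::nat. x [^] n \<odot>[q] v \<in> G.bset ?S q (k + int n * int e)"
      using z by metis
  qed
qed

text \<open>Induction on q. Koszul cohomology of M over \<open>ysg\<close> is Noetherian over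
  \<open>R\<^sub>0\<close> by \<open>kos_strip\<close>; truncation passes this on to the socle of
  \<open>H\<^sup>q\<close>, and torsion under elements of degree 1 leads from the socle to
  \<open>H\<^sup>q\<close>.\<close>

theorem bounded_noetherian_cohomology:
  assumes e: "e = 1" and gen: "generate_ring R (Rg 0 \<union> set xs) = carrier R"
    and cc: "noetherian 0 Z0 {\<zero>[0]}"
  shows "bounded_noetherian Om0 fact (cyc dd (G.gam (set xs)) base (int q)) (bnd dd (G.gam (set xs)) base (int q))"
proof -
  let ?Om = "Om0 \<union> set ysg" and ?bn = "bounded_noetherian Om0 fact"
  have Om: "Om0 \<subseteq> ?Om" "set ysg \<subseteq> ?Om" by auto
  interpret S: koszul_class fact finl finr fev fod ?Om ?bn
    by (intro koszul_class.intro F.pairing_axioms F.serre_bounded_noetherian Om snd_Om0)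
  let ?C = "G.gam (set xs)"
  note c = G.cpx_gam[OF xs_carrier']
  have bc: "bnd dd ?C base n k \<subseteq> cyc dd ?C base n k" for n k by (rule subsetI, rule F.bnd_cyc[OF c])
  note c0 = F.cpx_trunc(6)[OF G.cpx_gam[of "{}"], simplified, of 0]
  have "chain_condition True ?Om fact (\<lambda>k. lift 0 {v \<in> Eg 0 k. d 0 v = \<zero>[1]}) (\<lambda>k. lift 0 {\<zero>[0]})"
  proof (rule chain_condition_mono[OF noetherian_Z0_graded[OF gen cc]])
    show "lift 0 {v \<in> Eg 0 k. d 0 v = \<zero>[1]} \<subseteq> lift 0 (Z0 \<inter> Eg 0 k)" for k
      using prD(2)[of 0 k] by (intro lift_mono) (auto simp: Z0_def)
  qed simp
  from G.hs_augmentation[OF order_refl this]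
  have "chain_condition True ?Om fact (cyc dd (F.truncU dd (G.gam {}) base 0) base n) (bnd dd (F.truncU dd (G.gam {}) base 0) base n)" for n .
  from F.kos_strip[OF c0 Om(2,1) this]
  have kcc: "chain_condition True Om0 fact (cyc (F.kosD ysg dd) (F.kos ysg (F.truncU dd (G.gam {}) base 0)) (F.kos ysg base) n)
     (bnd (F.kosD ysg dd) (F.kos ysg (F.truncU dd (G.gam {}) base 0)) (F.kos ysg base) n)" for n .
  note ck = F.cpx_kos[OF Om(2) c0]
  have "S.khs ysg dd (F.truncU dd (G.gam {}) base 0) base n" for n
    unfolding S.khs_def S.hs_def
    by (rule F.bounded_noetherian_if_noetherian[OF snd_Om0 osub_mono[OF F.osub_cyc[OF ck] Om(1)] osub_mono[OF F.osub_bnd[OF ck] Om(1)] _ kcc])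
      (rule subsetI, rule F.bnd_cyc[OF ck])
  then have CN: "S.khs ysg dd ?C base n" for n
    by (intro G.khs_gam[OF S.serre_class_axioms Om(2)]) (auto simp: ysg_def)
  show ?thesis
  proof (induction q rule: less_induct)
    case (less q)
    have U: "S.khs ysg dd (F.truncU dd ?C base (int q')) (F.truncT dd ?C base (int q')) n" if "q' < q" for q' n
      by (rule S.khs_between[OF Om(2) c F.osub_cyc[OF c] bc subset_refl F.osub_bnd[OF c] subset_refl bc less[OF that]])
    have "S.khs ysg dd (F.truncU dd ?C base (int q)) (F.truncT dd ?C base (int q)) (int q)"
      by (rule S.khs_cohomology_low[OF Om(2) c G.gam_sub_neg CN U]) simp_all
    then have soc: "?bn (F.socle ysg (cyc dd ?C base (int q)) (bnd dd ?C base (int q))) (bnd dd ?C base (int q))"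
      by (rule S.sm_socle_between[OF Om(2) c F.osub_cyc[OF c] bc subset_refl F.osub_bnd[OF c] subset_refl bc])
    show ?case
    proof (rule F.bounded_noetherian_if_socle[OF Om(1) snd_Om0 Om(2) _ F.osub_cyc[OF c] F.osub_bnd[OF c] bc _ soc])
      fix y assume "y \<in> set ysg"
      then obtain x where x: "y = (x, int e)" "x \<in> set xs" unfolding ysg_def by auto
      show "snd y = 1" using x e by simp
      show "power_torsion fact y (cyc dd ?C base (int q)) (bnd dd ?C base (int q))"
        unfolding x(1) by (rule power_torsion_gam[OF x(2)])
    qed
  qed
qed

section \<open>Cocycles, coboundaries and the part of high degree\<close>

definition Zt :: "nat => 'e set" where
  "Zt q = {v \<in> tors_set R (set xs) (E q). d q v = \<zero>[Suc q]}"

definition Bt :: "nat => 'e set" where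
  "Bt q = (case q of 0 => {\<zero>[0]} | Suc p => d p ` tors_set R (set xs) (E p))"

lemma tors_carrier: "tors_set R S (E q) \<subseteq> carrier (E q)"
  by (auto simp: tors_set_def)

lemma submodule_tors: "submodule (tors_set R (set xs) (E q)) R (E q)"
  by (rule module.submodule_tors_set[OF modules xs_carrier'])

lemma Zt_carrier: "Zt q \<subseteq> carrier (E q)"
  using tors_carrier by (auto simp: Zt_def)

lemma submodule_Zt: "submodule (Zt q) R (E q)"
  using submodule_preimage_d[OF submodule_zero submodule_tors, of q] by (simp add: Zt_def)

lemma submodule_Bt: "submodule (Bt q) R (E q)"
proof (cases q)
  case 0
  then show ?thesis using submodule_zero[of 0] by (simp add: Bt_def)
next
  case (Suc p)
  interpret M: module R "E p" by (rule modules)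
  interpret N: module R "E (Suc p)" by (rule modules)
  note s = M.submoduleE[OF submodule_tors]
  let ?T = "tors_set R (set xs) (E p)"
  have c: "v \<in> carrier (E p)" if "v \<in> ?T" for v using that tors_carrier by blast
  have "submodule (d p ` ?T) R (E (Suc p))"
  proof (rule N.submoduleI)
    show "d p ` ?T \<subseteq> carrier (E (Suc p))" using d_closed c by blast
    show "\<zero>[Suc p] \<in> d p ` ?T" using module_zero_mem[OF submodule_tors, of p] d_zero[of p] by (metis imageI)
    show "\<ominus>[Suc p] a \<in> d p ` ?T" if a: "a \<in> d p ` ?T" for a
    proof -
      obtain v where v: "v \<in> ?T" "a = d p v" using a by (elim imageE)
      then show ?thesis using s(3)[OF v(1)] d_minus[OF c[OF v(1)]] by (metis imageI)
    qed
    show "a \<oplus>[Suc p] b \<in> d p ` ?T" if ab: "a \<in> d p ` ?T" "b \<in> d p ` ?T" for a b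
    proof -
      obtain v w where "v \<in> ?T" "a = d p v" "w \<in> ?T" "b = d p w" using ab by (elim imageE)
      then show ?thesis using s(5)[of v w] d_add[of v p w] c by (metis imageI)
    qed
    show "r \<odot>[Suc p] a \<in> d p ` ?T" if ra: "r \<in> carrier R" "a \<in> d p ` ?T" for r a
    proof -
      obtain v where "v \<in> ?T" "a = d p v" using ra(2) by (elim imageE)
      then show ?thesis using s(4)[OF ra(1), of v] d_smult[of v p r] c ra(1) by (metis imageI)
    qed
  qed
  then show ?thesis by (simp add: Suc Bt_def)
qed

lemma Bt_Zt: "Bt q \<subseteq> Zt q"
proof (cases q)
  case 0
  then show ?thesis using module_zero_mem[OF submodule_Zt, of 0] by (simp add: Bt_def)
next
  case (Suc p)
  have "d p v \<in> Zt (Suc p)" if "v \<in> tors_set R (set xs) (E p)" for v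
    using d_tors[OF xs_carrier' that] d_d[of v p] that tors_carrier by (auto simp: Zt_def)
  then show ?thesis by (auto simp: Suc Bt_def)
qed

lemma pr_tors: "v \<in> tors_set R (set xs) (E q) ==> pr q k v \<in> tors_set R (set xs) (E q)"
  by (rule component_tors_set[OF graded_E projections_pr xs_Rg])

lemma pr_Zt: "v \<in> Zt q ==> pr q k v \<in> Zt q"
  using pr_tors[of v q k] pr_d[of v q k] prD(10)[of "Suc q" k] by (auto simp: Zt_def tors_set_def)

lemma pr_Bt: "v \<in> Bt q ==> pr q k v \<in> Bt q"
proof (cases q)
  case 0
  then show "v \<in> Bt q ==> ?thesis" using prD(10) by (simp add: Bt_def)
next
  case (Suc p)
  assume "v \<in> Bt q"
  then obtain w where w: "w \<in> tors_set R (set xs) (E p)" "v = d p w" by (auto simp: Suc Bt_def)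
  then have "pr (Suc p) k v = d p (pr p k w)" using pr_d[of w p k] tors_carrier by auto
  then show ?thesis using pr_tors[OF w(1)] by (simp add: Suc Bt_def)
qed

lemma total_cyc: "cyc dd (T.gam (set xs)) base (int q) = (\<lambda>k. lift q (Zt q))"
  by (rule ext, subst T.cyc_fam, rule arg_cong[where f = "lift q"]) (use tors_carrier in \<open>auto simp: Zt_def\<close>)

lemma total_bnd: "bnd dd (T.gam (set xs)) base (int q) = (\<lambda>k. lift q (Bt q))"
proof (rule ext, subst T.bnd_fam[OF T.closed_tors[OF xs_carrier']], rule arg_cong[where f = "lift q"])
  have "tors_set R (set xs) (E p) \<inter> carrier (E p) = tors_set R (set xs) (E p)" for p using tors_carrier by blast
  then show "T.bset (\<lambda>n k. tors_set R (set xs) (E n) \<inter> carrier (E n)) q k = Bt q" for k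
    by (simp add: T.bset_def Bt_def)
qed

lemma graded_cyc: "cyc dd (G.gam (set xs)) base (int q) = (\<lambda>k. lift q (Zt q \<inter> Eg q k))"
  by (rule ext, subst G.cyc_fam, rule arg_cong[where f = "lift q"]) (auto simp: Zt_def)

text \<open>A homogeneous coboundary has a homogeneous primitive: the component of matching degree
  of any primitive.\<close>

lemma graded_bnd: "bnd dd (G.gam (set xs)) base (int q) = (\<lambda>k. lift q (Bt q \<inter> Eg q k))"
proof (rule ext, subst G.bnd_fam[OF G.closed_tors[OF xs_carrier']], rule arg_cong[where f = "lift q"])
  show "G.bset (\<lambda>n k. tors_set R (set xs) (E n) \<inter> Eg n k) q k = Bt q \<inter> Eg q k" for k
  proof (cases q)
    case 0
    then show ?thesis using G.A_zero[of 0 k] by (auto simp: G.bset_def Bt_def)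
  next
    case (Suc p)
    have "d p ` (tors_set R (set xs) (E p) \<inter> Eg p k) = d p ` tors_set R (set xs) (E p) \<inter> Eg (Suc p) k" (is "?l = ?r")
    proof
      show "?l \<subseteq> ?r" using d_Eg by blast
      show "?r \<subseteq> ?l"
      proof
        fix v assume "v \<in> ?r"
        then obtain w where w: "w \<in> tors_set R (set xs) (E p)" "v = d p w" "v \<in> Eg (Suc p) k" by blast
        have wc: "w \<in> carrier (E p)" using w(1) tors_carrier by blast
        have "v = d p (pr p k w)" using pr_d[OF wc, of k] prD(6)[OF w(3)] w(2) by simp
        then show "v \<in> ?l" using pr_tors[OF w(1)] prD(3)[OF wc] by blast
      qed
    qed
    then show ?thesis by (simp add: Suc G.bset_def Bt_def)
  qed
qed

text \<open>Modulo \<open>Bt q\<close> this is the part of \<open>H\<^sup>q\<close> in degrees at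
  least m, taken inside the ungraded module.\<close>

definition V :: "nat => int => 'e set" where
  "V q m = {v \<in> Zt q. \<forall>k<m. pr q k v \<in> Bt q}"

lemma V_diff: "v \<in> V q m ==> w \<in> V q m ==> v \<ominus>[q] w \<in> V q m"
  using module_minus_closed[OF submodule_Zt] module_minus_closed[OF submodule_Bt] pr_minus Zt_carrier
  by (auto simp: V_def subset_iff)

lemma Bt_V: "Bt q \<subseteq> V q m"
  using Bt_Zt pr_Bt by (auto simp: V_def)

text \<open>R has no negative degrees, so multiplication never lowers the degree of a
  component.\<close>

lemma submodule_V:
  assumes gen: "generate_ring R (Rg 0 \<union> set xs) = carrier R"
  shows "submodule (V q m) R (E q)"
proof -
  interpret M: module R "E q" by (rule modules)
  have V0: "\<zero>[q] \<in> V q m" using Bt_V module_zero_mem[OF submodule_Bt] by blast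
  have c: "v \<in> carrier (E q)" if "v \<in> V q m" for v using that Zt_carrier by (auto simp: V_def)
  note z = M.submoduleE[OF submodule_Zt] and b = M.submoduleE[OF submodule_Bt]
  show ?thesis
  proof (rule submodule_if_generators[OF gen])
    show "V q m \<subseteq> carrier (E q)" using c by blast
    show "v \<ominus>[q] w \<in> V q m" if "v \<in> V q m" "w \<in> V q m" for v w using that by (rule V_diff)
    show "h \<odot>[q] v \<in> V q m" if i: "h \<in> Rg i" and v: "v \<in> V q m" for h i v
    proof -
      have hc: "h \<in> carrier R" using Rg_carrier[OF i] .
      have "pr q k (h \<odot>[q] v) \<in> Bt q" if "k < m" for k
      proof -
        have "pr q (k - int i) v \<in> Bt q" using v that by (auto simp: V_def)
        then show ?thesis using pr_smult[OF i c[OF v], of "k - int i"] b(4)[OF hc] by simp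
      qed
      then show ?thesis using z(4)[OF hc, of v] v by (simp add: V_def)
    qed
  qed (rule V0)
qed

text \<open>An element of \<open>V q m\<close> is congruent to its component of degree \<open>m\<close> modulo \<open>V q (m + 1)\<close>.\<close>

lemma noetherian_V_step:
  assumes gen: "generate_ring R (Rg 0 \<union> set xs) = carrier R"
    and bn: "bounded_noetherian Om0 fact (\<lambda>k. lift q (Zt q \<inter> Eg q k)) (\<lambda>k. lift q (Bt q \<inter> Eg q k))"
    and osB: "osub Om0 fact (\<lambda>k. lift q (Bt q \<inter> Eg q k))"
  shows "noetherian q (V q m) (V q (m + 1))"
proof (rule chain_condition_lift)
  have c: "V q m \<subseteq> carrier (E q)" for m using Zt_carrier by (auto simp: V_def)
  show "V q m \<subseteq> carrier (E q)" "V q (m + 1) \<subseteq> carrier (E q)" by (rule c)+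
  show "\<zero>[q] \<in> V q (m + 1)" using Bt_V module_zero_mem[OF submodule_Bt] by blast
  fix P :: "nat => 'e set"
  assume P: "!!i. submodule (P i) R (E q)" "!!i. V q (m + 1) \<subseteq> P i" "!!i. P i \<subseteq> V q m"
    and asc: "!!i. if True then P i \<subseteq> P (Suc i) else P (Suc i) \<subseteq> P i"
  interpret M: module R "E q" by (rule modules)
  have PZ: "P i \<subseteq> Zt q" for i using P(3)[of i] by (auto simp: V_def)
  \<comment> \<open>The chain P is read off in degree m alone, where the bounded Noetherian property
    applies; the degrees above are filled with coboundaries.\<close>
  define N where "N i k = (if k = m then lift q (P i \<inter> Eg q k) else trunc_ge m (\<lambda>k. lift q (Bt q \<inter> Eg q k)) k)" for i k
  have osP: "osub Om0 fact (\<lambda>k. lift q (P i \<inter> Eg q k))" for i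
  proof (rule osub_lift)
    show "P i \<inter> Eg q k \<subseteq> carrier (E q)" "\<zero>[q] \<in> P i \<inter> Eg q k" for k
      using prD(2) module_zero_mem[OF P(1)] G.A_zero by blast+
    show "x \<ominus>[q] y \<in> P i \<inter> Eg q k" if "x \<in> P i \<inter> Eg q k" "y \<in> P i \<inter> Eg q k" for x y k
      using that module_minus_closed[OF P(1)] Eg_minus by blast
    show "r \<in> carrier R \<and> r \<odot>[q] x \<in> P i \<inter> Eg q (k + e')" if r: "(r, e') \<in> Om0" and x: "x \<in> P i \<inter> Eg q k" for r e' x k
      using r x M.submoduleE(4)[OF P(1)[of i]] Rg_carrier[of r 0] Eg_smult[of r 0 x q k] by (auto simp: Om0_def)
  qed
  have "\<exists>l. \<forall>i\<ge>l. N i = N l"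
  proof (rule chain_conditionD[OF bn[unfolded bounded_noetherian_def, THEN spec, of m]])
    show "osub Om0 fact (N i)" for i
    proof (rule F.osub_piecewise[OF snd_Om0])
      show "\<exists>F. osub Om0 fact F \<and> N i k = F k" for k
        using osP[of i] F.osub_trunc_ge[OF osB snd_Om0] by (cases "k = m") (auto simp: N_def)
    qed
    have "Bt q \<subseteq> P i" for i using Bt_V P(2)[of i] by blast
    then have "lift q (Bt q \<inter> Eg q m) \<subseteq> lift q (P i \<inter> Eg q m)" for i by (intro lift_mono) blast
    then show "trunc_ge m (\<lambda>k. lift q (Bt q \<inter> Eg q k)) k \<subseteq> N i k" for i k by (simp add: N_def trunc_ge_def)
    have "lift q (P i \<inter> Eg q m) \<subseteq> lift q (Zt q \<inter> Eg q m)" for i using PZ[of i] by (intro lift_mono) blast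
    moreover have "lift q (Bt q \<inter> Eg q k) \<subseteq> lift q (Zt q \<inter> Eg q k)" for k using Bt_Zt[of q] by (intro lift_mono) blast
    ultimately show "N i k \<subseteq> trunc_ge m (\<lambda>k. lift q (Zt q \<inter> Eg q k)) k" for i k by (simp add: N_def trunc_ge_def)
    have "lift q (P i \<inter> Eg q m) \<subseteq> lift q (P (Suc i) \<inter> Eg q m)" for i using asc[of i] by (intro lift_mono) auto
    then show "if True then N i k \<subseteq> N (Suc i) k else N (Suc i) k \<subseteq> N i k" for i k by (simp add: N_def)
  qed
  then obtain l where l: "\<forall>i\<ge>l. N i = N l" ..
  have PE: "P i \<inter> Eg q m = P l \<inter> Eg q m" if "i \<ge> l" for i
  proof -
    have "N i = N l" using l that by blast
    from fun_cong[OF this, of m] have eq: "lift q (P i \<inter> Eg q m) = lift q (P l \<inter> Eg q m)" by (simp add: N_def)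
    have dl: "down q (lift q (P i \<inter> Eg q m)) = P i \<inter> Eg q m" for i by (rule down_lift) (use prD(2) in blast)
    show ?thesis using dl[of i] dl[of l] unfolding eq by (rule trans[OF sym])
  qed
  have "P i \<subseteq> P j" if ij: "P i \<inter> Eg q m = P j \<inter> Eg q m" for i j
  proof
    fix v assume v: "v \<in> P i"
    then have vV: "v \<in> V q m" and vZ: "v \<in> Zt q" using P(3) PZ by blast+
    have vc: "v \<in> carrier (E q)" using vV c by blast
    have pc: "pr q m v \<in> carrier (E q)" by (rule prD(4)[OF vc])
    define w where "w = v \<ominus>[q] pr q m v"
    have "pr q k w \<in> Bt q" if "k < m + 1" for k
    proof -
      have pp: "pr q k (pr q m v) = (if k = m then pr q m v else \<zero>[q])"
        using prD(6,7)[OF prD(3)[OF vc, of m]] by auto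
      have "pr q k w = pr q k v \<ominus>[q] pr q k (pr q m v)" unfolding w_def by (rule pr_minus[OF vc pc])
      moreover have "k = m \<or> k < m \<and> pr q k v \<in> Bt q" using that vV by (cases "k = m") (simp_all add: V_def)
      ultimately show ?thesis
        using module_zero_mem[OF submodule_Bt, of q] module_minus_closed[OF submodule_Bt, of "pr q k v" q "\<zero>[q]"] pc
        by (auto simp: pp M.M.minus_eq M.M.r_neg)
    qed
    moreover have "w \<in> Zt q" unfolding w_def by (rule module_minus_closed[OF submodule_Zt vZ pr_Zt[OF vZ]])
    ultimately have "w \<in> V q (m + 1)" by (simp add: V_def)
    then have w: "w \<in> P i" "w \<in> P j" using P(2) by blast+
    have v_eq: "pr q m v = v \<ominus>[q] w" "v = w \<oplus>[q] pr q m v"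
      using vc pc by (simp_all add: w_def M.M.minus_eq M.M.minus_add M.M.a_assoc M.M.l_neg M.M.r_neg1 M.M.r_neg2)
    have "pr q m v \<in> P i" unfolding v_eq(1) by (rule module_minus_closed[OF P(1) v w(1)])
    then have "pr q m v \<in> P j" using ij prD(3)[OF vc, of m] by blast
    from M.submoduleE(5)[OF P(1) w(2) this] show "v \<in> P j" unfolding v_eq(2)[symmetric] .
  qed
  then have "P i = P l" if "i \<ge> l" for i using PE[OF that] by (intro equalityI) auto
  then show "\<exists>l. \<forall>i\<ge>l. P i = P l" by blast
qed

text \<open>Descend from the degree k0 beyond which \<open>H\<^sup>q\<close> vanishes: there
  \<open>V\<close> consists of coboundaries, and each lower degree adds a Noetherian factor.\<close>

lemma noetherian_V:
  assumes gen: "generate_ring R (Rg 0 \<union> set xs) = carrier R"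
    and bn: "bounded_noetherian Om0 fact (\<lambda>k. lift q (Zt q \<inter> Eg q k)) (\<lambda>k. lift q (Bt q \<inter> Eg q k))"
  shows "noetherian q (V q m) (Bt q)"
proof -
  interpret M: module R "E q" by (rule modules)
  note b = M.submoduleE[OF submodule_Bt]
  have osub: "osub Om0 fact (\<lambda>k. lift q (Zt q \<inter> Eg q k))" "osub Om0 fact (\<lambda>k. lift q (Bt q \<inter> Eg q k))"
    unfolding graded_cyc[symmetric] graded_bnd[symmetric]
    by (rule osub_mono[OF F.osub_cyc[OF G.cpx_gam[OF xs_carrier']]], simp,
        rule osub_mono[OF F.osub_bnd[OF G.cpx_gam[OF xs_carrier']]], simp)
  have "\<exists>k0. \<forall>k\<ge>k0. lift q (Zt q \<inter> Eg q k) = lift q (Bt q \<inter> Eg q k)"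
    by (rule F.bounded_noetherian_vanish[OF osub snd_Om0 lift_mono bn[unfolded bounded_noetherian_def, THEN spec]])
      (use Bt_Zt[of q] in blast)
  then obtain k0 where k0: "!!k. k \<ge> k0 ==> lift q (Zt q \<inter> Eg q k) = lift q (Bt q \<inter> Eg q k)" by blast
  have ZB: "v \<in> Bt q" if v: "v \<in> Zt q" "v \<in> Eg q k" "k \<ge> k0" for v k
  proof -
    note r = lift_rep[OF subsetD[OF Zt_carrier v(1)]]
    have "frag_of (0, q, v) \<in> lift q (Zt q \<inter> Eg q k)" unfolding r using v(1,2) by blast
    then have "frag_of (0, q, v) \<in> lift q (Bt q \<inter> Eg q k)" unfolding k0[OF v(3)] .
    then show ?thesis unfolding r by blast
  qed
  have "noetherian q (V q m) (Bt q)" if "k0 \<le> m + int n" for n m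
    using that
  proof (induction n arbitrary: m)
    case 0
    have "V q m \<subseteq> Bt q"
    proof
      fix v assume v: "v \<in> V q m"
      then have vZ: "v \<in> Zt q" and vc: "v \<in> carrier (E q)" using Zt_carrier by (auto simp: V_def)
      have "pr q j v \<in> Bt q" for j
        using 0 v ZB[OF pr_Zt[OF vZ] prD(3)[OF vc], of j] by (cases "j < m") (auto simp: V_def)
      then show "v \<in> Bt q"
        by (intro M.M.projections_induct[OF projections_pr vc module_zero_mem[OF submodule_Bt] b(5) b(1)])
    qed
    then show ?case by (intro chain_condition_triv lift_mono)
  next
    case (Suc n)
    have cc: "noetherian q (V q (m + 1)) (Bt q)"
      by (rule Suc.IH) (use Suc.prems in simp)
    have le: "lift q (V q (m + 1)) \<subseteq> lift q (V q m)" by (rule lift_mono) (auto simp: V_def)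
    note os = osub_lift_submodule[OF submodule_V[OF gen]]
    show ?case
      by (rule chain_condition_ext[OF F.act_additive os lift_mono[OF Bt_V] le os noetherian_V_step[OF gen bn osub(2)] cc])
  qed
  from this[of m "nat (k0 - m)"] show ?thesis by simp
qed

end

section \<open>Artinian Koszul cohomology\<close>

text \<open>In the application \<open>zs\<close> generates the maximal ideal of
  \<open>R\<^sub>0\<close> and \<open>xs\<close> the irrelevant ideal. \<open>residue_field\<close>
  says that modulo the ideal of both every ring element is zero or invertible.\<close>

locale local_resolution = resolution_elements R Rg E Eg d xs e
  for R :: "('r, 'x) ring_scheme" (structure) and Rg and E :: "nat => ('r, 'e) module" and Eg d xs e +
  fixes zs :: "'r list"
  assumes degree_one: "e = 1" and generated: "generate_ring R (Rg 0 \<union> set xs) = carrier R"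
    and zs_Rg: "set zs \<subseteq> Rg 0"
    and residue_field: "r \<in> carrier R ==> r \<in> genideal R (set (zs @ xs)) \<or>
      (\<exists>r'\<in>carrier R. r' \<otimes> r \<ominus> \<one> \<in> genideal R (set (zs @ xs)))"
    and noetherian_M: "noetherian 0 Z0 {\<zero>[0]}"
begin

abbreviation ys :: "('r \<times> int) list" where "ys == map (\<lambda>t. (t, 0)) (zs @ xs)"

text \<open>What finite length yields through Nakayama: below degree m each class in
  \<open>H\<^sup>q\<close> is killed by powers of \<open>zs\<close>, with exponents that may depend
  on the class.\<close>

definition finite_length_below :: "nat => int => bool" where
  "finite_length_below q m \<longleftrightarrow> (\<forall>k<m. \<forall>w\<in>Zt q \<inter> Eg q k. \<forall>z\<in>set zs. \<exists>N::nat. z [^] N \<odot>[q] w \<in> Bt q)"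

lemma zs_carrier: "set zs \<subseteq> carrier R"
  using zs_Rg Rg_carrier by blast

lemma zxs_carrier: "set (zs @ xs) \<subseteq> carrier R"
  using zs_carrier xs_carrier' by simp

lemma ys_const: "set ys \<subseteq> F.const_ops"
  using zxs_carrier by (auto simp: F.const_ops_def)

sublocale A: koszul_class fact finl finr fev fod F.const_ops "chain_condition False F.const_ops fact"
  by (intro koszul_class.intro F.pairing_axioms F.serre_chain_condition order_refl)

lemma khs_total: "A.khs ys dd (T.gam (set xs)) base n"
proof -
  note c0 = F.cpx_trunc(6)[OF T.cpx_gam[of "{}"], simplified, of 0]
  have "A.khs ys dd (F.truncU dd (T.gam {}) base 0) base n" for n
  proof (rule artinian_kos[OF c0 _ zxs_carrier residue_field])
    show "F.radd (F.truncU dd (T.gam {}) base 0 n) (base n)" for n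
    proof (rule radd_fam)
      show "base n k \<subseteq> base n k" for n k by simp
      show "F.truncU dd (T.gam {}) base 0 n k \<subseteq> T.gam {} n k" for n k
        by (rule F.trunc_le(4)[OF T.cpx_gam]) simp
    qed
    show "chain_condition True F.const_ops fact (cyc dd (F.truncU dd (T.gam {}) base 0) base n) (bnd dd (F.truncU dd (T.gam {}) base 0) base n)" for n
      using noetherian_M by (intro T.hs_augmentation[OF order_refl]) (simp add: Z0_def)
  qed
  then show ?thesis
    using F.serre_chain_condition[OF order_refl, of F.const_ops False]
    by (intro T.khs_gam[OF _ ys_const]) auto
qed

text \<open>Elements of \<open>xs\<close> are nilpotent on every cocycle here. For t in
  \<open>zs\<close> each component below m has its own exponent; only finitely many components are
  nonzero, so the sum of these exponents serves for all of them.\<close>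

lemma power_torsion_V:
  assumes fl: "finite_length_below q m" and t: "t \<in> set (zs @ xs)"
  shows "power_torsion fact (t, 0) (\<lambda>k. lift q (Zt q)) (\<lambda>k. lift q (V q m))"
proof (rule power_torsion_lift)
  show "t \<in> carrier R" using t zxs_carrier by blast
  fix k :: int and v assume v: "v \<in> Zt q"
  interpret M: module R "E q" by (rule modules)
  note z = M.submoduleE[OF submodule_Zt] and b = M.submoduleE[OF submodule_Bt]
  have vc: "v \<in> carrier (E q)" using v z(1) by blast
  have V0: "\<zero>[q] \<in> V q m" using Bt_V module_zero_mem[OF submodule_Bt] by blast
  show "\<exists>n::nat. t [^] n \<odot>[q] v \<in> V q m"
  proof (cases "t \<in> set xs")
    case True
    then obtain n :: nat where "t [^] n \<odot>[q] v = \<zero>[q]" using v by (auto simp: Zt_def tors_set_def)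
    then show ?thesis using V0 by metis
  next
    case False
    then have tz: "t \<in> set zs" using t by simp
    have tc: "t \<in> carrier R" using tz zs_carrier by blast
    have "\<exists>N::nat. t [^] N \<odot>[q] pr q k v \<in> Bt q" if "k < m" for k
      using fl tz that pr_Zt[OF v, of k] prD(3)[OF vc, of k] unfolding finite_length_below_def by blast
    then obtain f where f: "!!k. k < m ==> t [^] (f k :: nat) \<odot>[q] pr q k v \<in> Bt q" by metis
    define F where "F = {k. pr q k v \<noteq> \<zero>[q]}"
    have F: "finite F" unfolding F_def by (rule prD(8)[OF vc])
    define N where "N = sum f F"
    have tN: "t [^] n \<in> carrier R" "t [^] n \<in> Rg 0" for n :: nat using tc Rg_pow[of t 0 n] tz zs_Rg by auto
    have "pr q k (t [^] N \<odot>[q] v) \<in> Bt q" if k: "k < m" for k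
    proof -
      have eq: "pr q k (t [^] N \<odot>[q] v) = t [^] N \<odot>[q] pr q k v"
        using pr_smult[OF tN(2)[of N] vc, of k] by simp
      show ?thesis
      proof (cases "k \<in> F")
        case True
        have le: "f k \<le> N" unfolding N_def using F True by (intro member_le_sum) auto
        then have "t [^] N = t [^] (N - f k) \<otimes> t [^] f k" using tc by (simp add: R.nat_pow_mult)
        then have "t [^] N \<odot>[q] pr q k v = t [^] (N - f k) \<odot>[q] (t [^] f k \<odot>[q] pr q k v)"
          by (simp only: M.smult_assoc1[OF tN(1) tN(1) prD(4)[OF vc]])
        then show ?thesis unfolding eq using b(4)[OF tN(1) f[OF k]] by (simp only:)
      next
        case False
        then show ?thesis using tN(1)[of N] module_zero_mem[OF submodule_Bt, of q] by (simp add: eq F_def)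
      qed
    qed
    then have "t [^] N \<odot>[q] v \<in> V q m" using z(4)[OF tN(1) v] by (simp add: V_def)
    then show ?thesis by blast
  qed
qed

text \<open>Truncation alone gives Koszul degrees 0 and 1 of \<open>H\<^sup>q\<close>, which is too
  little for the next module. Below j the finite length hypothesis raises this to all Koszul
  degrees, so that the induction can go on.\<close>

theorem khs_cohomology:
  assumes fl: "!!q. q < j ==> \<exists>m. finite_length_below q m" and n: "n \<le> int j + 1"
  shows "A.khs ys dd (F.truncU dd (T.gam (set xs)) base (int j)) (F.truncT dd (T.gam (set xs)) base (int j)) n"
proof -
  let ?C = "T.gam (set xs)"
  note c = T.cpx_gam[OF xs_carrier']
  interpret N: koszul_class fact finl finr fev fod F.const_ops "chain_condition True F.const_ops fact"
    by (intro koszul_class.intro F.pairing_axioms F.serre_chain_condition order_refl)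
  have low: "A.khs ys dd (F.truncU dd ?C base (int q)) (F.truncT dd ?C base (int q)) n"
    if "!!q' n. q' < q ==> A.khs ys dd (F.truncU dd ?C base (int q')) (F.truncT dd ?C base (int q')) n" "n \<le> int q + 1" for q n
    by (rule A.khs_cohomology_low[OF ys_const c T.gam_sub_neg khs_total that])
  have "A.khs ys dd (F.truncU dd ?C base (int q)) (F.truncT dd ?C base (int q)) n"
    if "q < j" for q n
    using that
  proof (induction q arbitrary: n rule: less_induct)
    case (less q)
    have IH: "A.khs ys dd (F.truncU dd ?C base (int q)) (F.truncT dd ?C base (int q)) n" if "n \<le> int q + 1" for n
      by (rule low[OF _ that]) (rule less.IH, assumption, use less.prems in simp)
    obtain m where m: "finite_length_below q m" using fl[OF less.prems] ..
    let ?Z = "\<lambda>k::int. lift q (Zt q)" and ?B = "\<lambda>k::int. lift q (Bt q)" and ?V = "\<lambda>k::int. lift q (V q m)"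
    note cb = total_cyc[of q] total_bnd[of q]
    have os: "osub F.const_ops fact ?Z" "osub F.const_ops fact ?B" "osub F.const_ops fact ?V"
      by (rule osub_lift_submodule, rule submodule_Zt submodule_Bt submodule_V[OF generated])+
    have VZ: "?V k \<subseteq> ?Z k" for k :: int by (rule lift_mono) (auto simp: V_def)
    have BV: "?B k \<subseteq> ?V k" for k :: int by (rule lift_mono[OF Bt_V])
    have BZ: "?B k \<subseteq> ?Z k" for k :: int by (rule lift_mono[OF Bt_Zt])
    have V': "bnd dd ?C base (int q) k \<subseteq> ?V k" "?V k \<subseteq> cyc dd ?C base (int q) k" for k
      unfolding cb by (rule BV, rule VZ)
    have B': "bnd dd ?C base (int q) k \<subseteq> ?B k" "?B k \<subseteq> cyc dd ?C base (int q) k" for k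
      unfolding cb using BZ by auto
    have Z': "bnd dd ?C base (int q) k \<subseteq> ?Z k" "?Z k \<subseteq> cyc dd ?C base (int q) k" for k
      unfolding cb using BZ by auto
    let ?SZ = "F.splice ?C (int q) ?Z base" and ?SV = "F.splice ?C (int q) ?V base" and ?SB = "F.splice ?C (int q) ?B base"
    note cVB = F.cyc_bnd_between(1)[OF c os(3) V' os(2) B'(1) BV]
    note cZB = F.cyc_bnd_between(1)[OF c os(1) Z' os(2) B'(1) BZ]
    note cZV = F.cyc_bnd_between(1)[OF c os(1) Z' os(3) V'(1) VZ]
    have UT: "F.truncU dd ?C base (int q) = ?SZ" "F.truncT dd ?C base (int q) = ?SB"
      unfolding cb by simp_all
    have bn: "bounded_noetherian Om0 fact (\<lambda>k. lift q (Zt q \<inter> Eg q k)) (\<lambda>k. lift q (Bt q \<inter> Eg q k))"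
      using bounded_noetherian_cohomology[OF degree_one generated noetherian_M, of q] unfolding graded_cyc graded_bnd .
    have "N.hs dd ?SV ?SB n" for n
      by (rule N.hs_between[OF c os(3) V' os(2) B'(1) BV noetherian_V[OF generated bn]])
    then have hs: "chain_condition True F.const_ops fact (cyc dd ?SV ?SB n) (bnd dd ?SV ?SB n)" for n
      unfolding N.hs_def .
    have ra: "F.radd (?SV n) (?SB n)" for n
    proof (rule radd_fam)
      show "base n k \<subseteq> ?SB n k" for n k
        using F.trunc_le(3)[OF c, where q = "int q" and n = n and k = k] unfolding UT(2) .
      show "?SV n k \<subseteq> ?C n k" for n k
      proof -
        have "?SV n k \<subseteq> ?SZ n k" using VZ by (simp add: F.splice_def)
        also have "\<dots> \<subseteq> ?C n k"
          using F.trunc_le(4)[OF c, where q = "int q" and n = n and k = k] unfolding UT(1) .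
        finally show ?thesis .
      qed
    qed
    have VB: "A.khs ys dd ?SV ?SB n" for n
      by (rule artinian_kos[OF cVB ra zxs_carrier residue_field hs])
    \<comment> \<open>Koszul degree 0 of Z/V, from Koszul degree 0 of Z/B and degree 1 of V/B; it
      yields the socle of Z/V.\<close>
    have "A.khs ys dd ?SZ ?SV (int q)"
      by (rule A.khs_les2[OF ys_const cZV ys_const cVB ys_const cZB IH[of "int q", unfolded UT] VB]) simp
    from A.sm_socle_between[OF ys_const c os(1) Z' os(3) V'(1) VZ this]
    have soc: "chain_condition False F.const_ops fact (F.socle ys ?Z ?V) ?V" .
    have "chain_condition False F.const_ops fact ?Z ?V"
    proof (rule F.artinian_if_socle[OF ys_const os(1,3) VZ _ soc])
      fix y assume "y \<in> set ys"
      then obtain t where t: "y = (t, 0)" "t \<in> set (zs @ xs)" unfolding set_map by (elim imageE)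
      show "power_torsion fact y ?Z ?V" unfolding t(1) by (rule power_torsion_V[OF m t(2)])
    qed
    from A.khs_between[OF ys_const c os(1) Z' os(3) V'(1) VZ this]
    have ZV: "A.khs ys dd ?SZ ?SV n" for n .
    \<comment> \<open>Both factors V/B and Z/V of \<open>H\<^sup>q\<close> are now good in all
      Koszul degrees.\<close>
    show ?case
      unfolding UT by (rule A.khs_les1[OF ys_const cZV ys_const cVB ys_const cZB VB ZV])
  qed
  then show ?thesis by (rule low[OF _ n])
qed

end

section \<open>Local cohomology\<close>

text \<open>Connects the pairs of submodules used so far with the coset modules in which local
  cohomology is stated.\<close>

locale subquotient = module R M for R :: "('r, 'x) ring_scheme" (structure) and M :: "('r, 'm, 'y) module_scheme" +
  fixes Z K
  assumes Z: "submodule Z R M" and K: "submodule K R M" and KZ: "K \<subseteq> Z"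
begin

definition Q :: "('r, 'm set) module" where "Q = quotient_module (M\<lparr>carrier := Z\<rparr>) K"

definition cl :: "'m => 'm set" where "cl z = K +>\<^bsub>M\<^esub> z"

lemma coset_carrier_update: "a_r_coset (M\<lparr>carrier := S\<rparr>) = a_r_coset M"
  by (intro ext) (simp add: a_r_coset_def r_coset_def)

lemma Q_simps: "carrier Q = cl ` Z" "ring.zero Q = K" "add Q = set_add M"
    "smult Q = (\<lambda>a U. \<Union>x\<in>U. K +>\<^bsub>M\<^esub> (a \<odot>\<^bsub>M\<^esub> x))"
proof -
  show "carrier Q = cl ` Z"
    by (auto simp: Q_def quotient_module_def A_RCOSETS_def RCOSETS_def cl_def a_r_coset_def r_coset_def)
  show "ring.zero Q = K" by (simp add: Q_def quotient_module_def)
  show "add Q = set_add M" by (intro ext) (simp add: Q_def quotient_module_def set_add_def set_mult_def)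
  show "smult Q = (\<lambda>a U. \<Union>x\<in>U. K +>\<^bsub>M\<^esub> (a \<odot>\<^bsub>M\<^esub> x))"
    by (simp add: Q_def quotient_module_def coset_carrier_update)
qed

lemmas Zs = submoduleE[OF Z] and Ks = submoduleE[OF K]

lemma Z_zero: "\<zero>\<^bsub>M\<^esub> \<in> Z" and K_zero: "\<zero>\<^bsub>M\<^esub> \<in> K"
  using subgroup.one_closed[OF submodule.axioms(1)[OF Z]] subgroup.one_closed[OF submodule.axioms(1)[OF K]] by simp_all

lemma abelian_subgroup_K: "abelian_subgroup K M"
  using submodule.axioms(1)[OF K] by (intro abelian_subgroupI3 additive_subgroup.intro M.abelian_group_axioms)

lemma Zc: "z \<in> Z ==> z \<in> carrier M"
  using Zs(1) by blast

lemma cl_mem: "z \<in> carrier M ==> x \<in> cl z \<longleftrightarrow> x \<in> carrier M \<and> x \<ominus>\<^bsub>M\<^esub> z \<in> K"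
proof -
  interpret K: abelian_subgroup K M by (rule abelian_subgroup_K)
  assume c: "z \<in> carrier M"
  show ?thesis
    unfolding cl_def M.minus_eq using K.a_rcos_module[OF c, of x] K.a_elemrcos_carrier[OF c, of x] by blast
qed

lemma cl_eq_iff: "z \<in> carrier M ==> w \<in> carrier M ==> cl z = cl w \<longleftrightarrow> z \<ominus>\<^bsub>M\<^esub> w \<in> K"
proof
  assume c: "z \<in> carrier M" "w \<in> carrier M"
  have "z \<in> cl z" using cl_mem[OF c(1), of z] c(1) K_zero by (simp add: M.minus_eq M.r_neg)
  then show "cl z = cl w ==> z \<ominus>\<^bsub>M\<^esub> w \<in> K" using cl_mem[OF c(2), of z] by simp
  assume zw: "z \<ominus>\<^bsub>M\<^esub> w \<in> K"
  have "\<ominus>\<^bsub>M\<^esub> (z \<ominus>\<^bsub>M\<^esub> w) \<in> K" by (rule Ks(3)[OF zw])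
  then have wz: "w \<ominus>\<^bsub>M\<^esub> z \<in> K" using c by (simp add: M.minus_eq M.minus_add M.a_comm)
  have tr: "x \<ominus>\<^bsub>M\<^esub> b \<in> K" if "x \<ominus>\<^bsub>M\<^esub> a \<in> K" "a \<ominus>\<^bsub>M\<^esub> b \<in> K" "x \<in> carrier M" "a \<in> carrier M" "b \<in> carrier M" for a b x
  proof -
    have "(x \<ominus>\<^bsub>M\<^esub> a) \<oplus>\<^bsub>M\<^esub> (a \<ominus>\<^bsub>M\<^esub> b) = x \<ominus>\<^bsub>M\<^esub> b" using that by (simp add: M.minus_eq M.a_assoc M.r_neg1)
    then show ?thesis using Ks(5)[OF that(1,2)] by simp
  qed
  show "cl z = cl w"
    using tr[OF _ zw _ c] tr[OF _ wz _ c(2,1)] by (auto simp: cl_mem[OF c(1)] cl_mem[OF c(2)])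
qed

lemma cl_add: "z \<in> carrier M ==> w \<in> carrier M ==> cl z \<oplus>\<^bsub>Q\<^esub> cl w = cl (z \<oplus>\<^bsub>M\<^esub> w)"
  using abelian_subgroup.a_rcos_sum[OF abelian_subgroup_K, of z w] by (simp add: Q_simps cl_def)

lemma cl_zero: "cl \<zero>\<^bsub>M\<^esub> = \<zero>\<^bsub>Q\<^esub>"
  using Ks(1) by (auto simp: Q_simps cl_def a_r_coset_def r_coset_def subset_iff image_iff)

lemma cl_smult: "r \<in> carrier R ==> z \<in> carrier M ==> r \<odot>\<^bsub>Q\<^esub> cl z = cl (r \<odot>\<^bsub>M\<^esub> z)"
proof -
  assume r: "r \<in> carrier R" and z: "z \<in> carrier M"
  have eq: "cl (r \<odot>\<^bsub>M\<^esub> x) = cl (r \<odot>\<^bsub>M\<^esub> z)" if "x \<in> cl z" for x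
  proof -
    have x: "x \<in> carrier M" "x \<ominus>\<^bsub>M\<^esub> z \<in> K" using that cl_mem[OF z] by auto
    have "r \<odot>\<^bsub>M\<^esub> (x \<ominus>\<^bsub>M\<^esub> z) \<in> K" by (rule Ks(4)[OF r x(2)])
    then show ?thesis using x z r by (simp add: cl_eq_iff M.minus_eq smult_r_distr smult_r_minus)
  qed
  moreover have "z \<in> cl z" using z K_zero by (simp add: cl_mem M.minus_eq M.r_neg)
  ultimately have "(\<Union>x\<in>cl z. cl (r \<odot>\<^bsub>M\<^esub> x)) = cl (r \<odot>\<^bsub>M\<^esub> z)" by blast
  then show ?thesis by (simp add: Q_simps cl_def[symmetric])
qed

text \<open>Stated for a subset S because the homogeneous components of the quotient are subgroups
  but not R-submodules.\<close>

lemma abelian_group_part: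
  assumes S: "S \<subseteq> Z" "\<zero>\<^bsub>M\<^esub> \<in> S" "!!v w. v \<in> S ==> w \<in> S ==> v \<ominus>\<^bsub>M\<^esub> w \<in> S"
  shows "abelian_group (Q\<lparr>carrier := cl ` S\<rparr>)" "v \<in> S ==> \<ominus>\<^bsub>Q\<lparr>carrier := cl ` S\<rparr>\<^esub> cl v = cl (\<ominus>\<^bsub>M\<^esub> v)"
    "v \<in> S ==> \<ominus>\<^bsub>M\<^esub> v \<in> S"
proof -
  have c: "v \<in> carrier M" if "v \<in> S" for v using that S(1) Zs(1) by blast
  show neg: "\<ominus>\<^bsub>M\<^esub> v \<in> S" if "v \<in> S" for v
    using S(3)[OF S(2) that] c[OF that] by (simp add: M.minus_eq)
  have pl: "v \<oplus>\<^bsub>M\<^esub> w \<in> S" if "v \<in> S" "w \<in> S" for v w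
    using S(3)[OF that(1) neg[OF that(2)]] c[OF that(1)] c[OF that(2)] by (simp add: M.minus_eq)
  show ag: "abelian_group (Q\<lparr>carrier := cl ` S\<rparr>)"
  proof (rule abelian_groupI)
    show "\<exists>y\<in>carrier (Q\<lparr>carrier := cl ` S\<rparr>). y \<oplus>\<^bsub>Q\<lparr>carrier := cl ` S\<rparr>\<^esub> x = \<zero>\<^bsub>Q\<lparr>carrier := cl ` S\<rparr>\<^esub>"
      if x: "x \<in> carrier (Q\<lparr>carrier := cl ` S\<rparr>)" for x
    proof -
      obtain v where v: "v \<in> S" "x = cl v" using x by auto
      have "cl (\<ominus>\<^bsub>M\<^esub> v) \<oplus>\<^bsub>Q\<^esub> cl v = \<zero>\<^bsub>Q\<^esub>"
        using c[OF v(1)] by (simp add: cl_add M.l_neg cl_zero)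
      then show ?thesis using neg[OF v(1)] v(2) by auto
    qed
    show "\<zero>\<^bsub>Q\<lparr>carrier := cl ` S\<rparr>\<^esub> \<in> carrier (Q\<lparr>carrier := cl ` S\<rparr>)"
      using S(2) cl_zero by (simp add: rev_image_eqI)
  qed (use c pl in \<open>auto simp: cl_add cl_zero[symmetric] M.a_ac\<close>)
  show "\<ominus>\<^bsub>Q\<lparr>carrier := cl ` S\<rparr>\<^esub> cl v = cl (\<ominus>\<^bsub>M\<^esub> v)" if v: "v \<in> S"
  proof (rule abelian_group.minus_equality[OF ag])
    show "cl (\<ominus>\<^bsub>M\<^esub> v) \<oplus>\<^bsub>Q\<lparr>carrier := cl ` S\<rparr>\<^esub> cl v = \<zero>\<^bsub>Q\<lparr>carrier := cl ` S\<rparr>\<^esub>"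
      using c[OF v] by (simp add: cl_add M.l_neg cl_zero)
  qed (use v neg in auto)
qed

lemma subgroup_part:
  assumes S: "S \<subseteq> Z" "\<zero>\<^bsub>M\<^esub> \<in> S" "!!v w. v \<in> S ==> w \<in> S ==> v \<ominus>\<^bsub>M\<^esub> w \<in> S"
    and S': "S' \<subseteq> S" "\<zero>\<^bsub>M\<^esub> \<in> S'" "!!v w. v \<in> S' ==> w \<in> S' ==> v \<ominus>\<^bsub>M\<^esub> w \<in> S'"
  shows "subgroup (cl ` S') (add_monoid (Q\<lparr>carrier := cl ` S\<rparr>))"
proof -
  have c: "v \<in> carrier M" if "v \<in> S'" for v using that S'(1) S(1) Zs(1) by blast
  have neg: "\<ominus>\<^bsub>M\<^esub> v \<in> S'" if "v \<in> S'" for v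
    using S'(3)[OF S'(2) that] c[OF that] by (simp add: M.minus_eq)
  have pl: "v \<oplus>\<^bsub>M\<^esub> w \<in> S'" if "v \<in> S'" "w \<in> S'" for v w
    using S'(3)[OF that(1) neg[OF that(2)]] c[OF that(1)] c[OF that(2)] by (simp add: M.minus_eq)
  show ?thesis
  proof
    show "cl ` S' \<subseteq> carrier (add_monoid (Q\<lparr>carrier := cl ` S\<rparr>))" using S'(1) by auto
    show "x \<otimes>\<^bsub>add_monoid (Q\<lparr>carrier := cl ` S\<rparr>)\<^esub> y \<in> cl ` S'" if "x \<in> cl ` S'" "y \<in> cl ` S'" for x y
      using that pl c by (auto simp: cl_add)
    show "\<one>\<^bsub>add_monoid (Q\<lparr>carrier := cl ` S\<rparr>)\<^esub> \<in> cl ` S'"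
      using S'(2) cl_zero by (simp add: rev_image_eqI)
    show "inv\<^bsub>add_monoid (Q\<lparr>carrier := cl ` S\<rparr>)\<^esub> x \<in> cl ` S'" if x: "x \<in> cl ` S'" for x
    proof -
      obtain v where v: "v \<in> S'" "x = cl v" using x by blast
      have "inv\<^bsub>add_monoid (Q\<lparr>carrier := cl ` S\<rparr>)\<^esub> x = \<ominus>\<^bsub>Q\<lparr>carrier := cl ` S\<rparr>\<^esub> cl v"
        unfolding a_inv_def v(2) ..
      also have "\<dots> = cl (\<ominus>\<^bsub>M\<^esub> v)" using abelian_group_part(2)[OF S] v(1) S'(1) by blast
      finally show ?thesis using neg[OF v(1)] by simp
    qed
  qed
qed

lemma Z_minus: "v \<in> Z ==> w \<in> Z ==> v \<ominus>\<^bsub>M\<^esub> w \<in> Z"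
  using Zs(3,5) by (simp add: M.minus_eq)

lemma K_minus: "v \<in> K ==> w \<in> K ==> v \<ominus>\<^bsub>M\<^esub> w \<in> K"
  using Ks(3,5) by (simp add: M.minus_eq)

lemma Q_whole: "Q\<lparr>carrier := cl ` Z\<rparr> = Q"
  using Q_simps(1) by simp

lemma module_Q: "module R Q"
proof (rule moduleI)
  show "cring R" by (rule R.is_cring)
  show "abelian_group Q" using abelian_group_part(1)[OF order_refl Z_zero Z_minus] by (simp add: Q_whole)
qed (use Zs(4) Zc in \<open>auto simp: Q_simps(1) cl_smult cl_add smult_l_distr smult_r_distr smult_assoc1 M.add.m_closed\<close>)

lemma artinian_Q:
  assumes dcc: "!!P :: nat => 'm set. (!!i. submodule (P i) R M) ==> (!!i. K \<subseteq> P i) ==> (!!i. P i \<subseteq> Z) ==>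
     (!!i. P (Suc i) \<subseteq> P i) ==> \<exists>m. \<forall>i\<ge>m. P i = P m"
  shows "artinian_module R Q"
  unfolding artinian_module_def
proof (intro conjI allI impI module_Q)
  fix N :: "nat => 'm set set" assume N: "\<forall>n. submodule (N n) R Q \<and> N (Suc n) \<subseteq> N n"
  interpret Q: module R Q by (rule module_Q)
  define P where "P i = {z \<in> Z. cl z \<in> N i}" for i
  have Ni: "submodule (N i) R Q" for i using N by blast
  note n = Q.submoduleE[OF Ni]
  have Nz: "\<zero>\<^bsub>Q\<^esub> \<in> N i" for i using subgroup.one_closed[OF submodule.axioms(1)[OF Ni[of i]]] by simp
  have neg: "cl (\<ominus>\<^bsub>M\<^esub> z) = \<ominus>\<^bsub>Q\<^esub> cl z" if "z \<in> Z" for z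
    using abelian_group_part(2)[OF order_refl Z_zero Z_minus that] by (simp add: Q_whole)
  have NP: "N i = cl ` P i" for i
    using n(1)[of i] by (auto simp: P_def Q_simps(1))
  have "\<exists>m. \<forall>i\<ge>m. P i = P m"
  proof (rule dcc)
    show "submodule (P i) R M" for i
    proof (rule submoduleI)
      show "P i \<subseteq> carrier M" using Zs(1) by (auto simp: P_def)
      show "\<zero>\<^bsub>M\<^esub> \<in> P i" using Z_zero Nz cl_zero by (simp add: P_def)
      show "\<ominus>\<^bsub>M\<^esub> a \<in> P i" if "a \<in> P i" for a
        using that n(3)[of "cl a" i] neg[of a] Zs(3)[of a] by (simp add: P_def)
      show "a \<oplus>\<^bsub>M\<^esub> b \<in> P i" if "a \<in> P i" "b \<in> P i" for a b
        using that n(5)[of "cl a" i "cl b"] Zs(5)[of a b] cl_add[of a b] Zc by (simp add: P_def)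
      show "r \<odot>\<^bsub>M\<^esub> a \<in> P i" if "r \<in> carrier R" "a \<in> P i" for r a
        using that n(4)[of r "cl a" i] Zs(4)[of r a] cl_smult[of r a] Zc by (simp add: P_def)
    qed
    show "K \<subseteq> P i" for i
    proof
      fix z assume z: "z \<in> K"
      then have "cl z = cl \<zero>\<^bsub>M\<^esub>" using Ks(1) K_minus[OF z K_zero] by (subst cl_eq_iff) auto
      then show "z \<in> P i" using z KZ Nz by (auto simp: P_def cl_zero)
    qed
  qed (use N in \<open>auto simp: P_def\<close>)
  then show "\<exists>k. \<forall>n\<ge>k. N n = N k" using NP by (elim stable_image) simp
qed

end

lemma (in module_family) artinian_subquotient:
  assumes "submodule Z R (E n)" "submodule K R (E n)" "K \<subseteq> Z"
    and cc: "artinian n Z K"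
  shows "artinian_module R (quotient_module ((E n)\<lparr>carrier := Z\<rparr>) K)"
proof -
  interpret S: subquotient R "E n" Z K
    using assms(1-3) by (intro subquotient.intro modules subquotient_axioms.intro)
  have "artinian_module R S.Q"
  proof (rule S.artinian_Q)
    fix P :: "nat => 'e set"
    assume P: "!!i. submodule (P i) R (E n)" "!!i. K \<subseteq> P i" "!!i. P i \<subseteq> Z" "!!i. P (Suc i) \<subseteq> P i"
    have "\<exists>m. \<forall>i\<ge>m. (\<lambda>k::int. lift n (P i)) = (\<lambda>k. lift n (P m))"
      by (rule chain_conditionD[OF cc]) (simp_all add: osub_lift_submodule P lift_mono)
    then obtain m where m: "!!i. i \<ge> m ==> (\<lambda>k::int. lift n (P i)) = (\<lambda>k. lift n (P m))" by blast
    have "P i = P m" if "i \<ge> m" for i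
    proof -
      have eq: "lift n (P i) = lift n (P m)" using m[OF that] by (rule fun_cong)
      have dl: "down n (lift n (P i)) = P i" for i
        by (rule down_lift) (rule module.submoduleE(1)[OF modules P(1)])
      have "P i = down n (lift n (P i))" by (rule dl[symmetric])
      also have "\<dots> = P m" unfolding eq by (rule dl)
      finally show ?thesis .
    qed
    then show "\<exists>m. \<forall>i\<ge>m. P i = P m" by blast
  qed
  then show ?thesis by (simp add: S.Q_def)
qed

section \<open>Local cohomology, finite length and Koszul cohomology\<close>

context resolution_elements
begin

sublocale S: subquotient R "E q" "Zt q" "Bt q" for q
  by (intro subquotient.intro modules subquotient_axioms.intro submodule_Zt submodule_Bt Bt_Zt)

lemma torsion_part_eq:
  assumes "carrier (torsion_part R b (E n)) = tors_set R (set xs) (E n)"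
  shows "torsion_part R b (E n) = (E n)\<lparr>carrier := tors_set R (set xs) (E n)\<rparr>"
  using assms by (simp add: torsion_part_def)

lemma local_cohomology_eq:
  assumes b: "!!n. carrier (torsion_part R b (E n)) = tors_set R (set xs) (E n)"
  shows "local_cohomology R b E d q = S.Q q"
    "local_cohomology_component R b E Eg d q k = (S.Q q)\<lparr>carrier := S.cl q ` (Zt q \<inter> Eg q k)\<rparr>"
proof -
  let ?C = "\<lambda>k. torsion_part R b (E k)"
  note t = torsion_part_eq[OF b]
  have cc: "cocycles ?C d q = Zt q" by (auto simp: cocycles_def t Zt_def)
  have cb: "coboundaries ?C d q = Bt q" by (auto simp: coboundaries_def t Bt_def split: nat.split)
  show lc: "local_cohomology R b E d q = S.Q q"
    unfolding local_cohomology_def cohomology_def cc cb by (simp add: S.Q_def t)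
  have "(\<lambda>z. Bt q +>\<^bsub>?C q\<^esub> z) = S.cl q"
    by (rule ext) (simp add: t S.coset_carrier_update S.cl_def)
  then show "local_cohomology_component R b E Eg d q k = (S.Q q)\<lparr>carrier := S.cl q ` (Zt q \<inter> Eg q k)\<rparr>"
    unfolding local_cohomology_component_def Let_def lc cc cb by simp
qed

text \<open>Nakayama's argument: if no power of z kills w, the \<open>R\<^sub>0\<close>-submodules
  generated by z^j w descend strictly, since z^j w = r z^(j+1) w would make the unit 1 - r z kill
  z^j w. Then the length is infinite.\<close>

lemma power_annihilates_if_finite_length:
  assumes len: "module_length (degree_zero_ring R Rg) ((S.Q q)\<lparr>carrier := S.cl q ` (Zt q \<inter> Eg q k)\<rparr>) < \<infinity>"
    and w: "w \<in> Zt q" "w \<in> Eg q k" and z: "z \<in> Rg 0"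
    and unit: "!!r. r \<in> Rg 0 ==> \<exists>u\<in>Rg 0. u \<otimes> (\<one> \<ominus> r \<otimes> z) = \<one>"
  shows "\<exists>N::nat. z [^] N \<odot>[q] w \<in> Bt q"
proof (rule ccontr)
  assume neg: "\<not> ?thesis"
  note zz = S.submoduleE[OF submodule_Zt] and b = S.submoduleE[OF submodule_Bt]
  have Bz: "\<zero>[q] \<in> Bt q" by (rule module_zero_mem[OF submodule_Bt])
  have wc: "w \<in> carrier (E q)" using w(1) zz(1) by blast
  have zc: "z \<in> carrier R" by (rule Rg_carrier[OF z])
  have zj: "z [^] j \<in> carrier R" "z [^] j \<in> Rg 0" for j :: nat using zc Rg_pow[OF z, of j] by auto
  note R0 = additive_subgroupD[OF R.abelian_group_axioms rcompD(1)[of 0]]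
  let ?P = "Zt q \<inter> Eg q k"
  have P: "?P \<subseteq> Zt q" "\<zero>[q] \<in> ?P" "!!v u. v \<in> ?P ==> u \<in> ?P ==> v \<ominus>[q] u \<in> ?P"
    using G.A_zero module_zero_mem[OF submodule_Zt] module_minus_closed[OF submodule_Zt] Eg_minus by auto
  define y where "y j = z [^] j \<odot>[q] w" for j :: nat
  have yc: "y j \<in> carrier (E q)" for j using wc zj by (simp add: y_def)
  have yP: "y j \<in> ?P" for j using zz(4)[OF zj(1) w(1)] Eg_smult[OF zj(2) w(2)] by (simp add: y_def)
  have ySuc: "y (Suc j) = z \<odot>[q] y j" for j
    using R.m_comm[OF zj(1) zc, of j] wc zc zj by (simp add: y_def S.smult_assoc1)
  define S where "S j = {v \<in> ?P. \<exists>r\<in>Rg 0. v \<ominus>[q] r \<odot>[q] y j \<in> Bt q}" for j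
  have SP: "S j \<subseteq> ?P" for j by (auto simp: S_def)
  have S0: "\<zero>[q] \<in> S j" for j
    using P(2) R0(2) Bz yc[of j] by (auto simp: S_def S.M.minus_eq S.M.r_neg intro!: bexI[of _ \<zero>])
  have Sm: "v \<ominus>[q] u \<in> S j" if v: "v \<in> S j" and u: "u \<in> S j" for v u j
  proof -
    obtain r s where rs: "r \<in> Rg 0" "v \<ominus>[q] r \<odot>[q] y j \<in> Bt q" "s \<in> Rg 0" "u \<ominus>[q] s \<odot>[q] y j \<in> Bt q"
      using v u by (auto simp: S_def)
    have c: "v \<in> carrier (E q)" "u \<in> carrier (E q)" "r \<in> carrier R" "s \<in> carrier R"
      using v u SP zz(1) Rg_carrier rs by blast+
    have "(v \<ominus>[q] r \<odot>[q] y j) \<ominus>[q] (u \<ominus>[q] s \<odot>[q] y j) \<in> Bt q"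
      by (rule module_minus_closed[OF submodule_Bt rs(2,4)])
    moreover have "(v \<ominus>[q] r \<odot>[q] y j) \<ominus>[q] (u \<ominus>[q] s \<odot>[q] y j) = (v \<ominus>[q] u) \<ominus>[q] (r \<ominus> s) \<odot>[q] y j"
      using c yc[of j] by (simp add: S.M.minus_eq R.minus_eq S.smult_l_distr S.smult_l_minus S.M.minus_add S.M.a_ac)
    moreover have "r \<ominus> s \<in> Rg 0" using R0(3)[OF rs(1) R0(4)[OF rs(3)]] by (simp add: R.minus_eq)
    ultimately show ?thesis using P(3)[of v u] v u SP unfolding S_def by (auto intro!: bexI[of _ "r \<ominus> s"])
  qed
  have Sr: "r \<odot>[q] v \<in> S j" if r: "r \<in> Rg 0" and v: "v \<in> S j" for r v j
  proof -
    obtain s where s: "s \<in> Rg 0" "v \<ominus>[q] s \<odot>[q] y j \<in> Bt q" using v by (auto simp: S_def)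
    have c: "v \<in> carrier (E q)" "s \<in> carrier R" "r \<in> carrier R" using v SP zz(1) Rg_carrier s r by blast+
    have "r \<odot>[q] (v \<ominus>[q] s \<odot>[q] y j) \<in> Bt q" by (rule b(4)[OF c(3) s(2)])
    then have "r \<odot>[q] v \<ominus>[q] (r \<otimes> s) \<odot>[q] y j \<in> Bt q"
      using c yc[of j] by (simp add: S.M.minus_eq S.smult_r_distr S.smult_r_minus S.smult_assoc1)
    moreover have "r \<otimes> s \<in> Rg 0" using Rg_mult[OF r s(1)] by simp
    moreover have "r \<odot>[q] v \<in> ?P" using v SP zz(4)[OF c(3), of v] Eg_smult[OF r, of v q k] by auto
    ultimately show ?thesis unfolding S_def by blast
  qed
  have SB: "v \<in> S j" if vu: "v \<in> ?P" "u \<in> S j" "v \<ominus>[q] u \<in> Bt q" for v u j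
  proof -
    obtain s where s: "s \<in> Rg 0" "u \<ominus>[q] s \<odot>[q] y j \<in> Bt q" using vu(2) by (auto simp: S_def)
    have c: "v \<in> carrier (E q)" "u \<in> carrier (E q)" "s \<in> carrier R" using vu(1,2) SP zz(1) Rg_carrier s by blast+
    have "(v \<ominus>[q] u) \<oplus>[q] (u \<ominus>[q] s \<odot>[q] y j) = v \<ominus>[q] s \<odot>[q] y j"
      using c yc[of j] by (simp add: S.M.minus_eq S.M.a_assoc S.M.r_neg1)
    then show ?thesis using b(5)[OF vu(3) s(2)] s(1) vu(1) by (auto simp: S_def)
  qed
  have Sd: "S (Suc j) \<subseteq> S j" for j
  proof
    fix v assume v: "v \<in> S (Suc j)"
    then obtain s where s: "s \<in> Rg 0" "v \<ominus>[q] s \<odot>[q] y (Suc j) \<in> Bt q" by (auto simp: S_def)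
    have "s \<odot>[q] y (Suc j) = (s \<otimes> z) \<odot>[q] y j" using Rg_carrier[OF s(1)] zc yc[of j] by (simp add: ySuc S.smult_assoc1)
    moreover have "s \<otimes> z \<in> Rg 0" using Rg_mult[OF s(1) z] by simp
    ultimately show "v \<in> S j" using v s(2) by (auto simp: S_def)
  qed
  have yS: "y j \<in> S j" for j
    using yP[of j] yc[of j] Bz one_Rg by (auto simp: S_def S.M.minus_eq S.M.r_neg intro!: bexI[of _ \<one>])
  have yn: "y j \<notin> S (Suc j)" for j
  proof
    assume "y j \<in> S (Suc j)"
    then obtain r where r: "r \<in> Rg 0" "y j \<ominus>[q] r \<odot>[q] y (Suc j) \<in> Bt q" by (auto simp: S_def)
    have rc: "r \<in> carrier R" by (rule Rg_carrier[OF r(1)])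
    obtain u where u: "u \<in> Rg 0" "u \<otimes> (\<one> \<ominus> r \<otimes> z) = \<one>" using unit[OF r(1)] by blast
    have uc: "u \<in> carrier R" by (rule Rg_carrier[OF u(1)])
    have "y j \<ominus>[q] r \<odot>[q] y (Suc j) = (\<one> \<ominus> r \<otimes> z) \<odot>[q] y j"
      using rc zc yc[of j] by (simp add: ySuc S.smult_assoc1 S.M.minus_eq R.minus_eq S.smult_l_distr S.smult_l_minus)
    then have "u \<odot>[q] ((\<one> \<ominus> r \<otimes> z) \<odot>[q] y j) \<in> Bt q" using b(4)[OF uc r(2)] by simp
    moreover have "u \<odot>[q] ((\<one> \<ominus> r \<otimes> z) \<odot>[q] y j) = y j"
      using S.smult_assoc1[of u "\<one> \<ominus> r \<otimes> z" "y j"] uc rc zc yc[of j] u(2) by simp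
    ultimately show False using neg by (auto simp: y_def)
  qed
  let ?Q = "(S.Q q)\<lparr>carrier := S.cl q ` ?P\<rparr>"
  have sub: "submodule (S.cl q ` S j) (degree_zero_ring R Rg) ?Q" for j
  proof (intro submodule.intro submodule_axioms.intro)
    show "subgroup (S.cl q ` S j) (add_monoid ?Q)" by (rule S.subgroup_part[OF P SP S0 Sm])
    fix a x assume a: "a \<in> carrier (degree_zero_ring R Rg)" and x: "x \<in> S.cl q ` S j"
    then obtain v where v: "v \<in> S j" "x = S.cl q v" "a \<in> Rg 0" by auto
    have "v \<in> carrier (E q)" using v(1) SP zz(1) by blast
    then have "a \<odot>\<^bsub>?Q\<^esub> x = S.cl q (a \<odot>[q] v)" using S.cl_smult[OF Rg_carrier[OF v(3)], of v q] v(2) by simp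
    then show "a \<odot>\<^bsub>?Q\<^esub> x \<in> S.cl q ` S j" using Sr[OF v(3,1)] by simp
  qed
  have strict: "S.cl q ` S (Suc j) \<subset> S.cl q ` S j" for j
  proof
    show "S.cl q ` S (Suc j) \<subseteq> S.cl q ` S j" using Sd by blast
    have "S.cl q (y j) \<notin> S.cl q ` S (Suc j)"
    proof
      assume "S.cl q (y j) \<in> S.cl q ` S (Suc j)"
      then obtain v where v: "v \<in> S (Suc j)" "S.cl q (y j) = S.cl q v" by blast
      have "v \<in> carrier (E q)" using v(1) SP zz(1) by blast
      then have "y j \<ominus>[q] v \<in> Bt q" using v(2) S.cl_eq_iff[OF yc] by simp
      then show False using SB[OF yP v(1)] yn by blast
    qed
    then show "S.cl q ` S (Suc j) \<noteq> S.cl q ` S j" using yS[of j] by blast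
  qed
  have "enat n \<le> module_length (degree_zero_ring R Rg) ?Q" for n
    unfolding module_length_def
  proof (rule Sup_upper, intro CollectI exI conjI allI impI)
    show "enat n = enat n" ..
    \<comment> \<open>Length is measured by ascending chains, so the first n steps are read
      backwards.\<close>
    show "submodule (S.cl q ` S (n - i)) (degree_zero_ring R Rg) ?Q" for i by (rule sub)
    show "S.cl q ` S (n - i) \<subset> S.cl q ` S (n - Suc i)" if "i < n" for i
      using strict[of "n - Suc i"] that by (simp add: Suc_diff_Suc)
  qed
  then have "module_length (degree_zero_ring R Rg) ?Q = \<infinity>"
    by (metis enat_ord_simps(4) Suc_ile_eq enat.exhaust less_irrefl not_infinity_eq)
  then show False using len by simp
qed

text \<open>A submodule of \<open>E 0\<close> as a complex in the single degree j, to be used with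
  zero differential. The degree j is kept because the Koszul cohomology of \<open>H\<^sup>j\<close>
  was obtained with \<open>H\<^sup>j\<close> in that degree.\<close>

definition conc :: "int => 'e set => int => int => 'e ambient set" where
  "conc j S n k = (if n = j then lift 0 S else {0})"

lemma cpx_conc:
  assumes S: "submodule S R (E 0)" and T: "submodule T R (E 0)" and TS: "T \<subseteq> S"
  shows "F.cpx F.const_ops (\<lambda>_. 0) (conc j S) (conc j T)"
    and "cyc (\<lambda>_. 0) (conc j S) (conc j T) = conc j S" and "bnd (\<lambda>_. 0) (conc j S) (conc j T) = conc j T"
proof -
  have os: "osub F.const_ops fact (conc j S n)" if "submodule S R (E 0)" for S n
    using osub_lift_submodule[OF that] F.osub_zero by (cases "n = j") (simp_all add: conc_def[abs_def])
  have z: "0 \<in> conc j S n k" if "submodule S R (E 0)" for S n k using osubD(1)[OF os[OF that]] .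
  have sub: "conc j T n k \<subseteq> conc j S n k" for n k using lift_mono[OF TS] by (simp add: conc_def)
  show "F.cpx F.const_ops (\<lambda>_. 0) (conc j S) (conc j T)"
    unfolding F.cpx_def
  proof (intro conjI allI ballI)
    show "F.equivariant (\<lambda>_. 0)" by (simp add: F.equivariant_def additive_def F.act_simps)
  qed (rule os[OF S] os[OF T] z[OF S] z[OF T] sub)+
  show "cyc (\<lambda>_. 0) (conc j S) (conc j T) = conc j S"
    using z[OF T] by (intro ext) (simp add: cyc_def)
  show "bnd (\<lambda>_. 0) (conc j S) (conc j T) = conc j T"
  proof (intro ext Set.set_eqI iffI)
    fix n k x
    assume x: "x \<in> conc j T n k"
    have "0 \<in> conc j S (n - 1) k" by (rule z[OF S])
    then show "x \<in> bnd (\<lambda>_. 0) (conc j S) (conc j T) n k"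
      unfolding bnd_def using x subsetD[OF sub x] by (intro CollectI conjI bexI[of _ 0]) simp_all
  qed (simp add: bnd_def)
qed

lemma acyc_conc: "submodule S R (E 0) ==> submodule T R (E 0) ==> T \<subseteq> S ==> n \<noteq> j ==> F.acyc (\<lambda>_. 0) (conc j S) (conc j T) n"
  unfolding F.acyc_def by (simp add: cpx_conc) (simp add: conc_def)

text \<open>The degree 0 part of \<open>level_bij_gam\<close>, moved to degree j.\<close>

lemma level_bij_conc:
  assumes T: "T \<subseteq> set xs" and x: "x \<in> set xs"
  shows "F.level_bij (x, 0) (conc j (tors_set R T (E 0))) (conc j (tors_set R (insert x T) (E 0)))"
proof -
  have t: "tors_set R T' (E 0) \<inter> carrier (E 0) = tors_set R T' (E 0)" for T' by (auto simp: tors_set_def)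
  have g: "T.gam T' 0 k = lift 0 (tors_set R T' (E 0))" for T' k
    using fam_nat[of "\<lambda>n k. tors_set R T' (E n) \<inter> carrier (E n)" 0 k] by (simp add: t)
  note lb = T.level_bij_gam[OF T x, unfolded F.level_bij_def fst_conv snd_conv, THEN spec, of 0, THEN spec, unfolded g]
  show ?thesis
    unfolding F.level_bij_def fst_conv snd_conv
  proof (intro allI)
    fix n k
    show "(\<forall>v\<in>conc j (tors_set R T (E 0)) n k. fact x v \<in> conc j (tors_set R (insert x T) (E 0)) n (k + 0) -->
          v \<in> conc j (tors_set R (insert x T) (E 0)) n k) \<and>
        (\<forall>v\<in>conc j (tors_set R T (E 0)) n (k + 0). \<exists>u\<in>conc j (tors_set R T (E 0)) n k.
          v - fact x u \<in> conc j (tors_set R (insert x T) (E 0)) n (k + 0))"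
      using lb F.act_simps(3)[of x] by (cases "n = j") (simp_all add: conc_def)
  qed
qed

text \<open>\<open>Z0\<close> stands for the resolved module H, every element of which is torsion
  for \<open>ts\<close>; the degrees j and j + 1 are Koszul degrees 0 and 1 of H. The aim is
  \<open>H\<^sup>0\<close> and \<open>H\<^sup>1\<close> of H with respect to \<open>xs\<close>. In
  the application \<open>xs\<close> generates \<open>\<mm>\<^sub>0\<close> and \<open>ts\<close>
  generates \<open>R\<^sub>+\<close>.\<close>

context
  fixes ts j
  assumes ts: "set ts \<subseteq> carrier R"
    and tors: "!!v t. v \<in> Z0 ==> t \<in> set ts ==> \<exists>n::nat. t [^] n \<odot>[0] v = \<zero>[0]"
    and khs: "!!n. n \<in> {j, j + 1} ==> koszul_class.khs fact finl finr fev fod (chain_condition False F.const_ops fact)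
      (map (\<lambda>t. (t, 0)) (xs @ ts)) (\<lambda>_. 0) (conc j Z0) (conc j {\<zero>[0]}) n"
begin

interpretation A: koszul_class fact finl finr fev fod F.const_ops "chain_condition False F.const_ops fact"
  by (intro koszul_class.intro F.pairing_axioms F.serre_chain_condition order_refl)

abbreviation "xts == map (\<lambda>t. (t, 0 :: int)) (xs @ ts)"

lemma xts_const: "set xts \<subseteq> F.const_ops"
  using xs_carrier' ts by (auto simp: F.const_ops_def)

abbreviation "K S T n == A.khs xts (\<lambda>_. 0) (conc j S) (conc j T) n"

lemma submodule_torsion: "submodule (tors_set R T (E 0)) R (E 0)" if "T \<subseteq> set xs"
  using that xs_carrier' by (intro S.submodule_tors_set) blast

lemma K_if_artinian:
  assumes S: "submodule S R (E 0)" and T: "submodule T R (E 0)" and TS: "T \<subseteq> S"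
    and cc: "artinian 0 S T"
  shows "K S T n"
proof (rule A.khs_if_hs[OF xts_const cpx_conc(1)[OF S T TS]])
  fix m
  show "A.hs (\<lambda>_. 0) (conc j S) (conc j T) m"
  proof (cases "m = j")
    case True
    then show ?thesis using cc unfolding A.hs_def cpx_conc(2,3)[OF S T TS] by (simp add: conc_def[abs_def])
  next
    case False
    then show ?thesis unfolding A.hs_def cpx_conc(2,3)[OF S T TS] by (intro chain_condition_triv) (simp add: conc_def)
  qed
qed

lemma socle_if_K:
  assumes S: "submodule S R (E 0)" and T: "submodule T R (E 0)" and TS: "T \<subseteq> S" and K: "K S T j"
  shows "chain_condition False F.const_ops fact (F.socle xts (\<lambda>k. lift 0 S) (\<lambda>k. lift 0 T)) (\<lambda>k. lift 0 T)"
proof -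
  have "F.acyc (\<lambda>_. 0) (conc j S) (conc j T) m" if "m < j" for m by (rule acyc_conc[OF S T TS]) (use that in simp)
  from A.sm_socle_if_khs[OF xts_const cpx_conc(1)[OF S T TS] this K] show ?thesis
    unfolding cpx_conc(2,3)[OF S T TS] by (simp add: conc_def[abs_def])
qed

text \<open>The socle is controlled in a larger module S', where Koszul cohomology computes it,
  while torsion is known on S only.\<close>

lemma artinian_from_socle:
  assumes S: "submodule S R (E 0)" and T: "submodule T R (E 0)" and TS: "T \<subseteq> S"
    and S': "submodule S' R (E 0)" "S \<subseteq> S'"
    and soc: "chain_condition False F.const_ops fact (F.socle xts (\<lambda>k. lift 0 S') (\<lambda>k. lift 0 T)) (\<lambda>k. lift 0 T)"
    and tor: "!!t v. t \<in> set (xs @ ts) ==> v \<in> S ==> \<exists>n::nat. t [^] n \<odot>[0] v \<in> T"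
  shows "artinian 0 S T"
proof (rule F.artinian_if_socle[OF xts_const osub_lift_submodule[OF S] osub_lift_submodule[OF T] lift_mono[OF TS]])
  show "chain_condition False F.const_ops fact (F.socle xts (\<lambda>k. lift 0 S) (\<lambda>k. lift 0 T)) (\<lambda>k. lift 0 T)"
    by (rule chain_condition_mono[OF soc]) (use lift_mono[OF S'(2), of 0] in \<open>auto simp: F.socle_def\<close>)
  fix y assume "y \<in> set xts"
  then obtain t where t: "y = (t, 0)" "t \<in> set (xs @ ts)" unfolding set_map by (elim imageE)
  show "power_torsion fact y (\<lambda>k. lift 0 S) (\<lambda>k. lift 0 T)"
    unfolding t(1) by (rule power_torsion_lift) (use t(2) xs_carrier' ts tor in auto)
qed

lemma Zt_0: "Zt 0 = tors_set R (set xs) (E 0) \<inter> Z0"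
  by (auto simp: Zt_def Z0_def tors_set_def)

lemma artinian_Zt_0: "artinian 0 (Zt 0) {\<zero>[0]}"
proof (rule artinian_from_socle[OF submodule_Zt submodule_zero _ submodule_Z0])
  show "{\<zero>[0]} \<subseteq> Zt 0" using module_zero_mem[OF submodule_Zt] by blast
  show "Zt 0 \<subseteq> Z0" by (simp add: Zt_0)
  show "chain_condition False F.const_ops fact (F.socle xts (\<lambda>k. lift 0 Z0) (\<lambda>k. lift 0 {\<zero>[0]})) (\<lambda>k. lift 0 {\<zero>[0]})"
    using module_zero_mem[OF submodule_Z0] khs[of j] by (intro socle_if_K submodule_Z0 submodule_zero) auto
  show "\<exists>n::nat. t [^] n \<odot>[0] v \<in> {\<zero>[0]}" if "t \<in> set (xs @ ts)" "v \<in> Zt 0" for t v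
    using that tors[of v t] by (auto simp: Zt_0 tors_set_def)
qed

text \<open>Torsion conditions are imposed for one element of \<open>xs\<close> at a time; each
  factor is Koszul acyclic since that element acts bijectively on it.\<close>

lemma K_torsion: "K (carrier (E 0)) (tors_set R (set xs) (E 0)) n"
proof -
  have c: "submodule (carrier (E 0)) R (E 0)" by (rule S.submoduleI) auto
  have sub: "tors_set R T (E 0) \<subseteq> carrier (E 0)" for T by (rule tors_carrier)
  have "K (carrier (E 0)) (tors_set R (set l) (E 0)) n" if "set l \<subseteq> set xs" for l
    using that
  proof (induction l)
    case Nil
    show ?case
      by (rule K_if_artinian[OF c submodule_torsion sub]) (auto simp: tors_set_def intro!: chain_condition_triv)
  next
    case (Cons x l)
    have x: "x \<in> set xs" "set l \<subseteq> set xs" "insert x (set l) \<subseteq> set xs" using Cons.prems by auto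
    have le: "tors_set R (insert x (set l)) (E 0) \<subseteq> tors_set R (set l) (E 0)" by (auto simp: tors_set_def)
    note s = submodule_torsion[OF x(2)] submodule_torsion[OF x(3)]
    have "F.kacyc xts (\<lambda>_. 0) (conc j (tors_set R (set l) (E 0))) (conc j (tors_set R (insert x (set l)) (E 0))) n"
      by (rule F.kacyc_level_bij[OF xts_const cpx_conc(1)[OF s le] _ level_bij_conc[OF x(2,1)]]) (use x(1) in auto)
    then have "K (tors_set R (set l) (E 0)) (tors_set R (insert x (set l)) (E 0)) n"
      by (rule A.khs_if_kacyc[OF xts_const cpx_conc(1)[OF s le]])
    then have "K (carrier (E 0)) (tors_set R (insert x (set l)) (E 0)) n"
      by (rule A.khs_les1[OF xts_const cpx_conc(1)[OF c s(1) sub] xts_const cpx_conc(1)[OF s le] xts_const cpx_conc(1)[OF c s(2) sub]])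
        (rule Cons.IH[OF x(2)])
    then show ?case by simp
  qed
  then show ?thesis by blast
qed

text \<open>\<open>d 0\<close> induces an isomorphism from W1/W0 to \<open>H\<^sup>1\<close> with
  respect to \<open>xs\<close>. So this \<open>H\<^sup>1\<close> can be studied inside the quotient
  of \<open>E 0\<close> by W0, whose Koszul cohomology is accessible.\<close>

definition W0 :: "'e set" where "W0 = {w \<in> carrier (E 0). d 0 w \<in> Bt 1}"
definition W1 :: "'e set" where "W1 = {w \<in> carrier (E 0). d 0 w \<in> Zt 1}"

lemma submodule_W: "submodule W0 R (E 0)" "submodule W1 R (E 0)"
  unfolding W0_def W1_def using submodule_preimage_d[OF submodule_Bt S.carrier_is_submodule, of 0] submodule_preimage_d[OF submodule_Zt S.carrier_is_submodule, of 0] by simp_all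

text \<open>Two elements with the same differential differ by a cocycle; hence W0 is the sum of
  \<open>Z0\<close> and the torsion submodule of \<open>E 0\<close>.\<close>

lemma W0_iff: "w \<in> W0 \<longleftrightarrow> w \<in> carrier (E 0) \<and> (\<exists>g\<in>tors_set R (set xs) (E 0). w \<ominus>[0] g \<in> Z0)"
proof -
  have "d 0 w = d 0 g \<longleftrightarrow> w \<ominus>[0] g \<in> Z0" if "w \<in> carrier (E 0)" "g \<in> carrier (E 0)" for g
    using that d_diff[OF that] S.M.minus_zero_iff[of "d 0 w" "Suc 0" "d 0 g"] d_closed[of w 0] d_closed[of g 0]
    by (auto simp: Z0_def)
  then show ?thesis using tors_carrier[of "set xs" 0] by (auto simp: W0_def Bt_def subset_iff)
qed

lemma Z0_W0: "Z0 \<subseteq> W0"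
  using module_zero_mem[OF submodule_Bt, of 1] by (auto simp: W0_def Z0_def)

lemma tors_W0: "tors_set R (set xs) (E 0) \<subseteq> W0"
  using tors_carrier[of "set xs" 0] by (auto simp: W0_def Bt_def)

text \<open>By the second isomorphism theorem W0 modulo torsion is \<open>Z0\<close> modulo
  \<open>Zt 0\<close>. This is good in degree j + 1 because \<open>Z0\<close> is, and because
  \<open>Zt 0\<close>, being Artinian, is good in all degrees.\<close>

lemma K_W0: "K W0 (tors_set R (set xs) (E 0)) (j + 1)"
proof -
  let ?G = "tors_set R (set xs) (E 0)"
  note sG = submodule_torsion[OF order_refl]
  have z0: "{\<zero>[0]} \<subseteq> Zt 0" "{\<zero>[0]} \<subseteq> Z0" "Zt 0 \<subseteq> Z0"
    using module_zero_mem[OF submodule_Zt, of 0] module_zero_mem[OF submodule_Z0] by (blast, blast, simp add: Zt_0)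
  have KG: "K (Zt 0) {\<zero>[0]} n" for n
    by (rule K_if_artinian[OF submodule_Zt submodule_zero z0(1) artinian_Zt_0])
  have KT: "K Z0 (Zt 0) (j + 1)"
    by (rule A.khs_les2[OF xts_const cpx_conc(1)[OF submodule_Z0 submodule_Zt z0(3)] xts_const
          cpx_conc(1)[OF submodule_Zt submodule_zero z0(1)] xts_const cpx_conc(1)[OF submodule_Z0 submodule_zero z0(2)] khs KG]) simp
  interpret I: pairing_hom fact finl finr fev fod fact finl finr fev fod "\<lambda>v. v"
    by unfold_locales (simp_all add: additive_def)
  have li: "I.level_iso (\<lambda>_. 0) (conc j Z0) (conc j (Zt 0)) (\<lambda>_. 0) (conc j W0) (conc j ?G)"
    unfolding I.level_iso_def
  proof (intro allI)
    fix n k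
    have s: "\<exists>v\<in>lift 0 Z0. v' - v \<in> lift 0 ?G" if v': "v' \<in> lift 0 W0" for v'
    proof -
      have c: "v' \<in> fdom 0" "val 0 v' \<in> W0" using v' by (auto simp: lift_def)
      then obtain g where g: "g \<in> ?G" "val 0 v' \<ominus>[0] g \<in> Z0" by (auto simp: W0_iff)
      define t where "t = val 0 v' \<ominus>[0] g"
      have tc: "t \<in> carrier (E 0)" using g(2) by (auto simp: t_def Z0_def)
      have f: "frag_of (0, 0, t) \<in> fdom 0" using tc by (auto simp: basis_def)
      have gc: "g \<in> carrier (E 0)" using g(1) tors_carrier by blast
      have "val 0 (v' - frag_of (0, 0, t)) = g"
        using val_diff[OF c(1) f] val_of[OF tc] val_closed[OF c(1)] gc
        by (simp add: t_def S.M.minus_eq S.M.minus_add S.M.a_assoc[symmetric] S.M.r_neg)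
      then have "v' - frag_of (0, 0, t) \<in> lift 0 ?G" using g(1) dom_add(2)[OF c(1) f] by (simp add: lift_def)
      moreover have "frag_of (0, 0, t) \<in> lift 0 Z0" unfolding lift_rep[OF tc] using g(2) by (simp add: t_def)
      ultimately show ?thesis by blast
    qed
    have m: "lift 0 Z0 \<subseteq> lift 0 W0" "lift 0 (Zt 0) \<subseteq> lift 0 ?G" by (rule lift_mono, rule Z0_W0, rule lift_mono, simp add: Zt_0)
    have i: "v \<in> lift 0 (Zt 0)" if "v \<in> lift 0 Z0" "v \<in> lift 0 ?G" for v using that by (simp add: Zt_0 lift_def)
    have z: "0 \<in> lift 0 ?G" using osubD(1)[OF osub_lift_submodule[OF sG]] .
    show "(\<forall>v\<in>conc j Z0 n k. v \<in> conc j W0 n k \<and> (v \<in> conc j ?G n k --> v \<in> conc j (Zt 0) n k) \<and>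
        0 - 0 \<in> conc j ?G (n + 1) k \<and> (\<forall>r. fact r v = fact r v)) \<and> (\<forall>v\<in>conc j (Zt 0) n k. v \<in> conc j ?G n k) \<and>
        (\<forall>v'\<in>conc j W0 n k. \<exists>v\<in>conc j Z0 n k. v' - v \<in> conc j ?G n k)"
    proof (cases "n = j")
      case True
      have "\<forall>v\<in>lift 0 Z0. v \<in> lift 0 W0 \<and> (v \<in> lift 0 ?G --> v \<in> lift 0 (Zt 0))"
        using m(1) i by blast
      moreover have "\<forall>v\<in>lift 0 (Zt 0). v \<in> lift 0 ?G" using m(2) by blast
      moreover have "\<forall>v'\<in>lift 0 W0. \<exists>v\<in>lift 0 Z0. v' - v \<in> lift 0 ?G" using s by blast
      ultimately show ?thesis using True by (simp add: conc_def)
    next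
      case False
      then show ?thesis using z by (simp add: conc_def)
    qed
  qed
  show ?thesis
    using I.kos_level_iso[OF xts_const cpx_conc(1)[OF submodule_Z0 submodule_Zt z0(3)] cpx_conc(1)[OF submodule_W(1) sG tors_W0] li order_refl] KT
    unfolding A.khs_def A.hs_def by blast
qed

text \<open>Koszul degree 0 of \<open>E 0\<close> modulo W0, which is its socle, follows from
  \<open>E 0\<close> modulo torsion in degree j and W0 modulo torsion in degree j + 1. This is where
  Koszul degree 1 of H enters.\<close>

lemma artinian_W: "artinian 0 W1 W0"
proof -
  have c: "submodule (carrier (E 0)) R (E 0)" by (rule S.submoduleI) auto
  have W0c: "W0 \<subseteq> carrier (E 0)" "W1 \<subseteq> carrier (E 0)" "W0 \<subseteq> W1" using Bt_Zt[of 1] by (auto simp: W0_def W1_def)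
  have "K (carrier (E 0)) W0 j"
    by (rule A.khs_les2[OF xts_const cpx_conc(1)[OF c submodule_W(1) W0c(1)] xts_const
          cpx_conc(1)[OF submodule_W(1) submodule_torsion[OF order_refl] tors_W0] xts_const
          cpx_conc(1)[OF c submodule_torsion[OF order_refl] tors_carrier] K_torsion K_W0])
  note soc = socle_if_K[OF c submodule_W(1) W0c(1) this]
  show ?thesis
  proof (rule artinian_from_socle[OF submodule_W(2,1) W0c(3) c W0c(2) soc])
    fix t w assume t: "t \<in> set (xs @ ts)" and w: "w \<in> W1"
    have wc: "w \<in> carrier (E 0)" using w W0c(2) by blast
    have kz: "\<exists>n::nat. x [^] n \<odot>[0] w \<in> Z0" if x: "x \<in> set xs" for x
    proof -
      obtain n :: nat where n: "x [^] n \<odot>[Suc 0] d 0 w = \<zero>[Suc 0]"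
        using w x by (auto simp: W1_def Zt_def tors_set_def)
      have xn: "x [^] n \<in> carrier R" using x xs_carrier' by auto
      have "x [^] n \<odot>[0] w \<in> Z0" using d_smult[OF wc xn] n wc xn by (simp add: Z0_def)
      then show ?thesis ..
    qed
    show "\<exists>n::nat. t [^] n \<odot>[0] w \<in> W0"
    proof (cases "t \<in> set xs")
      case True
      then obtain n :: nat where "t [^] n \<odot>[0] w \<in> Z0" using kz by blast
      then have "t [^] n \<odot>[0] w \<in> W0" by (rule subsetD[OF Z0_W0])
      then show ?thesis by (rule exI)
    next
      case False
      then have tt: "t \<in> set ts" using t by simp
      have tc: "t \<in> carrier R" using tt ts by blast
      \<comment> \<open>t may fail to be nilpotent on w itself. Some power of each x moves w into
        \<open>Z0\<close>; a common power of t kills all these multiples, so that t^N w is torsion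
        for \<open>xs\<close>.\<close>
      obtain f :: "'r => nat" where f: "!!x. x \<in> set xs ==> x [^] f x \<odot>[0] w \<in> Z0" using kz by metis
      have "\<forall>x\<in>set xs. \<exists>n::nat. t [^] n \<odot>[0] (x [^] f x \<odot>[0] w) = \<zero>[0]" using tors[OF f tt] by blast
      then obtain g :: "'r => nat" where g: "!!x. x \<in> set xs ==> t [^] g x \<odot>[0] (x [^] f x \<odot>[0] w) = \<zero>[0]" by metis
      define N where "N = sum g (set xs)"
      have tN: "t [^] N \<in> carrier R" using tc by simp
      have "x [^] f x \<odot>[0] (t [^] N \<odot>[0] w) = \<zero>[0]" if x: "x \<in> set xs" for x
      proof -
        have xc: "x [^] f x \<in> carrier R" using x xs_carrier' by auto
        have xw: "x [^] f x \<odot>[0] w \<in> carrier (E 0)" using xc wc by simp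
        have le: "g x \<le> N" unfolding N_def using x by (intro member_le_sum) auto
        have "t [^] N \<odot>[0] (x [^] f x \<odot>[0] w) = \<zero>[0]" by (rule S.pow_ann_mono[OF tc xw g[OF x] le])
        then show ?thesis using S.smult_swap[OF xc tN wc] by simp
      qed
      then have "t [^] N \<odot>[0] w \<in> tors_set R (set xs) (E 0)" using tN wc by (auto simp: tors_set_def)
      then have "t [^] N \<odot>[0] w \<in> W0" by (rule subsetD[OF tors_W0])
      then show ?thesis by (rule exI)
    qed
  qed
qed

lemma artinian_H0: "artinian_module R (S.Q 0)"
proof -
  have "Bt 0 = {\<zero>[0]}" by (simp add: Bt_def)
  then show ?thesis
    using artinian_subquotient[OF submodule_Zt submodule_Bt Bt_Zt, of 0] artinian_Zt_0 unfolding S.Q_def by simp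
qed

lemma artinian_H1: "artinian_module R (S.Q 1)"
proof -
  have "artinian 1 (Zt 1) (Bt 1)"
  proof (rule chain_condition_surj[where f = dd and e = 0, OF dmap_additive _ F.act_additive _ _ _ _ _ artinian_W])
    show "dd (fact r x) = fact r (dd x)" for r x
      by (rule F.equivariantD(5)[OF equivariant_dmap[of d, OF d_module_hom]])
    show "osub F.const_ops fact (\<lambda>k. lift 0 W1)" "osub F.const_ops fact (\<lambda>k. lift 1 (Bt 1))"
      by (rule osub_lift_submodule[OF submodule_W(2)], rule osub_lift_submodule[OF submodule_Bt])
    show "lift 0 W0 \<subseteq> lift 0 W1" by (rule lift_mono) (auto simp: W0_def W1_def intro: subsetD[OF Bt_Zt])
    show "dd x \<in> lift 1 (Bt 1)" if "x \<in> lift 0 W0" for x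
      using that dd_dom[of x 0] by (auto simp: lift_def W0_def)
    show "\<exists>x\<in>lift 0 W1. z - dd x \<in> lift 1 (Bt 1)" if z: "z \<in> lift 1 (Zt 1)" for z
    proof -
      have c: "z \<in> fdom (Suc 0)" "val (Suc 0) z \<in> Zt 1" using z by (auto simp: lift_def)
      have "val (Suc 0) z \<in> carrier (E (Suc 0))" "d (Suc 0) (val (Suc 0) z) = \<zero>[Suc (Suc 0)]"
        using c(2) Zt_carrier[of 1] by (auto simp: Zt_def)
      then obtain w where w: "w \<in> carrier (E 0)" "d 0 w = val (Suc 0) z" using T.A_exact by blast
      have f: "frag_of (0, 0, w) \<in> fdom 0" using w(1) by (auto simp: basis_def)
      note df = dd_dom[OF f]
      have "val (Suc 0) (z - dd (frag_of (0, 0, w))) = \<zero>[Suc 0]"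
        using val_diff[OF c(1) df(1)] df(2) val_of[OF w(1)] w(2) val_closed[OF c(1)] by (simp add: S.M.minus_eq S.M.r_neg)
      then have "z - dd (frag_of (0, 0, w)) \<in> lift 1 (Bt 1)"
        using dom_add(2)[OF c(1) df(1)] module_zero_mem[OF submodule_Bt, of 1] by (simp add: lift_def)
      moreover have "frag_of (0, 0, w) \<in> lift 0 W1" unfolding lift_rep[OF w(1)] using w c(2) by (simp add: W1_def)
      ultimately show ?thesis by blast
    qed
  qed
  then show ?thesis
    unfolding S.Q_def by (rule artinian_subquotient[OF submodule_Zt submodule_Bt Bt_Zt])
qed

end

end

section \<open>Ungraded modules as trivially graded ones\<close>

definition concentrated :: "('a, 'x) ring_scheme => 'i::zero => 'a set" where
  "concentrated G i = (if i = 0 then carrier G else {\<zero>\<^bsub>G\<^esub>})"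

lemma (in abelian_group) projections_concentrated:
  "projections G (concentrated G) (\<lambda>i x. if i = 0 then x else \<zero>)"
proof -
  have a: "additive_subgroup {\<zero>} G" "additive_subgroup (carrier G) G"
    by (rule additive_subgroupI, rule add.subgroupI; auto)+
  have "finite {i. (if i = 0 then x else \<zero>) \<noteq> \<zero>}" for x :: 'a
    by (rule finite_subset[of _ "{0}"]) auto
  then show ?thesis
    unfolding projections_def concentrated_def using a by (auto split: if_splits)
qed

text \<open>With R placed in degree 0, an ungraded injective resolution fits the graded set-up, so
  both resolutions are treated by the same locale.\<close>

lemma (in cring) standard_graded_concentrated: "standard_graded R (concentrated R)"
proof
  show "graded_ring R (concentrated R)"
    unfolding graded_ring_def
    using is_cring internal_direct_sum_if_projections[OF projections_concentrated]
    by (auto simp: concentrated_def)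
  show "\<one> \<in> concentrated R 0" by (simp add: concentrated_def)
qed

text \<open>Over R in degree 0 the components of a graded module are submodules. An ungraded
  extension h becomes homogeneous after projecting to degree 0, and still extends g because g
  vanishes off degree 0.\<close>

lemma (in cring) graded_injective_concentrated:
  assumes inj: "injective_module R E"
  shows "graded_injective_module R (concentrated R) E (concentrated E)"
proof -
  interpret E: module R E using inj by (simp add: injective_module_def)
  interpret G: standard_graded R "concentrated R" by (rule standard_graded_concentrated)
  let ?pE = "\<lambda>i x. if i = 0 then x else \<zero>\<^bsub>E\<^esub>"
  note pE = E.M.projections_concentrated
  show ?thesis
    unfolding graded_injective_module_def
  proof (intro conjI allI impI)
    show "graded_module R (concentrated R) E (concentrated E)"
      unfolding graded_module_def using E.module_axioms E.M.internal_direct_sum_if_projections[OF pE]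
      by (auto simp: concentrated_def)
    fix A B :: "('a, 'a) module" and Ag Bg :: "int => 'a set" and f g
    assume *: "graded_module R (concentrated R) A Ag \<and> graded_module R (concentrated R) B Bg \<and>
      graded_hom R A Ag B Bg f \<and> inj_on f (carrier A) \<and> graded_hom R A Ag E (concentrated E) g"
    have gA: "graded_module R (concentrated R) A Ag" and gB: "graded_module R (concentrated R) B Bg"
      and gf: "graded_hom R A Ag B Bg f" and fi: "inj_on f (carrier A)" and gg: "graded_hom R A Ag E (concentrated E) g"
      by (rule *[THEN conjunct1], rule *[THEN conjunct2, THEN conjunct1], rule *[THEN conjunct2, THEN conjunct2, THEN conjunct1],
          rule *[THEN conjunct2, THEN conjunct2, THEN conjunct2, THEN conjunct1], rule *[THEN conjunct2, THEN conjunct2, THEN conjunct2, THEN conjunct2])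
    interpret A: module R A using gA by (simp add: graded_module_def)
    interpret B: module R B using gB by (simp add: graded_module_def)
    have fh: "module_hom R A B f" "!!n. f ` Ag n \<subseteq> Bg n" and gh: "module_hom R A E g" "!!n. g ` Ag n \<subseteq> concentrated E n"
      using gf gg by (simp_all add: graded_hom_def)
    have "\<exists>h. module_hom R B E h \<and> (\<forall>x\<in>carrier A. h (f x) = g x)"
      by (rule inj[unfolded injective_module_def, THEN conjunct2, rule_format])
        (intro conjI A.module_axioms B.module_axioms fh gh fi)
    then obtain h where h: "module_hom R B E h" "!!x. x \<in> carrier A ==> h (f x) = g x" by (elim exE conjE) simp
    have "internal_direct_sum A Ag" "internal_direct_sum B Bg" using gA gB by (simp_all add: graded_module_def)
    then have "\<exists>p. projections A Ag p" "\<exists>p. projections B Bg p"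
      using A.M.projections_if_internal_direct_sum[of Ag] B.M.projections_if_internal_direct_sum[of Bg] by simp_all
    then obtain pA pB where pA: "projections A Ag pA" and pB: "projections B Bg pB" by (elim exE)
    note DA = A.M.projectionsD[OF pA] and DB = B.M.projectionsD[OF pB]
    have sm: "pB 0 (a \<odot>\<^bsub>B\<^esub> x) = a \<odot>\<^bsub>B\<^esub> pB 0 x" if "a \<in> carrier R" "x \<in> carrier B" for a x
      using G.component_smult[OF gB pB, of a 0 x 0] that by (simp add: concentrated_def)
    have h0: "h \<zero>\<^bsub>B\<^esub> = \<zero>\<^bsub>E\<^esub>" 
    proof -
      have "h (\<zero> \<odot>\<^bsub>B\<^esub> \<zero>\<^bsub>B\<^esub>) = \<zero> \<odot>\<^bsub>E\<^esub> h \<zero>\<^bsub>B\<^esub>"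
        using h(1)[unfolded module_hom_def, THEN conjunct2, THEN conjunct2] zero_closed B.M.zero_closed by blast
      moreover have "h \<zero>\<^bsub>B\<^esub> \<in> carrier E" using h(1) B.M.zero_closed unfolding module_hom_def by blast
      ultimately show ?thesis by simp
    qed
    have "graded_hom R B Bg E (concentrated E) (\<lambda>x. h (pB 0 x))"
      unfolding graded_hom_def
    proof (intro conjI allI)
      show "module_hom R B E (\<lambda>x. h (pB 0 x))"
        using h(1) DB(4) DB(5) sm by (simp add: module_hom_def Pi_iff)
      show "(\<lambda>x. h (pB 0 x)) ` Bg n \<subseteq> concentrated E n" for n
      proof (cases "n = 0")
        case True
        have "h (pB 0 x) \<in> carrier E" if "x \<in> Bg n" for x
          using that DB(2)[of n] DB(4)[of x 0] h(1) by (auto simp: module_hom_def)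
        then show ?thesis using True by (auto simp: concentrated_def)
      next
        case False
        then show ?thesis using DB(7)[of _ n 0] h0 by (auto simp: concentrated_def)
      qed
    qed
    moreover have "h (pB 0 (f x)) = g x" if x: "x \<in> carrier A" for x
    proof -
      have fi: "y \<in> Ag i ==> f y \<in> Bg i" "y \<in> Ag i ==> g y \<in> concentrated E i" for i y
        using fh(2)[of i] gh(2)[of i] by blast+
      have fc: "y \<in> carrier A ==> f y \<in> carrier B" "y \<in> carrier A ==> g y \<in> carrier E" for y
        using fh(1) gh(1) by (auto simp: module_hom_def)
      have fa: "y \<in> carrier A ==> z \<in> carrier A ==> f (y \<oplus>\<^bsub>A\<^esub> z) = f y \<oplus>\<^bsub>B\<^esub> f z"
        "y \<in> carrier A ==> z \<in> carrier A ==> g (y \<oplus>\<^bsub>A\<^esub> z) = g y \<oplus>\<^bsub>E\<^esub> g z" for y z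
        using fh(1) gh(1) by (auto simp: module_hom_def)
      have "pB 0 (f x) = f (pA 0 x)"
        by (rule projections_map(1)[OF A.M.abelian_group_axioms B.M.abelian_group_axioms pA pB fc(1) fa(1) fi(1) _ x]) simp_all
      moreover have "g x = g (pA 0 x)"
        using projections_map(1)[OF A.M.abelian_group_axioms E.M.abelian_group_axioms pA pE fc(2) fa(2) fi(2) inj_on_id2 x, of 0]
        by simp
      ultimately show ?thesis using h(2)[OF DA(4)[OF x]] by simp
    qed
    ultimately show "\<exists>h. graded_hom R B Bg E (concentrated E) h \<and> (\<forall>x\<in>carrier A. h (f x) = g x)" by blast
  qed
qed

text \<open>A non-unit lies in a maximal ideal, found by Zorn's lemma. Chains have upper bounds by
  the Noetherian property, which makes the union of a chain of ideals one of its members.\<close>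

lemma unit_if_local_ring:
  assumes noeth: "noetherian_ring A" and loc: "local_ring A m" and a: "a \<in> carrier A" "a \<notin> m"
  shows "\<exists>u\<in>carrier A. u \<otimes>\<^bsub>A\<^esub> a = \<one>\<^bsub>A\<^esub>"
proof (rule ccontr)
  assume neg: "\<not> ?thesis"
  interpret A: cring A using loc by (simp add: local_ring_def)
  define I where "I = PIdl\<^bsub>A\<^esub> a"
  have I: "ideal I A" unfolding I_def by (rule A.cgenideal_ideal[OF a(1)])
  have aI: "a \<in> I" unfolding I_def by (rule A.cgenideal_self[OF a(1)])
  have ne: "\<one>\<^bsub>A\<^esub> \<notin> I" using neg by (auto simp: I_def cgenideal_def)
  define C where "C = {J. ideal J A \<and> I \<subseteq> J \<and> \<one>\<^bsub>A\<^esub> \<notin> J}"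
  have "\<exists>J\<in>C. \<forall>L\<in>C. J \<subseteq> L --> L = J"
  proof (rule subset_Zorn)
    fix K assume K: "subset.chain C K"
    show "\<exists>U\<in>C. \<forall>L\<in>K. L \<subseteq> U"
    proof (cases "K = {}")
      case True
      then show ?thesis using I ne by (auto simp: C_def)
    next
      case False
      have "subset.chain {I. ideal I A} K" using K by (auto simp: subset_chain_def C_def)
      then have "\<Union> K \<in> K" by (rule noetherian_ring.ideal_chain_is_trivial[OF noeth False])
      then show ?thesis using K by (auto simp: subset_chain_def)
    qed
  qed
  then obtain J where J: "ideal J A" "I \<subseteq> J" "\<one>\<^bsub>A\<^esub> \<notin> J" "!!L. L \<in> C ==> J \<subseteq> L ==> L = J" by (auto simp: C_def)
  have "maximalideal J A"
  proof (rule maximalidealI[OF J(1)])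
    show "carrier A \<noteq> J" using J(3) by auto
    show "L = J \<or> L = carrier A" if L: "ideal L A" "J \<subseteq> L" "L \<subseteq> carrier A" for L
    proof (cases "\<one>\<^bsub>A\<^esub> \<in> L")
      case True
      then show ?thesis using ideal.one_imp_carrier[OF L(1)] by simp
    next
      case False
      then show ?thesis using J(4)[of L] L J(2) by (auto simp: C_def)
    qed
  qed
  then have "J = m" using loc by (simp add: local_ring_def)
  then show False using aI J(2) a(2) by blast
qed

text \<open>Joins the resolution of M with one of \<open>H\<^sup>j\<close>, which \<eta> identifies
  with the kernel of the first differential of J. The list \<open>zs\<close> changes its role: in
  the first part it only supplies Koszul elements, in the second it defines the torsion.\<close>

locale cohomology_resolution =
  A: local_resolution R Rg E Eg d xs e zs + B: resolution_elements R Rt J Jg \<delta> zs e'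
  for R :: "('r, 'x) ring_scheme" (structure) and Rg and E :: "nat => ('r, 'e) module" and Eg d xs e zs
    and Rt and J :: "nat => ('r, 'f) module" and Jg \<delta> e' +
  fixes j :: nat and \<eta> :: "'e set => 'f"
  assumes eta_hom: "module_hom R (A.S.Q j) (J 0) \<eta>" and eta_inj: "inj_on \<eta> (carrier (A.S.Q j))"
    and eta_image: "\<eta> ` carrier (A.S.Q j) = B.Z0"
begin

lemma eta:
  assumes "v \<in> A.Zt j"
  shows "\<eta> (A.S.cl j v) \<in> carrier (J 0)" "\<eta> (A.S.cl j v) \<in> B.Z0"
    "w \<in> A.Zt j ==> \<eta> (A.S.cl j (v \<ominus>\<^bsub>E j\<^esub> w)) = \<eta> (A.S.cl j v) \<ominus>\<^bsub>J 0\<^esub> \<eta> (A.S.cl j w)"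
    "r \<in> carrier R ==> \<eta> (A.S.cl j (r \<odot>\<^bsub>E j\<^esub> v)) = r \<odot>\<^bsub>J 0\<^esub> \<eta> (A.S.cl j v)"
    "\<eta> (A.S.cl j v) = \<zero>\<^bsub>J 0\<^esub> \<longleftrightarrow> v \<in> A.Bt j"
proof -
  have mem: "A.S.cl j v \<in> carrier (A.S.Q j)" if "v \<in> A.Zt j" for v using that by (simp add: A.S.Q_simps(1))
  have c: "v \<in> carrier (E j)" if "v \<in> A.Zt j" for v using that A.Zt_carrier by blast
  show "\<eta> (A.S.cl j v) \<in> carrier (J 0)" using eta_hom mem[OF assms] by (auto simp: module_hom_def)
  show "\<eta> (A.S.cl j v) \<in> B.Z0" using eta_image mem[OF assms] by blast
  have sm: "\<eta> (A.S.cl j (r \<odot>\<^bsub>E j\<^esub> v)) = r \<odot>\<^bsub>J 0\<^esub> \<eta> (A.S.cl j v)" if "r \<in> carrier R" "v \<in> A.Zt j" for r v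
  proof -
    have "\<eta> (r \<odot>\<^bsub>A.S.Q j\<^esub> A.S.cl j v) = r \<odot>\<^bsub>J 0\<^esub> \<eta> (A.S.cl j v)"
      using eta_hom mem[OF that(2)] that(1) unfolding module_hom_def by blast
    then show ?thesis using A.S.cl_smult[OF that(1) c[OF that(2)]] by simp
  qed
  then show "r \<in> carrier R ==> \<eta> (A.S.cl j (r \<odot>\<^bsub>E j\<^esub> v)) = r \<odot>\<^bsub>J 0\<^esub> \<eta> (A.S.cl j v)" using assms by blast
  show "\<eta> (A.S.cl j (v \<ominus>\<^bsub>E j\<^esub> w)) = \<eta> (A.S.cl j v) \<ominus>\<^bsub>J 0\<^esub> \<eta> (A.S.cl j w)" if w: "w \<in> A.Zt j"
  proof -
    have vw: "v \<ominus>\<^bsub>E j\<^esub> w \<in> A.Zt j" by (rule A.S.Z_minus[OF assms w])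
    have v: "v = (v \<ominus>\<^bsub>E j\<^esub> w) \<oplus>\<^bsub>E j\<^esub> w" using c[OF assms] c[OF w] by (simp add: A.S.M.minus_eq A.S.M.a_assoc A.S.M.l_neg)
    have "A.S.cl j v = A.S.cl j (v \<ominus>\<^bsub>E j\<^esub> w) \<oplus>\<^bsub>A.S.Q j\<^esub> A.S.cl j w"
      using A.S.cl_add[OF c[OF vw] c[OF w]] v by simp
    then have "\<eta> (A.S.cl j v) = \<eta> (A.S.cl j (v \<ominus>\<^bsub>E j\<^esub> w)) \<oplus>\<^bsub>J 0\<^esub> \<eta> (A.S.cl j w)"
      using eta_hom mem[OF vw] mem[OF w] by (simp add: module_hom_def)
    moreover have "\<eta> (A.S.cl j (v \<ominus>\<^bsub>E j\<^esub> w)) \<in> carrier (J 0)" "\<eta> (A.S.cl j w) \<in> carrier (J 0)"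
      using eta_hom mem[OF vw] mem[OF w] by (auto simp: module_hom_def)
    ultimately show ?thesis by (simp add: B.S.M.minus_eq B.S.M.a_assoc B.S.M.r_neg)
  qed
  have z: "\<zero>\<^bsub>E j\<^esub> \<in> A.Zt j" by (rule A.S.Z_zero)
  have "\<eta> (A.S.cl j \<zero>\<^bsub>E j\<^esub>) = \<zero>\<^bsub>J 0\<^esub>"
  proof -
    have "\<eta> (A.S.cl j \<zero>\<^bsub>E j\<^esub>) \<in> carrier (J 0)" using eta_hom mem[OF z] unfolding module_hom_def by blast
    then show ?thesis using sm[OF A.R.zero_closed z] c[OF z] by simp
  qed
  then have "\<eta> (A.S.cl j v) = \<zero>\<^bsub>J 0\<^esub> \<longleftrightarrow> A.S.cl j v = A.S.cl j \<zero>\<^bsub>E j\<^esub>"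
    using inj_onD[OF eta_inj _ mem[OF assms] mem[OF z]] by auto
  also have "\<dots> \<longleftrightarrow> v \<ominus>\<^bsub>E j\<^esub> \<zero>\<^bsub>E j\<^esub> \<in> A.Bt j" by (rule A.S.cl_eq_iff[OF c[OF assms] c[OF z]])
  also have "\<dots> \<longleftrightarrow> v \<in> A.Bt j"
  proof -
    have "v \<ominus>\<^bsub>E j\<^esub> \<zero>\<^bsub>E j\<^esub> = v"
      using c[OF assms] A.S.M.minus_equality[of j "\<zero>\<^bsub>E j\<^esub>" "\<zero>\<^bsub>E j\<^esub>"] by (simp add: A.S.M.minus_eq)
    then show ?thesis by simp
  qed
  finally show "\<eta> (A.S.cl j v) = \<zero>\<^bsub>J 0\<^esub> \<longleftrightarrow> v \<in> A.Bt j" .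
qed

text \<open>
  On the free group on the cocycles the map to the ambient group of \<open>J\<close> commutes strictly with the
  operators; this is why it intervenes between the two complexes.
\<close>

definition FZ :: "'e ambient set" where
  "FZ = {f. Poly_Mapping.keys f \<subseteq> A.basis j (A.Zt j)}"

definition phi :: "'e ambient => 'f ambient" where
  "phi = frag_extend (\<lambda>(t, n, e). frag_of (t, 0, \<eta> (A.S.cl j e)))"

lemma phi_additive: "additive phi"
  by (simp add: phi_def additive_frag_extend)

lemma phi_of: "phi (frag_of (t, n, v)) = frag_of (t, 0, \<eta> (A.S.cl j v))"
  by (simp add: phi_def)

lemma FZ_induct [consumes 1, case_names zero of diff]:
  assumes "f \<in> FZ" "P 0" "!!v. v \<in> A.Zt j ==> P (frag_of (0, j, v))" "!!a b. a \<in> FZ ==> b \<in> FZ ==> P a ==> P b ==> P (a - b)"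
  shows "P f"
proof -
  have "f \<in> FZ \<and> P f"
  proof (rule frag_induction[where S = "A.basis j (A.Zt j)"])
    show "Poly_Mapping.keys f \<subseteq> A.basis j (A.Zt j)" using assms(1) by (simp add: FZ_def)
    show "0 \<in> FZ \<and> P 0" using assms(2) by (simp add: FZ_def)
    show "frag_of x \<in> FZ \<and> P (frag_of x)" if "x \<in> A.basis j (A.Zt j)" for x
      using that assms(3) by (auto simp: FZ_def A.basis_def)
    show "a - b \<in> FZ \<and> P (a - b)" if "a \<in> FZ \<and> P a" "b \<in> FZ \<and> P b" for a b
      using that assms(4) keys_diff[of a b] unfolding FZ_def by blast
  qed
  then show ?thesis by blast
qed

lemma FZ_diff: "a \<in> FZ ==> b \<in> FZ ==> a - b \<in> FZ"
  using keys_diff[of a b] by (auto simp: FZ_def)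

lemma FZ_of: "v \<in> A.Zt j ==> frag_of (0, j, v) \<in> FZ"
  by (auto simp: FZ_def A.basis_def)

lemma FZ_lift: "f \<in> FZ ==> f \<in> A.lift j (A.Zt j)"
proof (induction rule: FZ_induct)
  case zero
  show ?case using osubD(1)[OF A.osub_lift_submodule[OF A.submodule_Zt]] .
next
  case (of v)
  then show ?case using A.lift_rep[of v j "A.Zt j"] A.Zt_carrier by blast
next
  case (diff a b)
  then show ?case using osubD(2)[OF A.osub_lift_submodule[OF A.submodule_Zt]] by blast
qed

lemma FZ_act: "f \<in> FZ ==> r \<in> carrier R ==> A.fact r f \<in> FZ"
proof (induction rule: FZ_induct)
  case zero
  then show ?case by (simp add: A.F.act_simps FZ_def)
next
  case (of v)
  have "r \<odot>\<^bsub>E j\<^esub> v \<in> A.Zt j" by (rule A.S.Zs(4)[OF of(2,1)])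
  then show ?case using of A.Zt_carrier[of j] by (auto simp: A.fact_of intro: FZ_of)
next
  case (diff a b)
  then show ?case using FZ_diff by (simp add: A.F.act_simps)
qed

lemma phi_val: "f \<in> FZ ==> phi f \<in> B.fdom 0 \<and> B.val 0 (phi f) = \<eta> (A.S.cl j (A.val j f))"
proof (induction rule: FZ_induct)
  case zero
  have z: "\<zero>\<^bsub>E j\<^esub> \<in> A.Zt j" by (rule A.S.Z_zero)
  have "\<eta> (A.S.cl j \<zero>\<^bsub>E j\<^esub>) = \<zero>\<^bsub>J 0\<^esub>" using eta(5)[OF z] A.S.K_zero by simp
  then show ?case using B.dom_add(3) by (simp add: additive.zero[OF phi_additive] A.val_zero B.val_zero)
next
  case (of v)
  have "v \<in> carrier (E j)" using of A.Zt_carrier by blast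
  then show ?case using eta(1)[OF of] by (auto simp: phi_of A.val_of B.val_of B.basis_def)
next
  case (diff a b)
  have Z: "A.val j a \<in> A.Zt j" "A.val j b \<in> A.Zt j" and dom: "a \<in> A.fdom j" "b \<in> A.fdom j"
    using FZ_lift[OF diff(1)] FZ_lift[OF diff(2)] by (auto simp: A.lift_def)
  have dom': "phi a \<in> B.fdom 0" "phi b \<in> B.fdom 0" using diff by blast+
  show ?case
    unfolding additive.diff[OF phi_additive]
    using B.dom_add(2)[OF dom'] B.val_diff[OF dom'] A.val_diff[OF dom] eta(3)[OF Z] diff by simp
qed

lemma phi_act: "f \<in> FZ ==> phi (A.fact r f) = B.fact r (phi f)"
proof (induction rule: FZ_induct)
  case zero
  then show ?case by (simp add: A.F.act_simps B.F.act_simps additive.zero[OF phi_additive])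
next
  case (of v)
  have "v \<in> carrier (E j)" using of A.Zt_carrier by blast
  then show ?case using eta(1)[OF of] eta(4)[OF of] by (simp add: phi_of A.fact_of B.fact_of additive.zero[OF phi_additive])
next
  case (diff a b)
  then show ?case by (simp add: A.F.act_simps B.F.act_simps additive.diff[OF phi_additive])
qed

text \<open>\<open>FZ\<close> as a complex in degree j. Dividing by FB, the sums that represent
  coboundaries, gives \<open>H\<^sup>j\<close> once more.\<close>

definition FA :: "int => int => 'e ambient set" where
  "FA n k = (if n = int j then FZ else {0})"
definition FB :: "int => int => 'e ambient set" where
  "FB n k = (if n = int j then {f \<in> FZ. A.val j f \<in> A.Bt j} else {0})"

lemma FB_iff: "f \<in> FZ ==> A.val j f \<in> A.Bt j \<longleftrightarrow> f \<in> A.lift j (A.Bt j)"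
  using FZ_lift[of f] by (simp add: A.lift_def)

lemma cpx_FA: "A.F.cpx A.F.const_ops (\<lambda>_. 0) FA FB"
proof -
  have z: "0 \<in> FZ" by (simp add: FZ_def)
  have r: "r \<in> carrier R" if "(r, i) \<in> A.F.const_ops" for r i using that by (auto simp: A.F.const_ops_def)
  have FBe: "{f \<in> FZ. A.val j f \<in> A.Bt j} = FZ \<inter> A.lift j (A.Bt j)" using FB_iff by blast
  have osB: "osub A.F.const_ops A.fact (\<lambda>k. A.lift j (A.Bt j))" by (rule A.osub_lift_submodule[OF A.submodule_Bt])
  have 1: "osub A.F.const_ops A.fact (\<lambda>k. FZ)"
    using z FZ_diff FZ_act r by (intro osubI) auto
  have 2: "osub A.F.const_ops A.fact (\<lambda>k. FZ \<inter> A.lift j (A.Bt j))"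
  proof (rule osubI)
    show "A.fact s x \<in> FZ \<inter> A.lift j (A.Bt j)" if "(s, i) \<in> A.F.const_ops" "x \<in> FZ \<inter> A.lift j (A.Bt j)" for s i x
      using osubD(5)[OF osB that(1), of x] FZ_act[of x s] r[OF that(1)] that(2) by simp
    show "0 \<in> FZ \<inter> A.lift j (A.Bt j)" using z osubD(1)[OF osB] by simp
    show "x - y \<in> FZ \<inter> A.lift j (A.Bt j)" if "x \<in> FZ \<inter> A.lift j (A.Bt j)" "y \<in> FZ \<inter> A.lift j (A.Bt j)" for x y
      using that FZ_diff osubD(2)[OF osB, of x y] by simp
  qed
  have os: "osub A.F.const_ops A.fact (FA n)" "osub A.F.const_ops A.fact (FB n)" for n
    using 1 2 A.F.osub_zero by (cases "n = int j"; simp add: FA_def[abs_def] FB_def[abs_def] FBe)+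
  show ?thesis
    unfolding A.F.cpx_def
  proof (intro conjI allI ballI)
    show "A.F.equivariant (\<lambda>_. 0)" by (simp add: A.F.equivariant_def additive_def A.F.act_simps)
    show "FB n k \<subseteq> FA n k" for n k by (auto simp: FA_def FB_def)
  qed (rule os osubD(1)[OF os(1)] osubD(1)[OF os(2)])+
qed

text \<open>Two levelwise isomorphisms start from FA/FB: the inclusion into the truncations of the
  first complex, and \<open>phi\<close> into \<open>Z0\<close> of the second resolution. Koszul
  cohomology is carried back along one and forward along the other.\<close>

lemma khs_J:
  assumes K: "A.A.khs A.ys A.dd (A.F.truncU A.dd (A.T.gam (set xs)) A.base (int j)) (A.F.truncT A.dd (A.T.gam (set xs)) A.base (int j)) n"
  shows "koszul_class.khs B.fact B.finl B.finr B.fev B.fod (chain_condition False B.F.const_ops B.fact)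
      A.ys (\<lambda>_. 0) (B.conc (int j) B.Z0) (B.conc (int j) {\<zero>\<^bsub>J 0\<^esub>}) n"
proof -
  interpret K: koszul_class B.fact B.finl B.finr B.fev B.fod B.F.const_ops "chain_condition False B.F.const_ops B.fact"
    by (intro koszul_class.intro B.F.pairing_axioms B.F.serre_chain_condition order_refl)
  note c = A.T.cpx_gam[OF A.xs_carrier']
  let ?U = "A.F.truncU A.dd (A.T.gam (set xs)) A.base (int j)" and ?T = "A.F.truncT A.dd (A.T.gam (set xs)) A.base (int j)"
  note cU = A.F.cpx_trunc(4)[OF c, of "int j"]
  have UT: "?U (int j) k = A.lift j (A.Zt j)" "?T (int j) k = A.lift j (A.Bt j)" for k
    by (simp_all add: A.F.splice_def A.total_cyc A.total_bnd)
  have UTn: "?U n k = ?T n k" if "n \<noteq> int j" for n k using that by (simp add: A.F.splice_def)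
  have zT: "0 \<in> ?T n k" for n k by (rule osubD(1)[OF A.F.cpxD(3)[OF cU]])
  interpret I: pairing_hom A.fact A.finl A.finr A.fev A.fod A.fact A.finl A.finr A.fev A.fod "\<lambda>v. v"
    by unfold_locales (simp_all add: additive_def)
  have "I.level_iso (\<lambda>_. 0) FA FB A.dd ?U ?T"
    unfolding I.level_iso_def
  proof (intro allI)
    fix n k
    show "(\<forall>v\<in>FA n k. v \<in> ?U n k \<and> (v \<in> ?T n k --> v \<in> FB n k) \<and> 0 - A.dd v \<in> ?T (n + 1) k \<and>
        (\<forall>r. A.fact r v = A.fact r v)) \<and> (\<forall>v\<in>FB n k. v \<in> ?T n k) \<and> (\<forall>v'\<in>?U n k. \<exists>v\<in>FA n k. v' - v \<in> ?T n k)"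
    proof (cases "n = int j")
      case True
      \<comment> \<open>In degree j + 1 both truncations consist of relations, so there the zero
        differential agrees with \<open>dd\<close>.\<close>
      have dT: "0 - A.dd v \<in> ?T (int j + 1) k" if "v \<in> FZ" for v
      proof -
        have "v \<in> ?U (int j) k" using FZ_lift[OF that] UT by simp
        then have "A.dd v \<in> ?U (int j + 1) k" by (rule A.F.cpxD(5)[OF cU])
        then have "A.dd v \<in> ?T (int j + 1) k" using UTn[of "int j + 1" k] by simp
        then show ?thesis using osubD(4)[OF A.F.cpxD(3)[OF cU]] by simp
      qed
      have s: "\<exists>v\<in>FZ. v' - v \<in> A.lift j (A.Bt j)" if v': "v' \<in> A.lift j (A.Zt j)" for v'
      proof -
        have f: "v' \<in> A.fdom j" "A.val j v' \<in> A.Zt j" using v' by (auto simp: A.lift_def)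
        have "v' - frag_of (0, j, A.val j v') \<in> A.lift j (A.Bt j)"
          using A.rep_diff[OF f(1)] A.base_sub_lift[OF A.S.K_zero, of j] by blast
        then show ?thesis using FZ_of[OF f(2)] by blast
      qed
      have 1: "\<forall>v\<in>FZ. v \<in> A.lift j (A.Zt j) \<and> (v \<in> A.lift j (A.Bt j) --> v \<in> {f \<in> FZ. A.val j f \<in> A.Bt j})"
        using FZ_lift FB_iff by simp
      have 2: "\<forall>v\<in>{f \<in> FZ. A.val j f \<in> A.Bt j}. v \<in> A.lift j (A.Bt j)" using FB_iff by blast
      have eq: "FA n k = FZ" "FB n k = {f \<in> FZ. A.val j f \<in> A.Bt j}" "?U n k = A.lift j (A.Zt j)" "?T n k = A.lift j (A.Bt j)"
        unfolding True UT by (simp_all add: FA_def FB_def)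
      show ?thesis
        unfolding eq using 1 2 s dT unfolding True by blast
    next
      case False
      then have eq: "FA n k = {0}" "FB n k = {0}" "?U n k = ?T n k" using UTn by (simp_all add: FA_def FB_def)
      show ?thesis unfolding eq using zT by (simp add: A.dd_zero)
    qed
  qed
  note I.kos_level_iso[OF A.ys_const cpx_FA cU this order_refl]
  then have KF: "chain_condition False A.F.const_ops A.fact (cyc (A.F.kosD A.ys (\<lambda>_. 0)) (A.F.kos A.ys FA) (A.F.kos A.ys FB) n)
     (bnd (A.F.kosD A.ys (\<lambda>_. 0)) (A.F.kos A.ys FA) (A.F.kos A.ys FB) n)"
    using K unfolding A.A.khs_def A.A.hs_def by blast
  interpret P: pairing_hom A.fact A.finl A.finr A.fev A.fod B.fact B.finl B.finr B.fev B.fod phi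
  proof (intro pairing_hom.intro pairing_hom_axioms.intro A.F.pairing_axioms B.F.pairing_axioms)
    show "additive phi" by (rule phi_additive)
    show "phi (A.finl x) = B.finl (phi x)" for x
      by (rule frag_ext[OF A.additive_comp[OF phi_additive A.f_additive(2)] A.additive_comp[OF B.f_additive(2) phi_additive]])
        (auto simp: A.f_of B.f_of phi_of)
    show "phi (A.finr x) = B.finr (phi x)" for x
      by (rule frag_ext[OF A.additive_comp[OF phi_additive A.f_additive(3)] A.additive_comp[OF B.f_additive(3) phi_additive]])
        (auto simp: A.f_of B.f_of phi_of)
  qed
  have z0: "{\<zero>\<^bsub>J 0\<^esub>} \<subseteq> B.Z0" using B.module_zero_mem[OF B.submodule_Z0] by blast
  note s0 = B.submodule_zero[of 0]
  have li: "P.level_iso (\<lambda>_. 0) FA FB (\<lambda>_. 0) (B.conc (int j) B.Z0) (B.conc (int j) {\<zero>\<^bsub>J 0\<^esub>})"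
    unfolding P.level_iso_def
  proof (intro allI)
    fix n k
    have zero: "phi 0 = 0" by (rule additive.zero[OF phi_additive])
    have zc: "0 \<in> B.conc (int j) {\<zero>\<^bsub>J 0\<^esub>} m k" for m
      by (rule osubD(1)[OF B.F.cpxD(3)[OF B.cpx_conc(1)[OF B.submodule_Z0 s0 z0]]])
    show "(\<forall>v\<in>FA n k. phi v \<in> B.conc (int j) B.Z0 n k \<and> (phi v \<in> B.conc (int j) {\<zero>\<^bsub>J 0\<^esub>} n k --> v \<in> FB n k) \<and>
        phi 0 - 0 \<in> B.conc (int j) {\<zero>\<^bsub>J 0\<^esub>} (n + 1) k \<and> (\<forall>r. phi (A.fact r v) = B.fact r (phi v))) \<and>
        (\<forall>v\<in>FB n k. phi v \<in> B.conc (int j) {\<zero>\<^bsub>J 0\<^esub>} n k) \<and>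
        (\<forall>v'\<in>B.conc (int j) B.Z0 n k. \<exists>v\<in>FA n k. v' - phi v \<in> B.conc (int j) {\<zero>\<^bsub>J 0\<^esub>} n k)"
    proof (cases "n = int j")
      case True
      have val: "A.val j v \<in> A.Zt j" if "v \<in> FZ" for v using FZ_lift[OF that] by (simp add: A.lift_def)
      have 1: "phi v \<in> B.lift 0 B.Z0" if "v \<in> FZ" for v
        using phi_val[OF that] eta(2)[OF val[OF that]] by (simp add: B.lift_def)
      have 2: "phi v \<in> B.lift 0 {\<zero>\<^bsub>J 0\<^esub>} \<longleftrightarrow> A.val j v \<in> A.Bt j" if "v \<in> FZ" for v
        using phi_val[OF that] eta(5)[OF val[OF that]] by (simp add: B.lift_def)
      have 3: "\<exists>v\<in>FZ. v' - phi v \<in> B.lift 0 {\<zero>\<^bsub>J 0\<^esub>}" if v': "v' \<in> B.lift 0 B.Z0" for v'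
      proof -
        have f: "v' \<in> B.fdom 0" "B.val 0 v' \<in> B.Z0" using v' by (auto simp: B.lift_def)
        then obtain v where v: "v \<in> A.Zt j" "B.val 0 v' = \<eta> (A.S.cl j v)"
          using eta_image by (auto simp: A.S.Q_simps(1))
        then have "v' - phi (frag_of (0, j, v)) \<in> B.lift 0 {\<zero>\<^bsub>J 0\<^esub>}" using B.rep_diff[OF f(1)] by (simp add: phi_of)
        then show ?thesis using FZ_of[OF v(1)] by blast
      qed
      have eq: "FA n k = FZ" "FB n k = {f \<in> FZ. A.val j f \<in> A.Bt j}" "B.conc (int j) S n k = B.lift 0 S" for S
        unfolding True by (simp_all add: FA_def FB_def B.conc_def)
      show ?thesis
        unfolding eq zero using 1 2 3 phi_act zc[of "n + 1"] by simp
    next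
      case False
      then have eq: "FA n k = {0}" "FB n k = {0}" "B.conc (int j) S n k = {0}" for S by (simp_all add: FA_def FB_def B.conc_def)
      show ?thesis unfolding eq using zero zc[of "n + 1"] by (simp add: A.F.act_simps B.F.act_simps)
    qed
  qed
  show ?thesis
    unfolding K.khs_def K.hs_def
    using KF P.kos_level_iso[OF A.ys_const cpx_FA B.cpx_conc(1)[OF B.submodule_Z0 s0 z0] li order_refl] by blast
qed

end

section \<open>The degree zero part and its residue field\<close>

context standard_graded
begin

lemma ideal_degree_zero:
  assumes "ideal b R" and "cring (degree_zero_ring R Rg)"
  shows "ideal (b \<inter> Rg 0) (degree_zero_ring R Rg)"
proof -
  interpret b: ideal b R by fact
  interpret A: cring "degree_zero_ring R Rg" by fact
  note R0 = additive_subgroupD[OF R.abelian_group_axioms rcompD(1)[of 0]]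
  have neg: "\<ominus>\<^bsub>degree_zero_ring R Rg\<^esub> x = \<ominus> x" if "x \<in> Rg 0" for x
    using that R0(4)[OF that] Rg_carrier[OF that] R.l_neg by (intro A.minus_equality) auto
  show ?thesis
  proof (rule idealI)
    show "ring (degree_zero_ring R Rg)" by (rule A.ring_axioms)
    show "subgroup (b \<inter> Rg 0) (add_monoid (degree_zero_ring R Rg))"
    proof (rule A.add.subgroupI)
      show "b \<inter> Rg 0 \<noteq> {}" using R0(2) b.zero_closed by blast
      show "\<ominus>\<^bsub>degree_zero_ring R Rg\<^esub> x \<in> b \<inter> Rg 0" if "x \<in> b \<inter> Rg 0" for x
        using that neg[of x] R0(4)[of x] b.a_inv_closed[of x] by simp
    qed (use R0(3) b.a_closed in auto)
    show "x \<otimes>\<^bsub>degree_zero_ring R Rg\<^esub> a \<in> b \<inter> Rg 0" "a \<otimes>\<^bsub>degree_zero_ring R Rg\<^esub> x \<in> b \<inter> Rg 0"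
      if "a \<in> b \<inter> Rg 0" "x \<in> carrier (degree_zero_ring R Rg)" for a x
      using that Rg_mult[of x 0 a 0] Rg_mult[of a 0 x 0] b.I_l_closed[of a x] b.I_r_closed[of a x] Rg_carrier[of x 0] by simp_all
  qed
qed

text \<open>\<open>R / (\<mm>\<^sub>0 R + R\<^sub>+)\<close> is the residue field of \<open>R\<^sub>0\<close>.\<close>

lemma residue_field:
  assumes noeth: "noetherian_ring (degree_zero_ring R Rg)" and loc: "local_ring (degree_zero_ring R Rg) m"
    and xs: "set xs \<subseteq> Rg 1" and gen: "generate_ring R (Rg 0 \<union> set xs) = carrier R"
    and zs: "set zs \<subseteq> Rg 0" "m = genideal (degree_zero_ring R Rg) (set zs)"
  shows "m \<subseteq> genideal R (set zs)"
    and "r \<in> carrier R ==> r \<in> genideal R (set (zs @ xs)) \<or> (\<exists>r'\<in>carrier R. r' \<otimes> r \<ominus> \<one> \<in> genideal R (set (zs @ xs)))"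
    and "z \<in> set zs ==> r \<in> Rg 0 ==> \<exists>u\<in>Rg 0. u \<otimes> (\<one> \<ominus> r \<otimes> z) = \<one>"
proof -
  let ?A = "degree_zero_ring R Rg"
  interpret A: cring ?A using loc by (simp add: local_ring_def)
  note R0 = additive_subgroupD[OF R.abelian_group_axioms rcompD(1)[of 0]]
  have zc: "set zs \<subseteq> carrier R" and xc: "set xs \<subseteq> carrier R" using zs xs Rg_carrier by blast+
  then have zxc: "set (zs @ xs) \<subseteq> carrier R" by simp
  show mz: "m \<subseteq> genideal R (set zs)"
  proof -
    have "genideal ?A (set zs) \<subseteq> genideal R (set zs) \<inter> Rg 0"
      using R.genideal_self[OF zc] zs(1)
      by (intro A.genideal_minimal ideal_degree_zero[OF R.genideal_ideal[OF zc] A.is_cring]) auto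
    then show ?thesis using zs(2) by blast
  qed
  interpret m: maximalideal m ?A using loc by (simp add: local_ring_def)
  have one_m: "\<one> \<notin> m" using m.one_imp_carrier m.I_notcarr by auto
  interpret b: ideal "genideal R (set (zs @ xs))" R by (rule R.genideal_ideal[OF zxc])
  have sub: "genideal R S \<subseteq> genideal R (set (zs @ xs))" if "S \<subseteq> set (zs @ xs)" for S
    using that R.genideal_self[OF zxc] by (intro R.genideal_minimal R.genideal_ideal[OF zxc]) blast
  show "r \<in> genideal R (set (zs @ xs)) \<or> (\<exists>r'\<in>carrier R. r' \<otimes> r \<ominus> \<one> \<in> genideal R (set (zs @ xs)))" if r: "r \<in> carrier R"
  proof -
    obtain r0 where r0: "r0 \<in> Rg 0" "r \<ominus> r0 \<in> genideal R (set xs)"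
      using irrelevant_ideal_generators(4)[OF xs gen r] by blast
    have d: "r \<ominus> r0 \<in> genideal R (set (zs @ xs))" using r0(2) sub[of "set xs"] by auto
    have c: "r0 \<in> carrier R" by (rule Rg_carrier[OF r0(1)])
    show ?thesis
    proof (cases "r0 \<in> m")
      case True
      then have "r0 \<in> genideal R (set (zs @ xs))" using mz sub[of "set zs"] by auto
      then have "(r \<ominus> r0) \<oplus> r0 \<in> genideal R (set (zs @ xs))" using d by (intro b.a_closed)
      moreover have "(r \<ominus> r0) \<oplus> r0 = r" using r c by (simp add: R.minus_eq R.a_assoc R.l_neg)
      ultimately show ?thesis by simp
    next
      case False
      \<comment> \<open>Modulo the irrelevant ideal r is the unit r0 of degree 0, whose inverse
        inverts r modulo the larger ideal.\<close>
      obtain u where u: "u \<in> Rg 0" "u \<otimes> r0 = \<one>"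
        using unit_if_local_ring[OF noeth loc, of r0] r0(1) False by auto
      have uc: "u \<in> carrier R" by (rule Rg_carrier[OF u(1)])
      have "u \<otimes> (r \<ominus> r0) \<in> genideal R (set (zs @ xs))" by (rule b.I_l_closed[OF d uc])
      moreover have "u \<otimes> (r \<ominus> r0) = u \<otimes> r \<ominus> \<one>"
        using uc r c u(2) by (simp add: R.minus_eq R.r_distr R.r_minus)
      ultimately show ?thesis using uc by auto
    qed
  qed
  show "\<exists>u\<in>Rg 0. u \<otimes> (\<one> \<ominus> r \<otimes> z) = \<one>" if z: "z \<in> set zs" and r: "r \<in> Rg 0"
  proof -
    have zR: "z \<in> Rg 0" using z zs(1) by blast
    have zm: "z \<in> m" using A.genideal_self[of "set zs"] z zs by auto
    have rz: "r \<otimes> z \<in> Rg 0" "r \<otimes> z \<in> m" using Rg_mult[OF r zR] m.I_l_closed[OF zm, of r] r by auto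
    have c: "r \<otimes> z \<in> carrier R" by (rule Rg_carrier[OF rz(1)])
    have a: "\<one> \<ominus> r \<otimes> z \<in> Rg 0" by (rule R0(5)[OF one_Rg rz(1)])
    have "\<one> \<ominus> r \<otimes> z \<notin> m"
    proof
      assume "\<one> \<ominus> r \<otimes> z \<in> m"
      from m.a_closed[OF this rz(2)] have "(\<one> \<ominus> r \<otimes> z) \<oplus> r \<otimes> z \<in> m" by simp
      moreover have "(\<one> \<ominus> r \<otimes> z) \<oplus> r \<otimes> z = \<one>" using c by (simp add: R.minus_eq R.a_assoc R.l_neg)
      ultimately show False using one_m by simp
    qed
    then show ?thesis using unit_if_local_ring[OF noeth loc, of "\<one> \<ominus> r \<otimes> z"] a by auto
  qed
qed

end

section \<open>Assembling the two resolutions\<close>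

lemma resolution_concentrated:
  assumes noeth: "noetherian_ring R" and R: "cring R" and J: "injective_resolution R H J \<delta> \<eta>"
  shows "resolution R (concentrated R) J (\<lambda>n. concentrated (J n)) \<delta>"
proof (intro resolution.intro resolution_axioms.intro module_family.intro module_family_axioms.intro)
  show "standard_graded R (concentrated R)" by (rule cring.standard_graded_concentrated[OF R])
  have inj: "injective_module R (J n)" and hom: "module_hom R (J n) (J (Suc n)) (\<delta> n)" for n
    using J unfolding injective_resolution_def by blast+
  show mod: "module R (J n)" for n using inj[of n] unfolding injective_module_def by blast
  show "cring R" "noetherian_ring R" by (rule R, rule noeth)
  show "graded_injective_module R (concentrated R) (J n) (concentrated (J n))" for n
    by (rule cring.graded_injective_concentrated[OF R inj])
  show "graded_hom R (J n) (concentrated (J n)) (J (Suc n)) (concentrated (J (Suc n))) (\<delta> n)" for n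
  proof -
    interpret M: module R "J n" by (rule mod)
    interpret N: module R "J (Suc n)" by (rule mod)
    have c: "\<delta> n v \<in> carrier (J (Suc n))" if "v \<in> carrier (J n)" for v
      using hom[of n] that unfolding module_hom_def by blast
    have "\<delta> n (\<zero>\<^bsub>R\<^esub> \<odot>\<^bsub>J n\<^esub> \<zero>\<^bsub>J n\<^esub>) = \<zero>\<^bsub>R\<^esub> \<odot>\<^bsub>J (Suc n)\<^esub> \<delta> n \<zero>\<^bsub>J n\<^esub>"
      using hom[of n, unfolded module_hom_def, THEN conjunct2, THEN conjunct2] M.R.zero_closed M.M.zero_closed by blast
    then have "\<delta> n \<zero>\<^bsub>J n\<^esub> = \<zero>\<^bsub>J (Suc n)\<^esub>" using c[OF M.M.zero_closed] by simp
    then have "\<delta> n ` concentrated (J n) k \<subseteq> concentrated (J (Suc n)) k" for k :: int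
      using c unfolding concentrated_def by (cases "k = 0") auto
    then show ?thesis unfolding graded_hom_def using hom by blast
  qed
  show "\<delta> n ` carrier (J n) = {x \<in> carrier (J (Suc n)). \<delta> (Suc n) x = \<zero>\<^bsub>J (Suc (Suc n))\<^esub>}" for n
    using J unfolding injective_resolution_def exact_coresolution_def cocycles_def by blast
qed

lemma (in resolution_elements) noetherian_augmentation:
  assumes M: "module R M" "finitely_generated_module R M" and \<epsilon>: "module_hom R M (E 0) \<epsilon>" "\<epsilon> ` carrier M = Z0"
  shows "noetherian 0 Z0 {\<zero>\<^bsub>E 0\<^esub>}"
proof -
  interpret M: module R M by (rule M(1))
  obtain S where S: "finite S" "S \<subseteq> carrier M" "!!N. submodule N R M ==> S \<subseteq> N ==> N = carrier M"
    using M(2) unfolding finitely_generated_module_def by blast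
  have e: "\<epsilon> v \<in> carrier (E 0)" "\<epsilon> (v \<oplus>\<^bsub>M\<^esub> w) = \<epsilon> v \<oplus>\<^bsub>E 0\<^esub> \<epsilon> w" "r \<in> carrier R ==> \<epsilon> (r \<odot>\<^bsub>M\<^esub> v) = r \<odot>\<^bsub>E 0\<^esub> \<epsilon> v"
    if "v \<in> carrier M" "w \<in> carrier M" for v w r
    using \<epsilon>(1) that unfolding module_hom_def by blast+
  have e0: "\<epsilon> \<zero>\<^bsub>M\<^esub> = \<zero>\<^bsub>E 0\<^esub>"
    using e(3)[OF M.M.zero_closed M.M.zero_closed R.zero_closed] e(1)[OF M.M.zero_closed M.M.zero_closed] by simp
  have em: "\<epsilon> (\<ominus>\<^bsub>M\<^esub> v) = \<ominus>\<^bsub>E 0\<^esub> \<epsilon> v" if v: "v \<in> carrier M" for v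
  proof -
    have "\<epsilon> (\<ominus>\<^bsub>M\<^esub> v) \<oplus>\<^bsub>E 0\<^esub> \<epsilon> v = \<zero>\<^bsub>E 0\<^esub>" using e(2)[of "\<ominus>\<^bsub>M\<^esub> v" v] v e0 by (simp add: M.M.l_neg)
    then show ?thesis using e(1)[OF v v] e(1)[of "\<ominus>\<^bsub>M\<^esub> v" v] v by (simp add: S.M.minus_equality)
  qed
  show ?thesis
  proof (rule noetherian_Z0)
    show "finite (\<epsilon> ` S)" "\<epsilon> ` S \<subseteq> Z0" using S(1,2) \<epsilon>(2) by auto
    fix N assume N: "submodule N R (E 0)" "\<epsilon> ` S \<subseteq> N"
    note n = S.submoduleE[OF N(1)]
    have "submodule {v \<in> carrier M. \<epsilon> v \<in> N} R M"
      by (rule M.submoduleI) (use n e e0 em module_zero_mem[OF N(1)] in auto)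
    then have "{v \<in> carrier M. \<epsilon> v \<in> N} = carrier M" using N(2) S(2) by (intro S(3)) auto
    then have "\<epsilon> ` carrier M \<subseteq> N" by blast
    then show "Z0 \<subseteq> N" unfolding \<epsilon>(2) .
  qed
qed

theorem theorem2p4:
  fixes R :: "('r, 'x) ring_scheme" and Rg :: "nat \<Rightarrow> 'r set" and m0 :: "'r set"
    and M :: "('r, 'm, 'y) module_scheme" and Mg :: "int \<Rightarrow> 'm set"
    and I :: "nat \<Rightarrow> ('r, 'e) module" and Ig :: "nat \<Rightarrow> int \<Rightarrow> 'e set"
    and d :: "nat \<Rightarrow> 'e \<Rightarrow> 'e" and \<epsilon> :: "'m \<Rightarrow> 'e"
    and J :: "nat \<Rightarrow> ('r, 'f) module" and \<delta> :: "nat \<Rightarrow> 'f \<Rightarrow> 'f" and \<eta> :: "'e set \<Rightarrow> 'f"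
    and i j :: nat
  assumes "graded_ring R Rg"
    and "noetherian_ring R"
    and "noetherian_ring (degree_zero_ring R Rg)"
    and "local_ring (degree_zero_ring R Rg) m0"
    and "generated_in_degree_one R Rg"
    and "graded_module R Rg M Mg"
    and "carrier M \<noteq> {\<zero>\<^bsub>M\<^esub>}"
    and "finitely_generated_module R M"
    and "graded_injective_resolution R Rg M Mg I Ig d \<epsilon>"
    and "cohomological_finite_length_dim R Rg I Ig d < \<infinity>"
    and "i \<in> {0, 1}"
    and "enat j \<le> cohomological_finite_length_dim R Rg I Ig d"
    and "injective_resolution R (local_cohomology R (irrelevant_ideal R Rg) I d j) J \<delta> \<eta>"
  shows "artinian_module R (local_cohomology R (Idl\<^bsub>R\<^esub> m0) J \<delta> i)"
proof -
  have A0: "cring (degree_zero_ring R Rg)" using assms(4) by (simp add: local_ring_def)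
  have "\<one>\<^bsub>R\<^esub> \<in> Rg 0" using cring.cring_simprules(6)[OF A0] by simp
  then interpret G: standard_graded R Rg using assms(1) by (intro standard_graded.intro)
  obtain S where S: "finite S" "S \<subseteq> Rg 1" "generate_ring R (Rg 0 \<union> S) = carrier R"
    using assms(5) unfolding generated_in_degree_one_def by blast
  obtain xs where xs: "set xs = S" using finite_list[OF S(1)] by blast
  note gens = S(2,3)[folded xs]
  have "ideal m0 (degree_zero_ring R Rg)"
    using assms(4) maximalideal.axioms(1) unfolding local_ring_def by blast
  then obtain Z where Z: "Z \<subseteq> Rg 0" "finite Z" "m0 = genideal (degree_zero_ring R Rg) Z"
    using noetherian_ring.finetely_gen[OF assms(3)] by auto
  obtain zs where zs: "set zs = Z" using finite_list[OF Z(2)] by blast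
  note zgens = Z(1,3)[folded zs]
  note rf = G.residue_field[OF assms(3,4) gens zgens]
  note res = assms(9)[unfolded graded_injective_resolution_def]
  have injI: "graded_injective_module R Rg (I n) (Ig n)" for n using res by blast
  interpret A: resolution_elements R Rg I Ig d xs 1
  proof (intro resolution_elements.intro resolution.intro resolution_axioms.intro module_family.intro
      module_family_axioms.intro resolution_elements_axioms.intro)
    show "standard_graded R Rg" "cring R" "noetherian_ring R" "set xs \<subseteq> Rg 1"
      by (rule G.standard_graded_axioms, rule G.R.is_cring, rule assms(2), rule gens(1))
    show "module R (I n)" "graded_injective_module R Rg (I n) (Ig n)" for n
      using injI[of n] unfolding graded_injective_module_def graded_module_def by blast+
    show "graded_hom R (I n) (Ig n) (I (Suc n)) (Ig (Suc n)) (d n)" for n using res by blast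
    show "d n ` carrier (I n) = {x \<in> carrier (I (Suc n)). d (Suc n) x = \<zero>\<^bsub>I (Suc (Suc n))\<^esub>}" for n
      using res unfolding exact_coresolution_def cocycles_def by blast
  qed
  have Z0: "\<epsilon> ` carrier M = A.Z0"
    using res unfolding exact_coresolution_def cocycles_def A.Z0_def by simp
  have "chain_condition True A.F.const_ops A.fact (\<lambda>k. A.lift 0 A.Z0) (\<lambda>k. A.lift 0 {\<zero>\<^bsub>I 0\<^esub>})"
    by (rule A.noetherian_augmentation[OF _ assms(8) _ Z0])
      (use res assms(6) in \<open>simp_all add: graded_module_def graded_hom_def\<close>)
  then interpret L: local_resolution R Rg I Ig d xs 1 zs
    using gens(2) zgens(1) rf(2) by (intro local_resolution.intro A.resolution_elements_axioms local_resolution_axioms.intro) simp_all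
  have tA: "carrier (torsion_part R (irrelevant_ideal R Rg) (I n)) = tors_set R (set xs) (I n)" for n
    by (rule module.carrier_torsion_part[OF A.modules finite_set])
      (use G.irrelevant_ideal_generators(1-3)[OF gens] in simp_all)
  have fl: "\<exists>m. L.finite_length_below q m" if q: "q < j" for q
  proof -
    \<comment> \<open>Being strictly below the supremum, q is below some index l that satisfies the
      length condition.\<close>
    have "enat q < cohomological_finite_length_dim R Rg I Ig d" using q assms(12) by (simp add: less_le_trans[of "enat q" "enat j"])
    then obtain l where l: "q < l" "\<forall>j<l. \<exists>n0. \<forall>n\<le>n0. module_length (degree_zero_ring R Rg)
        (local_cohomology_component R (irrelevant_ideal R Rg) I Ig d j n) < \<infinity>"
      unfolding cohomological_finite_length_dim_def less_Sup_iff by auto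
    then obtain n0 where n0: "!!n. n \<le> n0 ==> module_length (degree_zero_ring R Rg)
        (local_cohomology_component R (irrelevant_ideal R Rg) I Ig d q n) < \<infinity>" by blast
    \<comment> \<open>The bound n0 is inclusive whereas \<open>finite_length_below\<close> is
      strict, hence n0 + 1.\<close>
    have "\<exists>N::nat. z [^]\<^bsub>R\<^esub> N \<odot>\<^bsub>I q\<^esub> w \<in> A.Bt q"
      if k: "k < n0 + 1" and w: "w \<in> A.Zt q \<inter> Ig q k" and z: "z \<in> set zs" for k w z
    proof (rule A.power_annihilates_if_finite_length)
      show "module_length (degree_zero_ring R Rg) ((A.S.Q q)\<lparr>carrier := A.S.cl q ` (A.Zt q \<inter> Ig q k)\<rparr>) < \<infinity>"
        using n0[of k] k unfolding A.local_cohomology_eq(2)[OF tA] by simp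
      show "w \<in> A.Zt q" "w \<in> Ig q k" "z \<in> Rg 0" using w z zgens(1) by auto
      show "\<exists>u\<in>Rg 0. u \<otimes>\<^bsub>R\<^esub> (\<one>\<^bsub>R\<^esub> \<ominus>\<^bsub>R\<^esub> r \<otimes>\<^bsub>R\<^esub> z) = \<one>\<^bsub>R\<^esub>" if "r \<in> Rg 0" for r
        by (rule rf(3)[OF z that])
    qed
    then show ?thesis unfolding L.finite_length_below_def by blast
  qed
  have lcA: "local_cohomology R (irrelevant_ideal R Rg) I d j = A.S.Q j" by (rule A.local_cohomology_eq(1)[OF tA])
  note resJ = assms(13)[unfolded lcA]
  have zc: "set zs \<subseteq> carrier R" using zgens(1) G.Rg_carrier by blast
  \<comment> \<open>The second resolution is ungraded, so R gets the trivial grading and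
    \<open>zs\<close>, now in degree 0, becomes the list that defines torsion.\<close>
  interpret B: resolution_elements R "concentrated R" J "\<lambda>n. concentrated (J n)" \<delta> zs 0
    using zc by (intro resolution_elements.intro resolution_concentrated[OF assms(2) G.R.is_cring resJ]
        resolution_elements_axioms.intro) (simp add: concentrated_def)
  interpret C: cohomology_resolution R Rg I Ig d xs 1 zs "concentrated R" J "\<lambda>n. concentrated (J n)" \<delta> 0 j \<eta>
  proof (intro cohomology_resolution.intro L.local_resolution_axioms B.resolution_elements_axioms cohomology_resolution_axioms.intro)
    show "module_hom R (A.S.Q j) (J 0) \<eta>" "inj_on \<eta> (carrier (A.S.Q j))" "\<eta> ` carrier (A.S.Q j) = B.Z0"
      using resJ unfolding injective_resolution_def exact_coresolution_def cocycles_def B.Z0_def by simp_all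
  qed
  have xc: "set xs \<subseteq> carrier R" using gens(1) G.Rg_carrier by blast
  \<comment> \<open>\<open>H\<^sup>j\<close> is torsion for the generators of
    \<open>R\<^sub>+\<close>, and \<eta> carries this to its image in J.\<close>
  have tors: "\<exists>n::nat. t [^]\<^bsub>R\<^esub> n \<odot>\<^bsub>J 0\<^esub> v = \<zero>\<^bsub>J 0\<^esub>" if v: "v \<in> B.Z0" and t: "t \<in> set xs" for v t
  proof -
    obtain w where w: "w \<in> A.Zt j" "v = \<eta> (A.S.cl j w)" using v unfolding C.eta_image[symmetric] A.S.Q_simps(1) by blast
    then obtain n :: nat where n: "t [^]\<^bsub>R\<^esub> n \<odot>\<^bsub>I j\<^esub> w = \<zero>\<^bsub>I j\<^esub>" using t by (auto simp: A.Zt_def tors_set_def)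
    have "t [^]\<^bsub>R\<^esub> n \<in> carrier R" using t xc by (intro G.R.nat_pow_closed) blast
    from C.eta(4)[OF w(1) this] have "t [^]\<^bsub>R\<^esub> n \<odot>\<^bsub>J 0\<^esub> v = \<eta> (A.S.cl j \<zero>\<^bsub>I j\<^esub>)"
      unfolding n w(2) by simp
    also have "\<dots> = \<zero>\<^bsub>J 0\<^esub>" using C.eta(5)[OF A.S.Z_zero] A.S.K_zero by simp
    finally show ?thesis ..
  qed
  have khs: "koszul_class.khs B.fact B.finl B.finr B.fev B.fod (chain_condition False B.F.const_ops B.fact)
      (map (\<lambda>t. (t, 0)) (zs @ xs)) (\<lambda>_. 0) (B.conc (int j) B.Z0) (B.conc (int j) {\<zero>\<^bsub>J 0\<^esub>}) n"
    if "n \<in> {int j, int j + 1}" for n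
    by (rule C.khs_J[OF L.khs_cohomology[OF fl]]) (use that in auto)
  \<comment> \<open>The ideal generated by \<open>\<mm>\<^sub>0\<close> in R is already generated by
    \<open>zs\<close>, so its torsion can be tested on \<open>zs\<close>.\<close>
  have "carrier (torsion_part R (Idl\<^bsub>R\<^esub> m0) (J n)) = tors_set R (set zs) (J n)" for n
  proof (rule module.carrier_torsion_part[OF B.modules finite_set])
    have mc: "m0 \<subseteq> carrier R" using rf(1) G.R.genideal_ideal[OF zc] by (meson ideal.Icarr subset_iff)
    have "set zs \<subseteq> m0" using ring.genideal_self[OF cring.axioms(1)[OF A0], of "set zs"] zgens by simp
    then show "set zs \<subseteq> Idl\<^bsub>R\<^esub> m0" using G.R.genideal_self[OF mc] by blast
    show "Idl\<^bsub>R\<^esub> m0 \<subseteq> Idl\<^bsub>R\<^esub> set zs" by (rule G.R.genideal_minimal[OF G.R.genideal_ideal[OF zc] rf(1)])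
    show "Idl\<^bsub>R\<^esub> m0 \<subseteq> carrier R" using G.R.genideal_ideal[OF mc] by (meson ideal.Icarr subset_iff)
  qed
  from B.local_cohomology_eq(1)[OF this] show ?thesis
    using B.artinian_H0[OF xc tors khs] B.artinian_H1[OF xc tors khs] assms(11) by auto
qed

end
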